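(* Let $f^{\rm 2d}(\beta,S)$ be the thermodynamic-limit free energy per site of the ferromagnetic quantum Heisenberg model on $\mathbb Z^2$ with spin $S$, and let $$C_2:=\frac1{(2\pi)^2}\int_{\mathbb R^2}\ln\bigl(1-e^{-|p|^2}\bigr)\,dp=\frac{-\zeta(2)}{4\pi}=-\frac{\pi}{24}.$$ Then, for any $S\in\{\tfrac12,1,\tfrac32,\dots\}$, $$f^{\rm 2d}(\beta,S)\le C_2\,S^{-1}\beta^{-2}\Bigl(1-\mathcal O\bigl((\beta S)^{-1/3}(\ln\beta S)^{2/3}\bigr)\Bigr)$$ as $\beta S\to\infty$.
   Context: Let $S\in\{\tfrac12,1,\tfrac32,\dots\}$. For a finite set $\Lambda\subset\mathbb Z^2$ let $\mathscr H_\Lambda=\bigotimes_{x\in\Lambda}\mathbb C^{2S+1}$. For $x\in\Lambda$, $\vec S_x=(S^1_x,S^2_x,S^3_x)$ denotes the spin operators acting on the $x$-th tensor factor, i.e. the (self-adjoint) generators of rotations in the $(2S+1)$-dimensional irreducible representation of $SU(2)$, satisfying $[S^j_x,S^k_x]=i\sum_l\epsilon_{jkl}S^l_x$ and $\vec S_x\cdot\vec S_x=S(S+1)$. The Hamiltonian is $$H_\Lambda=\sum_{\langle x,y\rangle\subset\Lambda}\bigl(S^2-\vec S_x\cdot\vec S_y\bigr),$$ the sum running over (unordered) pairs of nearest neighbours in $\Lambda$. For $\beta>0$, $$f^{\rm 2d}(\beta,S)=\lim_{\Lambda\to\mathbb Z^2}f^{\rm 2d}_\Lambda(\beta,S)=-\lim_{\Lambda\to\mathbb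 Z^2}\frac1{\beta|\Lambda|}\ln\mathrm{Tr}\,e^{-\beta H_\Lambda},$$ where the limit is along a suitable sequence of increasing domains, e.g. squares of side length $L$ with $L\to\infty$. Here $\zeta$ is the Riemann zeta function. The notation $\mathcal O(\cdot)$ refers to the limit $\beta S\to\infty$, with constants independent of $\beta$ and $S$: the inequality holds with $\mathcal O(g)$ replaced by $Cg$ for some constant $C>0$ as soon as $\beta S$ is larger than some constant. *)

theory Defs
  imports
    "HOL-Analysis.Analysis"
    "Jordan_Normal_Form.Schur_Decomposition"
begin

text \<open>
  Throughout, \<open>n = 2 S\<close> is twice the spin, so that \<open>S\<close> ranges over
  \<open>1/2, 1, 3/2, \<dots>\<close> when \<open>n\<close> ranges over the positive naturals.
\<close>

subsection \<open>Spin matrices\<close>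

text \<open>
  Basis vector number \<open>k \<in> {0..n}\<close> is the eigenvector of the third component
  with eigenvalue \<open>m = S - k\<close>.  The raising operator maps it to basis vector
  \<open>k - 1\<close> with coefficient \<open>sqrt (S (S + 1) - m (m + 1)) = sqrt (k (n + 1 - k))\<close>.
\<close>

definition spin_raise :: "nat \<Rightarrow> complex mat" where
  "spin_raise n = Matrix.mat (n + 1) (n + 1)
     (\<lambda>(a, b). if b = a + 1 then complex_of_real (sqrt (real b * (real n + 1 - real b))) else 0)"

definition spin_lower :: "nat \<Rightarrow> complex mat" where
  "spin_lower n = mat_adjoint (spin_raise n)"

definition spin1 :: "nat \<Rightarrow> complex mat" where
  "spin1 n = (1 / 2) \<cdot>\<^sub>m (spin_raise n + spin_lower n)"

definition spin2 :: "nat \<Rightarrow> complex mat" where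
  "spin2 n = (1 / (2 * \<i>)) \<cdot>\<^sub>m (spin_raise n - spin_lower n)"

definition spin3 :: "nat \<Rightarrow> complex mat" where
  "spin3 n = Matrix.mat (n + 1) (n + 1)
     (\<lambda>(a, b). if a = b then complex_of_real (real n / 2 - real a) else 0)"


subsection \<open>Operators on the tensor product over a finite set of sites\<close>

type_synonym site = "int \<times> int"

text \<open>
  The product basis of the tensor product over \<open>\<Lambda>\<close> is indexed by configurations
  \<open>\<sigma> : \<Lambda> \<rightarrow> {0..n}\<close>.  To use matrices indexed by naturals, the configurations are
  enumerated by \<^const>\<open>from_nat_into\<close>, a bijection from \<open>{..<card (configs n \<Lambda>)}\<close>
  for finite \<open>\<Lambda>\<close>; the choice of the enumeration affects neither products nor traces.
\<close>

definition configs :: "nat \<Rightarrow> site set \<Rightarrow> (site \<Rightarrow> nat) set" where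
  "configs n \<Lambda> = (\<Lambda> \<rightarrow>\<^sub>E {0..n})"

definition hdim :: "nat \<Rightarrow> site set \<Rightarrow> nat" where
  "hdim n \<Lambda> = card (configs n \<Lambda>)"

definition config :: "nat \<Rightarrow> site set \<Rightarrow> nat \<Rightarrow> site \<Rightarrow> nat" where
  "config n \<Lambda> a = from_nat_into (configs n \<Lambda>) a"

text \<open>The one-site matrix \<open>A\<close> acting on factor \<open>x\<close>, tensored with the identity elsewhere.\<close>

definition site_op :: "nat \<Rightarrow> site set \<Rightarrow> complex mat \<Rightarrow> site \<Rightarrow> complex mat" where
  "site_op n \<Lambda> A x = Matrix.mat (hdim n \<Lambda>) (hdim n \<Lambda>)
     (\<lambda>(a, b). if \<forall>y\<in>\<Lambda> - {x}. config n \<Lambda> a y = config n \<Lambda> b y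
               then A $$ (config n \<Lambda> a x, config n \<Lambda> b x) else 0)"

definition spin_dot :: "nat \<Rightarrow> site set \<Rightarrow> site \<Rightarrow> site \<Rightarrow> complex mat" where
  "spin_dot n \<Lambda> x y =
     site_op n \<Lambda> (spin1 n) x * site_op n \<Lambda> (spin1 n) y +
     site_op n \<Lambda> (spin2 n) x * site_op n \<Lambda> (spin2 n) y +
     site_op n \<Lambda> (spin3 n) x * site_op n \<Lambda> (spin3 n) y"

text \<open>
  Every unordered nearest-neighbour pair is represented exactly once, by the ordered
  pair whose second entry is the right or the upper neighbour of the first.
\<close>

definition nn_pairs :: "site set \<Rightarrow> (site \<times> site) set" where
  "nn_pairs \<Lambda> = {(x, y). x \<in> \<Lambda> \<and> y \<in> \<Lambda> \<and> (y = x + (1, 0) \<or> y = x + (0, 1))}"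

text \<open>
  Matrices of unspecified dimension form no additive monoid, so the sum over pairs is
  taken entrywise.
\<close>

definition hamiltonian :: "nat \<Rightarrow> site set \<Rightarrow> complex mat" where
  "hamiltonian n \<Lambda> = Matrix.mat (hdim n \<Lambda>) (hdim n \<Lambda>)
     (\<lambda>(a, b). \<Sum>(x, y)\<in>nn_pairs \<Lambda>.
        (complex_of_real ((real n / 2)\<^sup>2) \<cdot>\<^sub>m 1\<^sub>m (hdim n \<Lambda>) - spin_dot n \<Lambda> x y) $$ (a, b))"


subsection \<open>Free energy\<close>

definition mat_trace :: "complex mat \<Rightarrow> complex" where
  "mat_trace A = (\<Sum>i<dim_row A. A $$ (i, i))"

definition mat_exp :: "complex mat \<Rightarrow> complex mat" where
  "mat_exp A = Matrix.mat (dim_row A) (dim_row A) (\<lambda>(i, j). \<Sum>k. (A ^\<^sub>m k) $$ (i, j) / fact k)"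

text \<open>The trace is real because the Hamiltonian is self-adjoint; \<^const>\<open>Re\<close> is a coercion.\<close>

definition partition_fun :: "real \<Rightarrow> nat \<Rightarrow> site set \<Rightarrow> real" where
  "partition_fun \<beta> n \<Lambda> =
     Re (mat_trace (mat_exp (complex_of_real (- \<beta>) \<cdot>\<^sub>m hamiltonian n \<Lambda>)))"

definition free_energy_fin :: "real \<Rightarrow> nat \<Rightarrow> site set \<Rightarrow> real" where
  "free_energy_fin \<beta> n \<Lambda> = - (1 / (\<beta> * real (card \<Lambda>))) * ln (partition_fun \<beta> n \<Lambda>)"

definition square :: "nat \<Rightarrow> site set" where
  "square L = {0..<int L} \<times> {0..<int L}"

definition free_energy_2d :: "real \<Rightarrow> nat \<Rightarrow> real" where
  "free_energy_2d \<beta> n = lim (\<lambda>L. free_energy_fin \<beta> n (square L))"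


subsection \<open>The constant and the zeta function\<close>

text \<open>The Dirichlet series represents the Riemann zeta function for \<open>s > 1\<close> only.\<close>

definition riemann_zeta :: "real \<Rightarrow> real" where
  "riemann_zeta s = (\<Sum>k. 1 / real (Suc k) powr s)"

definition C2 :: real where
  "C2 = 1 / (2 * pi)\<^sup>2 * (\<integral>p. ln (1 - exp (- (norm p)\<^sup>2)) \<partial>(lborel :: (real ^ 2) measure))"


subsection \<open>Defining relations of the spin matrices\<close>

lemma spin_carrier [simp]:
  "spin_raise n \<in> carrier_mat (n + 1) (n + 1)" "spin_lower n \<in> carrier_mat (n + 1) (n + 1)"
  "spin1 n \<in> carrier_mat (n + 1) (n + 1)" "spin2 n \<in> carrier_mat (n + 1) (n + 1)"
  "spin3 n \<in> carrier_mat (n + 1) (n + 1)"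
  by (auto simp: spin1_def spin2_def spin3_def spin_lower_def spin_raise_def mat_adjoint_def
      mat_of_rows_def)

lemma spin_dim [simp]:
  "dim_row (spin_raise n) = n + 1" "dim_col (spin_raise n) = n + 1"
  "dim_row (spin_lower n) = n + 1" "dim_col (spin_lower n) = n + 1"
  "dim_row (spin1 n) = n + 1" "dim_col (spin1 n) = n + 1"
  "dim_row (spin2 n) = n + 1" "dim_col (spin2 n) = n + 1"
  "dim_row (spin3 n) = n + 1" "dim_col (spin3 n) = n + 1"
  using spin_carrier[of n] by (simp_all only: carrier_matD)

definition ladder_coeff :: "nat \<Rightarrow> nat \<Rightarrow> complex" where
  "ladder_coeff n k = complex_of_real (sqrt (real k * (real n + 1 - real k)))"

lemma ladder_coeff_bdry [simp]: "ladder_coeff n 0 = 0" "ladder_coeff n (n + 1) = 0"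
    "ladder_coeff n (Suc n) = 0"
  by (simp_all add: ladder_coeff_def)

lemma ladder_coeff_sq:
  assumes "k \<le> n + 1"
  shows "ladder_coeff n k * ladder_coeff n k = of_nat k * (of_nat n + 1 - of_nat k)"
proof -
  have "real k * (real n + 1 - real k) \<ge> 0" using assms by (intro mult_nonneg_nonneg) auto
  then show ?thesis
    by (simp add: ladder_coeff_def flip: of_real_mult) simp
qed

lemma spin_entries:
  assumes "a < n + 1" "b < n + 1"
  shows "spin_raise n $$ (a, b) = (if b = a + 1 then ladder_coeff n b else 0)"
    and "spin_lower n $$ (a, b) = (if a = b + 1 then ladder_coeff n a else 0)"
    and "spin3 n $$ (a, b) = (if a = b then of_nat n / 2 - of_nat a else 0)"
  using assms
  by (auto simp: spin_lower_def spin_raise_def spin3_def ladder_coeff_def mat_adjoint_def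
      mat_of_rows_def)

lemma spin12_entries:
  assumes "a < n + 1" "b < n + 1"
  shows "spin1 n $$ (a, b) = (spin_raise n $$ (a, b) + spin_lower n $$ (a, b)) / 2"
    and "spin2 n $$ (a, b) = (spin_raise n $$ (a, b) - spin_lower n $$ (a, b)) / (2 * \<i>)"
  using assms by (simp_all add: spin1_def spin2_def)

lemma mat_adjoint_entry:
  assumes "A \<in> carrier_mat m m" "a < m" "b < m"
  shows "mat_adjoint A $$ (a, b) = cnj (A $$ (b, a))"
  using assms by (auto simp: mat_adjoint_def mat_of_rows_def)

lemma mat_adjoint_carrier:
  assumes "A \<in> carrier_mat m m" shows "mat_adjoint A \<in> carrier_mat m m"
  using assms by (auto simp: mat_adjoint_def mat_of_rows_def)

lemma cnj_ladder_coeff [simp]: "cnj (ladder_coeff n k) = ladder_coeff n k"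
  by (simp add: ladder_coeff_def)

lemma spin_self_adjoint:
  "mat_adjoint (spin1 n) = spin1 n" "mat_adjoint (spin2 n) = spin2 n"
  "mat_adjoint (spin3 n) = spin3 n"
proof -
  have "mat_adjoint A = A" if "A \<in> carrier_mat (n + 1) (n + 1)"
    "\<And>a b. a < n + 1 \<Longrightarrow> b < n + 1 \<Longrightarrow> cnj (A $$ (b, a)) = A $$ (a, b)" for A
    using that mat_adjoint_carrier[OF that(1)] by (intro eq_matI) (auto simp: mat_adjoint_entry)
  note * = this
  show "mat_adjoint (spin1 n) = spin1 n"
    by (rule *) (auto simp: spin12_entries spin_entries)
  show "mat_adjoint (spin2 n) = spin2 n"
    by (rule *) (auto simp: spin12_entries spin_entries)
  show "mat_adjoint (spin3 n) = spin3 n"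
    by (rule *) (auto simp: spin_entries)
qed

lemma times_mat_entry:
  assumes "A \<in> carrier_mat m m" "B \<in> carrier_mat m m" "a < m" "b < m"
  shows "(A * B) $$ (a, b) = (\<Sum>k<m. A $$ (a, k) * B $$ (k, b))"
  using assms by (auto simp: scalar_prod_def atLeast0LessThan intro!: sum.cong)

lemma spin_sums:
  fixes X :: "complex mat"
  assumes "a < n + 1"
  shows "(\<Sum>k<n + 1. spin_raise n $$ (a, k) * X $$ (k, b)) = ladder_coeff n (a + 1) * X $$ (a + 1, b)"
    and "(\<Sum>k<n + 1. spin_lower n $$ (a, k) * X $$ (k, b)) = ladder_coeff n a * X $$ (a - 1, b)"
    and "(\<Sum>k<n + 1. spin3 n $$ (a, k) * X $$ (k, b)) = (of_nat n / 2 - of_nat a) * X $$ (a, b)"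
proof -
  have "(\<Sum>k<n + 1. spin_raise n $$ (a, k) * X $$ (k, b))
      = (\<Sum>k<n + 1. if k = a + 1 then ladder_coeff n (a + 1) * X $$ (a + 1, b) else 0)"
    using assms by (intro sum.cong) (auto simp: spin_entries)
  also have "\<dots> = ladder_coeff n (a + 1) * X $$ (a + 1, b)"
    using assms by (cases "a = n") (auto simp: sum.delta)
  finally show "(\<Sum>k<n + 1. spin_raise n $$ (a, k) * X $$ (k, b))
      = ladder_coeff n (a + 1) * X $$ (a + 1, b)" .
  have "(\<Sum>k<n + 1. spin_lower n $$ (a, k) * X $$ (k, b))
      = (\<Sum>k<n + 1. if k = a - 1 then ladder_coeff n a * X $$ (a - 1, b) else 0)"
    using assms by (intro sum.cong; cases a) (auto simp: spin_entries)
  also have "\<dots> = ladder_coeff n a * X $$ (a - 1, b)"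
    using assms by (auto simp: sum.delta)
  finally show "(\<Sum>k<n + 1. spin_lower n $$ (a, k) * X $$ (k, b))
      = ladder_coeff n a * X $$ (a - 1, b)" .
  have "(\<Sum>k<n + 1. spin3 n $$ (a, k) * X $$ (k, b))
      = (\<Sum>k<n + 1. if k = a then (of_nat n / 2 - of_nat a) * X $$ (a, b) else 0)"
    using assms by (intro sum.cong) (auto simp: spin_entries)
  also have "\<dots> = (of_nat n / 2 - of_nat a) * X $$ (a, b)"
    using assms by (auto simp: sum.delta)
  finally show "(\<Sum>k<n + 1. spin3 n $$ (a, k) * X $$ (k, b))
      = (of_nat n / 2 - of_nat a) * X $$ (a, b)" .
qed

lemma spin12_sums:
  fixes X :: "complex mat"
  assumes "a < n + 1"
  shows "(\<Sum>k<n + 1. spin1 n $$ (a, k) * X $$ (k, b)) =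
      (ladder_coeff n (a + 1) * X $$ (a + 1, b) + ladder_coeff n a * X $$ (a - 1, b)) / 2"
    and "(\<Sum>k<n + 1. spin2 n $$ (a, k) * X $$ (k, b)) =
      (ladder_coeff n (a + 1) * X $$ (a + 1, b) - ladder_coeff n a * X $$ (a - 1, b)) / (2 * \<i>)"
proof -
  have "(\<Sum>k<n + 1. spin1 n $$ (a, k) * X $$ (k, b)) =
      (\<Sum>k<n + 1. (spin_raise n $$ (a, k) * X $$ (k, b) + spin_lower n $$ (a, k) * X $$ (k, b)) / 2)"
    using assms by (intro sum.cong) (auto simp: spin12_entries ring_distribs)
  then show "(\<Sum>k<n + 1. spin1 n $$ (a, k) * X $$ (k, b)) =
      (ladder_coeff n (a + 1) * X $$ (a + 1, b) + ladder_coeff n a * X $$ (a - 1, b)) / 2"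
    using spin_sums(1,2)[OF assms, of X b] by (simp only: sum.distrib flip: sum_divide_distrib)
  have "(\<Sum>k<n + 1. spin2 n $$ (a, k) * X $$ (k, b)) =
      (\<Sum>k<n + 1. (spin_raise n $$ (a, k) * X $$ (k, b) - spin_lower n $$ (a, k) * X $$ (k, b)) / (2 * \<i>))"
    using assms by (intro sum.cong) (auto simp: spin12_entries field_simps)
  then show "(\<Sum>k<n + 1. spin2 n $$ (a, k) * X $$ (k, b)) =
      (ladder_coeff n (a + 1) * X $$ (a + 1, b) - ladder_coeff n a * X $$ (a - 1, b)) / (2 * \<i>)"
    using spin_sums(1,2)[OF assms, of X b] by (simp only: sum_subtractf flip: sum_divide_distrib)
qed

lemma spin_commutation_and_casimir:
  "spin1 n * spin2 n - spin2 n * spin1 n = \<i> \<cdot>\<^sub>m spin3 n" (is ?c12)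
  "spin2 n * spin3 n - spin3 n * spin2 n = \<i> \<cdot>\<^sub>m spin1 n" (is ?c23)
  "spin3 n * spin1 n - spin1 n * spin3 n = \<i> \<cdot>\<^sub>m spin2 n" (is ?c31)
  "spin1 n * spin1 n + spin2 n * spin2 n + spin3 n * spin3 n =
     (of_nat n / 2 * (of_nat n / 2 + 1)) \<cdot>\<^sub>m 1\<^sub>m (n + 1)" (is ?cas)
proof -
  have prod: "(A * B) $$ (a, b) = (\<Sum>k<n + 1. A $$ (a, k) * B $$ (k, b))"
    if "A \<in> carrier_mat (n + 1) (n + 1)" "B \<in> carrier_mat (n + 1) (n + 1)" "a < n + 1" "b < n + 1"
    for A B :: "complex mat" and a b
    using times_mat_entry[OF that] .
  have R: "ladder_coeff n (a + 1) * spin_raise n $$ (a + 1, b) =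
        (if b = a + 2 then ladder_coeff n (a + 1) * ladder_coeff n (a + 2) else 0)"
      "ladder_coeff n (a + 1) * spin_lower n $$ (a + 1, b) =
        (if a = b then of_nat (a + 1) * (of_nat n - of_nat a) else 0)"
      "ladder_coeff n (a + 1) * spin3 n $$ (a + 1, b) =
        (if b = a + 1 then ladder_coeff n (a + 1) * (of_nat n / 2 - of_nat (a + 1)) else 0)"
      "ladder_coeff n a * spin_raise n $$ (a - 1, b) =
        (if a = b then of_nat a * (of_nat n + 1 - of_nat a) else 0)"
      "ladder_coeff n a * spin_lower n $$ (a - 1, b) =
        (if a = b + 2 then ladder_coeff n a * ladder_coeff n (a - 1) else 0)"
      "ladder_coeff n a * spin3 n $$ (a - 1, b) =
        (if a = b + 1 then ladder_coeff n a * (of_nat n / 2 - of_nat (a - 1)) else 0)"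
    if "a < n + 1" "b < n + 1" for a b
    using that ladder_coeff_sq[of "a + 1" n] ladder_coeff_sq[of a n]
    by (cases "a = n"; cases a; auto simp: spin_entries)+
  have E: "ladder_coeff n (a + 1) * spin1 n $$ (a + 1, b) = (ladder_coeff n (a + 1) *
        spin_raise n $$ (a + 1, b) + ladder_coeff n (a + 1) * spin_lower n $$ (a + 1, b)) / 2"
      "ladder_coeff n a * spin1 n $$ (a - 1, b) = (ladder_coeff n a *
        spin_raise n $$ (a - 1, b) + ladder_coeff n a * spin_lower n $$ (a - 1, b)) / 2"
      "ladder_coeff n (a + 1) * spin2 n $$ (a + 1, b) = (ladder_coeff n (a + 1) *
        spin_raise n $$ (a + 1, b) - ladder_coeff n (a + 1) * spin_lower n $$ (a + 1, b)) / (2 * \<i>)"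
      "ladder_coeff n a * spin2 n $$ (a - 1, b) = (ladder_coeff n a *
        spin_raise n $$ (a - 1, b) - ladder_coeff n a * spin_lower n $$ (a - 1, b)) / (2 * \<i>)"
    if "a < n + 1" "b < n + 1" for a b
    using that by (cases "a = n"; auto simp: spin12_entries field_simps)+
  have key: "A = B" if "A \<in> carrier_mat (n + 1) (n + 1)" "B \<in> carrier_mat (n + 1) (n + 1)"
    "\<And>a b. a < n + 1 \<Longrightarrow> b < n + 1 \<Longrightarrow> A $$ (a, b) = B $$ (a, b)" for A B :: "complex mat"
    using that by (intro eq_matI) auto
  have carr: "A * B \<in> carrier_mat (n + 1) (n + 1)" "A + B \<in> carrier_mat (n + 1) (n + 1)"
      "A - B \<in> carrier_mat (n + 1) (n + 1)" "c \<cdot>\<^sub>m A \<in> carrier_mat (n + 1) (n + 1)"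
      "1\<^sub>m (n + 1) \<in> carrier_mat (n + 1) (n + 1)"
    if "A \<in> carrier_mat (n + 1) (n + 1)" "B \<in> carrier_mat (n + 1) (n + 1)"
    for A B :: "complex mat" and c using that by auto
  have diff_entry: "(A * B - C * D) $$ (a, b) = (A * B) $$ (a, b) - (C * D) $$ (a, b)"
    if "a < n + 1" "b < n + 1" "C \<in> carrier_mat (n + 1) (n + 1)" "D \<in> carrier_mat (n + 1) (n + 1)"
    for A B C D :: "complex mat" and a b using that by auto
  have sum_entry: "(A * A + B * B + C * C) $$ (a, b) =
      (A * A) $$ (a, b) + (B * B) $$ (a, b) + (C * C) $$ (a, b)"
    if "a < n + 1" "b < n + 1" "A \<in> carrier_mat (n + 1) (n + 1)" "B \<in> carrier_mat (n + 1) (n + 1)"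
      "C \<in> carrier_mat (n + 1) (n + 1)"
    for A B C :: "complex mat" and a b using that by auto
  note F = diff_entry sum_entry prod spin_carrier spin12_sums spin_sums E R
  show ?c12
  proof (rule key)
    fix a b assume ab: "a < n + 1" "b < n + 1"
    have "(spin1 n * spin2 n - spin2 n * spin1 n) $$ (a, b) = \<i> * spin3 n $$ (a, b)"
      unfolding spin_entries(3)[OF ab]
      by (simp only: ab F) (auto simp: field_simps)
    then show "(spin1 n * spin2 n - spin2 n * spin1 n) $$ (a, b) = (\<i> \<cdot>\<^sub>m spin3 n) $$ (a, b)"
      using ab by simp
  qed (auto intro!: carr simp del: One_nat_def add_Suc_right)
  show ?c23
  proof (rule key)
    fix a b assume ab: "a < n + 1" "b < n + 1"
    have "(spin2 n * spin3 n - spin3 n * spin2 n) $$ (a, b) = \<i> * spin1 n $$ (a, b)"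
      unfolding spin12_entries(1)[OF ab]
      by (simp only: ab F spin12_entries spin_entries) (auto simp: field_simps)
    then show "(spin2 n * spin3 n - spin3 n * spin2 n) $$ (a, b) = (\<i> \<cdot>\<^sub>m spin1 n) $$ (a, b)"
      using ab by simp
  qed (auto intro!: carr simp del: One_nat_def add_Suc_right)
  show ?c31
  proof (rule key)
    fix a b assume ab: "a < n + 1" "b < n + 1"
    have "(spin3 n * spin1 n - spin1 n * spin3 n) $$ (a, b) = \<i> * spin2 n $$ (a, b)"
      unfolding spin12_entries(2)[OF ab]
      by (simp only: ab F spin12_entries spin_entries) (auto simp: field_simps)
    then show "(spin3 n * spin1 n - spin1 n * spin3 n) $$ (a, b) = (\<i> \<cdot>\<^sub>m spin2 n) $$ (a, b)"
      using ab by simp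
  qed (auto intro!: carr simp del: One_nat_def add_Suc_right)
  show ?cas
  proof (rule key)
    fix a b assume ab: "a < n + 1" "b < n + 1"
    have "(spin1 n * spin1 n + spin2 n * spin2 n + spin3 n * spin3 n) $$ (a, b) =
        (if a = b then of_nat n / 2 * (of_nat n / 2 + 1) else 0)"
      by (simp only: ab F spin_entries) (auto simp: field_simps power2_eq_square)
    then show "(spin1 n * spin1 n + spin2 n * spin2 n + spin3 n * spin3 n) $$ (a, b) =
        ((of_nat n / 2 * (of_nat n / 2 + 1)) \<cdot>\<^sub>m 1\<^sub>m (n + 1)) $$ (a, b)"
      using ab by simp
  qed (auto intro!: carr simp del: One_nat_def add_Suc_right)
qed

end

theory Submission
  imports Defs "HOL-Probability.Distributions" "HOL-Real_Asymp.Real_Asymp"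
begin

text \<open>
  In a box of side \<open>L\<close> with all spins up along its boundary, the trial vectors are images of the bosonic
  occupation number states built from the Dirichlet modes of the discrete Laplacian, with bosonic creation
  operators replaced by spin lowering operators.  Written as a sum of squares over bonds, the energy of such a
  vector is at most the energy of the free boson state, and its squared norm is at least one minus the expected
  number of coinciding pairs of bosons, which is of order \<open>(N / L)^2\<close> for \<open>N\<close> bosons.  Replacing bosons by
  spins is a contraction, so the trial vectors still satisfy Bessel's inequality, and convexity of the
  exponential (the Peierls-Bogoliubov argument) bounds the partition function from below by that of free
  bosons at a slightly smaller temperature, truncated to twice the mean particle number.  Such bounds
  multiply over disjoint boxes, because the bonds between boxes do not contribute.  The limit along squares exists since the bond terms are
  nonnegative, which makes the logarithm of the partition function subadditive.
\<close>

section \<open>The spectral theorem for real symmetric kernels\<close>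

text \<open>In the \<open>S^3\<close> basis the Hamiltonian has real entries, so apart from the link
  to \<open>partition_fun\<close> the whole argument runs on real symmetric kernels indexed by
  configurations. What limits the box size is that two magnons on one site do not behave like free
  bosons. In two dimensions the mean number of bosons is governed by a sum of
  \<open>1 / |k|^2\<close> and so carries a logarithm: \<open>N\<close> is of order
  \<open>L^2 ln b / b\<close> with \<open>b = \<beta> S\<close>. The probability
  \<open>(N / L)^2\<close> of a coincidence favours small boxes. The relative cost of letting the
  modes vanish on the box boundary, of order \<open>sqrt b / L\<close>, favours large ones, but it
  buys exact additivity over boxes. Equating the two errors yields the exponents 1/3 and 2/3. The
  coincidence estimate carries a further factor \<open>1 / (2 S)\<close>, which is bounded by 1;
  hence \<open>\<beta>\<close> and \<open>S\<close> enter the error only through \<open>b\<close>,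
  and the constants are uniform in the spin.\<close>

definition ip_on :: "'a set \<Rightarrow> ('a \<Rightarrow> real) \<Rightarrow> ('a \<Rightarrow> real) \<Rightarrow> real" where
  "ip_on X v w = (\<Sum>s\<in>X. v s * w s)"

definition quad_form :: "'a set \<Rightarrow> ('a \<Rightarrow> 'a \<Rightarrow> real) \<Rightarrow> ('a \<Rightarrow> real) \<Rightarrow> real" where
  "quad_form X h v = (\<Sum>s\<in>X. \<Sum>t\<in>X. h s t * v s * v t)"

lemma ip_on_commute: "ip_on X v w = ip_on X w v"
  by (simp add: ip_on_def mult.commute)

lemma ip_on_self_nonneg: "ip_on X v v \<ge> 0"
  by (simp add: ip_on_def sum_nonneg)

lemma ip_on_self_eq_0: "finite X \<Longrightarrow> ip_on X v v = 0 \<longleftrightarrow> (\<forall>s\<in>X. v s = 0)"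
  unfolding ip_on_def by (subst sum_nonneg_eq_0_iff) auto

lemma ip_on_sum_right: "ip_on X v (\<lambda>s. \<Sum>i\<in>I. c i * w i s) = (\<Sum>i\<in>I. c i * ip_on X v (w i))"
  unfolding ip_on_def by (simp add: sum_distrib_left sum.swap[of _ _ X] mult_ac)

lemma ip_on_lin:
  "ip_on X u (\<lambda>s. a * v s + b * w s) = a * ip_on X u v + b * ip_on X u w"
  unfolding ip_on_def by (simp add: sum_distrib_left sum.distrib algebra_simps)

lemma ip_on_lin_left:
  "ip_on X (\<lambda>s. a * v s + b * w s) u = a * ip_on X v u + b * ip_on X w u"
  unfolding ip_on_def by (simp add: sum_distrib_left sum.distrib algebra_simps)

text \<open>Pythagoras for the residual of the projection onto the span. Besides Bessel's inequality
  it serves twice: a positive residual yields a further orthonormal vector, a vanishing one proves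
  completeness.\<close>

lemma bessel_identity:
  assumes "finite I" and on: "\<And>i j. i \<in> I \<Longrightarrow> j \<in> I \<Longrightarrow> ip_on X (e i) (e j) = of_bool (i = j)"
  shows "(\<Sum>s\<in>X. (v s - (\<Sum>i\<in>I. ip_on X (e i) v * e i s))\<^sup>2) = ip_on X v v - (\<Sum>i\<in>I. (ip_on X (e i) v)\<^sup>2)"
proof -
  define p where "p s = (\<Sum>i\<in>I. ip_on X (e i) v * e i s)" for s
  have vp: "ip_on X v p = (\<Sum>i\<in>I. (ip_on X (e i) v)\<^sup>2)"
    unfolding p_def ip_on_sum_right by (simp add: ip_on_commute[of X v] power2_eq_square)
  have ep: "ip_on X p (e i) = ip_on X (e i) v" if "i \<in> I" for i
    unfolding p_def ip_on_commute[of X _ "e i"] ip_on_sum_right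
    using assms that by (simp add: on of_bool_def sum.delta' if_distrib[of "(*) _"] cong: if_cong)
  have p: "(\<lambda>s. \<Sum>i\<in>I. ip_on X (e i) v * e i s) = p" by (simp add: p_def[abs_def])
  have "ip_on X p p = (\<Sum>i\<in>I. ip_on X (e i) v * ip_on X p (e i))"
    using ip_on_sum_right[of X p "\<lambda>i. ip_on X (e i) v" e I] unfolding p .
  also have "\<dots> = (\<Sum>i\<in>I. (ip_on X (e i) v)\<^sup>2)"
    by (simp add: ep power2_eq_square)
  finally have pp: "ip_on X p p = (\<Sum>i\<in>I. (ip_on X (e i) v)\<^sup>2)" .
  have "(\<Sum>s\<in>X. (v s - p s)\<^sup>2) = ip_on X v v - 2 * ip_on X v p + ip_on X p p"
  proof -
    have "(\<Sum>s\<in>X. (v s - p s)\<^sup>2) = (\<Sum>s\<in>X. v s * v s - 2 * (v s * p s) + p s * p s)"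
      by (intro sum.cong) (auto simp: power2_eq_square algebra_simps)
    then show ?thesis
      by (simp add: ip_on_def sum.distrib sum_subtractf flip: sum_distrib_left)
  qed
  then show ?thesis using vp pp unfolding p_def by simp
qed

lemma bessel_inequality:
  assumes "finite I" "\<And>i j. i \<in> I \<Longrightarrow> j \<in> I \<Longrightarrow> ip_on X (e i) (e j) = of_bool (i = j)"
  shows "(\<Sum>i\<in>I. (ip_on X (e i) v)\<^sup>2) \<le> ip_on X v v"
  using bessel_identity[OF assms, of v]
    sum_nonneg[of X "\<lambda>s. (v s - (\<Sum>i\<in>I. ip_on X (e i) v * e i s))\<^sup>2"] by simp

lemma ip_on_delta:
  assumes "finite X" "x \<in> X" shows "ip_on X v (\<lambda>s. of_bool (s = x)) = v x"
  using assms by (simp add: ip_on_def of_bool_def sum.delta if_distrib[of "(*) _"] cong: if_cong)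

lemma sum_orthonormal_sq:
  assumes "\<And>i. i \<in> I \<Longrightarrow> ip_on X (e i) (e i) = 1"
  shows "(\<Sum>s\<in>X. \<Sum>i\<in>I. (e i s)\<^sup>2) = real (card I)"
proof -
  have "(\<Sum>s\<in>X. \<Sum>i\<in>I. (e i s)\<^sup>2) = (\<Sum>i\<in>I. ip_on X (e i) (e i))"
    by (subst sum.swap) (simp add: ip_on_def power2_eq_square)
  then show ?thesis using assms by simp
qed

text \<open>The numbers \<open>(e i x)^2\<close> add up to \<open>card I\<close> over all
  \<open>i\<close> and \<open>x\<close>, so with \<open>card I < card X\<close> some point
  \<open>x\<close> has a sum over \<open>i\<close> below 1. The indicator of that point is outside
  the span, and its normalised residual is the new vector.\<close>

lemma orthonormal_complement:
  assumes X: "finite X" and I: "finite I" "card I < card X"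
    and on: "\<And>i j. i \<in> I \<Longrightarrow> j \<in> I \<Longrightarrow> ip_on X (e i) (e j) = of_bool (i = j)"
  obtains v where "ip_on X v v = 1" "\<And>i. i \<in> I \<Longrightarrow> ip_on X (e i) v = 0" "\<And>s. s \<notin> X \<Longrightarrow> v s = 0"
proof -
  have "\<exists>x\<in>X. (\<Sum>i\<in>I. (e i x)\<^sup>2) < 1"
  proof (rule ccontr)
    assume "\<not> ?thesis"
    then have "(\<Sum>s\<in>X. \<Sum>i\<in>I. (e i s)\<^sup>2) \<ge> (\<Sum>s\<in>X. 1)" by (intro sum_mono) force
    then show False using sum_orthonormal_sq[of I X e] on I by simp
  qed
  then obtain x where x: "x \<in> X" "(\<Sum>i\<in>I. (e i x)\<^sup>2) < 1" by blast
  define d where "d s = (of_bool (s = x) :: real)" for s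
  define p where "p s = (if s \<in> X then d s - (\<Sum>i\<in>I. ip_on X (e i) d * e i s) else 0)" for s
  have ed: "ip_on X (e i) d = e i x" for i
    using ip_on_delta[OF X x(1)] by (simp add: d_def[abs_def])
  have dd: "ip_on X d d = 1"
    using ip_on_delta[OF X x(1), of d] by (simp add: d_def[abs_def])
  have "ip_on X p p = (\<Sum>s\<in>X. (d s - (\<Sum>i\<in>I. ip_on X (e i) d * e i s))\<^sup>2)"
    by (simp add: ip_on_def p_def power2_eq_square)
  also have "\<dots> = 1 - (\<Sum>i\<in>I. (e i x)\<^sup>2)"
    using bessel_identity[OF I(1), where X = X and e = e and v = d] on by (simp add: dd ed)
  finally have pos: "ip_on X p p > 0" using x by simp
  have orth: "ip_on X (e i) p = 0" if "i \<in> I" for i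
  proof -
    have "ip_on X (e i) p = ip_on X (e i) (\<lambda>s. 1 * d s + (-1) * (\<Sum>j\<in>I. ip_on X (e j) d * e j s))"
      by (simp add: ip_on_def p_def)
    also have "\<dots> = 0"
      unfolding ip_on_lin ip_on_sum_right using that I
      by (simp add: on of_bool_def sum.delta if_distrib[of "(*) _"] cong: if_cong)
    finally show ?thesis .
  qed
  define c where "c = 1 / sqrt (ip_on X p p)"
  have sc: "ip_on X u (\<lambda>s. c * p s) = c * ip_on X u p" for u
    using ip_on_lin[of X u c p 0 p] by simp
  show ?thesis
  proof
    show "ip_on X (\<lambda>s. c * p s) (\<lambda>s. c * p s) = 1"
      using sc[of "\<lambda>s. c * p s"] sc[of p] ip_on_commute[of X "\<lambda>s. c * p s" p] pos by (simp add: c_def)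
    show "ip_on X (e i) (\<lambda>s. c * p s) = 0" if "i \<in> I" for i using sc orth[OF that] by simp
    show "c * p s = 0" if "s \<notin> X" for s using that by (simp add: p_def)
  qed
qed

text \<open>Requiring \<open>v s = 0\<close> off \<open>X\<close> places the unit sphere in a
  product of compact factors, so Tychonoff's theorem gives compactness in the function space even
  over an infinite type.\<close>

lemma compact_orthonormal_complement:
  assumes X: "finite X"
  shows "compact {v :: 'a \<Rightarrow> real. ip_on X v v = 1 \<and> (\<forall>i\<in>I. ip_on X (e i) v = 0) \<and> (\<forall>s. s \<notin> X \<longrightarrow> v s = 0)}"
    (is "compact ?K")
proof -
  define B where "B = (PiE UNIV (\<lambda>s. if s \<in> X then {-1..1} else {0}) :: ('a \<Rightarrow> real) set)"
  have "compactin (product_topology (\<lambda>i. euclidean) UNIV) B"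
    unfolding B_def compactin_PiE by (auto simp: compactin_euclidean_iff)
  then have "compact B" by (simp add: euclidean_product_topology compactin_euclidean_iff)
  have cont: "continuous_on UNIV (\<lambda>v. ip_on X v v)" "continuous_on UNIV (\<lambda>v. ip_on X (e i) v)" for i
    unfolding ip_on_def by (intro continuous_intros continuous_on_product_coordinates)+
  have "?K \<subseteq> B"
  proof
    fix v assume "v \<in> ?K"
    have "\<bar>v s\<bar> \<le> 1" if "s \<in> X" for s
    proof -
      have "v s * v s \<le> ip_on X v v" unfolding ip_on_def using X that by (intro member_le_sum) auto
      then have "(v s)\<^sup>2 \<le> 1" using \<open>v \<in> ?K\<close> by (simp add: power2_eq_square)
      then show ?thesis using abs_square_le_1 by blast
    qed
    then show "v \<in> B" using \<open>v \<in> ?K\<close> by (auto simp: B_def abs_le_iff minus_le_iff)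
  qed
  moreover have "closed ?K"
  proof -
    have "?K = {v. ip_on X v v = 1} \<inter> (\<Inter>i\<in>I. {v. ip_on X (e i) v = 0}) \<inter> (\<Inter>s\<in>-X. {v. v s = 0})"
      by auto
    also have "closed \<dots>"
      by (intro closed_Int closed_INT ballI closed_Collect_eq cont continuous_on_const
          continuous_on_product_coordinates)
    finally show ?thesis .
  qed
  ultimately have "compact (B \<inter> ?K)" "B \<inter> ?K = ?K"
    using compact_Int_closed[OF \<open>compact B\<close>] by auto
  then show ?thesis by simp
qed

definition apply_kernel :: "'a set \<Rightarrow> ('a \<Rightarrow> 'a \<Rightarrow> real) \<Rightarrow> ('a \<Rightarrow> real) \<Rightarrow> 'a \<Rightarrow> real" where
  "apply_kernel X h v s = (\<Sum>t\<in>X. h s t * v t)"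

lemma quad_form_apply: "quad_form X h v = ip_on X v (apply_kernel X h v)"
  by (simp add: quad_form_def ip_on_def apply_kernel_def sum_distrib_left mult_ac)

lemma apply_kernel_lin:
  "apply_kernel X h (\<lambda>s. a * v s + b * w s) t = a * apply_kernel X h v t + b * apply_kernel X h w t"
  by (simp add: apply_kernel_def sum_distrib_left sum.distrib algebra_simps)

lemma apply_kernel_adjoint:
  assumes "\<And>s t. s \<in> X \<Longrightarrow> t \<in> X \<Longrightarrow> h s t = h t s"
  shows "ip_on X v (apply_kernel X h w) = ip_on X (apply_kernel X h v) w"
proof -
  have "ip_on X v (apply_kernel X h w) = (\<Sum>s\<in>X. \<Sum>t\<in>X. v s * (h s t * w t))"
    by (simp add: ip_on_def apply_kernel_def sum_distrib_left)
  also have "\<dots> = (\<Sum>t\<in>X. \<Sum>s\<in>X. v s * (h s t * w t))" by (rule sum.swap)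
  also have "\<dots> = (\<Sum>t\<in>X. \<Sum>s\<in>X. v s * (h t s * w t))" using assms by (intro sum.cong) auto
  also have "\<dots> = ip_on X (apply_kernel X h v) w"
    unfolding ip_on_def apply_kernel_def sum_distrib_right by (simp add: mult_ac)
  finally show ?thesis .
qed

text \<open>First-order stationarity. At \<open>t = b / d\<close> with
  \<open>d = \<bar>c\<bar> + 1\<close> the linear term is \<open>2 b^2 / d\<close> and the quadratic
  one at least \<open>- b^2 / d\<close>, so a nonzero \<open>b\<close> would make the sum
  positive.\<close>

lemma linear_coeff_zero:
  fixes b c :: real
  assumes "\<And>t. 2 * t * b + t\<^sup>2 * c \<le> 0"
  shows "b = 0"
proof (rule ccontr)
  assume b: "b \<noteq> 0"
  define d where "d = \<bar>c\<bar> + 1"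
  have d: "d > 0" "- d \<le> c" by (auto simp: d_def)
  have "(b / d)\<^sup>2 * (- d) \<le> (b / d)\<^sup>2 * c" using d by (intro mult_left_mono) auto
  moreover have "(b / d)\<^sup>2 * (- d) = - (b\<^sup>2 / d)" "2 * (b / d) * b = 2 * (b\<^sup>2 / d)"
    using d by (simp_all add: power2_eq_square)
  moreover have "b\<^sup>2 / d > 0" using b d by simp
  ultimately show False using assms[of "b / d"] by linarith
qed

text \<open>A maximiser \<open>v\<close> of the quadratic form on the unit sphere of the complement
  exists by compactness. Its residual \<open>r = h v - \<mu> v\<close> stays in the complement
  because \<open>h\<close> is symmetric and the \<open>e i\<close> are eigenvectors, so
  \<open>v + t r\<close> may compete with \<open>v\<close>; stationarity at \<open>t = 0\<close>
  forces \<open>r = 0\<close>.\<close>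

lemma next_eigenvector:
  assumes X: "finite X" and I: "finite I" "card I < card X"
    and sym: "\<And>s t. s \<in> X \<Longrightarrow> t \<in> X \<Longrightarrow> h s t = h t s"
    and on: "\<And>i j. i \<in> I \<Longrightarrow> j \<in> I \<Longrightarrow> ip_on X (e i) (e j) = of_bool (i = j)"
    and ev: "\<And>i s. i \<in> I \<Longrightarrow> s \<in> X \<Longrightarrow> apply_kernel X h (e i) s = lam i * e i s"
  shows "\<exists>v \<mu>. ip_on X v v = 1 \<and> (\<forall>i\<in>I. ip_on X (e i) v = 0) \<and>
    (\<forall>s\<in>X. apply_kernel X h v s = \<mu> * v s)"
proof -
  define K where "K = {v. ip_on X v v = 1 \<and> (\<forall>i\<in>I. ip_on X (e i) v = 0) \<and> (\<forall>s. s \<notin> X \<longrightarrow> v s = 0)}"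
  obtain v0 where "ip_on X v0 v0 = 1" "\<And>i. i \<in> I \<Longrightarrow> ip_on X (e i) v0 = 0" "\<And>s. s \<notin> X \<Longrightarrow> v0 s = 0"
    by (rule orthonormal_complement[OF X I, of e]) (use on in auto)
  then have "v0 \<in> K" by (simp add: K_def)
  then have "K \<noteq> {}" by blast
  moreover have "compact K" unfolding K_def by (rule compact_orthonormal_complement[OF X])
  moreover have "continuous_on K (quad_form X h)"
    unfolding quad_form_def
    by (rule continuous_on_subset[OF _ subset_UNIV]) (intro continuous_intros continuous_on_product_coordinates)
  ultimately obtain v where v: "v \<in> K" and max: "\<And>w. w \<in> K \<Longrightarrow> quad_form X h w \<le> quad_form X h v"
    using continuous_attains_sup by metis
  define \<mu> where "\<mu> = quad_form X h v"
  have v1: "ip_on X v v = 1" "\<And>i. i \<in> I \<Longrightarrow> ip_on X (e i) v = 0" using v by (auto simp: K_def)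
  have rayleigh: "quad_form X h w \<le> \<mu> * ip_on X w w" if w: "\<And>i. i \<in> I \<Longrightarrow> ip_on X (e i) w = 0" for w
  proof (cases "ip_on X w w = 0")
    case True
    then have "quad_form X h w = 0" using ip_on_self_eq_0[OF X, of w] by (simp add: quad_form_def)
    then show ?thesis using True by simp
  next
    case False
    then have pos: "ip_on X w w > 0" using ip_on_self_nonneg[of X w] by simp
    define c where "c = 1 / sqrt (ip_on X w w)"
    have c2: "c * c = 1 / ip_on X w w" using pos by (simp add: c_def)
    \<comment> \<open>Normalised and set to zero off \<open>X\<close>, as membership in
      \<open>K\<close> demands; the forms only see \<open>X\<close>.\<close>
    define w' where "w' s = (if s \<in> X then c * w s else 0)" for s
    have "ip_on X w' w' = c * c * ip_on X w w"
      by (simp add: ip_on_def w'_def sum_distrib_left mult_ac)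
    moreover have "ip_on X (e i) w' = c * ip_on X (e i) w" for i
      by (simp add: ip_on_def w'_def sum_distrib_left mult_ac)
    ultimately have "w' \<in> K" using w c2 pos by (auto simp: K_def w'_def)
    moreover have "quad_form X h w' = c * c * quad_form X h w"
      by (simp add: quad_form_def w'_def sum_distrib_left mult_ac)
    ultimately have "quad_form X h w / ip_on X w w \<le> \<mu>" using max[of w'] c2 by (simp add: \<mu>_def)
    then show ?thesis using pos by (simp add: field_simps)
  qed
  define r where "r s = 1 * apply_kernel X h v s + (- \<mu>) * v s" for s
  have er: "ip_on X (e i) r = 0" if "i \<in> I" for i
  proof -
    have "ip_on X (e i) (apply_kernel X h v) = ip_on X (apply_kernel X h (e i)) v"
      by (rule apply_kernel_adjoint[OF sym])
    also have "\<dots> = ip_on X (\<lambda>s. lam i * e i s) v" using ev[OF that] by (simp add: ip_on_def)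
    also have "\<dots> = lam i * ip_on X (e i) v" by (simp add: ip_on_def sum_distrib_left mult_ac)
    finally show ?thesis using v1(2)[OF that] unfolding r_def ip_on_lin by simp
  qed
  have "ip_on X r r = 0"
  proof (rule linear_coeff_zero)
    fix t :: real
    define w where "w s = 1 * v s + t * r s" for s
    have "ip_on X (e i) w = 0" if "i \<in> I" for i
      unfolding w_def ip_on_lin using that v1(2) er by simp
    then have le: "quad_form X h w \<le> \<mu> * ip_on X w w" by (rule rayleigh)
    have hw: "apply_kernel X h w = (\<lambda>s. 1 * apply_kernel X h v s + t * apply_kernel X h r s)"
      unfolding w_def by (rule ext, rule apply_kernel_lin)
    have rv: "ip_on X r r = ip_on X r (apply_kernel X h v) - \<mu> * ip_on X v r"
    proof -
      have "ip_on X r r = ip_on X r (\<lambda>s. 1 * apply_kernel X h v s + (- \<mu>) * v s)"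
        by (simp only: r_def[abs_def])
      then show ?thesis unfolding ip_on_lin using ip_on_commute[of X r v] by simp
    qed
    have vr: "ip_on X v (apply_kernel X h r) = ip_on X r (apply_kernel X h v)"
      using apply_kernel_adjoint[of X h v r, OF sym] ip_on_commute[of X r] by simp
    have "quad_form X h w = quad_form X h v + 2 * t * ip_on X r (apply_kernel X h v) + t\<^sup>2 * quad_form X h r"
      unfolding quad_form_apply hw unfolding w_def ip_on_lin ip_on_lin_left
      using vr by (simp add: algebra_simps power2_eq_square)
    moreover have "ip_on X w w = ip_on X v v + 2 * t * ip_on X v r + t\<^sup>2 * ip_on X r r"
      unfolding w_def ip_on_lin ip_on_lin_left
      using ip_on_commute[of X r v] by (simp add: algebra_simps power2_eq_square)
    ultimately have "2 * t * (ip_on X r (apply_kernel X h v) - \<mu> * ip_on X v r)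
        + t\<^sup>2 * (quad_form X h r - \<mu> * ip_on X r r) \<le> 0"
      using le v1(1) by (simp add: \<mu>_def algebra_simps)
    then show "2 * t * ip_on X r r + t\<^sup>2 * (quad_form X h r - \<mu> * ip_on X r r) \<le> 0" using rv by simp
  qed
  then have "\<And>s. s \<in> X \<Longrightarrow> apply_kernel X h v s = \<mu> * v s"
    using ip_on_self_eq_0[OF X, of r] by (auto simp: r_def)
  then show ?thesis using v1 by blast
qed

text \<open>The index set \<open>J\<close> is arbitrary so that products of decompositions and
  relabelled configurations stay within the predicate. Completeness is recorded next to
  orthonormality, so no dimension count is needed later.\<close>

definition spectral_on :: "'a set \<Rightarrow> ('a \<Rightarrow> 'a \<Rightarrow> real) \<Rightarrow> 'i set \<Rightarrow> ('i \<Rightarrow> 'a \<Rightarrow> real) \<Rightarrow> ('i \<Rightarrow> real) \<Rightarrow> bool" where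
  "spectral_on X h J e lam \<longleftrightarrow> finite X \<and> finite J \<and>
     (\<forall>i\<in>J. \<forall>j\<in>J. ip_on X (e i) (e j) = of_bool (i = j)) \<and>
     (\<forall>s\<in>X. \<forall>t\<in>X. (\<Sum>i\<in>J. e i s * e i t) = of_bool (s = t)) \<and>
     (\<forall>s\<in>X. \<forall>t\<in>X. h s t = (\<Sum>i\<in>J. lam i * e i s * e i t))"

lemma spectral_theorem:
  assumes X: "finite X" and sym: "\<And>s t. s \<in> X \<Longrightarrow> t \<in> X \<Longrightarrow> h s t = h t s"
  obtains e lam where "spectral_on X h {..<card X} e lam"
proof -
  have "\<exists>e lam. (\<forall>i<k. \<forall>j<k. ip_on X (e i) (e j) = of_bool (i = j)) \<and>
      (\<forall>i<k. \<forall>s\<in>X. apply_kernel X h (e i) s = lam i * e i s)" if "k \<le> card X" for k :: nat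
    using that
  proof (induction k)
    case 0 then show ?case by simp
  next
    case (Suc k)
    obtain e lam where on: "\<forall>i<k. \<forall>j<k. ip_on X (e i) (e j) = of_bool (i = j)"
      and ev: "\<forall>i<k. \<forall>s\<in>X. apply_kernel X h (e i) s = lam i * e i s"
      using Suc.IH[OF Suc_leD[OF Suc.prems]] by blast
    have prem: "finite {..<k}" "card {..<k} < card X" using Suc.prems by auto
    have on': "ip_on X (e i) (e j) = of_bool (i = j)" if "i \<in> {..<k}" "j \<in> {..<k}" for i j
      using on that by blast
    have ev': "apply_kernel X h (e i) s = lam i * e i s" if "i \<in> {..<k}" "s \<in> X" for i s
      using ev that by blast
    obtain v \<mu> where v: "ip_on X v v = 1" "\<forall>i\<in>{..<k}. ip_on X (e i) v = 0"
      "\<forall>s\<in>X. apply_kernel X h v s = \<mu> * v s"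
      using next_eigenvector[OF X prem sym on' ev'] by blast
    define e' where "e' i = (if i = k then v else e i)" for i
    define lam' where "lam' i = (if i = k then \<mu> else lam i)" for i
    have "ip_on X (e' i) (e' j) = of_bool (i = j)" if "i < Suc k" "j < Suc k" for i j
    proof -
      have "ip_on X v (e j) = 0" if "j < k" for j using v(2) that ip_on_commute[of X v "e j"] by simp
      then show ?thesis using that v(1,2) on by (cases "i = k"; cases "j = k") (auto simp: e'_def)
    qed
    moreover have "apply_kernel X h (e' i) s = lam' i * e' i s" if "i < Suc k" "s \<in> X" for i s
      using that v(3) ev by (cases "i = k") (auto simp: e'_def lam'_def)
    ultimately show ?case by blast
  qed
  then obtain e lam where on: "\<forall>i<card X. \<forall>j<card X. ip_on X (e i) (e j) = of_bool (i = j)"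
      and ev: "\<forall>i<card X. \<forall>s\<in>X. apply_kernel X h (e i) s = lam i * e i s"
    by (metis order_refl)
  define J where "J = {..<card X}"
  have onJ: "\<And>i j. i \<in> J \<Longrightarrow> j \<in> J \<Longrightarrow> ip_on X (e i) (e j) = of_bool (i = j)" using on by (simp add: J_def)
  \<comment> \<open>Completeness without dimension theory: the diagonal sums are at most 1, by
    Bessel for an indicator, and add up to \<open>card X\<close>, so each equals 1. Then the
    residual of every indicator vanishes.\<close>
  have le1: "(\<Sum>i\<in>J. (e i x)\<^sup>2) \<le> 1" if "x \<in> X" for x
    using bessel_inequality[of J X e "\<lambda>s. of_bool (s = x)"] onJ that X
    by (simp add: ip_on_delta J_def)
  have tot: "(\<Sum>x\<in>X. 1 - (\<Sum>i\<in>J. (e i x)\<^sup>2)) = 0"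
    using sum_orthonormal_sq[of J X e] onJ by (simp add: sum_subtractf J_def)
  have eq1: "(\<Sum>i\<in>J. (e i x)\<^sup>2) = 1" if "x \<in> X" for x
  proof -
    have "\<forall>x\<in>X. 1 - (\<Sum>i\<in>J. (e i x)\<^sup>2) = 0"
      by (subst sum_nonneg_eq_0_iff[symmetric]) (use X le1 tot in auto)
    then show ?thesis using that by simp
  qed
  have compl: "(\<Sum>i\<in>J. e i s * e i t) = of_bool (s = t)" if "s \<in> X" "t \<in> X" for s t
  proof -
    have "(\<Sum>s\<in>X. (of_bool (s = t) - (\<Sum>i\<in>J. e i t * e i s))\<^sup>2) = 0"
      using bessel_identity[of J X e "\<lambda>s. of_bool (s = t)"] onJ that X eq1[of t]
      by (simp add: ip_on_delta J_def)
    then have "\<forall>s\<in>X. (of_bool (s = t) - (\<Sum>i\<in>J. e i t * e i s))\<^sup>2 = 0"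
      using X by (subst (asm) sum_nonneg_eq_0_iff) auto
    then show ?thesis using that by (simp add: mult.commute)
  qed
  have "h s t = (\<Sum>i\<in>J. lam i * e i s * e i t)" if "s \<in> X" "t \<in> X" for s t
  proof -
    have "h s t = (\<Sum>r\<in>X. h s r * of_bool (r = t))"
      using X that by (simp add: of_bool_def if_distrib[of "(*) _"] sum.delta' cong: if_cong)
    also have "\<dots> = (\<Sum>r\<in>X. \<Sum>i\<in>J. h s r * (e i r * e i t))"
      using compl that by (simp flip: sum_distrib_left)
    also have "\<dots> = (\<Sum>i\<in>J. \<Sum>r\<in>X. h s r * (e i r * e i t))" by (rule sum.swap)
    also have "\<dots> = (\<Sum>i\<in>J. apply_kernel X h (e i) s * e i t)"
      unfolding apply_kernel_def sum_distrib_right by (simp only: mult.assoc)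
    also have "\<dots> = (\<Sum>i\<in>J. lam i * e i s * e i t)"
    proof (rule sum.cong[OF refl])
      fix i assume "i \<in> J"
      then have "apply_kernel X h (e i) s = lam i * e i s" using ev that by (auto simp: J_def)
      then show "apply_kernel X h (e i) s * e i t = lam i * e i s * e i t" by simp
    qed
    finally show ?thesis .
  qed
  moreover have "finite J" by (simp add: J_def)
  ultimately have "spectral_on X h J e lam"
    unfolding spectral_on_def using X onJ compl by blast
  then show ?thesis using that by (simp add: J_def)
qed

section \<open>Trace inequalities\<close>

lemma spectral_onD:
  assumes "spectral_on X h J e lam"
  shows "finite X" "finite J"
    and "\<And>i j. i \<in> J \<Longrightarrow> j \<in> J \<Longrightarrow> ip_on X (e i) (e j) = of_bool (i = j)"
    and "\<And>s t. s \<in> X \<Longrightarrow> t \<in> X \<Longrightarrow> (\<Sum>i\<in>J. e i s * e i t) = of_bool (s = t)"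
    and "\<And>s t. s \<in> X \<Longrightarrow> t \<in> X \<Longrightarrow> h s t = (\<Sum>i\<in>J. lam i * e i s * e i t)"
  using assms unfolding spectral_on_def by blast+

lemma spectral_quad_form:
  assumes "spectral_on X h J e lam"
  shows "quad_form X h v = (\<Sum>i\<in>J. lam i * (ip_on X (e i) v)\<^sup>2)"
proof -
  have "quad_form X h v = (\<Sum>s\<in>X. \<Sum>t\<in>X. \<Sum>i\<in>J. lam i * ((e i s * v s) * (e i t * v t)))"
    unfolding quad_form_def
  proof (intro sum.cong refl)
    fix s t assume "s \<in> X" "t \<in> X"
    then show "h s t * v s * v t = (\<Sum>i\<in>J. lam i * ((e i s * v s) * (e i t * v t)))"
      unfolding spectral_onD(5)[OF assms \<open>s \<in> X\<close> \<open>t \<in> X\<close>] sum_distrib_right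
      by (intro sum.cong) (auto simp: mult_ac)
  qed
  also have "\<dots> = (\<Sum>s\<in>X. \<Sum>i\<in>J. \<Sum>t\<in>X. lam i * ((e i s * v s) * (e i t * v t)))"
    by (intro sum.cong refl sum.swap)
  also have "\<dots> = (\<Sum>i\<in>J. \<Sum>s\<in>X. \<Sum>t\<in>X. lam i * ((e i s * v s) * (e i t * v t)))"
    by (rule sum.swap)
  also have "\<dots> = (\<Sum>i\<in>J. lam i * (ip_on X (e i) v)\<^sup>2)"
    unfolding power2_eq_square ip_on_def sum_product by (simp only: sum_distrib_left)
  finally show ?thesis .
qed

lemma spectral_on_identity:
  assumes "spectral_on X h J e lam"
  shows "spectral_on X (\<lambda>s t. of_bool (s = t)) J e (\<lambda>_. 1)"
  using assms unfolding spectral_on_def by simp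

lemma quad_form_identity:
  assumes "finite X" shows "quad_form X (\<lambda>s t. of_bool (s = t)) v = ip_on X v v"
  unfolding quad_form_def ip_on_def
proof (intro sum.cong refl)
  fix s assume "s \<in> X"
  have "(\<Sum>t\<in>X. of_bool (s = t) * v s * v t) = (\<Sum>t\<in>X. if s = t then v s * v t else 0)"
    by (intro sum.cong) auto
  then show "(\<Sum>t\<in>X. of_bool (s = t) * v s * v t) = v s * v s"
    using assms \<open>s \<in> X\<close> by simp
qed

lemma spectral_parseval:
  assumes "spectral_on X h J e lam"
  shows "ip_on X v v = (\<Sum>i\<in>J. (ip_on X (e i) v)\<^sup>2)"
  using spectral_quad_form[OF spectral_on_identity[OF assms], of v]
    quad_form_identity[OF spectral_onD(1)[OF assms], of v] by simp

text \<open>The tangent line of \<open>exp\<close> at the mean energy \<open>\<mu>\<close> is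
  averaged with the weights \<open>w i\<close>, and its linear part averages to zero. For a vector
  of norm zero the factor in front removes the meaningless quotient.\<close>

lemma exp_jensen:
  assumes sp: "spectral_on X h J e lam"
  shows "ip_on X v v * exp (- \<beta> * (quad_form X h v / ip_on X v v))
    \<le> (\<Sum>i\<in>J. (ip_on X (e i) v)\<^sup>2 * exp (- \<beta> * lam i))"
proof (cases "ip_on X v v = 0")
  case True
  then show ?thesis by (simp add: sum_nonneg)
next
  case False
  define \<mu> where "\<mu> = quad_form X h v / ip_on X v v"
  define w where "w i = (ip_on X (e i) v)\<^sup>2" for i
  have W: "(\<Sum>i\<in>J. w i) = ip_on X v v" using spectral_parseval[OF sp, of v] by (simp add: w_def)
  have Q: "(\<Sum>i\<in>J. lam i * w i) = \<mu> * ip_on X v v"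
    using spectral_quad_form[OF sp, of v] False by (simp add: w_def \<mu>_def)
  have "w i * (exp (- \<beta> * \<mu>) * (1 - \<beta> * (lam i - \<mu>))) \<le> w i * exp (- \<beta> * lam i)" for i
  proof (rule mult_left_mono)
    have "1 + (- \<beta> * (lam i - \<mu>)) \<le> exp (- \<beta> * (lam i - \<mu>))" by (rule exp_ge_add_one_self)
    then have "exp (- \<beta> * \<mu>) * (1 - \<beta> * (lam i - \<mu>)) \<le> exp (- \<beta> * \<mu>) * exp (- \<beta> * (lam i - \<mu>))"
      by (intro mult_left_mono) auto
    also have "\<dots> = exp (- \<beta> * lam i)" by (simp add: algebra_simps flip: exp_add)
    finally show "exp (- \<beta> * \<mu>) * (1 - \<beta> * (lam i - \<mu>)) \<le> exp (- \<beta> * lam i)" .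
  qed (simp add: w_def)
  then have "(\<Sum>i\<in>J. w i * (exp (- \<beta> * \<mu>) * (1 - \<beta> * (lam i - \<mu>)))) \<le> (\<Sum>i\<in>J. w i * exp (- \<beta> * lam i))"
    by (intro sum_mono)
  moreover have "(\<Sum>i\<in>J. w i * (exp (- \<beta> * \<mu>) * (1 - \<beta> * (lam i - \<mu>))))
      = exp (- \<beta> * \<mu>) * ((\<Sum>i\<in>J. w i) - \<beta> * ((\<Sum>i\<in>J. lam i * w i) - \<mu> * (\<Sum>i\<in>J. w i)))"
  proof -
    have "(\<Sum>i\<in>J. w i * (exp (- \<beta> * \<mu>) * (1 - \<beta> * (lam i - \<mu>))))
        = (\<Sum>i\<in>J. exp (- \<beta> * \<mu>) * (w i - \<beta> * (lam i * w i - \<mu> * w i)))"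
      by (intro sum.cong) (auto simp: algebra_simps)
    then show ?thesis by (simp only: sum_distrib_left[symmetric] sum_subtractf)
  qed
  ultimately show ?thesis using W Q by (simp add: w_def \<mu>_def mult.commute)
qed

text \<open>\<open>exp_jensen\<close> is applied to every trial vector and the sums are exchanged;
  Bessel's inequality at the eigenvector \<open>e i\<close> then keeps the total weight on each
  eigenvalue at most 1.\<close>

lemma peierls_bogoliubov:
  assumes sp: "spectral_on X h J e lam" and I: "finite I"
    and bessel: "\<And>\<eta>. (\<Sum>m\<in>I. (ip_on X (v m) \<eta>)\<^sup>2) \<le> ip_on X \<eta> \<eta>"
  shows "(\<Sum>m\<in>I. ip_on X (v m) (v m) * exp (- \<beta> * (quad_form X h (v m) / ip_on X (v m) (v m))))
    \<le> (\<Sum>i\<in>J. exp (- \<beta> * lam i))"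
proof -
  have "(\<Sum>m\<in>I. ip_on X (v m) (v m) * exp (- \<beta> * (quad_form X h (v m) / ip_on X (v m) (v m))))
      \<le> (\<Sum>m\<in>I. \<Sum>i\<in>J. (ip_on X (e i) (v m))\<^sup>2 * exp (- \<beta> * lam i))"
    by (intro sum_mono exp_jensen[OF sp])
  also have "\<dots> = (\<Sum>i\<in>J. (\<Sum>m\<in>I. (ip_on X (v m) (e i))\<^sup>2) * exp (- \<beta> * lam i))"
    by (subst sum.swap) (simp only: ip_on_commute[of X "v _"] sum_distrib_right)
  also have "\<dots> \<le> (\<Sum>i\<in>J. 1 * exp (- \<beta> * lam i))"
  proof (intro sum_mono mult_right_mono)
    fix i assume "i \<in> J"
    then show "(\<Sum>m\<in>I. (ip_on X (v m) (e i))\<^sup>2) \<le> 1"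
      using bessel[of "e i"] spectral_onD(3)[OF sp, of i i] by simp
  qed simp
  finally show ?thesis by simp
qed

text \<open>The eigenvectors of \<open>h\<close> serve as trial vectors for \<open>k\<close>: they
  satisfy Parseval's identity, and their \<open>k\<close>-energies are at most \<open>lam i\<close>.
  This takes the place of a min-max comparison of single eigenvalues.\<close>

lemma trace_exp_antimono:
  assumes h: "spectral_on X h J e lam" and k: "spectral_on X k J' e' lam'" and "\<beta> \<ge> 0"
    and le: "\<And>v. quad_form X k v \<le> quad_form X h v"
  shows "(\<Sum>i\<in>J. exp (- \<beta> * lam i)) \<le> (\<Sum>i\<in>J'. exp (- \<beta> * lam' i))"
proof -
  have 1: "ip_on X (e i) (e i) = 1" if "i \<in> J" for i using spectral_onD(3)[OF h that that] by simp
  have "quad_form X k (e i) \<le> lam i" if "i \<in> J" for i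
  proof -
    have "quad_form X h (e i) = (\<Sum>j\<in>J. lam j * (of_bool (j = i))\<^sup>2)"
      unfolding spectral_quad_form[OF h] using that by (intro sum.cong) (auto simp: spectral_onD(3)[OF h])
    also have "\<dots> = (\<Sum>j\<in>J. if j = i then lam j else 0)" by (intro sum.cong) auto
    also have "\<dots> = lam i" using that spectral_onD(2)[OF h] by simp
    finally show ?thesis using le[of "e i"] by simp
  qed
  then have "(\<Sum>i\<in>J. exp (- \<beta> * lam i)) \<le> (\<Sum>i\<in>J. ip_on X (e i) (e i) * exp (- \<beta> * (quad_form X k (e i) / ip_on X (e i) (e i))))"
    using \<open>\<beta> \<ge> 0\<close> by (intro sum_mono) (auto simp: 1 mult_left_mono)
  also have "\<dots> \<le> (\<Sum>i\<in>J'. exp (- \<beta> * lam' i))"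
    by (rule peierls_bogoliubov[OF k spectral_onD(2)[OF h]]) (simp add: spectral_parseval[OF h])
  finally show ?thesis .
qed

section \<open>Two independent subsystems (\<open>h \<otimes> 1 + 1 \<otimes> k\<close>) and change
  of labels\<close>

definition kernel_sum where
  "kernel_sum h k = (\<lambda>(s, s') (t, t'). h s t * of_bool (s' = t') + of_bool (s = t) * k s' t')"

lemma spectral_on_product:
  assumes h: "spectral_on X h J e lam" and k: "spectral_on Y k J' e' lam'"
  shows "spectral_on (X \<times> Y) (kernel_sum h k) (J \<times> J')
    (\<lambda>(i, j) (s, t). e i s * e' j t) (\<lambda>(i, j). lam i + lam' j)"
  unfolding spectral_on_def
proof (intro conjI ballI)
  note fin = spectral_onD(1,2)[OF h] spectral_onD(1,2)[OF k]
  show "finite (X \<times> Y)" "finite (J \<times> J')" using fin by auto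
  show "ip_on (X \<times> Y) ((\<lambda>(i, j) (s, t). e i s * e' j t) p) ((\<lambda>(i, j) (s, t). e i s * e' j t) q) = of_bool (p = q)"
    if "p \<in> J \<times> J'" "q \<in> J \<times> J'" for p q
  proof -
    obtain i j i' j' where p: "p = (i, j)" "q = (i', j')" by (cases p; cases q)
    have "ip_on (X \<times> Y) ((\<lambda>(i, j) (s, t). e i s * e' j t) p) ((\<lambda>(i, j) (s, t). e i s * e' j t) q)
        = ip_on X (e i) (e i') * ip_on Y (e' j) (e' j')"
      unfolding ip_on_def p sum_product sum.cartesian_product
      by (intro sum.cong) (auto simp: mult_ac)
    then show ?thesis using that p by (auto simp: spectral_onD(3)[OF h] spectral_onD(3)[OF k])
  qed
  fix p q assume pq: "p \<in> X \<times> Y" "q \<in> X \<times> Y"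
  obtain s s' t t' where p: "p = (s, s')" "q = (t, t')" by (cases p; cases q)
  have mem: "s \<in> X" "t \<in> X" "s' \<in> Y" "t' \<in> Y" using pq p by auto
  have "(\<Sum>i\<in>J \<times> J'. (\<lambda>(i, j) (s, t). e i s * e' j t) i p * (\<lambda>(i, j) (s, t). e i s * e' j t) i q)
      = (\<Sum>i\<in>J. e i s * e i t) * (\<Sum>j\<in>J'. e' j s' * e' j t')"
    unfolding p sum_product sum.cartesian_product by (intro sum.cong) (auto simp: mult_ac)
  then show "(\<Sum>i\<in>J \<times> J'. (\<lambda>(i, j) (s, t). e i s * e' j t) i p * (\<lambda>(i, j) (s, t). e i s * e' j t) i q) = of_bool (p = q)"
    using mem p by (auto simp: spectral_onD(4)[OF h] spectral_onD(4)[OF k])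
  have "(\<Sum>i\<in>J \<times> J'. (\<lambda>(i, j). lam i + lam' j) i * (\<lambda>(i, j) (s, t). e i s * e' j t) i p * (\<lambda>(i, j) (s, t). e i s * e' j t) i q)
      = (\<Sum>i\<in>J. lam i * e i s * e i t) * (\<Sum>j\<in>J'. e' j s' * e' j t')
        + (\<Sum>i\<in>J. e i s * e i t) * (\<Sum>j\<in>J'. lam' j * e' j s' * e' j t')"
    unfolding p sum_product sum.cartesian_product sum.distrib[symmetric]
    by (intro sum.cong) (auto simp: algebra_simps)
  then show "kernel_sum h k p q = (\<Sum>i\<in>J \<times> J'. (\<lambda>(i, j). lam i + lam' j) i * (\<lambda>(i, j) (s, t). e i s * e' j t) i p * (\<lambda>(i, j) (s, t). e i s * e' j t) i q)"
    using mem by (simp add: p kernel_sum_def spectral_onD(4)[OF h] spectral_onD(4)[OF k]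
        spectral_onD(5)[OF h, symmetric] spectral_onD(5)[OF k, symmetric])
qed

lemma trace_exp_product:
  fixes lam lam' :: "_ \<Rightarrow> real"
  shows "(\<Sum>p\<in>J \<times> J'. exp (- \<beta> * (\<lambda>(i, j). lam i + lam' j) p))
    = (\<Sum>i\<in>J. exp (- \<beta> * lam i)) * (\<Sum>j\<in>J'. exp (- \<beta> * lam' j))"
  unfolding sum_product sum.cartesian_product
  by (intro sum.cong) (auto simp: algebra_simps simp flip: exp_add)

lemma spectral_on_reindex:
  assumes f: "bij_betw f X Y" and sp: "spectral_on Y h J e lam"
  shows "spectral_on X (\<lambda>s t. h (f s) (f t)) J (\<lambda>i s. e i (f s)) lam"
  unfolding spectral_on_def
proof (intro conjI ballI)
  show "finite X" using f spectral_onD(1)[OF sp] bij_betw_finite by blast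
  show "finite J" by (rule spectral_onD(2)[OF sp])
  show "ip_on X (\<lambda>s. e i (f s)) (\<lambda>s. e j (f s)) = of_bool (i = j)" if "i \<in> J" "j \<in> J" for i j
    using spectral_onD(3)[OF sp that] sum.reindex_bij_betw[OF f, of "\<lambda>s. e i s * e j s"]
    by (simp add: ip_on_def)
  fix s t assume st: "s \<in> X" "t \<in> X"
  then have "f s \<in> Y" "f t \<in> Y" "f s = f t \<longleftrightarrow> s = t"
    using f by (auto simp: bij_betw_def inj_on_def)
  then show "(\<Sum>i\<in>J. e i (f s) * e i (f t)) = of_bool (s = t)"
    "h (f s) (f t) = (\<Sum>i\<in>J. lam i * e i (f s) * e i (f t))"
    using spectral_onD(4,5)[OF sp] by auto
qed

lemma spectral_on_scale:
  "spectral_on X h J e lam \<Longrightarrow> spectral_on X (\<lambda>s t. c * h s t) J e (\<lambda>i. c * lam i)"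
  unfolding spectral_on_def by (simp add: sum_distrib_left mult.assoc)

lemma spectral_on_cong:
  "(\<And>s t. s \<in> X \<Longrightarrow> t \<in> X \<Longrightarrow> h s t = h' s t) \<Longrightarrow> spectral_on X h J e lam \<Longrightarrow> spectral_on X h' J e lam"
  unfolding spectral_on_def by auto

section \<open>Powers and exponential of a complex matrix with real spectral data\<close>

lemma pow_mat_entry_spectral:
  fixes A :: "complex mat"
  assumes A: "A \<in> carrier_mat N N" and ent: "\<And>a b. a < N \<Longrightarrow> b < N \<Longrightarrow> A $$ (a, b) = of_real (h a b)"
    and sp: "spectral_on {..<N} h J e lam" and ab: "a < N" "b < N"
  shows "(A ^\<^sub>m k) $$ (a, b) = of_real (\<Sum>i\<in>J. lam i ^ k * e i a * e i b)"
  using ab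
proof (induction k arbitrary: a b)
  case 0
  have "(\<Sum>i\<in>J. lam i ^ 0 * e i a * e i b) = of_bool (a = b)"
    using spectral_onD(4)[OF sp, of a b] 0 by simp
  then show ?case using 0 A by (auto simp: pow_mat.simps)
next
  case (Suc k)
  have Ak: "A ^\<^sub>m k \<in> carrier_mat N N" using A by (rule pow_carrier_mat)
  have "(A ^\<^sub>m Suc k) $$ (a, b) = (\<Sum>c<N. (A ^\<^sub>m k) $$ (a, c) * A $$ (c, b))"
    using times_mat_entry[OF Ak A Suc.prems] by simp
  also have "\<dots> = (\<Sum>c<N. of_real (\<Sum>i\<in>J. lam i ^ k * e i a * e i c) * of_real (h c b))"
    using Suc.IH Suc.prems ent by (intro sum.cong) auto
  also have "\<dots> = of_real (\<Sum>c<N. (\<Sum>i\<in>J. lam i ^ k * e i a * e i c) * h c b)" by simp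
  also have "(\<Sum>c<N. (\<Sum>i\<in>J. lam i ^ k * e i a * e i c) * h c b)
      = (\<Sum>c<N. \<Sum>i\<in>J. \<Sum>j\<in>J. (lam i ^ k * e i a) * (lam j * e j b) * (e i c * e j c))"
  proof (rule sum.cong[OF refl])
    fix c assume "c \<in> {..<N}"
    then have "h c b = (\<Sum>j\<in>J. lam j * e j c * e j b)" using spectral_onD(5)[OF sp] Suc.prems by simp
    then show "(\<Sum>i\<in>J. lam i ^ k * e i a * e i c) * h c b
        = (\<Sum>i\<in>J. \<Sum>j\<in>J. (lam i ^ k * e i a) * (lam j * e j b) * (e i c * e j c))"
      by (simp only: sum_product) (simp add: mult_ac)
  qed
  also have "\<dots> = (\<Sum>i\<in>J. \<Sum>c<N. \<Sum>j\<in>J. (lam i ^ k * e i a) * (lam j * e j b) * (e i c * e j c))"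
    by (rule sum.swap)
  also have "\<dots> = (\<Sum>i\<in>J. \<Sum>j\<in>J. \<Sum>c<N. (lam i ^ k * e i a) * (lam j * e j b) * (e i c * e j c))"
    by (intro sum.cong refl sum.swap)
  also have "\<dots> = (\<Sum>i\<in>J. \<Sum>j\<in>J. (lam i ^ k * e i a) * (lam j * e j b) * of_bool (i = j))"
    using spectral_onD(3)[OF sp] by (intro sum.cong refl) (simp add: ip_on_def flip: sum_distrib_left)
  also have "\<dots> = (\<Sum>i\<in>J. \<Sum>j\<in>J. if j = i then (lam i ^ k * e i a) * (lam j * e j b) else 0)"
    by (intro sum.cong) auto
  also have "\<dots> = (\<Sum>i\<in>J. lam i ^ Suc k * e i a * e i b)"
    using spectral_onD(2)[OF sp] by (intro sum.cong) (auto simp: mult_ac)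
  finally show ?case .
qed

lemma trace_mat_exp_spectral:
  fixes A :: "complex mat"
  assumes A: "A \<in> carrier_mat N N" and ent: "\<And>a b. a < N \<Longrightarrow> b < N \<Longrightarrow> A $$ (a, b) = of_real (h a b)"
    and sp: "spectral_on {..<N} h J e lam"
  shows "mat_trace (mat_exp A) = of_real (\<Sum>i\<in>J. exp (lam i))"
proof -
  have diag: "(\<Sum>k. (A ^\<^sub>m k) $$ (a, a) / fact k) = of_real (\<Sum>i\<in>J. exp (lam i) * (e i a * e i a))" if "a < N" for a
  proof -
    have "(\<lambda>k. (lam i ^ k /\<^sub>R fact k) * (e i a * e i a)) sums (exp (lam i) * (e i a * e i a))" for i
      by (intro sums_mult2 exp_converges)
    then have "(\<lambda>k. \<Sum>i\<in>J. (lam i ^ k /\<^sub>R fact k) * (e i a * e i a)) sums (\<Sum>i\<in>J. exp (lam i) * (e i a * e i a))"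
      by (intro sums_sum)
    moreover have "(\<Sum>i\<in>J. (lam i ^ k /\<^sub>R fact k) * (e i a * e i a)) = (\<Sum>i\<in>J. lam i ^ k * e i a * e i a) / fact k" for k
      unfolding sum_divide_distrib by (intro sum.cong) (auto simp: field_simps)
    ultimately have "(\<lambda>k. complex_of_real ((\<Sum>i\<in>J. lam i ^ k * e i a * e i a) / fact k)) sums of_real (\<Sum>i\<in>J. exp (lam i) * (e i a * e i a))"
      by (subst sums_of_real_iff) simp
    moreover have "complex_of_real ((\<Sum>i\<in>J. lam i ^ k * e i a * e i a) / fact k) = (A ^\<^sub>m k) $$ (a, a) / fact k" for k
      using pow_mat_entry_spectral[OF A ent sp that that, of k] by simp
    ultimately show ?thesis by (simp add: sums_iff)
  qed
  have "mat_trace (mat_exp A) = (\<Sum>a<N. \<Sum>k. (A ^\<^sub>m k) $$ (a, a) / fact k)"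
    using A by (simp add: mat_trace_def mat_exp_def)
  also have "\<dots> = (\<Sum>a<N. of_real (\<Sum>i\<in>J. exp (lam i) * (e i a * e i a)))"
    by (intro sum.cong refl diag) simp
  also have "\<dots> = of_real (\<Sum>i\<in>J. \<Sum>a<N. exp (lam i) * (e i a * e i a))"
    by (simp only: of_real_sum[symmetric] sum.swap[of _ J])
  also have "\<dots> = of_real (\<Sum>i\<in>J. exp (lam i))"
    using spectral_onD(3)[OF sp] by (simp add: ip_on_def flip: sum_distrib_left)
  finally show ?thesis .
qed

section \<open>The Hamiltonian as a sum of squares\<close>

lemma finite_configs: "finite \<Lambda> \<Longrightarrow> finite (configs n \<Lambda>)"
  by (simp add: configs_def finite_PiE)

lemma bij_config:
  "finite \<Lambda> \<Longrightarrow> bij_betw (config n \<Lambda>) {..<hdim n \<Lambda>} (configs n \<Lambda>)"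
  unfolding config_def[abs_def] hdim_def by (rule bij_betw_from_nat_into_finite[OF finite_configs])

lemma config_mem: "finite \<Lambda> \<Longrightarrow> a < hdim n \<Lambda> \<Longrightarrow> config n \<Lambda> a \<in> configs n \<Lambda>"
  using bij_config[of \<Lambda> n] by (auto simp: bij_betw_def)

lemma configs_le: "\<sigma> \<in> configs n \<Lambda> \<Longrightarrow> x \<in> \<Lambda> \<Longrightarrow> \<sigma> x \<le> n"
  unfolding configs_def by (drule (1) PiE_mem) simp

lemma configs_upd: "\<sigma> \<in> configs n \<Lambda> \<Longrightarrow> x \<in> \<Lambda> \<Longrightarrow> k \<le> n \<Longrightarrow> \<sigma>(x := k) \<in> configs n \<Lambda>"
  by (auto simp: configs_def PiE_def Pi_def extensional_def)

lemma configs_eqI: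
  "\<sigma> \<in> configs n \<Lambda> \<Longrightarrow> \<tau> \<in> configs n \<Lambda> \<Longrightarrow> (\<And>z. z \<in> \<Lambda> \<Longrightarrow> \<sigma> z = \<tau> z) \<Longrightarrow> \<sigma> = \<tau>"
  unfolding configs_def by (rule PiE_ext)

text \<open>The bond term \<open>S^2 - S_x \<cdot> S_y\<close> is half the sum over \<open>B\<close> of the rank-one forms of these vectors,
  which compare adding one more magnon to \<open>B\<close> at \<open>x\<close> with adding it at \<open>y\<close>; a sum of squares makes both
  positivity and the comparison with free bosons visible.\<close>

definition bond_vec :: "nat \<Rightarrow> site \<Rightarrow> site \<Rightarrow> (site \<Rightarrow> nat) \<Rightarrow> (site \<Rightarrow> nat) \<Rightarrow> real" where
  "bond_vec n x y B \<sigma> =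
     sqrt (real (B x + 1) * (real n - real (B y))) * of_bool (\<sigma> = B(x := B x + 1)) -
     sqrt (real (B y + 1) * (real n - real (B x))) * of_bool (\<sigma> = B(y := B y + 1))"

text \<open>For a \<open>B\<close> excluded here, a raised configuration either leaves
  \<open>configs n \<Lambda>\<close> or carries the coefficient zero in \<open>bond_vec\<close>, so
  nothing is lost on admissible configurations.\<close>

definition below_configs :: "nat \<Rightarrow> site set \<Rightarrow> site \<Rightarrow> site \<Rightarrow> (site \<Rightarrow> nat) set" where
  "below_configs n \<Lambda> x y = {B \<in> configs n \<Lambda>. B x < n \<and> B y < n}"

definition bond_kernel :: "nat \<Rightarrow> site set \<Rightarrow> site \<Rightarrow> site \<Rightarrow> (site \<Rightarrow> nat) \<Rightarrow> (site \<Rightarrow> nat) \<Rightarrow> real" where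
  "bond_kernel n \<Lambda> x y \<sigma> \<tau> = (\<Sum>B\<in>below_configs n \<Lambda> x y. bond_vec n x y B \<sigma> * bond_vec n x y B \<tau>) / 2"

definition ham_kernel :: "nat \<Rightarrow> site set \<Rightarrow> (site \<Rightarrow> nat) \<Rightarrow> (site \<Rightarrow> nat) \<Rightarrow> real" where
  "ham_kernel n \<Lambda> \<sigma> \<tau> = (\<Sum>(x, y)\<in>nn_pairs \<Lambda>. bond_kernel n \<Lambda> x y \<sigma> \<tau>)"

text \<open>Two-site matrix element of \<open>S^2 - S_x \<cdot> S_y\<close> from
  \<open>(k, l)\<close> to \<open>(i, j)\<close>. The diagonal is
  \<open>S^2 - (S - i) (S - j) = S (i + j) - i j\<close> with \<open>S = n / 2\<close>; the other
  two terms are the exchange \<open>(S^+ S^- + S^- S^+) / 2\<close>.\<close>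

definition spin_bond :: "nat \<Rightarrow> nat \<Rightarrow> nat \<Rightarrow> nat \<Rightarrow> nat \<Rightarrow> real" where
  "spin_bond n i j k l =
     (if i = k \<and> j = l then (real i * (real n - real j) + real j * (real n - real i)) / 2 else 0)
     - (if i = k + 1 \<and> l = j + 1 then sqrt (real i * (real n + 1 - real i)) * sqrt (real l * (real n + 1 - real l)) else 0) / 2
     - (if k = i + 1 \<and> j = l + 1 then sqrt (real k * (real n + 1 - real k)) * sqrt (real j * (real n + 1 - real j)) else 0) / 2"

lemma finite_below: "finite \<Lambda> \<Longrightarrow> finite (below_configs n \<Lambda> x y)"
  by (simp add: below_configs_def finite_configs)

lemma eq_upd_Suc_iff:
  fixes \<sigma> B :: "'s \<Rightarrow> nat"
  shows "\<sigma> = B(x := B x + 1) \<longleftrightarrow> 0 < \<sigma> x \<and> B = \<sigma>(x := \<sigma> x - 1)"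
proof
  assume "\<sigma> = B(x := B x + 1)" then show "0 < \<sigma> x \<and> B = \<sigma>(x := \<sigma> x - 1)" by auto
next
  assume "0 < \<sigma> x \<and> B = \<sigma>(x := \<sigma> x - 1)" then show "\<sigma> = B(x := B x + 1)" by auto
qed

lemma sum_of_bool_raise:
  fixes f :: "('s \<Rightarrow> nat) \<Rightarrow> real"
  assumes "finite D"
  shows "(\<Sum>B\<in>D. f B * of_bool (\<sigma> = B(x := B x + 1)))
    = (if 0 < \<sigma> x \<and> \<sigma>(x := \<sigma> x - 1) \<in> D then f (\<sigma>(x := \<sigma> x - 1)) else 0)"
proof -
  have "(\<Sum>B\<in>D. f B * of_bool (\<sigma> = B(x := B x + 1)))
      = (\<Sum>B\<in>D. if B = \<sigma>(x := \<sigma> x - 1) then (if 0 < \<sigma> x then f B else 0) else 0)"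
    unfolding eq_upd_Suc_iff by (intro sum.cong) auto
  then show ?thesis using assms by simp
qed

lemma lower_below_iff:
  assumes "\<sigma> \<in> configs n \<Lambda>" "x \<in> \<Lambda>" "y \<in> \<Lambda>" "x \<noteq> y" "0 < \<sigma> x"
  shows "\<sigma>(x := \<sigma> x - 1) \<in> below_configs n \<Lambda> x y \<longleftrightarrow> \<sigma> y < n"
    and "\<sigma>(x := \<sigma> x - 1) \<in> below_configs n \<Lambda> y x \<longleftrightarrow> \<sigma> y < n"
proof -
  have "\<sigma> x \<le> n" using configs_le assms by blast
  then have "\<sigma>(x := \<sigma> x - 1) \<in> configs n \<Lambda>" "\<sigma> x - 1 < n" using assms by (auto intro!: configs_upd)
  then show "\<sigma>(x := \<sigma> x - 1) \<in> below_configs n \<Lambda> x y \<longleftrightarrow> \<sigma> y < n"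
    "\<sigma>(x := \<sigma> x - 1) \<in> below_configs n \<Lambda> y x \<longleftrightarrow> \<sigma> y < n"
    using assms(4) by (auto simp: below_configs_def)
qed

lemma below_configs_commute: "below_configs n \<Lambda> x y = below_configs n \<Lambda> y x"
  by (auto simp: below_configs_def)

lemma bond_diag_sum:
  assumes "finite \<Lambda>" "\<sigma> \<in> configs n \<Lambda>" "x \<in> \<Lambda>" "y \<in> \<Lambda>" "x \<noteq> y"
  shows "(\<Sum>B\<in>below_configs n \<Lambda> x y. real (B x + 1) * (real n - real (B y)) *
      of_bool (\<sigma> = B(x := B x + 1))) = real (\<sigma> x) * (real n - real (\<sigma> y))"
proof -
  have "\<sigma> y \<le> n" using assms configs_le by blast
  then show ?thesis
    unfolding sum_of_bool_raise[OF finite_below[OF assms(1)]]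
    using lower_below_iff(1)[OF assms(2-5)] assms(5)
    by (cases "\<sigma> x = 0"; cases "\<sigma> y = n") (simp_all add: of_nat_diff)
qed

text \<open>A single \<open>B\<close> can contribute: \<open>\<sigma>\<close> with one magnon
  removed at \<open>x\<close>, which must also be \<open>\<tau>\<close> with one removed at
  \<open>y\<close>. The four factors under the roots then regroup into one ladder coefficient per
  site.\<close>

lemma bond_cross_sum:
  assumes "finite \<Lambda>" "\<sigma> \<in> configs n \<Lambda>" "\<tau> \<in> configs n \<Lambda>" "x \<in> \<Lambda>" "y \<in> \<Lambda>" "x \<noteq> y"
  shows "(\<Sum>B\<in>below_configs n \<Lambda> x y.
      (sqrt (real (B x + 1) * (real n - real (B y))) * sqrt (real (B y + 1) * (real n - real (B x))) *
       of_bool (\<tau> = B(y := B y + 1))) * of_bool (\<sigma> = B(x := B x + 1)))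
    = (if (\<forall>z\<in>\<Lambda> - {x, y}. \<sigma> z = \<tau> z) \<and> \<sigma> x = \<tau> x + 1 \<and> \<tau> y = \<sigma> y + 1
       then sqrt (real (\<sigma> x) * (real n + 1 - real (\<sigma> x))) * sqrt (real (\<tau> y) * (real n + 1 - real (\<tau> y))) else 0)"
proof -
  let ?R = "(\<forall>z\<in>\<Lambda> - {x, y}. \<sigma> z = \<tau> z) \<and> \<sigma> x = \<tau> x + 1 \<and> \<tau> y = \<sigma> y + 1"
  have iff: "\<tau> = (\<sigma>(x := \<sigma> x - 1))(y := (\<sigma>(x := \<sigma> x - 1)) y + 1) \<longleftrightarrow>
      (\<forall>z\<in>\<Lambda> - {x, y}. \<sigma> z = \<tau> z) \<and> \<sigma> x = \<tau> x + 1 \<and> \<tau> y = \<sigma> y + 1" if "0 < \<sigma> x"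
  proof
    assume "\<tau> = (\<sigma>(x := \<sigma> x - 1))(y := (\<sigma>(x := \<sigma> x - 1)) y + 1)"
    then show "(\<forall>z\<in>\<Lambda> - {x, y}. \<sigma> z = \<tau> z) \<and> \<sigma> x = \<tau> x + 1 \<and> \<tau> y = \<sigma> y + 1"
      using assms(6) that by auto
  next
    assume r: "(\<forall>z\<in>\<Lambda> - {x, y}. \<sigma> z = \<tau> z) \<and> \<sigma> x = \<tau> x + 1 \<and> \<tau> y = \<sigma> y + 1"
    show "\<tau> = (\<sigma>(x := \<sigma> x - 1))(y := (\<sigma>(x := \<sigma> x - 1)) y + 1)"
    proof
      fix z
      show "\<tau> z = ((\<sigma>(x := \<sigma> x - 1))(y := (\<sigma>(x := \<sigma> x - 1)) y + 1)) z"
      proof (cases "z \<in> \<Lambda>")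
        case True
        then show ?thesis using r assms(6) by auto
      next
        case False
        then have "\<sigma> z = undefined" "\<tau> z = undefined" "z \<noteq> x" "z \<noteq> y"
          using assms PiE_arb[of _ \<Lambda> _ z] by (auto simp: configs_def)
        then show ?thesis by simp
      qed
    qed
  qed
  show ?thesis
  proof (cases ?R)
    case True
    have "\<sigma> y < n" using configs_le[OF assms(3,5)] True by simp
    have pos: "0 < \<sigma> x" using True by simp
    have D: "\<sigma>(x := \<sigma> x - 1) \<in> below_configs n \<Lambda> x y"
      using lower_below_iff(1)[OF assms(2,4,5,6) pos] \<open>\<sigma> y < n\<close> by simp
    have "sqrt (real (\<sigma> x) * (real n - real (\<sigma> y))) * sqrt (real (\<sigma> y + 1) * (real n - real (\<sigma> x - 1)))
        = sqrt (real (\<sigma> x) * (real n + 1 - real (\<sigma> x))) * sqrt (real (\<sigma> y + 1) * (real n + 1 - real (\<sigma> y + 1)))"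
      unfolding real_sqrt_mult[symmetric] using pos by (simp add: of_nat_diff mult_ac)
    then show ?thesis
      unfolding sum_of_bool_raise[OF finite_below[OF assms(1)]] if_P[OF True]
      using D pos True iff[OF pos] assms(6) by simp
  next
    case False
    then show ?thesis
      unfolding sum_of_bool_raise[OF finite_below[OF assms(1)]] if_not_P[OF False]
      using iff by (cases "0 < \<sigma> x") auto
  qed
qed

lemma binomial_product:
  fixes a b :: real
  shows "(a * p - b * q) * (a * r - b * s) =
    (a * a) * (p * r) + (b * b) * (q * s) - (a * b * s) * p - (a * b * q) * r"
  by (simp add: algebra_simps)

text \<open>Verifies that the sum of squares is the Heisenberg bond: the squares inside
  \<open>bond_vec\<close> products give the diagonal term, the mixed products the exchange
  term.\<close>

lemma bond_kernel_eq:
  assumes "finite \<Lambda>" "\<sigma> \<in> configs n \<Lambda>" "\<tau> \<in> configs n \<Lambda>" "x \<in> \<Lambda>" "y \<in> \<Lambda>" "x \<noteq> y"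
  shows "bond_kernel n \<Lambda> x y \<sigma> \<tau> =
    (if \<forall>z\<in>\<Lambda> - {x, y}. \<sigma> z = \<tau> z then spin_bond n (\<sigma> x) (\<sigma> y) (\<tau> x) (\<tau> y) else 0)"
proof -
  let ?D = "below_configs n \<Lambda> x y"
  let ?a = "\<lambda>B. sqrt (real (B x + 1) * (real n - real (B y)))"
  let ?b = "\<lambda>B. sqrt (real (B y + 1) * (real n - real (B x)))"
  let ?r = "\<lambda>x \<sigma> B. of_bool (\<sigma> = B(x := B x + 1)) :: real"
  have aa: "?a B * ?a B = real (B x + 1) * (real n - real (B y))"
    "?b B * ?b B = real (B y + 1) * (real n - real (B x))" if "B \<in> ?D" for B
    using that by (auto simp: below_configs_def)
  have "(\<Sum>B\<in>?D. bond_vec n x y B \<sigma> * bond_vec n x y B \<tau>)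
      = (\<Sum>B\<in>?D. of_bool (\<sigma> = \<tau>) * (real (B x + 1) * (real n - real (B y)) * ?r x \<sigma> B)
          + of_bool (\<sigma> = \<tau>) * (real (B y + 1) * (real n - real (B x)) * ?r y \<sigma> B)
          - (?a B * ?b B * ?r y \<tau> B) * ?r x \<sigma> B - (?a B * ?b B * ?r y \<sigma> B) * ?r x \<tau> B)"
  proof (intro sum.cong refl)
    fix B assume B: "B \<in> ?D"
    have 1: "?r x \<sigma> B * ?r x \<tau> B = of_bool (\<sigma> = \<tau>) * ?r x \<sigma> B"
      "?r y \<sigma> B * ?r y \<tau> B = of_bool (\<sigma> = \<tau>) * ?r y \<sigma> B" by auto
    have "bond_vec n x y B \<sigma> * bond_vec n x y B \<tau> =
        (?a B * ?a B) * (?r x \<sigma> B * ?r x \<tau> B) + (?b B * ?b B) * (?r y \<sigma> B * ?r y \<tau> B)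
        - (?a B * ?b B * ?r y \<tau> B) * ?r x \<sigma> B - (?a B * ?b B * ?r y \<sigma> B) * ?r x \<tau> B"
      unfolding bond_vec_def by (rule binomial_product)
    then show "bond_vec n x y B \<sigma> * bond_vec n x y B \<tau> =
        of_bool (\<sigma> = \<tau>) * (real (B x + 1) * (real n - real (B y)) * ?r x \<sigma> B)
          + of_bool (\<sigma> = \<tau>) * (real (B y + 1) * (real n - real (B x)) * ?r y \<sigma> B)
          - (?a B * ?b B * ?r y \<tau> B) * ?r x \<sigma> B - (?a B * ?b B * ?r y \<sigma> B) * ?r x \<tau> B"
      unfolding aa[OF B] 1 by (simp only: mult_ac)
  qed
  also have "\<dots> = of_bool (\<sigma> = \<tau>) * (real (\<sigma> x) * (real n - real (\<sigma> y)))
      + of_bool (\<sigma> = \<tau>) * (real (\<sigma> y) * (real n - real (\<sigma> x)))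
      - (\<Sum>B\<in>?D. (?a B * ?b B * ?r y \<tau> B) * ?r x \<sigma> B) - (\<Sum>B\<in>?D. (?a B * ?b B * ?r y \<sigma> B) * ?r x \<tau> B)"
    using bond_diag_sum[OF assms(1,2,4,5,6)] bond_diag_sum[OF assms(1,2,5,4) assms(6)[symmetric]]
    by (simp only: sum_subtractf sum.distrib sum_distrib_left[symmetric] below_configs_commute[of n \<Lambda> y x])
  finally have eq: "(\<Sum>B\<in>?D. bond_vec n x y B \<sigma> * bond_vec n x y B \<tau>) = \<dots>" .
  define P where "P \<longleftrightarrow> (\<forall>z\<in>\<Lambda> - {x, y}. \<sigma> z = \<tau> z)"
  have P': "(\<forall>z\<in>\<Lambda> - {x, y}. \<tau> z = \<sigma> z) \<longleftrightarrow> P"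
    unfolding P_def by (rule ball_cong[OF refl]) (rule eq_commute)
  have st: "\<sigma> = \<tau> \<longleftrightarrow> P \<and> \<sigma> x = \<tau> x \<and> \<sigma> y = \<tau> y"
    unfolding P_def using configs_eqI[OF assms(2,3)] by blast
  show ?thesis
    unfolding bond_kernel_def eq bond_cross_sum[OF assms] bond_cross_sum[OF assms(1,3,2,4,5,6)] spin_bond_def
      P' P_def[symmetric] st
    by (cases P; cases "\<sigma> x = \<tau> x \<and> \<sigma> y = \<tau> y") (auto simp: diff_divide_distrib)
qed

section \<open>Matrix entries of the Heisenberg Hamiltonian\<close>

lemma site_op_carrier: "site_op n \<Lambda> A x \<in> carrier_mat (hdim n \<Lambda>) (hdim n \<Lambda>)"
  by (simp add: site_op_def)

text \<open>The first factor changes only \<open>x\<close> and the second only \<open>y\<close>, so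
  among the intermediate configurations only \<open>\<sigma>(x := \<tau> x)\<close>
  survives.\<close>

lemma site_op_mult_entry:
  assumes \<Lambda>: "finite \<Lambda>" "x \<in> \<Lambda>" "y \<in> \<Lambda>" "x \<noteq> y" and ab: "a < hdim n \<Lambda>" "b < hdim n \<Lambda>"
  defines "\<sigma> \<equiv> config n \<Lambda> a" and "\<tau> \<equiv> config n \<Lambda> b"
  shows "(site_op n \<Lambda> A x * site_op n \<Lambda> B y) $$ (a, b) =
    (if \<forall>z\<in>\<Lambda> - {x, y}. \<sigma> z = \<tau> z then A $$ (\<sigma> x, \<tau> x) * B $$ (\<sigma> y, \<tau> y) else 0)"
proof -
  have mem: "\<sigma> \<in> configs n \<Lambda>" "\<tau> \<in> configs n \<Lambda>" unfolding \<sigma>_def \<tau>_def by (intro config_mem \<Lambda> ab)+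
  define g where "g \<rho> = (if \<forall>z\<in>\<Lambda> - {x}. \<sigma> z = \<rho> z then A $$ (\<sigma> x, \<rho> x) else 0) *
      (if \<forall>z\<in>\<Lambda> - {y}. \<rho> z = \<tau> z then B $$ (\<rho> y, \<tau> y) else 0)" for \<rho>
  have "(site_op n \<Lambda> A x * site_op n \<Lambda> B y) $$ (a, b) = (\<Sum>c<hdim n \<Lambda>. g (config n \<Lambda> c))"
    unfolding times_mat_entry[OF site_op_carrier site_op_carrier ab]
    using ab by (intro sum.cong) (auto simp: site_op_def g_def \<sigma>_def \<tau>_def)
  also have "\<dots> = (\<Sum>\<rho>\<in>configs n \<Lambda>. g \<rho>)"
    by (rule sum.reindex_bij_betw[OF bij_config[OF \<Lambda>(1)]])
  also have "\<dots> = (\<Sum>\<rho>\<in>configs n \<Lambda>. if \<rho> = \<sigma>(x := \<tau> x) then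
      (if \<forall>z\<in>\<Lambda> - {x, y}. \<sigma> z = \<tau> z then A $$ (\<sigma> x, \<tau> x) * B $$ (\<sigma> y, \<tau> y) else 0) else 0)"
  proof (intro sum.cong refl)
    fix \<rho> assume \<rho>: "\<rho> \<in> configs n \<Lambda>"
    show "g \<rho> = (if \<rho> = \<sigma>(x := \<tau> x) then
      (if \<forall>z\<in>\<Lambda> - {x, y}. \<sigma> z = \<tau> z then A $$ (\<sigma> x, \<tau> x) * B $$ (\<sigma> y, \<tau> y) else 0) else 0)"
    proof (cases "\<rho> = \<sigma>(x := \<tau> x)")
      case True
      have "(\<forall>z\<in>\<Lambda> - {y}. \<rho> z = \<tau> z) \<longleftrightarrow> (\<forall>z\<in>\<Lambda> - {x, y}. \<sigma> z = \<tau> z)" using True \<Lambda> by auto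
      moreover have "\<forall>z\<in>\<Lambda> - {x}. \<sigma> z = \<rho> z" "\<rho> x = \<tau> x" "\<rho> y = \<sigma> y" using True \<Lambda>(4) by auto
      ultimately show ?thesis unfolding g_def if_P[OF True] by simp
    next
      case False
      have "\<not> ((\<forall>z\<in>\<Lambda> - {x}. \<sigma> z = \<rho> z) \<and> (\<forall>z\<in>\<Lambda> - {y}. \<rho> z = \<tau> z))"
      proof
        assume r: "(\<forall>z\<in>\<Lambda> - {x}. \<sigma> z = \<rho> z) \<and> (\<forall>z\<in>\<Lambda> - {y}. \<rho> z = \<tau> z)"
        have "\<rho> = \<sigma>(x := \<tau> x)"
          by (rule configs_eqI[OF \<rho> configs_upd[OF mem(1) \<Lambda>(2) configs_le[OF mem(2) \<Lambda>(2)]]])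
            (use r \<Lambda> in auto)
        then show False using False by simp
      qed
      then show ?thesis using False by (auto simp: g_def)
    qed
  qed
  also have "\<dots> = (if \<forall>z\<in>\<Lambda> - {x, y}. \<sigma> z = \<tau> z then A $$ (\<sigma> x, \<tau> x) * B $$ (\<sigma> y, \<tau> y) else 0)"
    using configs_upd[OF mem(1) \<Lambda>(2) configs_le[OF mem(2) \<Lambda>(2)]] finite_configs[OF \<Lambda>(1)] by simp
  finally show ?thesis .
qed

text \<open>By \<open>S^1 S^1 + S^2 S^2 = (S^+ S^- + S^- S^+) / 2\<close> the imaginary units
  cancel, which is why real kernels suffice.\<close>

lemma spin_bond_eq:
  assumes "i \<le> n" "j \<le> n" "k \<le> n" "l \<le> n"
  shows "(if i = k \<and> j = l then complex_of_real ((real n / 2)\<^sup>2) else 0) -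
     (spin1 n $$ (i, k) * spin1 n $$ (j, l) + spin2 n $$ (i, k) * spin2 n $$ (j, l) +
      spin3 n $$ (i, k) * spin3 n $$ (j, l)) = of_real (spin_bond n i j k l)"
proof -
  have lt: "i < n + 1" "j < n + 1" "k < n + 1" "l < n + 1" using assms by auto
  have lad: "ladder_coeff n k = complex_of_real (sqrt (real k * (real n + 1 - real k)))" for k
    by (simp add: ladder_coeff_def)
  have pm: "spin1 n $$ (i, k) * spin1 n $$ (j, l) + spin2 n $$ (i, k) * spin2 n $$ (j, l) =
      (spin_raise n $$ (i, k) * spin_lower n $$ (j, l) + spin_lower n $$ (i, k) * spin_raise n $$ (j, l)) / 2"
    unfolding spin12_entries(1)[OF lt(1,3)] spin12_entries(1)[OF lt(2,4)]
      spin12_entries(2)[OF lt(1,3)] spin12_entries(2)[OF lt(2,4)]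
    by (simp add: field_simps)
  show ?thesis
    unfolding pm
    unfolding spin_entries(1)[OF lt(1,3)] spin_entries(1)[OF lt(2,4)]
      spin_entries(2)[OF lt(1,3)] spin_entries(2)[OF lt(2,4)]
      spin_entries(3)[OF lt(1,3)] spin_entries(3)[OF lt(2,4)] spin_bond_def lad
    by (auto simp: field_simps power2_eq_square)
qed

lemma finite_nn_pairs: "finite \<Lambda> \<Longrightarrow> finite (nn_pairs \<Lambda>)"
  by (rule finite_subset[of _ "\<Lambda> \<times> \<Lambda>"]) (auto simp: nn_pairs_def)

lemma nn_pairsD: "(x, y) \<in> nn_pairs \<Lambda> \<Longrightarrow> x \<in> \<Lambda> \<and> y \<in> \<Lambda> \<and> x \<noteq> y"
  by (auto simp: nn_pairs_def prod_eq_iff)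

lemma hamiltonian_entry:
  assumes \<Lambda>: "finite \<Lambda>" and ab: "a < hdim n \<Lambda>" "b < hdim n \<Lambda>"
  shows "hamiltonian n \<Lambda> $$ (a, b) = of_real (ham_kernel n \<Lambda> (config n \<Lambda> a) (config n \<Lambda> b))"
proof -
  have "(complex_of_real ((real n / 2)\<^sup>2) \<cdot>\<^sub>m 1\<^sub>m (hdim n \<Lambda>) - spin_dot n \<Lambda> x y) $$ (a, b)
      = of_real (bond_kernel n \<Lambda> x y (config n \<Lambda> a) (config n \<Lambda> b))" if "(x, y) \<in> nn_pairs \<Lambda>" for x y
  proof -
    have xy: "x \<in> \<Lambda>" "y \<in> \<Lambda>" "x \<noteq> y" using nn_pairsD[OF that] by auto
    define \<sigma> \<tau> where "\<sigma> = config n \<Lambda> a" and "\<tau> = config n \<Lambda> b"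
    have mem: "\<sigma> \<in> configs n \<Lambda>" "\<tau> \<in> configs n \<Lambda>" unfolding \<sigma>_def \<tau>_def by (intro config_mem \<Lambda> ab)+
    have le: "\<sigma> x \<le> n" "\<sigma> y \<le> n" "\<tau> x \<le> n" "\<tau> y \<le> n" using mem xy configs_le by blast+
    have prod_carr: "site_op n \<Lambda> A x * site_op n \<Lambda> B y \<in> carrier_mat (hdim n \<Lambda>) (hdim n \<Lambda>)" for A B
      by (intro mult_carrier_mat[OF site_op_carrier site_op_carrier])
    have dot: "spin_dot n \<Lambda> x y $$ (a, b) = (if \<forall>z\<in>\<Lambda> - {x, y}. \<sigma> z = \<tau> z then
        spin1 n $$ (\<sigma> x, \<tau> x) * spin1 n $$ (\<sigma> y, \<tau> y) + spin2 n $$ (\<sigma> x, \<tau> x) * spin2 n $$ (\<sigma> y, \<tau> y) +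
        spin3 n $$ (\<sigma> x, \<tau> x) * spin3 n $$ (\<sigma> y, \<tau> y) else 0)"
    proof -
      have "spin_dot n \<Lambda> x y $$ (a, b) =
          (site_op n \<Lambda> (spin1 n) x * site_op n \<Lambda> (spin1 n) y) $$ (a, b) +
          (site_op n \<Lambda> (spin2 n) x * site_op n \<Lambda> (spin2 n) y) $$ (a, b) +
          (site_op n \<Lambda> (spin3 n) x * site_op n \<Lambda> (spin3 n) y) $$ (a, b)"
        unfolding spin_dot_def
        using ab carrier_matD[OF prod_carr] by (simp add: index_add_mat del: index_mult_mat(1))
      then show ?thesis
        unfolding site_op_mult_entry[OF \<Lambda> xy ab] by (simp add: \<sigma>_def \<tau>_def)
    qed
    have dim: "dim_row (spin_dot n \<Lambda> x y) = hdim n \<Lambda>" "dim_col (spin_dot n \<Lambda> x y) = hdim n \<Lambda>"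
      by (simp_all add: spin_dot_def site_op_def)
    have ab_eq: "a = b \<longleftrightarrow> \<sigma> = \<tau>"
      using bij_config[OF \<Lambda>, of n] ab by (auto simp: bij_betw_def inj_on_def \<sigma>_def \<tau>_def)
    have st: "\<sigma> = \<tau> \<longleftrightarrow> (\<forall>z\<in>\<Lambda> - {x, y}. \<sigma> z = \<tau> z) \<and> \<sigma> x = \<tau> x \<and> \<sigma> y = \<tau> y"
      using configs_eqI[OF mem] by blast
    have "(complex_of_real ((real n / 2)\<^sup>2) \<cdot>\<^sub>m 1\<^sub>m (hdim n \<Lambda>) - spin_dot n \<Lambda> x y) $$ (a, b)
        = (if a = b then complex_of_real ((real n / 2)\<^sup>2) else 0) - spin_dot n \<Lambda> x y $$ (a, b)"
      using ab dim by simp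
    also have "\<dots> = (if \<forall>z\<in>\<Lambda> - {x, y}. \<sigma> z = \<tau> z then of_real (spin_bond n (\<sigma> x) (\<sigma> y) (\<tau> x) (\<tau> y)) else 0)"
    proof (cases "\<forall>z\<in>\<Lambda> - {x, y}. \<sigma> z = \<tau> z")
      case True
      have eq: "(if a = b then complex_of_real ((real n / 2)\<^sup>2) else 0)
          = (if \<sigma> x = \<tau> x \<and> \<sigma> y = \<tau> y then complex_of_real ((real n / 2)\<^sup>2) else 0)"
        using True unfolding ab_eq st by simp
      show ?thesis unfolding dot eq if_P[OF True] by (rule spin_bond_eq[OF le])
    next
      case False
      then have "a \<noteq> b" using ab_eq by auto
      then show ?thesis unfolding dot if_not_P[OF False] by simp
    qed
    also have "\<dots> = of_real (bond_kernel n \<Lambda> x y \<sigma> \<tau>)"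
      unfolding bond_kernel_eq[OF \<Lambda> mem xy] by simp
    finally show ?thesis by (simp only: \<sigma>_def \<tau>_def)
  qed
  then have "(\<Sum>(x, y)\<in>nn_pairs \<Lambda>. (complex_of_real ((real n / 2)\<^sup>2) \<cdot>\<^sub>m 1\<^sub>m (hdim n \<Lambda>) - spin_dot n \<Lambda> x y) $$ (a, b))
      = (\<Sum>(x, y)\<in>nn_pairs \<Lambda>. of_real (bond_kernel n \<Lambda> x y (config n \<Lambda> a) (config n \<Lambda> b)))"
    by (intro sum.cong) auto
  then show ?thesis
    using ab by (simp add: hamiltonian_def ham_kernel_def of_real_sum case_prod_beta)
qed

text \<open>The link between the matrix definition and the kernels: any eigenbasis of
  \<open>ham_kernel\<close> on configurations computes the partition function, whatever enumeration
  \<open>config\<close> uses.\<close>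

lemma partition_fun_spectral:
  assumes \<Lambda>: "finite \<Lambda>" and sp: "spectral_on (configs n \<Lambda>) (ham_kernel n \<Lambda>) J e lam"
  shows "partition_fun \<beta> n \<Lambda> = (\<Sum>i\<in>J. exp (- \<beta> * lam i))"
proof -
  let ?f = "config n \<Lambda>"
  let ?A = "complex_of_real (- \<beta>) \<cdot>\<^sub>m hamiltonian n \<Lambda>"
  have A: "?A \<in> carrier_mat (hdim n \<Lambda>) (hdim n \<Lambda>)" by (simp add: hamiltonian_def)
  have ent: "?A $$ (a, b) = of_real (- \<beta> * ham_kernel n \<Lambda> (?f a) (?f b))"
    if "a < hdim n \<Lambda>" "b < hdim n \<Lambda>" for a b
    using hamiltonian_entry[OF \<Lambda> that] that by (simp add: hamiltonian_def)
  have "spectral_on {..<hdim n \<Lambda>} (\<lambda>a b. - \<beta> * ham_kernel n \<Lambda> (?f a) (?f b)) J (\<lambda>i a. e i (?f a)) (\<lambda>i. - \<beta> * lam i)"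
    by (intro spectral_on_scale spectral_on_reindex[OF bij_config[OF \<Lambda>] sp])
  from trace_mat_exp_spectral[OF A ent this] show ?thesis
    by (simp add: partition_fun_def)
qed

lemma ham_kernel_sym: "ham_kernel n \<Lambda> \<sigma> \<tau> = ham_kernel n \<Lambda> \<tau> \<sigma>"
  by (simp add: ham_kernel_def bond_kernel_def mult.commute)

lemma ham_spectral:
  assumes "finite \<Lambda>"
  obtains J :: "nat set" and e lam where "spectral_on (configs n \<Lambda>) (ham_kernel n \<Lambda>) J e lam"
proof -
  obtain e lam where "spectral_on (configs n \<Lambda>) (ham_kernel n \<Lambda>) {..<card (configs n \<Lambda>)} e lam"
    by (rule spectral_theorem[OF finite_configs[OF assms] ham_kernel_sym])
  then show thesis by (rule that)
qed

section \<open>Bosonic Fock space\<close>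

text \<open>Fock space in its polynomial (Bargmann) form: \<open>F \<sigma>\<close> is the
  coefficient of the monomial with exponents \<open>\<sigma>\<close>, \<open>create\<close>
  multiplies by the linear form \<open>v\<close>, and \<open>annih x\<close> differentiates in the
  variable \<open>x\<close>. This avoids square roots of occupation numbers.\<close>

definition create :: "'s set \<Rightarrow> ('s \<Rightarrow> real) \<Rightarrow> (('s \<Rightarrow> nat) \<Rightarrow> real) \<Rightarrow> ('s \<Rightarrow> nat) \<Rightarrow> real" where
  "create \<Lambda> v F \<sigma> = (\<Sum>x\<in>\<Lambda>. if 0 < \<sigma> x then v x * F (\<sigma>(x := \<sigma> x - 1)) else 0)"

definition annih :: "'s \<Rightarrow> (('s \<Rightarrow> nat) \<Rightarrow> real) \<Rightarrow> ('s \<Rightarrow> nat) \<Rightarrow> real" where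
  "annih x F \<sigma> = (real (\<sigma> x) + 1) * F (\<sigma>(x := \<sigma> x + 1))"

definition vacuum :: "'s set \<Rightarrow> ('s \<Rightarrow> nat) \<Rightarrow> real" where
  "vacuum \<Lambda> \<sigma> = of_bool (\<forall>x\<in>\<Lambda>. \<sigma> x = 0)"

text \<open>The cutoff on the particle number only keeps the sums finite.\<close>

definition fock_domain :: "'s set \<Rightarrow> nat \<Rightarrow> ('s \<Rightarrow> nat) set" where
  "fock_domain \<Lambda> M = {\<sigma> \<in> \<Lambda> \<rightarrow>\<^sub>E UNIV. sum \<sigma> \<Lambda> \<le> M}"

definition fact_prod :: "'s set \<Rightarrow> ('s \<Rightarrow> nat) \<Rightarrow> real" where
  "fact_prod \<Lambda> \<sigma> = (\<Prod>x\<in>\<Lambda>. fact (\<sigma> x))"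

text \<open>The Fischer product: monomials are orthogonal with squared norm
  \<open>fact_prod \<Lambda> \<sigma>\<close>, which makes multiplication by a variable adjoint to
  differentiation.\<close>

definition fock_ip :: "'s set \<Rightarrow> nat \<Rightarrow> (('s \<Rightarrow> nat) \<Rightarrow> real) \<Rightarrow> (('s \<Rightarrow> nat) \<Rightarrow> real) \<Rightarrow> real" where
  "fock_ip \<Lambda> M F G = (\<Sum>\<sigma>\<in>fock_domain \<Lambda> M. fact_prod \<Lambda> \<sigma> * F \<sigma> * G \<sigma>)"

lemma fact_prod_pos: "fact_prod \<Lambda> \<sigma> > 0"
  unfolding fact_prod_def by (intro prod_pos) auto

lemma finite_fock_domain:
  assumes "finite \<Lambda>" shows "finite (fock_domain \<Lambda> M)"
proof (rule finite_subset)
  show "fock_domain \<Lambda> M \<subseteq> \<Lambda> \<rightarrow>\<^sub>E {..M}"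
  proof
    fix \<sigma> assume "\<sigma> \<in> fock_domain \<Lambda> M"
    then have s: "\<sigma> \<in> \<Lambda> \<rightarrow>\<^sub>E UNIV" "sum \<sigma> \<Lambda> \<le> M" by (auto simp: fock_domain_def)
    have "\<sigma> x \<le> M" if "x \<in> \<Lambda>" for x
      using member_le_sum[OF that, of \<sigma>] s(2) assms by simp
    then show "\<sigma> \<in> \<Lambda> \<rightarrow>\<^sub>E {..M}" using s(1) unfolding PiE_def Pi_def by blast
  qed
  show "finite (\<Lambda> \<rightarrow>\<^sub>E {..M})" using assms by (intro finite_PiE) auto
qed

text \<open>The canonical commutation relation, here the product rule for differentiating a linear
  form times \<open>F\<close>.\<close>

lemma annih_create:
  assumes "finite \<Lambda>" "x \<in> \<Lambda>"
  shows "annih x (create \<Lambda> v F) \<sigma> = v x * F \<sigma> + create \<Lambda> v (annih x F) \<sigma>"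
proof -
  let ?\<tau> = "\<sigma>(x := \<sigma> x + 1)"
  define R where "R = (\<Sum>y\<in>\<Lambda> - {x}. if 0 < \<sigma> y then v y * F (?\<tau>(y := \<sigma> y - 1)) else 0)"
  have "create \<Lambda> v F ?\<tau> = v x * F \<sigma> + (\<Sum>y\<in>\<Lambda> - {x}. if 0 < ?\<tau> y then v y * F (?\<tau>(y := ?\<tau> y - 1)) else 0)"
    unfolding create_def sum.remove[OF assms] by simp
  also have "(\<Sum>y\<in>\<Lambda> - {x}. if 0 < ?\<tau> y then v y * F (?\<tau>(y := ?\<tau> y - 1)) else 0) = R"
    unfolding R_def by (intro sum.cong) auto
  finally have "create \<Lambda> v F ?\<tau> = v x * F \<sigma> + R" .
  then have 1: "annih x (create \<Lambda> v F) \<sigma> = (real (\<sigma> x) + 1) * (v x * F \<sigma> + R)"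
    unfolding annih_def by (rule arg_cong)
  have "(\<Sum>y\<in>\<Lambda> - {x}. if 0 < \<sigma> y then v y * annih x F (\<sigma>(y := \<sigma> y - 1)) else 0) = (real (\<sigma> x) + 1) * R"
    unfolding R_def sum_distrib_left
    by (intro sum.cong) (auto simp: annih_def fun_upd_twist)
  moreover have "(if 0 < \<sigma> x then v x * annih x F (\<sigma>(x := \<sigma> x - 1)) else 0) = real (\<sigma> x) * (v x * F \<sigma>)"
    by (auto simp: annih_def)
  ultimately have "create \<Lambda> v (annih x F) \<sigma> = real (\<sigma> x) * (v x * F \<sigma>) + (real (\<sigma> x) + 1) * R"
    unfolding create_def sum.remove[OF assms] by simp
  then show ?thesis using 1 by (simp add: algebra_simps)
qed

lemma create_sum: "create \<Lambda> v (\<lambda>\<sigma>. \<Sum>k\<in>K. c k * F k \<sigma>) \<sigma> = (\<Sum>k\<in>K. c k * create \<Lambda> v (F k) \<sigma>)"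
proof -
  have "create \<Lambda> v (\<lambda>\<sigma>. \<Sum>k\<in>K. c k * F k \<sigma>) \<sigma>
      = (\<Sum>x\<in>\<Lambda>. \<Sum>k\<in>K. c k * (if 0 < \<sigma> x then v x * F k (\<sigma>(x := \<sigma> x - 1)) else 0))"
    unfolding create_def
  proof (intro sum.cong refl)
    fix x
    show "(if 0 < \<sigma> x then v x * (\<Sum>k\<in>K. c k * F k (\<sigma>(x := \<sigma> x - 1))) else 0)
      = (\<Sum>k\<in>K. c k * (if 0 < \<sigma> x then v x * F k (\<sigma>(x := \<sigma> x - 1)) else 0))"
      by (cases "0 < \<sigma> x") (simp_all add: sum_distrib_left mult.left_commute)
  qed
  also have "\<dots> = (\<Sum>k\<in>K. c k * create \<Lambda> v (F k) \<sigma>)"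
    unfolding create_def by (subst sum.swap) (simp only: sum_distrib_left)
  finally show ?thesis .
qed

text \<open>Multiplications by linear forms commute; the fold over a multiset in
  \<open>fock_state\<close> relies on this to be independent of the order.\<close>

lemma create_commute: "create \<Lambda> v (create \<Lambda> w F) = create \<Lambda> w (create \<Lambda> v F)"
proof
  fix \<sigma>
  define G where "G x y = (if 0 < \<sigma> x \<and> 0 < (\<sigma>(x := \<sigma> x - 1)) y
    then F ((\<sigma>(x := \<sigma> x - 1))(y := (\<sigma>(x := \<sigma> x - 1)) y - 1)) else 0)" for x y
  have G: "G x y = G y x" for x y
    unfolding G_def by (cases "x = y") (auto simp: fun_upd_twist)
  have expand: "create \<Lambda> v (create \<Lambda> w F) \<sigma> = (\<Sum>x\<in>\<Lambda>. \<Sum>y\<in>\<Lambda>. v x * w y * G x y)" for v w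
    unfolding create_def
  proof (intro sum.cong refl)
    fix x
    show "(if 0 < \<sigma> x then v x * (\<Sum>y\<in>\<Lambda>. if 0 < (\<sigma>(x := \<sigma> x - 1)) y
        then w y * F ((\<sigma>(x := \<sigma> x - 1))(y := (\<sigma>(x := \<sigma> x - 1)) y - 1)) else 0) else 0)
      = (\<Sum>y\<in>\<Lambda>. v x * w y * G x y)"
      unfolding G_def sum_distrib_left by (cases "0 < \<sigma> x") (auto intro!: sum.cong)
  qed
  have "(\<Sum>x\<in>\<Lambda>. \<Sum>y\<in>\<Lambda>. v x * w y * G x y) = (\<Sum>y\<in>\<Lambda>. \<Sum>x\<in>\<Lambda>. w y * v x * G y x)"
    by (subst sum.swap) (intro sum.cong refl, use G in \<open>simp add: mult.commute\<close>)
  then show "create \<Lambda> v (create \<Lambda> w F) \<sigma> = create \<Lambda> w (create \<Lambda> v F) \<sigma>"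
    unfolding expand .
qed

lemma fact_prod_raise:
  assumes "finite \<Lambda>" "x \<in> \<Lambda>"
  shows "fact_prod \<Lambda> (\<sigma>(x := \<sigma> x + 1)) = (real (\<sigma> x) + 1) * fact_prod \<Lambda> \<sigma>"
proof -
  have "(\<Prod>y\<in>\<Lambda> - {x}. fact ((\<sigma>(x := \<sigma> x + 1)) y)) = (\<Prod>y\<in>\<Lambda> - {x}. fact (\<sigma> y) :: real)"
    by (intro prod.cong) auto
  then show ?thesis unfolding fact_prod_def prod.remove[OF assms] by (simp add: algebra_simps)
qed

lemma fock_domain_raise:
  assumes "finite \<Lambda>" "x \<in> \<Lambda>"
  shows "(\<Sum>\<sigma>\<in>fock_domain \<Lambda> (Suc M). if 0 < \<sigma> x then H \<sigma> else 0) = (\<Sum>\<tau>\<in>fock_domain \<Lambda> M. H (\<tau>(x := \<tau> x + 1)) :: real)"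
proof -
  have up: "sum (\<tau>(x := \<tau> x + 1)) \<Lambda> = sum \<tau> \<Lambda> + 1" for \<tau> :: "_ \<Rightarrow> nat"
    using sum.remove[OF assms, of \<tau>] sum.remove[OF assms, of "\<tau>(x := \<tau> x + 1)"]
      sum.cong[of "\<Lambda> - {x}" "\<Lambda> - {x}" "\<tau>(x := \<tau> x + 1)" \<tau>] by simp
  have "(\<Sum>\<sigma>\<in>fock_domain \<Lambda> (Suc M). if 0 < \<sigma> x then H \<sigma> else 0) = (\<Sum>\<sigma>\<in>{\<sigma> \<in> fock_domain \<Lambda> (Suc M). 0 < \<sigma> x}. H \<sigma>)"
    using finite_fock_domain[OF assms(1)] by (simp add: sum.inter_filter)
  also have "\<dots> = (\<Sum>\<tau>\<in>fock_domain \<Lambda> M. H (\<tau>(x := \<tau> x + 1)))"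
  proof (rule sum.reindex_bij_witness[where i = "\<lambda>\<tau>. \<tau>(x := \<tau> x + 1)" and j = "\<lambda>\<sigma>. \<sigma>(x := \<sigma> x - 1)"])
    fix \<sigma> assume s: "\<sigma> \<in> {\<sigma> \<in> fock_domain \<Lambda> (Suc M). 0 < \<sigma> x}"
    show eq: "(\<sigma>(x := \<sigma> x - 1))(x := (\<sigma>(x := \<sigma> x - 1)) x + 1) = \<sigma>" using s by auto
    show "\<sigma>(x := \<sigma> x - 1) \<in> fock_domain \<Lambda> M"
      using s up[of "\<sigma>(x := \<sigma> x - 1)", unfolded eq] assms(2)
      by (auto simp: fock_domain_def PiE_def extensional_def)
    show "H ((\<sigma>(x := \<sigma> x - 1))(x := (\<sigma>(x := \<sigma> x - 1)) x + 1)) = H \<sigma>" unfolding eq ..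
  next
    fix \<tau> assume t: "\<tau> \<in> fock_domain \<Lambda> M"
    show "(\<tau>(x := \<tau> x + 1))(x := (\<tau>(x := \<tau> x + 1)) x - 1) = \<tau>" by auto
    show "\<tau>(x := \<tau> x + 1) \<in> {\<sigma> \<in> fock_domain \<Lambda> (Suc M). 0 < \<sigma> x}"
      using t up[of \<tau>] assms(2) by (auto simp: fock_domain_def PiE_def extensional_def)
  qed
  finally show ?thesis .
qed

text \<open>Adjointness of creation and annihilation. The cutoff falls by one because the
  configuration paired with \<open>F\<close> has one particle fewer.\<close>

lemma fock_ip_create:
  assumes "finite \<Lambda>"
  shows "fock_ip \<Lambda> (Suc M) (create \<Lambda> v F) G = fock_ip \<Lambda> M F (\<lambda>\<tau>. \<Sum>x\<in>\<Lambda>. v x * annih x G \<tau>)"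
proof -
  have "fock_ip \<Lambda> (Suc M) (create \<Lambda> v F) G
      = (\<Sum>\<sigma>\<in>fock_domain \<Lambda> (Suc M). \<Sum>x\<in>\<Lambda>. if 0 < \<sigma> x then fact_prod \<Lambda> \<sigma> * (v x * F (\<sigma>(x := \<sigma> x - 1))) * G \<sigma> else 0)"
    unfolding fock_ip_def create_def sum_distrib_left sum_distrib_right by (intro sum.cong) auto
  also have "\<dots> = (\<Sum>x\<in>\<Lambda>. \<Sum>\<sigma>\<in>fock_domain \<Lambda> (Suc M). if 0 < \<sigma> x then fact_prod \<Lambda> \<sigma> * (v x * F (\<sigma>(x := \<sigma> x - 1))) * G \<sigma> else 0)"
    by (rule sum.swap)
  also have "\<dots> = (\<Sum>x\<in>\<Lambda>. \<Sum>\<tau>\<in>fock_domain \<Lambda> M. fact_prod \<Lambda> \<tau> * F \<tau> * (v x * annih x G \<tau>))"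
  proof (rule sum.cong[OF refl])
    fix x assume x: "x \<in> \<Lambda>"
    show "(\<Sum>\<sigma>\<in>fock_domain \<Lambda> (Suc M). if 0 < \<sigma> x then fact_prod \<Lambda> \<sigma> * (v x * F (\<sigma>(x := \<sigma> x - 1))) * G \<sigma> else 0)
      = (\<Sum>\<tau>\<in>fock_domain \<Lambda> M. fact_prod \<Lambda> \<tau> * F \<tau> * (v x * annih x G \<tau>))"
      unfolding fock_domain_raise[OF assms x] fact_prod_raise[OF assms x]
      by (intro sum.cong) (auto simp: annih_def)
  qed
  also have "\<dots> = fock_ip \<Lambda> M F (\<lambda>\<tau>. \<Sum>x\<in>\<Lambda>. v x * annih x G \<tau>)"
    unfolding fock_ip_def by (subst sum.swap) (simp only: sum_distrib_left)
  finally show ?thesis .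
qed

lemma fock_ip_sum:
  "fock_ip \<Lambda> M (\<lambda>\<sigma>. \<Sum>p\<in>A. c p * F p \<sigma>) (\<lambda>\<sigma>. \<Sum>q\<in>B. d q * G q \<sigma>)
    = (\<Sum>p\<in>A. \<Sum>q\<in>B. c p * d q * fock_ip \<Lambda> M (F p) (G q))"
proof -
  have "fock_ip \<Lambda> M (\<lambda>\<sigma>. \<Sum>p\<in>A. c p * F p \<sigma>) (\<lambda>\<sigma>. \<Sum>q\<in>B. d q * G q \<sigma>)
      = (\<Sum>\<sigma>\<in>fock_domain \<Lambda> M. \<Sum>p\<in>A. \<Sum>q\<in>B. c p * d q * (fact_prod \<Lambda> \<sigma> * F p \<sigma> * G q \<sigma>))"
    unfolding fock_ip_def
  proof (intro sum.cong refl)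
    fix \<sigma>
    have "fact_prod \<Lambda> \<sigma> * (\<Sum>p\<in>A. c p * F p \<sigma>) * (\<Sum>q\<in>B. d q * G q \<sigma>)
        = fact_prod \<Lambda> \<sigma> * (\<Sum>p\<in>A. \<Sum>q\<in>B. (c p * F p \<sigma>) * (d q * G q \<sigma>))"
      by (simp only: mult.assoc sum_product)
    also have "\<dots> = (\<Sum>p\<in>A. \<Sum>q\<in>B. fact_prod \<Lambda> \<sigma> * ((c p * F p \<sigma>) * (d q * G q \<sigma>)))"
      by (simp only: sum_distrib_left)
    also have "\<dots> = (\<Sum>p\<in>A. \<Sum>q\<in>B. c p * d q * (fact_prod \<Lambda> \<sigma> * F p \<sigma> * G q \<sigma>))"
      by (simp only: mult_ac)
    finally show "fact_prod \<Lambda> \<sigma> * (\<Sum>p\<in>A. c p * F p \<sigma>) * (\<Sum>q\<in>B. d q * G q \<sigma>)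
      = (\<Sum>p\<in>A. \<Sum>q\<in>B. c p * d q * (fact_prod \<Lambda> \<sigma> * F p \<sigma> * G q \<sigma>))" .
  qed
  also have "\<dots> = (\<Sum>p\<in>A. \<Sum>\<sigma>\<in>fock_domain \<Lambda> M. \<Sum>q\<in>B. c p * d q * (fact_prod \<Lambda> \<sigma> * F p \<sigma> * G q \<sigma>))"
    by (rule sum.swap)
  also have "\<dots> = (\<Sum>p\<in>A. \<Sum>q\<in>B. \<Sum>\<sigma>\<in>fock_domain \<Lambda> M. c p * d q * (fact_prod \<Lambda> \<sigma> * F p \<sigma> * G q \<sigma>))"
    by (intro sum.cong refl sum.swap)
  finally show ?thesis unfolding fock_ip_def sum_distrib_left .
qed

section \<open>Occupation number states of orthonormal modes\<close>

definition fock_state :: "'s set \<Rightarrow> ('k \<Rightarrow> 's \<Rightarrow> real) \<Rightarrow> 'k multiset \<Rightarrow> ('s \<Rightarrow> nat) \<Rightarrow> real" where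
  "fock_state \<Lambda> u m = fold_mset (\<lambda>k. create \<Lambda> (u k)) (vacuum \<Lambda>) m"

lemma fock_state_empty [simp]: "fock_state \<Lambda> u {#} = vacuum \<Lambda>"
  by (simp add: fock_state_def)

lemma fock_state_add [simp]: "fock_state \<Lambda> u (add_mset k m) = create \<Lambda> (u k) (fock_state \<Lambda> u m)"
proof -
  interpret comp_fun_commute "\<lambda>k. create \<Lambda> (u k)"
    by standard (auto simp: fun_eq_iff create_commute[of \<Lambda> "u _" "u _"])
  show ?thesis by (simp add: fock_state_def)
qed

locale orthonormal_modes =
  fixes \<Lambda> :: "'s set" and K :: "'k set" and u :: "'k \<Rightarrow> 's \<Rightarrow> real"
  assumes finite_sites: "finite \<Lambda>" and finite_modes: "finite K"
    and orthonormal: "\<And>k l. k \<in> K \<Longrightarrow> l \<in> K \<Longrightarrow> (\<Sum>x\<in>\<Lambda>. u k x * u l x) = of_bool (k = l)"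
begin

abbreviation "\<Psi> \<equiv> fock_state \<Lambda> u"

definition mode_fact :: "'k multiset \<Rightarrow> real" where
  "mode_fact m = (\<Prod>k\<in>K. fact (count m k))"

lemma mode_fact_pos: "mode_fact m > 0"
  unfolding mode_fact_def by (intro prod_pos) auto

lemma mode_fact_add: "k \<in> K \<Longrightarrow> mode_fact (add_mset k m) = (real (count m k) + 1) * mode_fact m"
proof -
  assume k: "k \<in> K"
  have "(\<Prod>l\<in>K - {k}. fact (count (add_mset k m) l)) = (\<Prod>l\<in>K - {k}. fact (count m l) :: real)"
    by (intro prod.cong) auto
  then show ?thesis unfolding mode_fact_def prod.remove[OF finite_modes k] by (simp add: algebra_simps)
qed

lemma mode_fact_remove: "k \<in> K \<Longrightarrow> k \<in># m \<Longrightarrow> real (count m k) * mode_fact (m - {#k#}) = mode_fact m"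
  using mode_fact_add[of k "m - {#k#}"] by (simp add: of_nat_diff)

text \<open>Moving the annihilator through the creators with \<open>annih_create\<close> removes
  each particle of \<open>m\<close> once, a particle in mode \<open>k\<close> with amplitude
  \<open>u k x\<close>; at the end it meets the vacuum and gives zero.\<close>

lemma annih_state:
  assumes x: "x \<in> \<Lambda>" and m: "set_mset m \<subseteq> K"
  shows "annih x (\<Psi> m) = (\<lambda>\<sigma>. \<Sum>k\<in>K. (real (count m k) * u k x) * \<Psi> (m - {#k#}) \<sigma>)"
  using m
proof (induction m)
  case empty
  have "annih x (vacuum \<Lambda>) \<sigma> = 0" for \<sigma>
    using x by (auto simp: annih_def vacuum_def)
  then show ?case by (auto simp: fun_eq_iff)
next
  case (add k m)
  have k: "k \<in> K" and IH: "annih x (\<Psi> m) = (\<lambda>\<sigma>. \<Sum>l\<in>K. (real (count m l) * u l x) * \<Psi> (m - {#l#}) \<sigma>)"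
    using add by auto
  show ?case
  proof
    fix \<sigma>
    have "annih x (\<Psi> (add_mset k m)) \<sigma> = u k x * \<Psi> m \<sigma> + (\<Sum>l\<in>K. (real (count m l) * u l x) * create \<Lambda> (u k) (\<Psi> (m - {#l#})) \<sigma>)"
      by (simp only: fock_state_add annih_create[OF finite_sites x] IH create_sum)
    also have "(\<Sum>l\<in>K. (real (count m l) * u l x) * create \<Lambda> (u k) (\<Psi> (m - {#l#})) \<sigma>)
        = (\<Sum>l\<in>K. (real (count m l) * u l x) * \<Psi> (add_mset k m - {#l#}) \<sigma>)"
    proof (intro sum.cong refl)
      fix l
      show "(real (count m l) * u l x) * create \<Lambda> (u k) (\<Psi> (m - {#l#})) \<sigma>
          = (real (count m l) * u l x) * \<Psi> (add_mset k m - {#l#}) \<sigma>"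
      \<comment> \<open>If \<open>l\<close> is absent from \<open>m\<close>, the truncated
        \<open>m - {#l#}\<close> is not one particle short, but then its coefficient
        \<open>count m l\<close> vanishes.\<close>
      proof (cases "l \<in># m")
        case True
        then have "add_mset k m - {#l#} = add_mset k (m - {#l#})"
          by (cases "k = l") auto
        then show ?thesis by (simp only: fock_state_add)
      next
        case False
        then have "count m l = 0" by (simp add: count_eq_zero_iff)
        then show ?thesis by simp
      qed
    qed
    also have "u k x * \<Psi> m \<sigma> = (\<Sum>l\<in>K. (of_bool (l = k) * u l x) * \<Psi> (add_mset k m - {#l#}) \<sigma>)"
    proof -
      have "(\<Sum>l\<in>K. (of_bool (l = k) * u l x) * \<Psi> (add_mset k m - {#l#}) \<sigma>) = (\<Sum>l\<in>K. if l = k then u k x * \<Psi> m \<sigma> else 0)"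
        by (intro sum.cong) auto
      then show ?thesis using k finite_modes by simp
    qed
    also have "\<dots> + (\<Sum>l\<in>K. (real (count m l) * u l x) * \<Psi> (add_mset k m - {#l#}) \<sigma>)
        = (\<Sum>l\<in>K. (real (count (add_mset k m) l) * u l x) * \<Psi> (add_mset k m - {#l#}) \<sigma>)"
      unfolding sum.distrib[symmetric] by (intro sum.cong) (auto simp: algebra_simps)
    finally show "annih x (\<Psi> (add_mset k m)) \<sigma> = (\<Sum>l\<in>K. (real (count (add_mset k m) l) * u l x) * \<Psi> (add_mset k m - {#l#}) \<sigma>)" .
  qed
qed

lemma annih_mode_state:
  assumes k: "k \<in> K" and m: "set_mset m \<subseteq> K"
  shows "(\<lambda>\<tau>. \<Sum>x\<in>\<Lambda>. u k x * annih x (\<Psi> m) \<tau>) = (\<lambda>\<tau>. real (count m k) * \<Psi> (m - {#k#}) \<tau>)"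
proof
  fix \<tau>
  have "(\<Sum>x\<in>\<Lambda>. u k x * annih x (\<Psi> m) \<tau>)
      = (\<Sum>x\<in>\<Lambda>. \<Sum>l\<in>K. (u k x * u l x) * (real (count m l) * \<Psi> (m - {#l#}) \<tau>))"
    by (intro sum.cong refl) (simp add: annih_state[OF _ m] sum_distrib_left mult_ac)
  also have "\<dots> = (\<Sum>l\<in>K. (\<Sum>x\<in>\<Lambda>. u k x * u l x) * (real (count m l) * \<Psi> (m - {#l#}) \<tau>))"
    by (subst sum.swap) (simp only: sum_distrib_right)
  also have "\<dots> = (\<Sum>l\<in>K. if l = k then real (count m k) * \<Psi> (m - {#k#}) \<tau> else 0)"
    using k by (intro sum.cong) (auto simp: orthonormal)
  also have "\<dots> = real (count m k) * \<Psi> (m - {#k#}) \<tau>" using k finite_modes by simp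
  finally show "(\<Sum>x\<in>\<Lambda>. u k x * annih x (\<Psi> m) \<tau>) = real (count m k) * \<Psi> (m - {#k#}) \<tau>" .
qed

lemma fock_ip_scale_right: "fock_ip \<Lambda> M F (\<lambda>\<tau>. c * G \<tau>) = c * fock_ip \<Lambda> M F G"
  unfolding fock_ip_def sum_distrib_left by (intro sum.cong) auto

text \<open>The creators of \<open>m\<close> move to the other side as annihilators, each removing
  one particle of its mode from \<open>m'\<close>. What is left is the coefficient at the empty
  configuration. The bound \<open>size m \<le> M\<close> ensures that the falling cutoff lasts for
  all steps.\<close>

lemma fock_ip_state:
  assumes "set_mset m \<subseteq> K" "set_mset m' \<subseteq> K" "size m \<le> M"
  shows "fock_ip \<Lambda> M (\<Psi> m) (\<Psi> m') = (if m = m' then mode_fact m else 0)"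
  using assms
proof (induction m arbitrary: m' M)
  case empty
  define z where "z = (\<lambda>x\<in>\<Lambda>. 0 :: nat)"
  have z: "z \<in> fock_domain \<Lambda> M" by (simp add: z_def fock_domain_def)
  have zu: "\<sigma> = z" if "\<sigma> \<in> fock_domain \<Lambda> M" "\<forall>x\<in>\<Lambda>. \<sigma> x = 0" for \<sigma>
    using that by (intro PiE_ext[of \<sigma> \<Lambda> "\<lambda>_. UNIV" z]) (auto simp: fock_domain_def z_def)
  have "fock_ip \<Lambda> M (\<Psi> {#}) (\<Psi> m') = (\<Sum>\<sigma>\<in>fock_domain \<Lambda> M. if \<sigma> = z then \<Psi> m' z else 0)"
    unfolding fock_ip_def
  proof (intro sum.cong refl)
    fix \<sigma> assume s: "\<sigma> \<in> fock_domain \<Lambda> M"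
    show "fact_prod \<Lambda> \<sigma> * \<Psi> {#} \<sigma> * \<Psi> m' \<sigma> = (if \<sigma> = z then \<Psi> m' z else 0)"
    proof (cases "\<sigma> = z")
      case True
      then show ?thesis by (simp add: z_def fact_prod_def vacuum_def)
    next
      case False
      then have "\<not> (\<forall>x\<in>\<Lambda>. \<sigma> x = 0)" using zu[OF s] by blast
      then show ?thesis using False by (simp add: vacuum_def)
    qed
  qed
  then have "fock_ip \<Lambda> M (\<Psi> {#}) (\<Psi> m') = \<Psi> m' z" using z finite_fock_domain[OF finite_sites] by simp
  moreover have "\<Psi> m' z = (if {#} = m' then 1 else 0)"
  proof (cases m')
    case empty
    then show ?thesis by (simp add: vacuum_def z_def)
  next
    case (add k m)
    then show ?thesis by (simp add: create_def z_def)
  qed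
  moreover have "mode_fact {#} = 1" by (simp add: mode_fact_def)
  ultimately show ?case by simp
next
  case (add k m)
  obtain M' where M: "M = Suc M'" "size m \<le> M'" using add.prems(3) by (cases M) auto
  have k: "k \<in> K" "set_mset m \<subseteq> K" using add.prems by auto
  have "set_mset (m' - {#k#}) \<subseteq> K" using add.prems(2) by (auto dest: in_diffD)
  note IH = add.IH[OF k(2) this M(2)]
  have "fock_ip \<Lambda> M (\<Psi> (add_mset k m)) (\<Psi> m') = real (count m' k) * fock_ip \<Lambda> M' (\<Psi> m) (\<Psi> (m' - {#k#}))"
    unfolding M fock_state_add fock_ip_create[OF finite_sites] annih_mode_state[OF k(1) add.prems(2)]
    by (rule fock_ip_scale_right)
  also have "\<dots> = (if add_mset k m = m' then mode_fact (add_mset k m) else 0)"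
  proof (cases "k \<in># m'")
    case True
    then obtain m'' where m': "m' = add_mset k m''" by (meson multi_member_split)
    show ?thesis unfolding IH unfolding m' using mode_fact_add[OF k(1), of m] by auto
  next
    case False
    then have "count m' k = 0" "add_mset k m \<noteq> m'" by (auto simp: count_eq_zero_iff)
    then show ?thesis by simp
  qed
  finally show ?case .
qed

lemma add_mset_left_cancel: "add_mset p R = add_mset q R \<Longrightarrow> p = q"
  using arg_cong[of "add_mset p R" "add_mset q R" "\<lambda>m. count m p"] by (auto split: if_splits)

lemma mset_remove_subset: "set_mset m \<subseteq> K \<Longrightarrow> set_mset (m - {#k#}) \<subseteq> K"
  by (auto dest: in_diffD)

text \<open>The states \<open>\<Psi> (m - {#k#})\<close> are orthogonal, with squared norm
  \<open>mode_fact m / count m k\<close>, so cross terms vanish and one of the two factors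
  \<open>count m k\<close> cancels. With \<open>a k = u k x - u k y\<close> this is the free boson
  energy of a bond.\<close>

lemma fock_ip_gradient:
  assumes m: "set_mset m \<subseteq> K" "size m \<le> M"
  shows "fock_ip \<Lambda> M (\<lambda>\<sigma>. \<Sum>k\<in>K. (real (count m k) * a k) * \<Psi> (m - {#k#}) \<sigma>)
      (\<lambda>\<sigma>. \<Sum>k\<in>K. (real (count m k) * a k) * \<Psi> (m - {#k#}) \<sigma>)
    = mode_fact m * (\<Sum>k\<in>K. real (count m k) * (a k)\<^sup>2)"
proof -
  have "(\<Sum>p\<in>K. \<Sum>q\<in>K. real (count m p) * a p * (real (count m q) * a q) * fock_ip \<Lambda> M (\<Psi> (m - {#p#})) (\<Psi> (m - {#q#})))
      = (\<Sum>p\<in>K. \<Sum>q\<in>K. if q = p then mode_fact m * (real (count m p) * (a p)\<^sup>2) else 0)"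
  proof (intro sum.cong refl)
    fix p q assume p: "p \<in> K" and q: "q \<in> K"
    have ip: "fock_ip \<Lambda> M (\<Psi> (m - {#p#})) (\<Psi> (m - {#q#})) = (if m - {#p#} = m - {#q#} then mode_fact (m - {#p#}) else 0)"
      using size_Diff1_le[of m p] m by (intro fock_ip_state mset_remove_subset) auto
    show "real (count m p) * a p * (real (count m q) * a q) * fock_ip \<Lambda> M (\<Psi> (m - {#p#})) (\<Psi> (m - {#q#}))
      = (if q = p then mode_fact m * (real (count m p) * (a p)\<^sup>2) else 0)"
    proof (cases "p \<in># m \<and> q \<in># m")
      case True
      then have "m - {#p#} = m - {#q#} \<longleftrightarrow> q = p"
        by (metis insert_DiffM add_mset_left_cancel)
      then show ?thesis using mode_fact_remove[OF p, of m] True ip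
        by (auto simp: power2_eq_square algebra_simps)
    next
      case False
      then have "count m p = 0 \<or> count m q = 0" by (auto simp: count_eq_zero_iff)
      then show ?thesis by auto
    qed
  qed
  also have "\<dots> = mode_fact m * (\<Sum>k\<in>K. real (count m k) * (a k)\<^sup>2)"
    using finite_modes by (simp add: sum_distrib_left)
  finally show ?thesis unfolding fock_ip_sum .
qed

end

section \<open>Trial states\<close>

text \<open>\<open>n (n - 1) \<dots> (n - k + 1) / n^k\<close>: the squared norm of \<open>k\<close> lowering operators applied to the reference
  state of a single spin, relative to that of \<open>k\<close> bosons.  It vanishes for \<open>k > n\<close>.\<close>

definition hardcore :: "nat \<Rightarrow> nat \<Rightarrow> real" where
  "hardcore n k = (\<Prod>i<k. 1 - real i / real n)"

lemma hardcore_Suc: "hardcore n (Suc k) = hardcore n k * (1 - real k / real n)"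
  by (simp add: hardcore_def)

lemma hardcore_eq_0: "0 < n \<Longrightarrow> n < k \<Longrightarrow> hardcore n k = 0"
  unfolding hardcore_def by (rule prod_zero) auto

lemma hardcore_bounds:
  assumes "0 < n" shows "0 \<le> hardcore n k" "hardcore n k \<le> 1"
proof -
  have "0 \<le> hardcore n k \<and> hardcore n k \<le> 1"
  proof (cases "k \<le> n")
    case True
    have "0 \<le> 1 - real i / real n \<and> 1 - real i / real n \<le> 1" if "i < k" for i
      using that True assms by (auto simp: field_simps)
    then show ?thesis unfolding hardcore_def by (auto intro!: prod_nonneg prod_le_1)
  next
    case False
    then show ?thesis using hardcore_eq_0[OF assms] by simp
  qed
  then show "0 \<le> hardcore n k" "hardcore n k \<le> 1" by auto
qed

text \<open>Each further factor \<open>1 - i / n\<close> lowers the product by at most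
  \<open>i / n\<close>; the total counts the \<open>k (k - 1) / 2\<close> pairs on a site.\<close>

lemma hardcore_ge:
  assumes "0 < n" shows "1 - hardcore n k \<le> real k * (real k - 1) / (2 * real n)"
proof (induction k)
  case 0 then show ?case by (simp add: hardcore_def)
next
  case (Suc k)
  have "hardcore n k - real k / real n \<le> hardcore n (Suc k)"
    using mult_right_mono[OF hardcore_bounds(2)[OF assms, of k], of "real k / real n"]
    by (simp add: hardcore_Suc algebra_simps)
  then have "1 - hardcore n (Suc k) \<le> real k * (real k - 1) / (2 * real n) + real k / real n"
    using Suc by simp
  also have "\<dots> = real (Suc k) * (real (Suc k) - 1) / (2 * real n)"
    using assms by (simp add: field_simps)
  finally show ?case .
qed

definition hardcore_prod :: "'s set \<Rightarrow> nat \<Rightarrow> ('s \<Rightarrow> nat) \<Rightarrow> real" where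
  "hardcore_prod \<Lambda> n \<sigma> = (\<Prod>x\<in>\<Lambda>. hardcore n (\<sigma> x))"

lemma one_minus_prod_le:
  fixes f :: "'a \<Rightarrow> real"
  assumes "finite A" "\<And>x. x \<in> A \<Longrightarrow> 0 \<le> f x" "\<And>x. x \<in> A \<Longrightarrow> f x \<le> 1"
  shows "1 - prod f A \<le> (\<Sum>x\<in>A. 1 - f x)"
  using assms
proof (induction A)
  case (insert a A)
  have p: "0 \<le> prod f A" "prod f A \<le> 1" using insert by (auto intro!: prod_nonneg prod_le_1)
  have "(1 - f a) * (1 - prod f A) \<ge> 0" using insert.prems p by (intro mult_nonneg_nonneg) auto
  then have "1 - f a * prod f A \<le> (1 - f a) + (1 - prod f A)" by (simp add: algebra_simps)
  then show ?case using insert by simp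
qed simp

lemma hardcore_prod_bounds:
  assumes "0 < n"
  shows "0 \<le> hardcore_prod \<Lambda> n \<sigma>" "hardcore_prod \<Lambda> n \<sigma> \<le> 1"
  unfolding hardcore_prod_def using hardcore_bounds[OF assms] by (auto intro!: prod_nonneg prod_le_1)

lemma hardcore_prod_ge:
  assumes "0 < n" "finite \<Lambda>"
  shows "1 - hardcore_prod \<Lambda> n \<sigma> \<le> (\<Sum>x\<in>\<Lambda>. real (\<sigma> x) * (real (\<sigma> x) - 1)) / (2 * real n)"
proof -
  have "1 - hardcore_prod \<Lambda> n \<sigma> \<le> (\<Sum>x\<in>\<Lambda>. 1 - hardcore n (\<sigma> x))"
    unfolding hardcore_prod_def using hardcore_bounds[OF assms(1)] assms by (intro one_minus_prod_le) auto
  also have "\<dots> \<le> (\<Sum>x\<in>\<Lambda>. real (\<sigma> x) * (real (\<sigma> x) - 1) / (2 * real n))"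
    using hardcore_ge[OF assms(1)] by (intro sum_mono)
  finally show ?thesis by (simp add: sum_divide_distrib)
qed

lemma hardcore_prod_raise:
  assumes "finite \<Lambda>" "x \<in> \<Lambda>"
  shows "hardcore_prod \<Lambda> n (\<sigma>(x := \<sigma> x + 1)) = (1 - real (\<sigma> x) / real n) * hardcore_prod \<Lambda> n \<sigma>"
proof -
  have "(\<Prod>y\<in>\<Lambda> - {x}. hardcore n ((\<sigma>(x := \<sigma> x + 1)) y)) = (\<Prod>y\<in>\<Lambda> - {x}. hardcore n (\<sigma> y))"
    by (intro prod.cong) auto
  then show ?thesis unfolding hardcore_prod_def prod.remove[OF assms] by (simp add: hardcore_Suc)
qed

lemma hardcore_prod_eq_0:
  "finite \<Lambda> \<Longrightarrow> 0 < n \<Longrightarrow> x \<in> \<Lambda> \<Longrightarrow> n < \<sigma> x \<Longrightarrow> hardcore_prod \<Lambda> n \<sigma> = 0"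
  unfolding hardcore_prod_def using hardcore_eq_0 by (intro prod_zero) auto

section \<open>Expected number of coinciding pairs\<close>

context orthonormal_modes
begin

text \<open>The factorial moment of the occupation at \<open>x\<close> is the squared norm after two
  annihilations. Both reindexings are exact because the weight vanishes at occupations 0 and
  1.\<close>

lemma number_pair_expectation:
  assumes x: "x \<in> \<Lambda>"
  shows "(\<Sum>\<sigma>\<in>fock_domain \<Lambda> (Suc (Suc M)). fact_prod \<Lambda> \<sigma> * (real (\<sigma> x) * (real (\<sigma> x) - 1)) * (F \<sigma>)\<^sup>2)
    = fock_ip \<Lambda> M (annih x (annih x F)) (annih x (annih x F))"
proof -
  let ?up = "\<lambda>\<tau>. \<tau>(x := \<tau> x + 1) :: 's \<Rightarrow> nat"
  define H where "H \<sigma> = fact_prod \<Lambda> \<sigma> * (real (\<sigma> x) * (real (\<sigma> x) - 1)) * (F \<sigma>)\<^sup>2" for \<sigma>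
  have "(\<Sum>\<sigma>\<in>fock_domain \<Lambda> (Suc (Suc M)). H \<sigma>) = (\<Sum>\<sigma>\<in>fock_domain \<Lambda> (Suc (Suc M)). if 0 < \<sigma> x then H \<sigma> else 0)"
    by (intro sum.cong) (auto simp: H_def)
  also have "\<dots> = (\<Sum>\<tau>\<in>fock_domain \<Lambda> (Suc M). H (?up \<tau>))"
    by (rule fock_domain_raise[OF finite_sites x])
  also have "\<dots> = (\<Sum>\<tau>\<in>fock_domain \<Lambda> (Suc M). if 0 < \<tau> x then H (?up \<tau>) else 0)"
    by (intro sum.cong) (auto simp: H_def)
  also have "\<dots> = (\<Sum>\<tau>\<in>fock_domain \<Lambda> M. H (?up (?up \<tau>)))"
    by (rule fock_domain_raise[OF finite_sites x])
  also have "\<dots> = fock_ip \<Lambda> M (annih x (annih x F)) (annih x (annih x F))"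
    unfolding fock_ip_def
  proof (rule sum.cong[OF refl])
    fix \<tau>
    show "H (?up (?up \<tau>)) = fact_prod \<Lambda> \<tau> * annih x (annih x F) \<tau> * annih x (annih x F) \<tau>"
      unfolding H_def fact_prod_raise[OF finite_sites x] annih_def
      by (simp add: power2_eq_square algebra_simps)
  qed
  finally show ?thesis by (simp add: H_def)
qed

lemma sum_count: "set_mset m \<subseteq> K \<Longrightarrow> (\<Sum>k\<in>K. count m k) = size m"
  unfolding size_multiset_overloaded_eq using finite_modes
  by (intro sum.mono_neutral_right) (auto simp: count_eq_zero_iff)

text \<open>Each remainder \<open>m - {k, l}\<close> arises from at most two ordered pairs, hence the factor 2.\<close>

lemma second_annih_bound:
  assumes x: "x \<in> \<Lambda>" and m: "set_mset m \<subseteq> K" "size m \<le> M" and U: "\<And>k. k \<in> K \<Longrightarrow> (u k x)\<^sup>2 \<le> U"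
  shows "fock_ip \<Lambda> M (annih x (annih x (\<Psi> m))) (annih x (annih x (\<Psi> m)))
    \<le> mode_fact m * (2 * U\<^sup>2 * (real (size m))\<^sup>2)"
proof -
  define c where "c = (\<lambda>(k, l). real (count m k) * real (count (m - {#k#}) l) * (u k x * u l x))"
  define r where "r = (\<lambda>(k, l). m - {#k#} - {#l#})"
  define w where "w = (\<lambda>(k, l). real (count m k) * real (count (m - {#k#}) l))"
  have U0: "0 \<le> U" if "k \<in> K" for k using U[OF that] zero_le_power2 order_trans by blast
  have lin: "annih x (\<lambda>\<sigma>. \<Sum>k\<in>K. b k * F k \<sigma>) = (\<lambda>\<sigma>. \<Sum>k\<in>K. b k * annih x (F k) \<sigma>)"
    for b :: "'k \<Rightarrow> real" and F
    unfolding annih_def sum_distrib_left by (simp only: mult_ac)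
  have G: "annih x (annih x (\<Psi> m)) = (\<lambda>\<sigma>. \<Sum>p\<in>K \<times> K. c p * \<Psi> (r p) \<sigma>)"
  proof
    fix \<sigma>
    have "annih x (annih x (\<Psi> m)) \<sigma> = (\<Sum>k\<in>K. (real (count m k) * u k x) *
        (\<Sum>l\<in>K. (real (count (m - {#k#}) l) * u l x) * \<Psi> (m - {#k#} - {#l#}) \<sigma>))"
      unfolding annih_state[OF x m(1)] lin
      by (intro sum.cong refl) (simp add: annih_state[OF x mset_remove_subset[OF m(1)]])
    also have "\<dots> = (\<Sum>k\<in>K. \<Sum>l\<in>K. c (k, l) * \<Psi> (r (k, l)) \<sigma>)"
      unfolding sum_distrib_left by (intro sum.cong refl) (simp add: c_def r_def)
    also have "\<dots> = (\<Sum>p\<in>K \<times> K. c p * \<Psi> (r p) \<sigma>)" by (simp add: sum.cartesian_product)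
    finally show "annih x (annih x (\<Psi> m)) \<sigma> = (\<Sum>p\<in>K \<times> K. c p * \<Psi> (r p) \<sigma>)" .
  qed
  have w0: "w p \<ge> 0" for p by (simp add: w_def case_prod_beta)
  have wr: "w p * mode_fact (r p) = of_bool (w p \<noteq> 0) * mode_fact m" if "p \<in> K \<times> K" for p
  proof (cases "w p = 0")
    case False
    obtain k l where p: "p = (k, l)" by (cases p)
    have "count m k \<noteq> 0 \<and> count (m - {#k#}) l \<noteq> 0" using False by (simp add: w_def p del: count_diff)
    then have kl: "k \<in># m" "l \<in># m - {#k#}" "k \<in> K" "l \<in> K"
      using that unfolding count_eq_zero_iff by (auto simp: p)
    have "w p * mode_fact (r p) = real (count m k) * (real (count (m - {#k#}) l) * mode_fact (m - {#k#} - {#l#}))"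
      by (simp only: w_def r_def p case_prod_conv mult.assoc)
    also have "\<dots> = mode_fact m"
      by (simp only: mode_fact_remove[OF kl(3,1)] mode_fact_remove[OF kl(4,2)])
    finally show ?thesis using False by simp
  qed simp
  have c0: "w p \<noteq> 0" if "c p \<noteq> 0" for p using that by (auto simp: c_def w_def case_prod_beta)
  have swap: "q = p \<or> q = prod.swap p" if "w p \<noteq> 0" "w q \<noteq> 0" "r p = r q" for p q
  proof -
    obtain k l k' l' where p: "p = (k, l)" "q = (k', l')" by (cases p; cases q)
    have "count m k \<noteq> 0 \<and> count (m - {#k#}) l \<noteq> 0 \<and> count m k' \<noteq> 0 \<and> count (m - {#k'#}) l' \<noteq> 0"
      using that(1,2) by (simp add: w_def p del: count_diff)
    then have kl: "k \<in># m" "l \<in># m - {#k#}" "k' \<in># m" "l' \<in># m - {#k'#}"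
      unfolding count_eq_zero_iff by auto
    have "add_mset k (add_mset l (r p)) = m" "add_mset k' (add_mset l' (r q)) = m"
      by (simp_all only: r_def p case_prod_conv insert_DiffM kl)
    then have "{#k, l#} + r p = {#k', l'#} + r p" using that(3) by simp
    then have "{#k, l#} = {#k', l'#}" by (simp only: add_right_cancel)
    then have "(k = k' \<and> l = l') \<or> (k = l' \<and> l = k')" by (auto simp: add_eq_conv_ex)
    then show ?thesis using p by auto
  qed
  \<comment> \<open>The pairs actually present in \<open>m\<close>: only for them do the truncated
    differences mean the removal of two particles, and all others have
    \<open>c p = 0\<close>.\<close>
  define S where "S = {p \<in> K \<times> K. w p \<noteq> 0}"
  have finS: "finite S" unfolding S_def using finite_modes by auto
  have restrict: "(\<Sum>p\<in>K \<times> K. c p * \<Psi> (r p) \<sigma>) = (\<Sum>p\<in>S. c p * \<Psi> (r p) \<sigma>)" for \<sigma>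
    unfolding S_def using c0 finite_modes by (intro sum.mono_neutral_right) auto
  have ip: "fock_ip \<Lambda> M (\<Psi> (r p)) (\<Psi> (r q)) = (if r p = r q then mode_fact (r p) else 0)" for p q
  proof -
    have sub: "set_mset (r p) \<subseteq> K" for p
      unfolding r_def case_prod_beta by (rule mset_remove_subset[OF mset_remove_subset[OF m(1)]])
    have "size (r p) \<le> size m"
      unfolding r_def case_prod_beta by (rule order_trans[OF size_Diff1_le size_Diff1_le])
    then have "size (r p) \<le> M" using m(2) by simp
    then show ?thesis by (intro fock_ip_state sub)
  qed
  have "fock_ip \<Lambda> M (annih x (annih x (\<Psi> m))) (annih x (annih x (\<Psi> m)))
      = (\<Sum>p\<in>S. \<Sum>q\<in>S. c p * c q * fock_ip \<Lambda> M (\<Psi> (r p)) (\<Psi> (r q)))"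
    unfolding G restrict fock_ip_sum ..
  \<comment> \<open>Replacing \<open>c p * c q\<close> by the mean of the squares is allowed since
    all inner products are nonnegative. The two halves then agree by symmetry, and only row sums of
    the Gram matrix remain.\<close>
  also have "\<dots> \<le> (\<Sum>p\<in>S. \<Sum>q\<in>S. ((c p)\<^sup>2 / 2 + (c q)\<^sup>2 / 2) * fock_ip \<Lambda> M (\<Psi> (r p)) (\<Psi> (r q)))"
  proof (intro sum_mono mult_right_mono)
    fix p q
    show "c p * c q \<le> (c p)\<^sup>2 / 2 + (c q)\<^sup>2 / 2"
      using zero_le_power2[of "c p - c q"] unfolding power2_diff by simp
    show "0 \<le> fock_ip \<Lambda> M (\<Psi> (r p)) (\<Psi> (r q))" using mode_fact_pos less_imp_le by (auto simp: ip)
  qed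
  also have "\<dots> = (\<Sum>p\<in>S. \<Sum>q\<in>S. (c p)\<^sup>2 / 2 * fock_ip \<Lambda> M (\<Psi> (r p)) (\<Psi> (r q)))
      + (\<Sum>p\<in>S. \<Sum>q\<in>S. (c q)\<^sup>2 / 2 * fock_ip \<Lambda> M (\<Psi> (r p)) (\<Psi> (r q)))"
    by (simp only: distrib_right sum.distrib)
  also have "(\<Sum>p\<in>S. \<Sum>q\<in>S. (c q)\<^sup>2 / 2 * fock_ip \<Lambda> M (\<Psi> (r p)) (\<Psi> (r q)))
      = (\<Sum>p\<in>S. \<Sum>q\<in>S. (c p)\<^sup>2 / 2 * fock_ip \<Lambda> M (\<Psi> (r p)) (\<Psi> (r q)))"
    by (subst sum.swap) (auto simp: ip intro!: sum.cong)
  also have "(\<Sum>p\<in>S. \<Sum>q\<in>S. (c p)\<^sup>2 / 2 * fock_ip \<Lambda> M (\<Psi> (r p)) (\<Psi> (r q)))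
      + (\<Sum>p\<in>S. \<Sum>q\<in>S. (c p)\<^sup>2 / 2 * fock_ip \<Lambda> M (\<Psi> (r p)) (\<Psi> (r q)))
      = (\<Sum>p\<in>S. (c p)\<^sup>2 * (\<Sum>q\<in>S. fock_ip \<Lambda> M (\<Psi> (r p)) (\<Psi> (r q))))"
    unfolding sum.distrib[symmetric] sum_distrib_left by (intro sum.cong) auto
  also have "\<dots> \<le> (\<Sum>p\<in>S. (c p)\<^sup>2 * (2 * mode_fact (r p)))"
  proof (intro sum_mono mult_left_mono)
    fix p assume p: "p \<in> S"
    have "(\<Sum>q\<in>S. fock_ip \<Lambda> M (\<Psi> (r p)) (\<Psi> (r q))) \<le> (\<Sum>q\<in>{p, prod.swap p}. mode_fact (r p))"
    proof -
      have "(\<Sum>q\<in>S. fock_ip \<Lambda> M (\<Psi> (r p)) (\<Psi> (r q))) = (\<Sum>q\<in>{q \<in> S. r p = r q}. mode_fact (r p))"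
        unfolding ip by (rule sum.inter_filter[OF finS, symmetric])
      also have "\<dots> \<le> (\<Sum>q\<in>{p, prod.swap p}. mode_fact (r p))"
      proof (rule sum_mono2)
        show "{q \<in> S. r p = r q} \<subseteq> {p, prod.swap p}"
          using p swap[of p] by (auto simp: S_def)
      qed (use mode_fact_pos less_imp_le in auto)
      finally show ?thesis .
    qed
    also have "\<dots> = real (card {p, prod.swap p}) * mode_fact (r p)" by simp
    also have "\<dots> \<le> 2 * mode_fact (r p)"
    proof (rule mult_right_mono)
      have "card {p, prod.swap p} \<le> 2" using card_insert_le_m1[of 2 "{prod.swap p}" p] by simp
      then show "real (card {p, prod.swap p}) \<le> 2" by linarith
    qed (use mode_fact_pos less_imp_le in auto)
    finally show "(\<Sum>q\<in>S. fock_ip \<Lambda> M (\<Psi> (r p)) (\<Psi> (r q))) \<le> 2 * mode_fact (r p)" .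
  qed simp
  \<comment> \<open>One of the two factors \<open>w p\<close> in the square of \<open>c p\<close>
    combines with \<open>mode_fact (r p)\<close> to \<open>mode_fact m\<close>; the other is left to
    be summed.\<close>
  also have "\<dots> \<le> (\<Sum>p\<in>S. mode_fact m * (2 * U\<^sup>2) * w p)"
  proof (rule sum_mono)
    fix p assume p: "p \<in> S"
    obtain k l where kl: "p = (k, l)" by (cases p)
    have K: "k \<in> K" "l \<in> K" "w p \<noteq> 0" using p kl by (auto simp: S_def)
    have "(c p)\<^sup>2 * (2 * mode_fact (r p)) = 2 * ((u k x)\<^sup>2 * (u l x)\<^sup>2) * w p * (w p * mode_fact (r p))"
      unfolding kl c_def w_def case_prod_conv power2_eq_square by (simp only: mult_ac)
    also have "\<dots> = 2 * ((u k x)\<^sup>2 * (u l x)\<^sup>2) * (w p * mode_fact m)"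
      using wr[of p] p K(3) by (simp add: S_def)
    also have "\<dots> \<le> 2 * U\<^sup>2 * (w p * mode_fact m)"
      using U[OF K(1)] U[OF K(2)] w0[of p] mode_fact_pos[of m] U0[OF K(1)]
      by (intro mult_right_mono mult_left_mono) (auto simp: power2_eq_square[of U] intro!: mult_mono)
    finally show "(c p)\<^sup>2 * (2 * mode_fact (r p)) \<le> mode_fact m * (2 * U\<^sup>2) * w p" by (simp add: mult_ac)
  qed
  also have "\<dots> = mode_fact m * (2 * U\<^sup>2) * (\<Sum>p\<in>S. w p)" by (simp only: sum_distrib_left)
  also have "\<dots> \<le> mode_fact m * (2 * U\<^sup>2) * (real (size m))\<^sup>2"
  proof (rule mult_left_mono)
    have "(\<Sum>p\<in>S. w p) \<le> (\<Sum>p\<in>K \<times> K. w p)"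
      unfolding S_def using finite_modes w0 by (intro sum_mono2) auto
    also have "\<dots> \<le> (\<Sum>p\<in>K \<times> K. (\<lambda>(k, l). real (count m k) * real (count m l)) p)"
      by (intro sum_mono) (auto simp: w_def diff_le_self intro!: mult_left_mono simp del: of_nat_diff)
    also have "\<dots> = (\<Sum>k\<in>K. real (count m k)) * (\<Sum>k\<in>K. real (count m k))"
      unfolding sum_product sum.cartesian_product ..
    also have "\<dots> = (real (size m))\<^sup>2"
      using sum_count[OF m(1)] by (simp add: power2_eq_square flip: of_nat_sum)
    finally show "(\<Sum>p\<in>S. w p) \<le> (real (size m))\<^sup>2" .
  qed (use mode_fact_pos[of m] in simp)
  finally show ?thesis by (simp only: mult.assoc)
qed

end

context orthonormal_modes
begin

text \<open>In the occupation basis this is the normalised boson state damped by the square root of the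
  hard-core factor, that is, bosonic creation operators are replaced by spin lowering operators.\<close>

definition trial :: "nat \<Rightarrow> 'k multiset \<Rightarrow> ('s \<Rightarrow> nat) \<Rightarrow> real" where
  "trial n m \<sigma> = sqrt (fact_prod \<Lambda> \<sigma> * hardcore_prod \<Lambda> n \<sigma> / mode_fact m) * \<Psi> m \<sigma>"

lemma bounded_configs_subset:
  assumes "n * card \<Lambda> \<le> M" shows "(\<Lambda> \<rightarrow>\<^sub>E {0..n}) \<subseteq> fock_domain \<Lambda> M"
proof
  fix \<sigma> assume s: "\<sigma> \<in> \<Lambda> \<rightarrow>\<^sub>E {0..n}"
  then have "sum \<sigma> \<Lambda> \<le> (\<Sum>x\<in>\<Lambda>. n)" by (intro sum_mono) (use PiE_mem[OF s] in auto)
  also have "\<dots> \<le> M" using assms by (simp add: mult.commute)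
  finally show "\<sigma> \<in> fock_domain \<Lambda> M" using s unfolding fock_domain_def PiE_def by blast
qed

text \<open>A trial vector is an orthonormal boson state times the square root of
  \<open>hardcore_prod\<close>. Moving this factor, which is at most 1, onto \<open>\<eta>\<close>
  reduces the claim to Bessel's inequality on Fock space.\<close>

lemma trial_bessel:
  assumes n: "0 < n" and I: "finite I" "\<And>m. m \<in> I \<Longrightarrow> set_mset m \<subseteq> K"
  shows "(\<Sum>m\<in>I. (ip_on (\<Lambda> \<rightarrow>\<^sub>E {0..n}) (trial n m) \<eta>)\<^sup>2) \<le> ip_on (\<Lambda> \<rightarrow>\<^sub>E {0..n}) \<eta> \<eta>"
proof -
  \<comment> \<open>A cutoff above every admissible spin configuration and every particle number
    occurring in \<open>I\<close>.\<close>
  define M where "M = n * card \<Lambda> + (\<Sum>m\<in>I. size m)"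
  let ?C = "\<Lambda> \<rightarrow>\<^sub>E {0..n}" and ?D = "fock_domain \<Lambda> M"
  have CD: "?C \<subseteq> ?D" by (rule bounded_configs_subset) (simp add: M_def)
  have finD: "finite ?D" by (rule finite_fock_domain[OF finite_sites])
  have size: "size m \<le> M" if "m \<in> I" for m
    using member_le_sum[OF that, of size] I(1) by (simp add: M_def)
  define e where "e m \<sigma> = sqrt (fact_prod \<Lambda> \<sigma> / mode_fact m) * \<Psi> m \<sigma>" for m \<sigma>
  define \<zeta> where "\<zeta> \<sigma> = (if \<sigma> \<in> ?C then sqrt (hardcore_prod \<Lambda> n \<sigma>) * \<eta> \<sigma> else 0)" for \<sigma>
  have on: "ip_on ?D (e m) (e m') = of_bool (m = m')" if "m \<in> I" "m' \<in> I" for m m'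
  proof -
    have pos: "0 < mode_fact m" "0 < mode_fact m'" by (rule mode_fact_pos)+
    have "ip_on ?D (e m) (e m') = fock_ip \<Lambda> M (\<Psi> m) (\<Psi> m') / (sqrt (mode_fact m) * sqrt (mode_fact m'))"
      unfolding ip_on_def fock_ip_def sum_divide_distrib
    proof (intro sum.cong refl)
      fix \<sigma>
      have "sqrt (fact_prod \<Lambda> \<sigma>) * sqrt (fact_prod \<Lambda> \<sigma>) = fact_prod \<Lambda> \<sigma>"
        using fact_prod_pos[of \<Lambda> \<sigma>] by simp
      then show "e m \<sigma> * e m' \<sigma> = fact_prod \<Lambda> \<sigma> * \<Psi> m \<sigma> * \<Psi> m' \<sigma> / (sqrt (mode_fact m) * sqrt (mode_fact m'))"
        unfolding e_def real_sqrt_divide by (simp add: field_simps)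
    qed
    then show ?thesis using pos fock_ip_state[OF I(2)[OF that(1)] I(2)[OF that(2)] size[OF that(1)]] by auto
  qed
  have "ip_on ?C (trial n m) \<eta> = ip_on ?D (e m) \<zeta>" for m
  proof -
    have "ip_on ?D (e m) \<zeta> = (\<Sum>\<sigma>\<in>?C. e m \<sigma> * \<zeta> \<sigma>)"
      unfolding ip_on_def by (rule sum.mono_neutral_right[OF finD CD]) (simp add: \<zeta>_def)
    also have "\<dots> = ip_on ?C (trial n m) \<eta>"
      unfolding ip_on_def
      by (intro sum.cong) (auto simp: \<zeta>_def e_def trial_def real_sqrt_mult real_sqrt_divide)
    finally show ?thesis ..
  qed
  then have "(\<Sum>m\<in>I. (ip_on ?C (trial n m) \<eta>)\<^sup>2) = (\<Sum>m\<in>I. (ip_on ?D (e m) \<zeta>)\<^sup>2)" by simp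
  also have "\<dots> \<le> ip_on ?D \<zeta> \<zeta>" by (rule bessel_inequality[OF I(1) on])
  also have "\<dots> = (\<Sum>\<sigma>\<in>?C. \<zeta> \<sigma> * \<zeta> \<sigma>)"
    unfolding ip_on_def by (rule sum.mono_neutral_right[OF finD CD]) (simp add: \<zeta>_def)
  also have "\<dots> \<le> ip_on ?C \<eta> \<eta>"
    unfolding ip_on_def
  proof (rule sum_mono)
    fix \<sigma> assume "\<sigma> \<in> ?C"
    then have "\<zeta> \<sigma> * \<zeta> \<sigma> = hardcore_prod \<Lambda> n \<sigma> * (\<eta> \<sigma> * \<eta> \<sigma>)"
      using hardcore_prod_bounds(1)[OF n, of \<Lambda> \<sigma>] by (simp add: \<zeta>_def algebra_simps flip: real_sqrt_mult)
    also have "\<dots> \<le> 1 * (\<eta> \<sigma> * \<eta> \<sigma>)"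
      by (intro mult_right_mono hardcore_prod_bounds[OF n]) simp
    finally show "\<zeta> \<sigma> * \<zeta> \<sigma> \<le> \<eta> \<sigma> * \<eta> \<sigma>" by simp
  qed
  finally show ?thesis .
qed

text \<open>The squared norm is the boson expectation of \<open>hardcore_prod\<close>, which
  vanishes once a site holds more than \<open>n\<close> particles; so the sum extends to Fock space,
  where the state is normalised. The defect is bounded through pairs on a site, and the 2 of
  \<open>second_annih_bound\<close> cancels the one in \<open>2 * real n\<close>.\<close>

lemma trial_norm_ge:
  assumes n: "0 < n" and m: "set_mset m \<subseteq> K" and U: "\<And>k x. k \<in> K \<Longrightarrow> x \<in> \<Lambda> \<Longrightarrow> (u k x)\<^sup>2 \<le> U"
  shows "1 - real (card \<Lambda>) * U\<^sup>2 * (real (size m))\<^sup>2 / real n \<le> ip_on (\<Lambda> \<rightarrow>\<^sub>E {0..n}) (trial n m) (trial n m)"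
proof -
  define M where "M = n * card \<Lambda> + size m"
  let ?C = "\<Lambda> \<rightarrow>\<^sub>E {0..n}" and ?D = "fock_domain \<Lambda> (Suc (Suc M))"
  have CD: "?C \<subseteq> ?D" by (rule bounded_configs_subset) (simp add: M_def)
  have finD: "finite ?D" by (rule finite_fock_domain[OF finite_sites])
  define g where "g \<sigma> = fact_prod \<Lambda> \<sigma> * (\<Psi> m \<sigma>)\<^sup>2 / mode_fact m" for \<sigma>
  have g0: "g \<sigma> \<ge> 0" for \<sigma> using fact_prod_pos[of \<Lambda> \<sigma>] mode_fact_pos[of m] by (simp add: g_def)
  have tt: "trial n m \<sigma> * trial n m \<sigma> = g \<sigma> * hardcore_prod \<Lambda> n \<sigma>" for \<sigma>
    using fact_prod_pos[of \<Lambda> \<sigma>] mode_fact_pos[of m] hardcore_prod_bounds(1)[OF n, of \<Lambda> \<sigma>]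
    by (simp add: trial_def g_def power2_eq_square algebra_simps)
  have "ip_on ?C (trial n m) (trial n m) = (\<Sum>\<sigma>\<in>?D. g \<sigma> * hardcore_prod \<Lambda> n \<sigma>)"
  proof -
    have "hardcore_prod \<Lambda> n \<sigma> = 0" if "\<sigma> \<in> ?D - ?C" for \<sigma>
    proof -
      have "\<exists>x\<in>\<Lambda>. n < \<sigma> x"
      proof (rule ccontr)
        assume "\<not> (\<exists>x\<in>\<Lambda>. n < \<sigma> x)"
        then have "\<sigma> \<in> ?C"
          using that PiE_arb[of \<sigma> \<Lambda> "\<lambda>_. UNIV"] by (intro PiE_I) (auto simp: fock_domain_def not_less)
        then show False using that by blast
      qed
      then obtain x where "x \<in> \<Lambda>" "n < \<sigma> x" by blast
      then show ?thesis using hardcore_prod_eq_0[OF finite_sites n] by blast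
    qed
    then show ?thesis unfolding ip_on_def tt
      by (intro sum.mono_neutral_left[OF finD CD]) auto
  qed
  moreover have "(\<Sum>\<sigma>\<in>?D. g \<sigma>) = 1"
  proof -
    have "(\<Sum>\<sigma>\<in>?D. g \<sigma>) = fock_ip \<Lambda> (Suc (Suc M)) (\<Psi> m) (\<Psi> m) / mode_fact m"
      unfolding fock_ip_def sum_divide_distrib by (intro sum.cong) (auto simp: g_def power2_eq_square)
    then show ?thesis using fock_ip_state[OF m m, of "Suc (Suc M)"] mode_fact_pos[of m] by (simp add: M_def)
  qed
  moreover have "(\<Sum>\<sigma>\<in>?D. g \<sigma> * (1 - hardcore_prod \<Lambda> n \<sigma>)) \<le> real (card \<Lambda>) * U\<^sup>2 * (real (size m))\<^sup>2 / real n"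
  proof -
    have "(\<Sum>\<sigma>\<in>?D. g \<sigma> * (1 - hardcore_prod \<Lambda> n \<sigma>))
        \<le> (\<Sum>\<sigma>\<in>?D. g \<sigma> * ((\<Sum>x\<in>\<Lambda>. real (\<sigma> x) * (real (\<sigma> x) - 1)) / (2 * real n)))"
      using hardcore_prod_ge[OF n finite_sites] g0 by (intro sum_mono mult_left_mono) auto
    also have "\<dots> = (\<Sum>\<sigma>\<in>?D. \<Sum>x\<in>\<Lambda>. (fact_prod \<Lambda> \<sigma> * (real (\<sigma> x) * (real (\<sigma> x) - 1)) * (\<Psi> m \<sigma>)\<^sup>2) / (mode_fact m * (2 * real n)))"
      unfolding sum_divide_distrib sum_distrib_left by (intro sum.cong refl) (simp add: g_def)
    also have "\<dots> = (\<Sum>x\<in>\<Lambda>. (\<Sum>\<sigma>\<in>?D. fact_prod \<Lambda> \<sigma> * (real (\<sigma> x) * (real (\<sigma> x) - 1)) * (\<Psi> m \<sigma>)\<^sup>2) / (mode_fact m * (2 * real n)))"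
      by (subst sum.swap) (simp only: sum_divide_distrib)
    also have "\<dots> \<le> (\<Sum>x\<in>\<Lambda>. mode_fact m * (2 * U\<^sup>2 * (real (size m))\<^sup>2) / (mode_fact m * (2 * real n)))"
    proof (intro sum_mono divide_right_mono)
      fix x assume x: "x \<in> \<Lambda>"
      show "(\<Sum>\<sigma>\<in>?D. fact_prod \<Lambda> \<sigma> * (real (\<sigma> x) * (real (\<sigma> x) - 1)) * (\<Psi> m \<sigma>)\<^sup>2) \<le> mode_fact m * (2 * U\<^sup>2 * (real (size m))\<^sup>2)"
        unfolding number_pair_expectation[OF x] using U[OF _ x] m
        by (intro second_annih_bound[OF x]) (auto simp: M_def)
    qed (use mode_fact_pos[of m] in simp)
    also have "\<dots> = real (card \<Lambda>) * U\<^sup>2 * (real (size m))\<^sup>2 / real n"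
      using mode_fact_pos[of m] n by (simp add: field_simps)
    finally show ?thesis .
  qed
  ultimately show ?thesis by (simp add: right_diff_distrib sum_subtractf)
qed

text \<open>Raising at \<open>x\<close> multiplies \<open>fact_prod\<close> by
  \<open>B x + 1\<close> and \<open>hardcore_prod\<close> by \<open>1 - B x / n\<close>. Together
  with the bond weight the root becomes symmetric in \<open>x\<close> and \<open>y\<close> up to a
  factor \<open>B x + 1\<close>, exactly the one contained in \<open>annih\<close>.\<close>

lemma trial_raise:
  assumes n: "0 < n" and x: "x \<in> \<Lambda>" and B: "B x \<le> n"
  shows "sqrt (real (B x + 1) * (real n - real (B y))) * trial n m (B(x := B x + 1))
    = sqrt (fact_prod \<Lambda> B * hardcore_prod \<Lambda> n B / mode_fact m * ((real n - real (B x)) * (real n - real (B y)) / real n))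
      * annih x (\<Psi> m) B"
proof -
  define a where "a = real (B x + 1) * (real n - real (B y))"
  define b where "b = (real (B x) + 1) * fact_prod \<Lambda> B * ((1 - real (B x) / real n) * hardcore_prod \<Lambda> n B) / mode_fact m"
  define c where "c = fact_prod \<Lambda> B * hardcore_prod \<Lambda> n B / mode_fact m * ((real n - real (B x)) * (real n - real (B y)) / real n)"
  have "a * b = (real (B x) + 1)\<^sup>2 * c"
    using n mode_fact_pos[of m] by (simp add: a_def b_def c_def field_simps power2_eq_square)
  then have "sqrt a * sqrt b = (real (B x) + 1) * sqrt c"
    unfolding real_sqrt_mult[symmetric] by (simp add: real_sqrt_mult)
  then have "sqrt a * (sqrt b * \<Psi> m (B(x := B x + 1))) = sqrt c * annih x (\<Psi> m) B"
    unfolding annih_def mult.assoc[symmetric] by (simp only: mult.commute[of "sqrt c"])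
  then show ?thesis
    unfolding trial_def fact_prod_raise[OF finite_sites x] hardcore_prod_raise[OF finite_sites x]
    by (simp only: a_def b_def c_def)
qed

text \<open>By \<open>trial_raise\<close> the two terms of a bond share one prefactor, so their
  difference is a multiple of \<open>a_x - a_y\<close> applied to the boson state. The squared
  prefactor is at most \<open>n\<close> times the bosonic weight, and
  \<open>fock_ip_gradient\<close> evaluates the rest.\<close>

lemma trial_bond_bound:
  assumes n: "0 < n" and xy: "x \<in> \<Lambda>" "y \<in> \<Lambda>" and m: "set_mset m \<subseteq> K"
  shows "(\<Sum>B\<in>{B \<in> \<Lambda> \<rightarrow>\<^sub>E {0..n}. B x < n \<and> B y < n}.
      (sqrt (real (B x + 1) * (real n - real (B y))) * trial n m (B(x := B x + 1)) -
       sqrt (real (B y + 1) * (real n - real (B x))) * trial n m (B(y := B y + 1)))\<^sup>2)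
    \<le> real n * (\<Sum>k\<in>K. real (count m k) * (u k x - u k y)\<^sup>2)"
proof -
  define M where "M = n * card \<Lambda> + size m"
  define D where "D = (\<lambda>\<sigma>. \<Sum>k\<in>K. (real (count m k) * (u k x - u k y)) * \<Psi> (m - {#k#}) \<sigma>)"
  have D: "annih x (\<Psi> m) B - annih y (\<Psi> m) B = D B" for B
    unfolding annih_state[OF xy(1) m] annih_state[OF xy(2) m] D_def sum_subtractf[symmetric]
    by (intro sum.cong) (auto simp: algebra_simps)
  have "(\<Sum>B\<in>{B \<in> \<Lambda> \<rightarrow>\<^sub>E {0..n}. B x < n \<and> B y < n}.
      (sqrt (real (B x + 1) * (real n - real (B y))) * trial n m (B(x := B x + 1)) -
       sqrt (real (B y + 1) * (real n - real (B x))) * trial n m (B(y := B y + 1)))\<^sup>2)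
    \<le> (\<Sum>B\<in>{B \<in> \<Lambda> \<rightarrow>\<^sub>E {0..n}. B x < n \<and> B y < n}. real n / mode_fact m * (fact_prod \<Lambda> B * D B * D B))"
  proof (rule sum_mono)
    fix B assume "B \<in> {B \<in> \<Lambda> \<rightarrow>\<^sub>E {0..n}. B x < n \<and> B y < n}"
    then have B: "B x < n" "B y < n" by auto
    define c where "c = fact_prod \<Lambda> B * hardcore_prod \<Lambda> n B / mode_fact m * ((real n - real (B x)) * (real n - real (B y)) / real n)"
    have pos: "0 < fact_prod \<Lambda> B" "0 < mode_fact m" "0 \<le> hardcore_prod \<Lambda> n B" "hardcore_prod \<Lambda> n B \<le> 1"
      using fact_prod_pos mode_fact_pos hardcore_prod_bounds[OF n] by auto
    have c0: "c \<ge> 0" using pos B by (simp add: c_def)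
    have "(real n - real (B x)) * (real n - real (B y)) \<le> real n * real n"
      using B by (intro mult_mono) auto
    then have "(real n - real (B x)) * (real n - real (B y)) / real n \<le> real n"
      using n by (simp add: field_simps)
    moreover have "fact_prod \<Lambda> B * hardcore_prod \<Lambda> n B / mode_fact m \<le> fact_prod \<Lambda> B * 1 / mode_fact m"
      using pos by (intro divide_right_mono mult_left_mono) auto
    ultimately have "c \<le> fact_prod \<Lambda> B * 1 / mode_fact m * real n"
      unfolding c_def using pos B by (intro mult_mono) auto
    then have c: "c \<le> real n / mode_fact m * fact_prod \<Lambda> B" by (simp add: mult.commute)
    have c': "sqrt (fact_prod \<Lambda> B * hardcore_prod \<Lambda> n B / mode_fact m * ((real n - real (B y)) * (real n - real (B x)) / real n)) = sqrt c"
      by (simp add: c_def mult.commute)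
    have "sqrt (real (B x + 1) * (real n - real (B y))) * trial n m (B(x := B x + 1)) -
       sqrt (real (B y + 1) * (real n - real (B x))) * trial n m (B(y := B y + 1)) = sqrt c * D B"
      using B unfolding trial_raise[where B = B, OF n xy(1) less_imp_le[OF B(1)]] trial_raise[where B = B, OF n xy(2) less_imp_le[OF B(2)]] c'
      unfolding c_def[symmetric] D[symmetric] by (simp add: right_diff_distrib)
    then have "(sqrt (real (B x + 1) * (real n - real (B y))) * trial n m (B(x := B x + 1)) -
       sqrt (real (B y + 1) * (real n - real (B x))) * trial n m (B(y := B y + 1)))\<^sup>2 = c * (D B)\<^sup>2"
      using c0 by (simp add: power_mult_distrib)
    also have "\<dots> \<le> real n / mode_fact m * fact_prod \<Lambda> B * (D B)\<^sup>2" by (rule mult_right_mono[OF c]) simp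
    also have "\<dots> = real n / mode_fact m * (fact_prod \<Lambda> B * D B * D B)" by (simp add: power2_eq_square)
    finally show "(sqrt (real (B x + 1) * (real n - real (B y))) * trial n m (B(x := B x + 1)) -
       sqrt (real (B y + 1) * (real n - real (B x))) * trial n m (B(y := B y + 1)))\<^sup>2
      \<le> real n / mode_fact m * (fact_prod \<Lambda> B * D B * D B)" .
  qed
  also have "\<dots> \<le> (\<Sum>B\<in>fock_domain \<Lambda> M. real n / mode_fact m * (fact_prod \<Lambda> B * D B * D B))"
  proof (rule sum_mono2[OF finite_fock_domain[OF finite_sites]])
    show "{B \<in> \<Lambda> \<rightarrow>\<^sub>E {0..n}. B x < n \<and> B y < n} \<subseteq> fock_domain \<Lambda> M"
      using bounded_configs_subset[of n M] by (auto simp: M_def)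
    show "0 \<le> real n / mode_fact m * (fact_prod \<Lambda> B * D B * D B)" for B
      using fact_prod_pos[of \<Lambda> B] mode_fact_pos[of m] by (simp add: mult.assoc)
  qed
  also have "\<dots> = real n / mode_fact m * fock_ip \<Lambda> M D D"
    unfolding fock_ip_def sum_distrib_left ..
  also have "\<dots> = real n * (\<Sum>k\<in>K. real (count m k) * (u k x - u k y)\<^sup>2)"
    unfolding D_def using m mode_fact_pos[of m] by (subst fock_ip_gradient) (auto simp: M_def)
  finally show ?thesis .
qed

text \<open>Where all modes vanish the annihilator gives zero, and at the lowered configuration it
  is a nonzero multiple of \<open>\<Psi> m \<sigma>\<close>.\<close>

lemma trial_vanishes:
  assumes x: "x \<in> \<Lambda>" and m: "set_mset m \<subseteq> K" and u: "\<And>k. k \<in> K \<Longrightarrow> u k x = 0" and s: "0 < \<sigma> x"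
  shows "trial n m \<sigma> = 0"
proof -
  have "annih x (\<Psi> m) (\<sigma>(x := \<sigma> x - 1)) = 0"
    unfolding annih_state[OF x m] using u by simp
  then have "\<Psi> m \<sigma> = 0" using s by (simp add: annih_def)
  then show ?thesis by (simp add: trial_def)
qed

end

section \<open>Disjoint regions\<close>

definition bond_energy :: "nat \<Rightarrow> site set \<Rightarrow> site \<Rightarrow> site \<Rightarrow> ((site \<Rightarrow> nat) \<Rightarrow> real) \<Rightarrow> real" where
  "bond_energy n \<Lambda> x y \<psi> = (\<Sum>B\<in>below_configs n \<Lambda> x y.
     (sqrt (real (B x + 1) * (real n - real (B y))) * \<psi> (B(x := B x + 1)) -
      sqrt (real (B y + 1) * (real n - real (B x))) * \<psi> (B(y := B y + 1)))\<^sup>2) / 2"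

lemma bond_energy_nonneg: "0 \<le> bond_energy n \<Lambda> x y \<psi>"
  unfolding bond_energy_def by (intro divide_nonneg_nonneg sum_nonneg) auto

lemma quad_form_sum_kernel:
  "quad_form X (\<lambda>s t. \<Sum>p\<in>P. h p s t) v = (\<Sum>p\<in>P. quad_form X (h p) v)"
proof -
  have "quad_form X (\<lambda>s t. \<Sum>p\<in>P. h p s t) v = (\<Sum>s\<in>X. \<Sum>t\<in>X. \<Sum>p\<in>P. h p s t * v s * v t)"
    by (simp only: quad_form_def sum_distrib_right)
  also have "\<dots> = (\<Sum>s\<in>X. \<Sum>p\<in>P. \<Sum>t\<in>X. h p s t * v s * v t)"
    by (intro sum.cong refl sum.swap)
  also have "\<dots> = (\<Sum>p\<in>P. quad_form X (h p) v)"
    unfolding quad_form_def by (rule sum.swap)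
  finally show ?thesis .
qed

lemma quad_form_rank_one:
  "quad_form X (\<lambda>s t. d s * d t) v = (ip_on X d v)\<^sup>2"
  unfolding quad_form_def power2_eq_square ip_on_def sum_product by (intro sum.cong refl) simp

lemma quad_form_scale: "quad_form X (\<lambda>s t. c * h s t) v = c * quad_form X h v"
  unfolding quad_form_def sum_distrib_left by (simp only: mult.assoc)

lemma quad_form_bond:
  assumes \<Lambda>: "finite \<Lambda>" and xy: "x \<in> \<Lambda>" "y \<in> \<Lambda>"
  shows "quad_form (configs n \<Lambda>) (bond_kernel n \<Lambda> x y) \<psi> = bond_energy n \<Lambda> x y \<psi>"
proof -
  let ?C = "configs n \<Lambda>" and ?D = "below_configs n \<Lambda> x y"
  have delta: "(\<Sum>\<sigma>\<in>?C. c * of_bool (\<sigma> = \<tau>) * \<psi> \<sigma>) = c * \<psi> \<tau>" if "\<tau> \<in> ?C" for \<tau> c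
  proof -
    have "(\<Sum>\<sigma>\<in>?C. c * of_bool (\<sigma> = \<tau>) * \<psi> \<sigma>) = (\<Sum>\<sigma>\<in>?C. if \<sigma> = \<tau> then c * \<psi> \<tau> else 0)"
      by (intro sum.cong) auto
    then show ?thesis using that finite_configs[OF \<Lambda>] by simp
  qed
  have ip: "ip_on ?C (bond_vec n x y B) \<psi> =
      sqrt (real (B x + 1) * (real n - real (B y))) * \<psi> (B(x := B x + 1)) -
      sqrt (real (B y + 1) * (real n - real (B x))) * \<psi> (B(y := B y + 1))" if "B \<in> ?D" for B
  proof -
    have "B(x := B x + 1) \<in> ?C" "B(y := B y + 1) \<in> ?C"
      using that xy by (auto simp: below_configs_def intro!: configs_upd)
    then show ?thesis
      unfolding ip_on_def bond_vec_def left_diff_distrib sum_subtractf by (simp only: delta)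
  qed
  have "quad_form ?C (bond_kernel n \<Lambda> x y) \<psi> = (1/2) * quad_form ?C (\<lambda>\<sigma> \<tau>. \<Sum>B\<in>?D. bond_vec n x y B \<sigma> * bond_vec n x y B \<tau>) \<psi>"
    unfolding quad_form_scale[symmetric] bond_kernel_def[abs_def] by simp
  also have "\<dots> = (1/2) * (\<Sum>B\<in>?D. (ip_on ?C (bond_vec n x y B) \<psi>)\<^sup>2)"
    unfolding quad_form_sum_kernel quad_form_rank_one ..
  also have "\<dots> = bond_energy n \<Lambda> x y \<psi>"
    using ip by (simp add: bond_energy_def)
  finally show ?thesis .
qed

lemma quad_form_ham:
  assumes \<Lambda>: "finite \<Lambda>"
  shows "quad_form (configs n \<Lambda>) (ham_kernel n \<Lambda>) \<psi> = (\<Sum>(x, y)\<in>nn_pairs \<Lambda>. bond_energy n \<Lambda> x y \<psi>)"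
proof -
  have h: "ham_kernel n \<Lambda> = (\<lambda>\<sigma> \<tau>. \<Sum>p\<in>nn_pairs \<Lambda>. (\<lambda>p. bond_kernel n \<Lambda> (fst p) (snd p)) p \<sigma> \<tau>)"
    by (simp add: ham_kernel_def fun_eq_iff case_prod_beta)
  show ?thesis unfolding h quad_form_sum_kernel case_prod_beta
  proof (rule sum.cong[OF refl])
    fix p assume "p \<in> nn_pairs \<Lambda>"
    then have "fst p \<in> \<Lambda>" "snd p \<in> \<Lambda>" using nn_pairsD[of "fst p" "snd p" \<Lambda>] by auto
    then show "quad_form (configs n \<Lambda>) (bond_kernel n \<Lambda> (fst p) (snd p)) \<psi> = bond_energy n \<Lambda> (fst p) (snd p) \<psi>"
      by (rule quad_form_bond[OF \<Lambda>])
  qed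
qed

section \<open>Splitting a region into two\<close>

definition split_config :: "site set \<Rightarrow> site set \<Rightarrow> (site \<Rightarrow> nat) \<Rightarrow> (site \<Rightarrow> nat) \<times> (site \<Rightarrow> nat)" where
  "split_config \<Lambda>1 \<Lambda>2 \<sigma> = (restrict \<sigma> \<Lambda>1, restrict \<sigma> \<Lambda>2)"

lemma bij_split_config:
  assumes "\<Lambda>1 \<inter> \<Lambda>2 = {}"
  shows "bij_betw (split_config \<Lambda>1 \<Lambda>2) (configs n (\<Lambda>1 \<union> \<Lambda>2)) (configs n \<Lambda>1 \<times> configs n \<Lambda>2)"
proof (rule bij_betw_byWitness[where f' = "\<lambda>(s, t) x. if x \<in> \<Lambda>1 then s x else t x"])
  have out: "f x = undefined" if "f \<in> configs n \<Lambda>" "x \<notin> \<Lambda>" for f x \<Lambda>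
    using that PiE_arb unfolding configs_def by metis
  have memI: "f \<in> configs n \<Lambda>" if "\<And>x. x \<in> \<Lambda> \<Longrightarrow> f x \<le> n" "\<And>x. x \<notin> \<Lambda> \<Longrightarrow> f x = undefined" for f \<Lambda>
    using that unfolding configs_def by (intro PiE_I) auto
  show "\<forall>\<sigma>\<in>configs n (\<Lambda>1 \<union> \<Lambda>2). (\<lambda>(s, t) x. if x \<in> \<Lambda>1 then s x else t x) (split_config \<Lambda>1 \<Lambda>2 \<sigma>) = \<sigma>"
  proof
    fix \<sigma> assume s: "\<sigma> \<in> configs n (\<Lambda>1 \<union> \<Lambda>2)"
    show "(\<lambda>(s, t) x. if x \<in> \<Lambda>1 then s x else t x) (split_config \<Lambda>1 \<Lambda>2 \<sigma>) = \<sigma>"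
      using out[OF s] unfolding split_config_def by (simp only: fun_eq_iff case_prod_conv restrict_def) (metis UnE)
  qed
  show "\<forall>p\<in>configs n \<Lambda>1 \<times> configs n \<Lambda>2. split_config \<Lambda>1 \<Lambda>2 ((\<lambda>(s, t) x. if x \<in> \<Lambda>1 then s x else t x) p) = p"
  proof
    fix p assume p: "p \<in> configs n \<Lambda>1 \<times> configs n \<Lambda>2"
    obtain s t where st: "p = (s, t)" by (cases p)
    have "restrict (\<lambda>x. if x \<in> \<Lambda>1 then s x else t x) \<Lambda>1 = s"
      using p st out[of s \<Lambda>1] by (intro ext) (simp add: restrict_def)
    moreover have "restrict (\<lambda>x. if x \<in> \<Lambda>1 then s x else t x) \<Lambda>2 = t"
      using p st out[of t \<Lambda>2] assms by (intro ext) (auto simp: restrict_def disjoint_iff)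
    ultimately show "split_config \<Lambda>1 \<Lambda>2 ((\<lambda>(s, t) x. if x \<in> \<Lambda>1 then s x else t x) p) = p"
      by (simp add: split_config_def st)
  qed
  show "split_config \<Lambda>1 \<Lambda>2 ` configs n (\<Lambda>1 \<union> \<Lambda>2) \<subseteq> configs n \<Lambda>1 \<times> configs n \<Lambda>2"
    using configs_le unfolding split_config_def by (auto intro!: memI simp del: split_paired_All)
  show "(\<lambda>(s, t) x. if x \<in> \<Lambda>1 then s x else t x) ` (configs n \<Lambda>1 \<times> configs n \<Lambda>2) \<subseteq> configs n (\<Lambda>1 \<union> \<Lambda>2)"
  proof
    fix f assume "f \<in> (\<lambda>(s, t) x. if x \<in> \<Lambda>1 then s x else t x) ` (configs n \<Lambda>1 \<times> configs n \<Lambda>2)"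
    then obtain s t where f: "f = (\<lambda>x. if x \<in> \<Lambda>1 then s x else t x)" "s \<in> configs n \<Lambda>1" "t \<in> configs n \<Lambda>2" by auto
    show "f \<in> configs n (\<Lambda>1 \<union> \<Lambda>2)"
      unfolding f(1) using configs_le[OF f(2)] configs_le[OF f(3)] out[OF f(3)] by (intro memI) auto
  qed
qed

definition cross_pairs :: "site set \<Rightarrow> site set \<Rightarrow> (site \<times> site) set" where
  "cross_pairs \<Lambda>1 \<Lambda>2 = nn_pairs (\<Lambda>1 \<union> \<Lambda>2) - nn_pairs \<Lambda>1 - nn_pairs \<Lambda>2"

text \<open>A bond kernel depends on the two bond sites and forces agreement everywhere else. For a
  bond inside one region it is therefore the kernel of that region times the identity on the other;
  the connecting bonds are left over.\<close>

lemma ham_kernel_union: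
  assumes fin: "finite \<Lambda>1" "finite \<Lambda>2" and disj: "\<Lambda>1 \<inter> \<Lambda>2 = {}"
    and mem: "\<sigma> \<in> configs n (\<Lambda>1 \<union> \<Lambda>2)" "\<tau> \<in> configs n (\<Lambda>1 \<union> \<Lambda>2)"
  shows "ham_kernel n (\<Lambda>1 \<union> \<Lambda>2) \<sigma> \<tau> =
    kernel_sum (ham_kernel n \<Lambda>1) (ham_kernel n \<Lambda>2) (split_config \<Lambda>1 \<Lambda>2 \<sigma>) (split_config \<Lambda>1 \<Lambda>2 \<tau>)
    + (\<Sum>(x, y)\<in>cross_pairs \<Lambda>1 \<Lambda>2. bond_kernel n (\<Lambda>1 \<union> \<Lambda>2) x y \<sigma> \<tau>)"
proof -
  let ?\<Lambda> = "\<Lambda>1 \<union> \<Lambda>2"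
  have part: "(\<Sum>(x, y)\<in>nn_pairs A. bond_kernel n ?\<Lambda> x y \<sigma> \<tau>)
      = ham_kernel n A (restrict \<sigma> A) (restrict \<tau> A) * of_bool (restrict \<sigma> B = restrict \<tau> B)"
    if AB: "A \<union> B = ?\<Lambda>" "A \<inter> B = {}" for A B
  proof -
    have finA: "finite A" using AB fin by (metis finite_Un)
    have resA: "restrict \<rho> A \<in> configs n A" if "\<rho> \<in> configs n ?\<Lambda>" for \<rho>
      using that AB(1) unfolding configs_def by (auto intro!: restrict_PiE simp del: split_paired_All)
    have eqB: "restrict \<sigma> B = restrict \<tau> B \<longleftrightarrow> (\<forall>z\<in>B. \<sigma> z = \<tau> z)"
      unfolding restrict_def fun_eq_iff by (auto simp del: split_paired_All)
    show ?thesis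
      unfolding ham_kernel_def sum_distrib_right
    proof (intro sum.cong refl, clarify)
      fix x y assume p: "(x, y) \<in> nn_pairs A"
      have xy: "x \<in> A" "y \<in> A" "x \<noteq> y" using nn_pairsD[OF p] by auto
      have xy': "x \<in> ?\<Lambda>" "y \<in> ?\<Lambda>" using xy AB(1) by auto
      have "(\<forall>z\<in>?\<Lambda> - {x, y}. \<sigma> z = \<tau> z) \<longleftrightarrow> (\<forall>z\<in>A - {x, y}. (restrict \<sigma> A) z = (restrict \<tau> A) z) \<and> (\<forall>z\<in>B. \<sigma> z = \<tau> z)"
        unfolding AB(1)[symmetric] using xy AB(2) by (auto simp del: split_paired_All)
      then show "bond_kernel n ?\<Lambda> x y \<sigma> \<tau> =
          bond_kernel n A x y (restrict \<sigma> A) (restrict \<tau> A) * of_bool (restrict \<sigma> B = restrict \<tau> B)"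
        unfolding eqB bond_kernel_eq[OF finA resA[OF mem(1)] resA[OF mem(2)] xy]
          bond_kernel_eq[OF finite_UnI[OF fin] mem xy' xy(3)]
        using xy by simp
    qed
  qed
  have un: "nn_pairs ?\<Lambda> = (nn_pairs \<Lambda>1 \<union> nn_pairs \<Lambda>2) \<union> cross_pairs \<Lambda>1 \<Lambda>2"
    by (auto simp: cross_pairs_def nn_pairs_def)
  have disj': "nn_pairs \<Lambda>1 \<inter> nn_pairs \<Lambda>2 = {}" "(nn_pairs \<Lambda>1 \<union> nn_pairs \<Lambda>2) \<inter> cross_pairs \<Lambda>1 \<Lambda>2 = {}"
    using disj by (auto simp: cross_pairs_def nn_pairs_def)
  have fins: "finite (nn_pairs \<Lambda>1)" "finite (nn_pairs \<Lambda>2)" "finite (cross_pairs \<Lambda>1 \<Lambda>2)"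
    using fin finite_nn_pairs unfolding cross_pairs_def by auto
  have "ham_kernel n ?\<Lambda> \<sigma> \<tau> = (\<Sum>(x, y)\<in>nn_pairs \<Lambda>1. bond_kernel n ?\<Lambda> x y \<sigma> \<tau>)
      + (\<Sum>(x, y)\<in>nn_pairs \<Lambda>2. bond_kernel n ?\<Lambda> x y \<sigma> \<tau>)
      + (\<Sum>(x, y)\<in>cross_pairs \<Lambda>1 \<Lambda>2. bond_kernel n ?\<Lambda> x y \<sigma> \<tau>)"
    unfolding ham_kernel_def un using fins disj' by (simp add: sum.union_disjoint)
  then show ?thesis
    using part[of \<Lambda>1 \<Lambda>2] part[of \<Lambda>2 \<Lambda>1] disj
    by (simp add: kernel_sum_def split_config_def Un_commute Int_commute mult.commute)
qed

lemma quad_form_add: "quad_form X (\<lambda>s t. h s t + k s t) v = quad_form X h v + quad_form X k v"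
  unfolding quad_form_def by (simp only: distrib_right sum.distrib)

lemma quad_form_cong:
  "(\<And>s t. s \<in> X \<Longrightarrow> t \<in> X \<Longrightarrow> h s t = k s t) \<Longrightarrow> quad_form X h v = quad_form X k v"
  unfolding quad_form_def by (intro sum.cong refl) simp

lemma quad_form_cross:
  assumes "finite \<Lambda>1" "finite \<Lambda>2"
  shows "quad_form (configs n (\<Lambda>1 \<union> \<Lambda>2)) (\<lambda>\<sigma> \<tau>. \<Sum>(x, y)\<in>cross_pairs \<Lambda>1 \<Lambda>2. bond_kernel n (\<Lambda>1 \<union> \<Lambda>2) x y \<sigma> \<tau>) \<psi>
    = (\<Sum>(x, y)\<in>cross_pairs \<Lambda>1 \<Lambda>2. bond_energy n (\<Lambda>1 \<union> \<Lambda>2) x y \<psi>)"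
  unfolding case_prod_beta quad_form_sum_kernel
proof (rule sum.cong[OF refl])
  fix p assume "p \<in> cross_pairs \<Lambda>1 \<Lambda>2"
  then have "fst p \<in> \<Lambda>1 \<union> \<Lambda>2" "snd p \<in> \<Lambda>1 \<union> \<Lambda>2"
    using nn_pairsD[of "fst p" "snd p" "\<Lambda>1 \<union> \<Lambda>2"] by (auto simp: cross_pairs_def)
  then show "quad_form (configs n (\<Lambda>1 \<union> \<Lambda>2)) (bond_kernel n (\<Lambda>1 \<union> \<Lambda>2) (fst p) (snd p)) \<psi>
      = bond_energy n (\<Lambda>1 \<union> \<Lambda>2) (fst p) (snd p) \<psi>"
    using assms by (intro quad_form_bond) auto
qed

lemma quad_form_union:
  assumes fin: "finite \<Lambda>1" "finite \<Lambda>2" and disj: "\<Lambda>1 \<inter> \<Lambda>2 = {}"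
  shows "quad_form (configs n (\<Lambda>1 \<union> \<Lambda>2)) (ham_kernel n (\<Lambda>1 \<union> \<Lambda>2)) \<psi> =
    quad_form (configs n (\<Lambda>1 \<union> \<Lambda>2)) (\<lambda>\<sigma> \<tau>. kernel_sum (ham_kernel n \<Lambda>1) (ham_kernel n \<Lambda>2)
      (split_config \<Lambda>1 \<Lambda>2 \<sigma>) (split_config \<Lambda>1 \<Lambda>2 \<tau>)) \<psi>
    + (\<Sum>(x, y)\<in>cross_pairs \<Lambda>1 \<Lambda>2. bond_energy n (\<Lambda>1 \<union> \<Lambda>2) x y \<psi>)"
  unfolding quad_form_cross[OF fin, symmetric] quad_form_add[symmetric]
  by (rule quad_form_cong) (rule ham_kernel_union[OF fin disj])

text \<open>Connecting bonds have nonnegative energy, so dropping them lowers the Hamiltonian and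
  raises the trace, which then factorises.\<close>

lemma partition_fun_union_le:
  assumes fin: "finite \<Lambda>1" "finite \<Lambda>2" and disj: "\<Lambda>1 \<inter> \<Lambda>2 = {}" and \<beta>: "0 \<le> \<beta>"
  shows "partition_fun \<beta> n (\<Lambda>1 \<union> \<Lambda>2) \<le> partition_fun \<beta> n \<Lambda>1 * partition_fun \<beta> n \<Lambda>2"
proof -
  obtain J :: "nat set" and e lam where s: "spectral_on (configs n (\<Lambda>1 \<union> \<Lambda>2)) (ham_kernel n (\<Lambda>1 \<union> \<Lambda>2)) J e lam"
    by (rule ham_spectral[OF finite_UnI[OF fin]])
  obtain J1 :: "nat set" and e1 lam1 where s1: "spectral_on (configs n \<Lambda>1) (ham_kernel n \<Lambda>1) J1 e1 lam1"
    by (rule ham_spectral[OF fin(1)])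
  obtain J2 :: "nat set" and e2 lam2 where s2: "spectral_on (configs n \<Lambda>2) (ham_kernel n \<Lambda>2) J2 e2 lam2"
    by (rule ham_spectral[OF fin(2)])
  note sp = spectral_on_reindex[OF bij_split_config[OF disj] spectral_on_product[OF s1 s2]]
  have "(\<Sum>i\<in>J. exp (- \<beta> * lam i)) \<le> (\<Sum>p\<in>J1 \<times> J2. exp (- \<beta> * (\<lambda>(i, j). lam1 i + lam2 j) p))"
  proof (rule trace_exp_antimono[OF s sp \<beta>])
    fix v
    have "0 \<le> (\<Sum>(x, y)\<in>cross_pairs \<Lambda>1 \<Lambda>2. bond_energy n (\<Lambda>1 \<union> \<Lambda>2) x y v)"
      using bond_energy_nonneg by (intro sum_nonneg) auto
    then show "quad_form (configs n (\<Lambda>1 \<union> \<Lambda>2)) (\<lambda>\<sigma> \<tau>. kernel_sum (ham_kernel n \<Lambda>1) (ham_kernel n \<Lambda>2)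
      (split_config \<Lambda>1 \<Lambda>2 \<sigma>) (split_config \<Lambda>1 \<Lambda>2 \<tau>)) v
      \<le> quad_form (configs n (\<Lambda>1 \<union> \<Lambda>2)) (ham_kernel n (\<Lambda>1 \<union> \<Lambda>2)) v"
      unfolding quad_form_union[OF fin disj] by simp
  qed
  then show ?thesis
    unfolding partition_fun_spectral[OF finite_UnI[OF fin] s] partition_fun_spectral[OF fin(1) s1]
      partition_fun_spectral[OF fin(2) s2] trace_exp_product .
qed

section \<open>Trial states without magnons on the boundary\<close>

definition boundary :: "site set \<Rightarrow> site set" where
  "boundary \<Lambda> = {x \<in> \<Lambda>. \<exists>d\<in>{(1, 0), (-1, 0), (0, 1), (0, -1)}. x + d \<notin> \<Lambda>}"

definition vanishes_at_boundary :: "nat \<Rightarrow> site set \<Rightarrow> ((site \<Rightarrow> nat) \<Rightarrow> real) \<Rightarrow> bool" where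
  "vanishes_at_boundary n \<Lambda> \<psi> \<longleftrightarrow>
     (\<forall>\<sigma>\<in>configs n \<Lambda>. \<forall>x\<in>boundary \<Lambda>. 0 < \<sigma> x \<longrightarrow> \<psi> \<sigma> = 0)"

text \<open>The share of one trial vector in the Peierls-Bogoliubov bound. A zero vector contributes
  0, the division by its norm notwithstanding.\<close>

definition gibbs_weight :: "real \<Rightarrow> nat \<Rightarrow> site set \<Rightarrow> ((site \<Rightarrow> nat) \<Rightarrow> real) \<Rightarrow> real" where
  "gibbs_weight \<beta> n \<Lambda> \<psi> = ip_on (configs n \<Lambda>) \<psi> \<psi> *
     exp (- \<beta> * (quad_form (configs n \<Lambda>) (ham_kernel n \<Lambda>) \<psi> / ip_on (configs n \<Lambda>) \<psi> \<psi>))"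

text \<open>A lower bound for the partition function that comes from trial states in which no magnon
  touches the boundary; such bounds are multiplicative over disjoint regions.\<close>

definition dirichlet_bound :: "real \<Rightarrow> nat \<Rightarrow> site set \<Rightarrow> real \<Rightarrow> bool" where
  "dirichlet_bound \<beta> n \<Lambda> X \<longleftrightarrow> 0 \<le> X \<and> (\<exists>(I :: nat set) v. finite I \<and>
     (\<forall>i\<in>I. vanishes_at_boundary n \<Lambda> (v i)) \<and>
     (\<forall>\<eta>. (\<Sum>i\<in>I. (ip_on (configs n \<Lambda>) (v i) \<eta>)\<^sup>2) \<le> ip_on (configs n \<Lambda>) \<eta> \<eta>) \<and>
     X \<le> (\<Sum>i\<in>I. gibbs_weight \<beta> n \<Lambda> (v i)))"

text \<open>An existential cannot range over types, so \<open>dirichlet_bound\<close> indexes trial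
  vectors by naturals; this rule admits any finite index set, such as multisets or pairs.\<close>

lemma dirichlet_boundI:
  fixes I :: "'i set"
  assumes "finite I" "0 \<le> X" "\<And>i. i \<in> I \<Longrightarrow> vanishes_at_boundary n \<Lambda> (v i)"
    and "\<And>\<eta>. (\<Sum>i\<in>I. (ip_on (configs n \<Lambda>) (v i) \<eta>)\<^sup>2) \<le> ip_on (configs n \<Lambda>) \<eta> \<eta>"
    and "X \<le> (\<Sum>i\<in>I. gibbs_weight \<beta> n \<Lambda> (v i))"
  shows "dirichlet_bound \<beta> n \<Lambda> X"
proof -
  obtain f :: "nat \<Rightarrow> 'i" where f: "bij_betw f {0..<card I} I"
    using ex_bij_betw_nat_finite[OF assms(1)] by blast
  have re: "(\<Sum>i\<in>{0..<card I}. g (v (f i))) = (\<Sum>i\<in>I. g (v i) :: real)" for g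
    by (rule sum.reindex_bij_betw[OF f])
  have mem: "f i \<in> I" if "i \<in> {0..<card I}" for i using f that by (auto simp: bij_betw_def)
  show ?thesis
    unfolding dirichlet_bound_def
  proof (intro conjI exI[of _ "{0..<card I}"] exI[of _ "\<lambda>i. v (f i)"] ballI allI)
    show "(\<Sum>i\<in>{0..<card I}. (ip_on (configs n \<Lambda>) (v (f i)) \<eta>)\<^sup>2) \<le> ip_on (configs n \<Lambda>) \<eta> \<eta>" for \<eta>
      using assms(4)[of \<eta>] re[of "\<lambda>\<psi>. (ip_on (configs n \<Lambda>) \<psi> \<eta>)\<^sup>2"] by simp
    show "X \<le> (\<Sum>i\<in>{0..<card I}. gibbs_weight \<beta> n \<Lambda> (v (f i)))"
      using assms(5) re[of "gibbs_weight \<beta> n \<Lambda>"] by simp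
  qed (use assms mem in auto)
qed

lemma dirichlet_bound_partition_fun:
  assumes "finite \<Lambda>" "dirichlet_bound \<beta> n \<Lambda> X"
  shows "X \<le> partition_fun \<beta> n \<Lambda>"
proof -
  obtain I :: "nat set" and v where I: "finite I"
    "\<And>\<eta>. (\<Sum>i\<in>I. (ip_on (configs n \<Lambda>) (v i) \<eta>)\<^sup>2) \<le> ip_on (configs n \<Lambda>) \<eta> \<eta>"
    "X \<le> (\<Sum>i\<in>I. gibbs_weight \<beta> n \<Lambda> (v i))"
    using assms(2) unfolding dirichlet_bound_def by blast
  obtain J :: "nat set" and e lam where s: "spectral_on (configs n \<Lambda>) (ham_kernel n \<Lambda>) J e lam"
    by (rule ham_spectral[OF assms(1)])
  show ?thesis
    using I(3) peierls_bogoliubov[OF s I(1,2), of \<beta>]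
    unfolding partition_fun_spectral[OF assms(1) s] gibbs_weight_def by (rule order_trans)
qed

definition tensor :: "site set \<Rightarrow> site set \<Rightarrow> ((site \<Rightarrow> nat) \<Rightarrow> real) \<Rightarrow> ((site \<Rightarrow> nat) \<Rightarrow> real) \<Rightarrow> (site \<Rightarrow> nat) \<Rightarrow> real" where
  "tensor \<Lambda>1 \<Lambda>2 v w \<sigma> = v (restrict \<sigma> \<Lambda>1) * w (restrict \<sigma> \<Lambda>2)"

lemma sum_split_config:
  assumes "\<Lambda>1 \<inter> \<Lambda>2 = {}"
  shows "(\<Sum>\<sigma>\<in>configs n (\<Lambda>1 \<union> \<Lambda>2). f (restrict \<sigma> \<Lambda>1) (restrict \<sigma> \<Lambda>2)) = (\<Sum>s\<in>configs n \<Lambda>1. \<Sum>t\<in>configs n \<Lambda>2. f s t :: real)"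
proof -
  have "(\<Sum>\<sigma>\<in>configs n (\<Lambda>1 \<union> \<Lambda>2). (\<lambda>(s, t). f s t) (split_config \<Lambda>1 \<Lambda>2 \<sigma>))
      = (\<Sum>p\<in>configs n \<Lambda>1 \<times> configs n \<Lambda>2. (\<lambda>(s, t). f s t) p)"
    by (rule sum.reindex_bij_betw[OF bij_split_config[OF assms]])
  then show ?thesis by (simp add: split_config_def sum.cartesian_product)
qed

lemma ip_tensor:
  assumes "\<Lambda>1 \<inter> \<Lambda>2 = {}"
  shows "ip_on (configs n (\<Lambda>1 \<union> \<Lambda>2)) (tensor \<Lambda>1 \<Lambda>2 v w) (tensor \<Lambda>1 \<Lambda>2 v w)
    = ip_on (configs n \<Lambda>1) v v * ip_on (configs n \<Lambda>2) w w"
  unfolding ip_on_def tensor_def sum_split_config[OF assms, of "\<lambda>s t. v s * w t * (v s * w t)"] sum_product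
  by (intro sum.cong refl) (simp add: mult_ac)

text \<open>Bessel on the second region is applied to the partial inner products \<open>a i\<close>,
  then Bessel on the first region for each fixed configuration \<open>t\<close> of the
  second.\<close>

lemma tensor_bessel:
  assumes disj: "\<Lambda>1 \<inter> \<Lambda>2 = {}"
    and b1: "\<And>\<eta>. (\<Sum>i\<in>I. (ip_on (configs n \<Lambda>1) (v i) \<eta>)\<^sup>2) \<le> ip_on (configs n \<Lambda>1) \<eta> \<eta>"
    and b2: "\<And>\<eta>. (\<Sum>j\<in>J. (ip_on (configs n \<Lambda>2) (w j) \<eta>)\<^sup>2) \<le> ip_on (configs n \<Lambda>2) \<eta> \<eta>"
  shows "(\<Sum>(i, j)\<in>I \<times> J. (ip_on (configs n (\<Lambda>1 \<union> \<Lambda>2)) (tensor \<Lambda>1 \<Lambda>2 (v i) (w j)) \<eta>)\<^sup>2)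
    \<le> ip_on (configs n (\<Lambda>1 \<union> \<Lambda>2)) \<eta> \<eta>"
proof -
  let ?C = "configs n (\<Lambda>1 \<union> \<Lambda>2)" and ?C1 = "configs n \<Lambda>1" and ?C2 = "configs n \<Lambda>2"
  define g where "g = inv_into ?C (split_config \<Lambda>1 \<Lambda>2)"
  have g: "g (restrict \<sigma> \<Lambda>1, restrict \<sigma> \<Lambda>2) = \<sigma>" if "\<sigma> \<in> ?C" for \<sigma>
    using bij_betw_inv_into_left[OF bij_split_config[OF disj, of n] that] by (simp add: g_def split_config_def)
  define a where "a i t = ip_on ?C1 (v i) (\<lambda>s. \<eta> (g (s, t)))" for i t
  have ip: "ip_on ?C (tensor \<Lambda>1 \<Lambda>2 (v i) (w j)) \<eta> = ip_on ?C2 (w j) (a i)" for i j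
  proof -
    have "ip_on ?C (tensor \<Lambda>1 \<Lambda>2 (v i) (w j)) \<eta>
        = (\<Sum>\<sigma>\<in>?C. (\<lambda>s t. w j t * (v i s * \<eta> (g (s, t)))) (restrict \<sigma> \<Lambda>1) (restrict \<sigma> \<Lambda>2))"
      unfolding ip_on_def tensor_def by (intro sum.cong) (auto simp: g)
    also have "\<dots> = (\<Sum>s\<in>?C1. \<Sum>t\<in>?C2. w j t * (v i s * \<eta> (g (s, t))))"
      by (rule sum_split_config[OF disj])
    also have "\<dots> = ip_on ?C2 (w j) (a i)"
      unfolding a_def ip_on_def sum_distrib_left by (rule sum.swap)
    finally show ?thesis .
  qed
  have "(\<Sum>(i, j)\<in>I \<times> J. (ip_on ?C (tensor \<Lambda>1 \<Lambda>2 (v i) (w j)) \<eta>)\<^sup>2) = (\<Sum>i\<in>I. \<Sum>j\<in>J. (ip_on ?C2 (w j) (a i))\<^sup>2)"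
    by (simp add: ip sum.cartesian_product)
  also have "\<dots> \<le> (\<Sum>i\<in>I. ip_on ?C2 (a i) (a i))" by (intro sum_mono b2)
  also have "\<dots> = (\<Sum>t\<in>?C2. \<Sum>i\<in>I. (ip_on ?C1 (v i) (\<lambda>s. \<eta> (g (s, t))))\<^sup>2)"
    unfolding ip_on_def[of ?C2] a_def power2_eq_square by (rule sum.swap)
  also have "\<dots> \<le> (\<Sum>t\<in>?C2. ip_on ?C1 (\<lambda>s. \<eta> (g (s, t))) (\<lambda>s. \<eta> (g (s, t))))" by (intro sum_mono b1)
  also have "\<dots> = (\<Sum>s\<in>?C1. \<Sum>t\<in>?C2. \<eta> (g (s, t)) * \<eta> (g (s, t)))"
    unfolding ip_on_def by (rule sum.swap)
  also have "\<dots> = (\<Sum>\<sigma>\<in>?C. (\<lambda>s t. \<eta> (g (s, t)) * \<eta> (g (s, t))) (restrict \<sigma> \<Lambda>1) (restrict \<sigma> \<Lambda>2))"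
    by (rule sum_split_config[OF disj, symmetric])
  also have "\<dots> = ip_on ?C \<eta> \<eta>" unfolding ip_on_def by (intro sum.cong) (auto simp: g)
  finally show ?thesis .
qed

lemma boundary_union: "boundary (\<Lambda>1 \<union> \<Lambda>2) \<subseteq> boundary \<Lambda>1 \<union> boundary \<Lambda>2"
  unfolding boundary_def by auto

lemma vanishes_tensor:
  assumes v: "vanishes_at_boundary n \<Lambda>1 v" and w: "vanishes_at_boundary n \<Lambda>2 w"
    and s: "\<sigma> \<in> configs n (\<Lambda>1 \<union> \<Lambda>2)" and x: "x \<in> boundary \<Lambda>1 \<union> boundary \<Lambda>2" "0 < \<sigma> x"
  shows "tensor \<Lambda>1 \<Lambda>2 v w \<sigma> = 0"
proof -
  have "restrict \<sigma> A \<in> configs n A" if "A \<subseteq> \<Lambda>1 \<union> \<Lambda>2" for A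
    unfolding configs_def by (intro PiE_I) (use configs_le[OF s] that in auto)
  then have r: "restrict \<sigma> \<Lambda>1 \<in> configs n \<Lambda>1" "restrict \<sigma> \<Lambda>2 \<in> configs n \<Lambda>2" by auto
  have sub: "boundary \<Lambda> \<subseteq> \<Lambda>" for \<Lambda> by (auto simp: boundary_def)
  have "v (restrict \<sigma> \<Lambda>1) = 0" if "x \<in> boundary \<Lambda>1"
    using v r(1) that x(2) sub[of \<Lambda>1] unfolding vanishes_at_boundary_def by (metis restrict_apply' subsetD)
  moreover have "w (restrict \<sigma> \<Lambda>2) = 0" if "x \<in> boundary \<Lambda>2"
    using w r(2) that x(2) sub[of \<Lambda>2] unfolding vanishes_at_boundary_def by (metis restrict_apply' subsetD)
  ultimately show ?thesis using x(1) by (auto simp: tensor_def)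
qed

text \<open>Both ends of a connecting bond are boundary sites, so raising either one gives a
  configuration of amplitude zero and the bond energy vanishes. What remains is the form of two
  independent systems.\<close>

lemma quad_form_tensor:
  assumes fin: "finite \<Lambda>1" "finite \<Lambda>2" and disj: "\<Lambda>1 \<inter> \<Lambda>2 = {}"
    and v: "vanishes_at_boundary n \<Lambda>1 v" and w: "vanishes_at_boundary n \<Lambda>2 w"
  shows "quad_form (configs n (\<Lambda>1 \<union> \<Lambda>2)) (ham_kernel n (\<Lambda>1 \<union> \<Lambda>2)) (tensor \<Lambda>1 \<Lambda>2 v w)
    = quad_form (configs n \<Lambda>1) (ham_kernel n \<Lambda>1) v * ip_on (configs n \<Lambda>2) w w
      + ip_on (configs n \<Lambda>1) v v * quad_form (configs n \<Lambda>2) (ham_kernel n \<Lambda>2) w"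
proof -
  let ?C = "configs n (\<Lambda>1 \<union> \<Lambda>2)" and ?C1 = "configs n \<Lambda>1" and ?C2 = "configs n \<Lambda>2"
  let ?h1 = "ham_kernel n \<Lambda>1" and ?h2 = "ham_kernel n \<Lambda>2"
  have cross: "bond_energy n (\<Lambda>1 \<union> \<Lambda>2) x y (tensor \<Lambda>1 \<Lambda>2 v w) = 0" if "(x, y) \<in> cross_pairs \<Lambda>1 \<Lambda>2" for x y
  proof -
    have nb: "\<exists>d\<in>{(1, 0), (-1, 0), (0, 1), (0, -1)}. x = y + d" "\<exists>d\<in>{(1, 0), (-1, 0), (0, 1), (0, -1)}. y = x + d"
      using that by (auto simp: cross_pairs_def nn_pairs_def prod_eq_iff)
    have bI: "p \<in> boundary \<Lambda>" if "p \<in> \<Lambda>" "q \<notin> \<Lambda>" "\<exists>d\<in>{(1, 0), (-1, 0), (0, 1), (0, -1)}. q = p + d" for p q \<Lambda>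
      using that unfolding boundary_def by blast
    have "x \<in> \<Lambda>1 \<and> y \<in> \<Lambda>2 \<or> x \<in> \<Lambda>2 \<and> y \<in> \<Lambda>1"
      using that by (auto simp: cross_pairs_def nn_pairs_def)
    then have b: "x \<in> boundary \<Lambda>1 \<union> boundary \<Lambda>2" "y \<in> boundary \<Lambda>1 \<union> boundary \<Lambda>2"
      using disj bI[of x \<Lambda>1 y] bI[of y \<Lambda>2 x] bI[of x \<Lambda>2 y] bI[of y \<Lambda>1 x] nb by blast+
    then have xy: "x \<in> \<Lambda>1 \<union> \<Lambda>2" "y \<in> \<Lambda>1 \<union> \<Lambda>2" by (auto simp: boundary_def)
    have "tensor \<Lambda>1 \<Lambda>2 v w (B(x := B x + 1)) = 0" "tensor \<Lambda>1 \<Lambda>2 v w (B(y := B y + 1)) = 0"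
      if "B \<in> below_configs n (\<Lambda>1 \<union> \<Lambda>2) x y" for B
    proof -
      have C: "B(x := B x + 1) \<in> ?C" "B(y := B y + 1) \<in> ?C"
        using that xy by (auto simp: below_configs_def intro!: configs_upd)
      show "tensor \<Lambda>1 \<Lambda>2 v w (B(x := B x + 1)) = 0"
        by (rule vanishes_tensor[OF v w C(1) b(1)]) simp
      show "tensor \<Lambda>1 \<Lambda>2 v w (B(y := B y + 1)) = 0"
        by (rule vanishes_tensor[OF v w C(2) b(2)]) simp
    qed
    then show ?thesis unfolding bond_energy_def by simp
  qed
  have inner: "(\<Sum>\<tau>\<in>?C. kernel_sum ?h1 ?h2 (split_config \<Lambda>1 \<Lambda>2 \<sigma>) (split_config \<Lambda>1 \<Lambda>2 \<tau>) * tensor \<Lambda>1 \<Lambda>2 v w \<sigma> * tensor \<Lambda>1 \<Lambda>2 v w \<tau>)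
      = (\<lambda>s s'. (\<Sum>t\<in>?C1. ?h1 s t * v s * v t) * (w s' * w s') + (v s * v s) * (\<Sum>t'\<in>?C2. ?h2 s' t' * w s' * w t'))
          (restrict \<sigma> \<Lambda>1) (restrict \<sigma> \<Lambda>2)" if s: "\<sigma> \<in> ?C" for \<sigma>
  proof -
    define s where "s = restrict \<sigma> \<Lambda>1"
    define s' where "s' = restrict \<sigma> \<Lambda>2"
    have mem: "s \<in> ?C1" "s' \<in> ?C2"
      using bij_split_config[OF disj, of n] s by (auto simp: bij_betw_def split_config_def s_def s'_def)
    have "(\<Sum>\<tau>\<in>?C. kernel_sum ?h1 ?h2 (split_config \<Lambda>1 \<Lambda>2 \<sigma>) (split_config \<Lambda>1 \<Lambda>2 \<tau>) * tensor \<Lambda>1 \<Lambda>2 v w \<sigma> * tensor \<Lambda>1 \<Lambda>2 v w \<tau>)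
        = (\<Sum>\<tau>\<in>?C. (\<lambda>t t'. (?h1 s t * of_bool (s' = t') + of_bool (s = t) * ?h2 s' t') * (v s * w s') * (v t * w t'))
            (restrict \<tau> \<Lambda>1) (restrict \<tau> \<Lambda>2))"
      by (simp only: kernel_sum_def split_config_def tensor_def case_prod_conv s_def s'_def)
    also have "\<dots> = (\<Sum>t\<in>?C1. \<Sum>t'\<in>?C2. (?h1 s t * of_bool (s' = t') + of_bool (s = t) * ?h2 s' t') * (v s * w s') * (v t * w t'))"
      by (rule sum_split_config[OF disj])
    also have "\<dots> = (\<Sum>t\<in>?C1. \<Sum>t'\<in>?C2. (?h1 s t * v s * v t) * (if t' = s' then w s' * w s' else 0)
        + (if t = s then v s * v s else 0) * (?h2 s' t' * w s' * w t'))"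
      by (intro sum.cong refl) (auto simp: algebra_simps)
    also have "\<dots> = (\<Sum>t\<in>?C1. ?h1 s t * v s * v t) * (\<Sum>t'\<in>?C2. if t' = s' then w s' * w s' else 0)
        + (\<Sum>t\<in>?C1. if t = s then v s * v s else 0) * (\<Sum>t'\<in>?C2. ?h2 s' t' * w s' * w t')"
      unfolding sum_product by (simp only: sum.distrib)
    also have "\<dots> = (\<Sum>t\<in>?C1. ?h1 s t * v s * v t) * (w s' * w s') + (v s * v s) * (\<Sum>t'\<in>?C2. ?h2 s' t' * w s' * w t')"
      using mem finite_configs fin by simp
    finally show ?thesis by (simp only: s_def s'_def)
  qed
  have "quad_form ?C (\<lambda>\<sigma> \<tau>. kernel_sum ?h1 ?h2 (split_config \<Lambda>1 \<Lambda>2 \<sigma>) (split_config \<Lambda>1 \<Lambda>2 \<tau>)) (tensor \<Lambda>1 \<Lambda>2 v w)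
      = (\<Sum>s\<in>?C1. \<Sum>s'\<in>?C2. (\<Sum>t\<in>?C1. ?h1 s t * v s * v t) * (w s' * w s') + (v s * v s) * (\<Sum>t'\<in>?C2. ?h2 s' t' * w s' * w t'))"
    unfolding quad_form_def sum_split_config[OF disj, symmetric] by (rule sum.cong[OF refl inner])
  also have "\<dots> = quad_form ?C1 ?h1 v * ip_on ?C2 w w + ip_on ?C1 v v * quad_form ?C2 ?h2 w"
    unfolding quad_form_def ip_on_def sum_product by (simp only: sum.distrib)
  finally show ?thesis
    unfolding quad_form_union[OF fin disj] using cross by (simp add: case_prod_beta)
qed

text \<open>For tensor products squared norms multiply and energies per squared norm add, so Gibbs
  weights multiply. The boundary condition is inherited because the boundary of a union lies in the
  union of the boundaries.\<close>

lemma dirichlet_bound_union: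
  assumes fin: "finite \<Lambda>1" "finite \<Lambda>2" and disj: "\<Lambda>1 \<inter> \<Lambda>2 = {}"
    and d1: "dirichlet_bound \<beta> n \<Lambda>1 X1" and d2: "dirichlet_bound \<beta> n \<Lambda>2 X2"
  shows "dirichlet_bound \<beta> n (\<Lambda>1 \<union> \<Lambda>2) (X1 * X2)"
proof -
  obtain I :: "nat set" and v where I: "finite I" "\<And>i. i \<in> I \<Longrightarrow> vanishes_at_boundary n \<Lambda>1 (v i)"
    "\<And>\<eta>. (\<Sum>i\<in>I. (ip_on (configs n \<Lambda>1) (v i) \<eta>)\<^sup>2) \<le> ip_on (configs n \<Lambda>1) \<eta> \<eta>"
    "X1 \<le> (\<Sum>i\<in>I. gibbs_weight \<beta> n \<Lambda>1 (v i))" and X1: "0 \<le> X1"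
    using d1 unfolding dirichlet_bound_def by blast
  obtain J :: "nat set" and w where J: "finite J" "\<And>j. j \<in> J \<Longrightarrow> vanishes_at_boundary n \<Lambda>2 (w j)"
    "\<And>\<eta>. (\<Sum>j\<in>J. (ip_on (configs n \<Lambda>2) (w j) \<eta>)\<^sup>2) \<le> ip_on (configs n \<Lambda>2) \<eta> \<eta>"
    "X2 \<le> (\<Sum>j\<in>J. gibbs_weight \<beta> n \<Lambda>2 (w j))" and X2: "0 \<le> X2"
    using d2 unfolding dirichlet_bound_def by blast
  define V where "V = (\<lambda>(i, j). tensor \<Lambda>1 \<Lambda>2 (v i) (w j))"
  have weight: "gibbs_weight \<beta> n (\<Lambda>1 \<union> \<Lambda>2) (V (i, j)) = gibbs_weight \<beta> n \<Lambda>1 (v i) * gibbs_weight \<beta> n \<Lambda>2 (w j)"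
    if "i \<in> I" "j \<in> J" for i j
  proof (cases "ip_on (configs n \<Lambda>1) (v i) (v i) = 0 \<or> ip_on (configs n \<Lambda>2) (w j) (w j) = 0")
    case True
    then show ?thesis by (auto simp: gibbs_weight_def V_def ip_tensor[OF disj])
  next
    case False
    have mult: "a * b * exp (- \<beta> * ((q * b + a * r) / (a * b))) = a * exp (- \<beta> * (q / a)) * (b * exp (- \<beta> * (r / b)))"
      if "a \<noteq> 0" "b \<noteq> 0" for a b q r :: real
    proof -
      have "(q * b + a * r) / (a * b) = q / a + r / b" using that by (simp add: add_divide_distrib)
      then have "- \<beta> * ((q * b + a * r) / (a * b)) = (- \<beta> * (q / a)) + (- \<beta> * (r / b))"
        by (simp only: distrib_left)
      then show ?thesis by (simp only: exp_add mult_ac)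
    qed
    show ?thesis
      unfolding gibbs_weight_def V_def case_prod_conv ip_tensor[OF disj]
        quad_form_tensor[OF fin disj I(2)[OF that(1)] J(2)[OF that(2)]]
      using False by (intro mult) auto
  qed
  show ?thesis
  proof (rule dirichlet_boundI[of "I \<times> J" _ _ _ V])
    show "finite (I \<times> J)" using I J by simp
    show "0 \<le> X1 * X2" using X1 X2 by simp
    show "vanishes_at_boundary n (\<Lambda>1 \<union> \<Lambda>2) (V p)" if "p \<in> I \<times> J" for p
      unfolding vanishes_at_boundary_def
    proof (intro ballI impI)
      fix \<sigma> x assume s: "\<sigma> \<in> configs n (\<Lambda>1 \<union> \<Lambda>2)" and x: "x \<in> boundary (\<Lambda>1 \<union> \<Lambda>2)" "0 < \<sigma> x"
      obtain i j where p: "p = (i, j)" "i \<in> I" "j \<in> J" using \<open>p \<in> I \<times> J\<close> by auto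
      have "x \<in> boundary \<Lambda>1 \<union> boundary \<Lambda>2" using boundary_union x(1) by blast
      then show "V p \<sigma> = 0"
        unfolding V_def p(1) case_prod_conv by (rule vanishes_tensor[OF I(2)[OF p(2)] J(2)[OF p(3)] s _ x(2)])
    qed
    show "(\<Sum>i\<in>I \<times> J. (ip_on (configs n (\<Lambda>1 \<union> \<Lambda>2)) (V i) \<eta>)\<^sup>2) \<le> ip_on (configs n (\<Lambda>1 \<union> \<Lambda>2)) \<eta> \<eta>" for \<eta>
      using tensor_bessel[OF disj I(3) J(3)] by (simp add: V_def case_prod_beta)
    have "X1 * X2 \<le> (\<Sum>i\<in>I. gibbs_weight \<beta> n \<Lambda>1 (v i)) * (\<Sum>j\<in>J. gibbs_weight \<beta> n \<Lambda>2 (w j))"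
      using I(4) J(4) X1 X2 by (intro mult_mono) auto
    also have "\<dots> = (\<Sum>p\<in>I \<times> J. gibbs_weight \<beta> n (\<Lambda>1 \<union> \<Lambda>2) (V p))"
      unfolding sum_product sum.cartesian_product using weight by (intro sum.cong) auto
    finally show "X1 * X2 \<le> (\<Sum>p\<in>I \<times> J. gibbs_weight \<beta> n (\<Lambda>1 \<union> \<Lambda>2) (V p))" .
  qed
qed

lemma configs_empty: "configs n {} = {\<lambda>x. undefined}"
  by (simp add: configs_def)

lemma dirichlet_bound_empty: "dirichlet_bound \<beta> n {} 1"
proof (rule dirichlet_boundI[of "{()}" _ _ _ "\<lambda>_ _. 1"])
  show "(\<Sum>i\<in>{()}. (ip_on (configs n {}) (\<lambda>_. 1) \<eta>)\<^sup>2) \<le> ip_on (configs n {}) \<eta> \<eta>" for \<eta>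
    by (simp add: ip_on_def configs_empty power2_eq_square)
  have "nn_pairs {} = {}" by (auto simp: nn_pairs_def)
  then show "1 \<le> (\<Sum>i\<in>{()}. gibbs_weight \<beta> n {} (\<lambda>_. 1))"
    by (simp add: gibbs_weight_def ip_on_def configs_empty quad_form_def ham_kernel_def)
qed (auto simp: vanishes_at_boundary_def boundary_def)

lemma dirichlet_bound_Union:
  assumes "finite A" "\<And>a. a \<in> A \<Longrightarrow> finite (R a)" "\<And>a b. a \<in> A \<Longrightarrow> b \<in> A \<Longrightarrow> a \<noteq> b \<Longrightarrow> R a \<inter> R b = {}"
    and "\<And>a. a \<in> A \<Longrightarrow> dirichlet_bound \<beta> n (R a) X"
  shows "dirichlet_bound \<beta> n (\<Union>a\<in>A. R a) (X ^ card A)"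
  using assms
proof (induction A)
  case empty
  then show ?case by (simp add: dirichlet_bound_empty)
next
  case (insert a A)
  have "dirichlet_bound \<beta> n (R a \<union> (\<Union>a\<in>A. R a)) (X * X ^ card A)"
    using insert by (intro dirichlet_bound_union) auto
  then show ?case using insert by simp
qed

lemma partition_fun_pos: assumes "finite \<Lambda>" shows "0 < partition_fun \<beta> n \<Lambda>"
proof -
  obtain J :: "nat set" and e lam where s: "spectral_on (configs n \<Lambda>) (ham_kernel n \<Lambda>) J e lam"
    by (rule ham_spectral[OF assms])
  define z where "z = (\<lambda>x\<in>\<Lambda>. 0 :: nat)"
  have "z \<in> configs n \<Lambda>" by (simp add: z_def configs_def)
  then have "J \<noteq> {}" using spectral_onD(4)[OF s, of z z] by auto
  then show ?thesis
    unfolding partition_fun_spectral[OF assms s] using spectral_onD(2)[OF s] by (intro sum_pos) auto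
qed

lemma partition_fun_Union_le:
  assumes "finite A" "\<And>a. a \<in> A \<Longrightarrow> finite (R a)" "\<And>a b. a \<in> A \<Longrightarrow> b \<in> A \<Longrightarrow> a \<noteq> b \<Longrightarrow> R a \<inter> R b = {}"
    and "0 \<le> \<beta>" "\<And>a. a \<in> A \<Longrightarrow> partition_fun \<beta> n (R a) \<le> X"
  shows "partition_fun \<beta> n (\<Union>a\<in>A. R a) \<le> X ^ card A"
  using assms
proof (induction A)
  case empty
  have id: "spectral_on (configs n {}) (ham_kernel n {}) {()} (\<lambda>_ _. 1) (\<lambda>_. 0)"
    by (simp add: spectral_on_def configs_empty ip_on_def ham_kernel_def nn_pairs_def)
  show ?case using partition_fun_spectral[OF finite.emptyI id] by simp
next
  case (insert a A)
  have "0 < partition_fun \<beta> n (R a)" using insert.prems by (intro partition_fun_pos) auto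
  then have X: "0 \<le> X" using insert.prems(4)[of a] by simp
  have "partition_fun \<beta> n (R a \<union> (\<Union>a\<in>A. R a)) \<le> partition_fun \<beta> n (R a) * partition_fun \<beta> n (\<Union>a\<in>A. R a)"
    using insert by (intro partition_fun_union_le) auto
  also have "\<dots> \<le> X * X ^ card A"
    using insert X less_imp_le[OF partition_fun_pos[of "\<Union>a\<in>A. R a"]] by (intro mult_mono) auto
  finally show ?case using insert by simp
qed

text \<open>\<open>q\<close> bounds the norm defect: squared norms of at least \<open>1 - q\<close>
  give the prefactor, and dividing the energy by them replaces \<open>\<beta>\<close> by
  \<open>\<beta> / (1 - q)\<close>. The factor \<open>real n / 2\<close> is the spin.\<close>

lemma modes_dirichlet_bound:
  fixes K :: "'k set" and u :: "'k \<Rightarrow> site \<Rightarrow> real"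
  assumes modes: "orthonormal_modes \<Lambda> K u" and n: "0 < n" and \<beta>: "0 \<le> \<beta>"
    and U: "\<And>k x. k \<in> K \<Longrightarrow> x \<in> \<Lambda> \<Longrightarrow> (u k x)\<^sup>2 \<le> U"
    and bd: "\<And>k x. k \<in> K \<Longrightarrow> x \<in> boundary \<Lambda> \<Longrightarrow> u k x = 0"
    and \<epsilon>: "\<And>k. k \<in> K \<Longrightarrow> (\<Sum>(x, y)\<in>nn_pairs \<Lambda>. (u k x - u k y)\<^sup>2) \<le> \<epsilon> k"
    and q: "real (card \<Lambda>) * U\<^sup>2 * M\<^sup>2 / real n \<le> q" "q < 1"
    and F: "finite F" "\<And>m. m \<in> F \<Longrightarrow> set_mset m \<subseteq> K" "\<And>m. m \<in> F \<Longrightarrow> real (size m) \<le> M"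
  shows "dirichlet_bound \<beta> n \<Lambda>
    ((1 - q) * (\<Sum>m\<in>F. exp (- (\<beta> / (1 - q) * (real n / 2)) * (\<Sum>k\<in>K. real (count m k) * \<epsilon> k))))"
proof -
  interpret orthonormal_modes \<Lambda> K u by (rule modes)
  have C: "\<Lambda> \<rightarrow>\<^sub>E {0..n} = configs n \<Lambda>" by (simp add: configs_def)
  have norm: "1 - q \<le> ip_on (configs n \<Lambda>) (trial n m) (trial n m)" if "m \<in> F" for m
  proof -
    have "(real (size m))\<^sup>2 \<le> M\<^sup>2" using F(3)[OF that] by (intro power_mono) auto
    then have "real (card \<Lambda>) * U\<^sup>2 * (real (size m))\<^sup>2 / real n \<le> real (card \<Lambda>) * U\<^sup>2 * M\<^sup>2 / real n"
      by (intro divide_right_mono mult_left_mono) auto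
    then show ?thesis using trial_norm_ge[OF n F(2)[OF that] U] q(1) unfolding C by fastforce
  qed
  define E where "E m = real n / 2 * (\<Sum>k\<in>K. real (count m k) * \<epsilon> k)" for m
  have energy: "quad_form (configs n \<Lambda>) (ham_kernel n \<Lambda>) (trial n m) \<le> E m" if "m \<in> F" for m
  proof -
    have "quad_form (configs n \<Lambda>) (ham_kernel n \<Lambda>) (trial n m) = (\<Sum>(x, y)\<in>nn_pairs \<Lambda>. bond_energy n \<Lambda> x y (trial n m))"
      by (rule quad_form_ham[OF finite_sites])
    also have "\<dots> \<le> (\<Sum>p\<in>nn_pairs \<Lambda>. real n / 2 * (\<Sum>k\<in>K. real (count m k) * (u k (fst p) - u k (snd p))\<^sup>2))"
    proof (rule sum_mono)
      fix p assume p: "p \<in> nn_pairs \<Lambda>"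
      obtain x y where xy: "p = (x, y)" by (cases p)
      have "x \<in> \<Lambda>" "y \<in> \<Lambda>" using nn_pairsD p xy by blast+
      from trial_bond_bound[OF n this F(2)[OF that]]
      show "(\<lambda>(x, y). bond_energy n \<Lambda> x y (trial n m)) p \<le> real n / 2 * (\<Sum>k\<in>K. real (count m k) * (u k (fst p) - u k (snd p))\<^sup>2)"
        unfolding C bond_energy_def below_configs_def xy by simp
    qed
    also have "\<dots> = real n / 2 * (\<Sum>k\<in>K. real (count m k) * (\<Sum>p\<in>nn_pairs \<Lambda>. (u k (fst p) - u k (snd p))\<^sup>2))"
      unfolding sum_distrib_left[symmetric] by (subst sum.swap) (simp only: sum_distrib_left)
    also have "\<dots> \<le> E m"
      unfolding E_def using \<epsilon> by (intro mult_left_mono sum_mono) (auto simp: case_prod_beta)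
    finally show ?thesis .
  qed
  have E0: "0 \<le> E m" for m
  proof -
    have "0 \<le> \<epsilon> k" if "k \<in> K" for k
      using order_trans[OF sum_nonneg \<epsilon>[OF that]] by (auto simp: case_prod_beta)
    then show ?thesis unfolding E_def by (intro mult_nonneg_nonneg sum_nonneg) auto
  qed
  have weight: "(1 - q) * exp (- (\<beta> / (1 - q)) * E m) \<le> gibbs_weight \<beta> n \<Lambda> (trial n m)" if m: "m \<in> F" for m
  proof -
    define a where "a = ip_on (configs n \<Lambda>) (trial n m) (trial n m)"
    define e where "e = quad_form (configs n \<Lambda>) (ham_kernel n \<Lambda>) (trial n m)"
    have a: "1 - q \<le> a" "0 < 1 - q" using norm[OF m] q by (auto simp: a_def)
    have "e / a \<le> E m / a" using energy[OF m] a by (intro divide_right_mono) (auto simp: e_def)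
    also have "\<dots> \<le> E m / (1 - q)" using a E0 by (intro divide_left_mono) auto
    finally have "\<beta> * (e / a) \<le> \<beta> * (E m / (1 - q))" using \<beta> by (rule mult_left_mono)
    then have "exp (- (\<beta> / (1 - q)) * E m) \<le> exp (- \<beta> * (e / a))" by simp
    then have "(1 - q) * exp (- (\<beta> / (1 - q)) * E m) \<le> a * exp (- \<beta> * (e / a))"
      using a by (intro mult_mono) auto
    then show ?thesis by (simp add: gibbs_weight_def a_def e_def)
  qed
  show ?thesis
  proof (rule dirichlet_boundI[OF F(1), where v = "trial n"])
    show "0 \<le> (1 - q) * (\<Sum>m\<in>F. exp (- (\<beta> / (1 - q) * (real n / 2)) * (\<Sum>k\<in>K. real (count m k) * \<epsilon> k)))"
      using q by (intro mult_nonneg_nonneg sum_nonneg) auto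
    show "vanishes_at_boundary n \<Lambda> (trial n m)" if "m \<in> F" for m
      unfolding vanishes_at_boundary_def
    proof (intro ballI impI)
      fix \<sigma> :: "site \<Rightarrow> nat" and x assume x: "x \<in> boundary \<Lambda>" "0 < \<sigma> x"
      then have "x \<in> \<Lambda>" by (simp add: boundary_def)
      then show "trial n m \<sigma> = 0" using trial_vanishes[where \<sigma> = \<sigma>, OF _ F(2)[OF that] bd[OF _ x(1)] x(2)] by blast
    qed
    show "(\<Sum>m\<in>F. (ip_on (configs n \<Lambda>) (trial n m) \<eta>)\<^sup>2) \<le> ip_on (configs n \<Lambda>) \<eta> \<eta>" for \<eta>
      using trial_bessel[OF n F(1,2)] unfolding C .
    have "(1 - q) * (\<Sum>m\<in>F. exp (- (\<beta> / (1 - q) * (real n / 2)) * (\<Sum>k\<in>K. real (count m k) * \<epsilon> k)))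
        = (\<Sum>m\<in>F. (1 - q) * exp (- (\<beta> / (1 - q)) * E m))"
      unfolding sum_distrib_left E_def by (simp only: mult_minus_left mult.assoc)
    also have "\<dots> \<le> (\<Sum>m\<in>F. gibbs_weight \<beta> n \<Lambda> (trial n m))" by (intro sum_mono weight)
    finally show "(1 - q) * (\<Sum>m\<in>F. exp (- (\<beta> / (1 - q) * (real n / 2)) * (\<Sum>k\<in>K. real (count m k) * \<epsilon> k)))
      \<le> (\<Sum>m\<in>F. gibbs_weight \<beta> n \<Lambda> (trial n m))" .
  qed
qed

section \<open>Grand canonical sums\<close>

text \<open>Truncation does not raise the mean of a geometric distribution above
  \<open>t / (1 - t)\<close>. The identity \<open>1\<close> is summation by parts, and the leftover
  \<open>R t^(R + 1)\<close> has the favourable sign.\<close>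

lemma geometric_mean_le:
  fixes t :: real
  assumes "0 \<le> t" "t < 1"
  shows "(\<Sum>j\<le>R. real j * t ^ j) \<le> t / (1 - t) * (\<Sum>j\<le>R. t ^ j)"
proof -
  have 1: "(1 - t) * (\<Sum>j\<le>R. real j * t ^ j) + real R * t ^ Suc R = (\<Sum>j\<le>R. t ^ j) - 1" for R
    by (induction R) (simp_all add: algebra_simps)
  have 2: "(1 - t) * (\<Sum>j\<le>R. t ^ j) = 1 - t ^ Suc R" by (rule sum_gp_basic)
  have "(1 - t) * (\<Sum>j\<le>R. real j * t ^ j) \<le> (\<Sum>j\<le>R. t ^ j) - 1"
    using 1[of R] assms zero_le_power[of t "Suc R"] mult_nonneg_nonneg[of "real R" "t ^ Suc R"] by linarith
  also have "\<dots> \<le> t * (\<Sum>j\<le>R. t ^ j)"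
    using 2 zero_le_power[OF assms(1), of "Suc R"] by (simp add: algebra_simps)
  finally show ?thesis using assms(2) by (simp add: field_simps)
qed

text \<open>Markov's inequality for the particle number: discarding more than twice the mean number of particles
  costs at most half of the partition function.\<close>

lemma occupation_sum_ge:
  fixes t :: "'k \<Rightarrow> real"
  assumes K: "finite K" and t: "\<And>k. k \<in> K \<Longrightarrow> 0 \<le> t k" "\<And>k. k \<in> K \<Longrightarrow> t k < 1"
    and M: "2 * (\<Sum>k\<in>K. t k / (1 - t k)) \<le> real M + 1"
  shows "(\<Prod>k\<in>K. \<Sum>j\<le>R. t k ^ j) / 2 \<le> (\<Sum>f\<in>{f \<in> K \<rightarrow>\<^sub>E {..R}. sum f K \<le> M}. \<Prod>k\<in>K. t k ^ f k)"
proof -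
  let ?P = "K \<rightarrow>\<^sub>E {..R}"
  define w where "w f = (\<Prod>k\<in>K. t k ^ f k)" for f
  define A where "A = (\<Prod>k\<in>K. \<Sum>j\<le>R. t k ^ j)"
  have fin: "finite ?P" using K by (intro finite_PiE) auto
  have w0: "0 \<le> w f" for f unfolding w_def using t by (intro prod_nonneg) auto
  have A: "A = (\<Sum>f\<in>?P. w f)" unfolding A_def w_def by (rule prod_sum_PiE[OF K]) auto
  have A0: "0 \<le> A" unfolding A using w0 by (intro sum_nonneg)
  have single: "(\<Sum>f\<in>?P. real (f k) * w f) \<le> t k / (1 - t k) * A" if k: "k \<in> K" for k
  proof -
    \<comment> \<open>\<open>h\<close> inserts the factor \<open>j\<close> into the sum of mode
      \<open>k\<close> alone, so the first moment still factorises over the modes.\<close>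
    define h where "h l j = (if l = k then real j else 1) * t l ^ j" for l j
    have "(\<Sum>f\<in>?P. real (f k) * w f) = (\<Sum>f\<in>?P. \<Prod>l\<in>K. h l (f l))"
    proof (intro sum.cong refl)
      fix f
      have "(\<Prod>l\<in>K. h l (f l)) = (\<Prod>l\<in>K. if l = k then real (f l) else 1) * w f"
        unfolding h_def w_def prod.distrib ..
      also have "(\<Prod>l\<in>K. if l = k then real (f l) else 1) = real (f k)"
        using K k by (simp add: prod.delta)
      finally show "real (f k) * w f = (\<Prod>l\<in>K. h l (f l))" ..
    qed
    also have "\<dots> = (\<Prod>l\<in>K. \<Sum>j\<le>R. h l j)" by (rule prod_sum_PiE[symmetric, OF K]) auto
    also have "\<dots> = (\<Sum>j\<le>R. real j * t k ^ j) * (\<Prod>l\<in>K - {k}. \<Sum>j\<le>R. t l ^ j)"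
      unfolding prod.remove[OF K k] by (intro arg_cong2[where f = "(*)"] prod.cong) (auto simp: h_def)
    also have "\<dots> \<le> (t k / (1 - t k) * (\<Sum>j\<le>R. t k ^ j)) * (\<Prod>l\<in>K - {k}. \<Sum>j\<le>R. t l ^ j)"
      using t k by (intro mult_right_mono geometric_mean_le prod_nonneg ballI sum_nonneg) auto
    also have "\<dots> = t k / (1 - t k) * A" unfolding A_def prod.remove[OF K k] by simp
    finally show ?thesis .
  qed
  have mean: "(\<Sum>f\<in>?P. real (sum f K) * w f) \<le> (real M + 1) / 2 * A"
  proof -
    have "(\<Sum>f\<in>?P. real (sum f K) * w f) = (\<Sum>k\<in>K. \<Sum>f\<in>?P. real (f k) * w f)"
      by (subst sum.swap) (simp add: sum_distrib_right)
    also have "\<dots> \<le> (\<Sum>k\<in>K. t k / (1 - t k) * A)" by (intro sum_mono single)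
    also have "\<dots> = (\<Sum>k\<in>K. t k / (1 - t k)) * A" by (simp only: sum_distrib_right)
    also have "\<dots> \<le> (real M + 1) / 2 * A" using M A0 by (intro mult_right_mono) auto
    finally show ?thesis .
  qed
  have split: "A = (\<Sum>f\<in>{f \<in> ?P. sum f K \<le> M}. w f) + (\<Sum>f\<in>{f \<in> ?P. \<not> sum f K \<le> M}. w f)"
    unfolding A using fin by (subst sum.union_disjoint[symmetric]) (auto intro!: sum.cong)
  \<comment> \<open>A discarded occupation has at least \<open>M + 1\<close> particles; this integer
    step in Markov's inequality is why the hypothesis compares with \<open>M + 1\<close>.\<close>
  have "(real M + 1) * (\<Sum>f\<in>{f \<in> ?P. \<not> sum f K \<le> M}. w f) \<le> (\<Sum>f\<in>{f \<in> ?P. \<not> sum f K \<le> M}. real (sum f K) * w f)"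
    unfolding sum_distrib_left
  proof (intro sum_mono mult_right_mono w0)
    fix f assume "f \<in> {f \<in> ?P. \<not> sum f K \<le> M}"
    then have "Suc M \<le> sum f K" by auto
    then have "real (Suc M) \<le> real (sum f K)" by (simp only: of_nat_le_iff)
    then show "real M + 1 \<le> real (sum f K)" by (simp only: of_nat_Suc add.commute)
  qed
  also have "\<dots> \<le> (\<Sum>f\<in>?P. real (sum f K) * w f)"
    using fin w0 by (intro sum_mono2 mult_nonneg_nonneg of_nat_0_le_iff) auto
  also have "\<dots> \<le> (real M + 1) / 2 * A" by (rule mean)
  finally have "(real M + 1) * (\<Sum>f\<in>{f \<in> ?P. \<not> sum f K \<le> M}. w f) \<le> (real M + 1) * (A / 2)" by simp
  then have "(\<Sum>f\<in>{f \<in> ?P. \<not> sum f K \<le> M}. w f) \<le> A / 2" by (simp add: mult_le_cancel_left)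
  then show ?thesis using split unfolding w_def A_def by linarith
qed

definition bounded_multisets :: "'k set \<Rightarrow> nat \<Rightarrow> 'k multiset set" where
  "bounded_multisets K M = {m. set_mset m \<subseteq> K \<and> size m \<le> M}"

lemma bij_bounded_multisets:
  assumes K: "finite K" and R: "M \<le> R"
  shows "bij_betw (\<lambda>m. restrict (count m) K) (bounded_multisets K M) {f \<in> K \<rightarrow>\<^sub>E {..R}. sum f K \<le> M}"
proof (rule bij_betw_byWitness[where f' = "\<lambda>f. \<Sum>k\<in>K. replicate_mset (f k) k"])
  have cnt: "count (\<Sum>k\<in>K. replicate_mset (f k) k) l = (if l \<in> K then f l else 0)" for f l
    using K by (simp add: count_sum sum.delta)
  have size: "size m = (\<Sum>k\<in>K. count m k)" if "set_mset m \<subseteq> K" for m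
    unfolding size_multiset_overloaded_eq using K that
    by (intro sum.mono_neutral_left) (auto simp: count_eq_zero_iff)
  have sub: "set_mset (\<Sum>k\<in>K. replicate_mset (f k) k) \<subseteq> K" for f
  proof
    fix x assume "x \<in># (\<Sum>k\<in>K. replicate_mset (f k) k)"
    then have "count (\<Sum>k\<in>K. replicate_mset (f k) k) x \<noteq> 0" by (simp add: count_eq_zero_iff)
    then show "x \<in> K" unfolding cnt by (simp split: if_splits)
  qed
  show "\<forall>m\<in>bounded_multisets K M. (\<Sum>k\<in>K. replicate_mset (restrict (count m) K k) k) = m"
  proof
    fix m assume m: "m \<in> bounded_multisets K M"
    show "(\<Sum>k\<in>K. replicate_mset (restrict (count m) K k) k) = m"
    proof (rule multiset_eqI)
      fix x
      have "count m x = 0" if "x \<notin> K" using m that by (auto simp: bounded_multisets_def count_eq_zero_iff)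
      then show "count (\<Sum>k\<in>K. replicate_mset (restrict (count m) K k) k) x = count m x"
        unfolding cnt by simp
    qed
  qed
  show "\<forall>f\<in>{f \<in> K \<rightarrow>\<^sub>E {..R}. sum f K \<le> M}. restrict (count (\<Sum>k\<in>K. replicate_mset (f k) k)) K = f"
  proof
    fix f assume f: "f \<in> {f \<in> K \<rightarrow>\<^sub>E {..R}. sum f K \<le> M}"
    show "restrict (count (\<Sum>k\<in>K. replicate_mset (f k) k)) K = f"
    proof
      fix x
      have "f x = undefined" if "x \<notin> K" using f that PiE_arb by blast
      then show "restrict (count (\<Sum>k\<in>K. replicate_mset (f k) k)) K x = f x" by (simp add: cnt restrict_def)
    qed
  qed
  show "(\<lambda>m. restrict (count m) K) ` bounded_multisets K M \<subseteq> {f \<in> K \<rightarrow>\<^sub>E {..R}. sum f K \<le> M}"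
  proof (rule image_subsetI)
    fix m assume m: "m \<in> bounded_multisets K M"
    then have mK: "set_mset m \<subseteq> K" "size m \<le> M" by (auto simp: bounded_multisets_def)
    have s: "(\<Sum>k\<in>K. count m k) \<le> M" using mK(2) unfolding size[OF mK(1)] .
    have "count m k \<le> R" if "k \<in> K" for k
      using member_le_sum[OF that, of "count m"] K s R by simp
    then show "restrict (count m) K \<in> {f \<in> K \<rightarrow>\<^sub>E {..R}. sum f K \<le> M}" using s by auto
  qed
  show "(\<lambda>f. \<Sum>k\<in>K. replicate_mset (f k) k) ` {f \<in> K \<rightarrow>\<^sub>E {..R}. sum f K \<le> M} \<subseteq> bounded_multisets K M"
  proof (rule image_subsetI)
    fix f assume f: "f \<in> {f \<in> K \<rightarrow>\<^sub>E {..R}. sum f K \<le> M}"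
    have "size (\<Sum>k\<in>K. replicate_mset (f k) k) = sum f K" unfolding size[OF sub] by (simp add: cnt)
    then show "(\<Sum>k\<in>K. replicate_mset (f k) k) \<in> bounded_multisets K M"
      using f sub by (simp add: bounded_multisets_def)
  qed
qed

lemma finite_bounded_multisets: "finite K \<Longrightarrow> finite (bounded_multisets K M)"
  using bij_betw_finite[OF bij_bounded_multisets[of K M M]]
  by (auto intro: finite_subset[OF _ finite_PiE[of K "\<lambda>_. {..M}"]])

text \<open>For \<open>R \<ge> M\<close> the bound on the total particle number already implies the
  cutoff \<open>R\<close> on single occupations, so the right side is the same for all such
  \<open>R\<close> and the geometric sums on the left may be completed.\<close>

lemma grand_canonical_sum_ge:
  fixes t :: "'k \<Rightarrow> real"
  assumes K: "finite K" and t: "\<And>k. k \<in> K \<Longrightarrow> 0 \<le> t k" "\<And>k. k \<in> K \<Longrightarrow> t k < 1"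
    and M: "2 * (\<Sum>k\<in>K. t k / (1 - t k)) \<le> real M + 1"
  shows "(\<Prod>k\<in>K. 1 / (1 - t k)) / 2 \<le> (\<Sum>m\<in>bounded_multisets K M. \<Prod>k\<in>K. t k ^ count m k)"
proof -
  let ?S = "\<Sum>m\<in>bounded_multisets K M. \<Prod>k\<in>K. t k ^ count m k"
  have le: "(\<Prod>k\<in>K. \<Sum>j\<le>R. t k ^ j) / 2 \<le> ?S" if R: "M \<le> R" for R
  proof -
    have "?S = (\<Sum>m\<in>bounded_multisets K M. (\<lambda>f. \<Prod>k\<in>K. t k ^ f k) (restrict (count m) K))" by simp
    also have "\<dots> = (\<Sum>f\<in>{f \<in> K \<rightarrow>\<^sub>E {..R}. sum f K \<le> M}. \<Prod>k\<in>K. t k ^ f k)"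
      by (rule sum.reindex_bij_betw[OF bij_bounded_multisets[OF K R]])
    finally show ?thesis using occupation_sum_ge[OF K t M, of R] by simp
  qed
  have "(\<lambda>R. (\<Prod>k\<in>K. \<Sum>j\<le>R. t k ^ j) / 2) \<longlonglongrightarrow> (\<Prod>k\<in>K. 1 / (1 - t k)) / 2"
  proof (intro tendsto_divide tendsto_prod tendsto_const)
    fix k assume "k \<in> K"
    then have "(\<lambda>j. t k ^ j) sums (1 / (1 - t k))" using t by (intro geometric_sums) auto
    then show "(\<lambda>R. \<Sum>j\<le>R. t k ^ j) \<longlonglongrightarrow> 1 / (1 - t k)" by (simp add: sums_def_le)
  qed simp
  then show ?thesis by (rule LIMSEQ_le_const2) (use le in blast)
qed

section \<open>The thermodynamic limit\<close>

lemma nn_pairs_translate: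
  "bij_betw (\<lambda>(x, y). (x + a, y + a)) (nn_pairs \<Lambda>) (nn_pairs ((\<lambda>x. x + a) ` \<Lambda>))"
proof (rule bij_betw_byWitness[where f' = "\<lambda>(x, y). (x - a, y - a)"])
  show "(\<lambda>(x, y). (x + a, y + a)) ` nn_pairs \<Lambda> \<subseteq> nn_pairs ((\<lambda>x. x + a) ` \<Lambda>)"
    unfolding nn_pairs_def by (auto simp del: split_paired_All split_paired_Ex simp: add_ac)
  show "(\<lambda>(x, y). (x - a, y - a)) ` nn_pairs ((\<lambda>x. x + a) ` \<Lambda>) \<subseteq> nn_pairs \<Lambda>"
    unfolding nn_pairs_def by (auto simp: algebra_simps)
qed auto

definition pull_config :: "site \<Rightarrow> site set \<Rightarrow> (site \<Rightarrow> nat) \<Rightarrow> site \<Rightarrow> nat" where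
  "pull_config a \<Lambda> \<sigma> = (\<lambda>x\<in>\<Lambda>. \<sigma> (x + a))"

lemma bij_pull_config:
  "bij_betw (pull_config a \<Lambda>) (configs n ((\<lambda>x. x + a) ` \<Lambda>)) (configs n \<Lambda>)"
proof (rule bij_betw_byWitness[where f' = "\<lambda>\<sigma>. \<lambda>x\<in>(\<lambda>x. x + a) ` \<Lambda>. \<sigma> (x - a)"])
  let ?\<Lambda>' = "(\<lambda>x. x + a) ` \<Lambda>"
  show "\<forall>\<sigma>\<in>configs n ?\<Lambda>'. (\<lambda>x\<in>?\<Lambda>'. pull_config a \<Lambda> \<sigma> (x - a)) = \<sigma>"
  proof
    fix \<sigma> assume s: "\<sigma> \<in> configs n ?\<Lambda>'"
    show "(\<lambda>x\<in>?\<Lambda>'. pull_config a \<Lambda> \<sigma> (x - a)) = \<sigma>"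
    proof
      fix x
      show "(\<lambda>x\<in>?\<Lambda>'. pull_config a \<Lambda> \<sigma> (x - a)) x = \<sigma> x"
      proof (cases "x \<in> ?\<Lambda>'")
        case True
        then have "x - a \<in> \<Lambda>" by auto
        then show ?thesis using True by (simp add: pull_config_def)
      next
        case False
        then have "\<sigma> x = undefined" using s PiE_arb unfolding configs_def by metis
        then show ?thesis using False by simp
      qed
    qed
  qed
  show "\<forall>\<sigma>\<in>configs n \<Lambda>. pull_config a \<Lambda> (\<lambda>x\<in>?\<Lambda>'. \<sigma> (x - a)) = \<sigma>"
  proof
    fix \<sigma> assume s: "\<sigma> \<in> configs n \<Lambda>"
    show "pull_config a \<Lambda> (\<lambda>x\<in>?\<Lambda>'. \<sigma> (x - a)) = \<sigma>"
    proof
      fix x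
      show "pull_config a \<Lambda> (\<lambda>x\<in>?\<Lambda>'. \<sigma> (x - a)) x = \<sigma> x"
      proof (cases "x \<in> \<Lambda>")
        case True
        then show ?thesis by (simp add: pull_config_def)
      next
        case False
        then have "\<sigma> x = undefined" using s PiE_arb unfolding configs_def by metis
        then show ?thesis using False by (simp add: pull_config_def)
      qed
    qed
  qed
  show "pull_config a \<Lambda> ` configs n ?\<Lambda>' \<subseteq> configs n \<Lambda>"
  proof (rule image_subsetI)
    fix \<sigma> assume s: "\<sigma> \<in> configs n ?\<Lambda>'"
    show "pull_config a \<Lambda> \<sigma> \<in> configs n \<Lambda>"
      unfolding configs_def by (rule PiE_I) (use configs_le[OF s] in \<open>simp_all add: pull_config_def\<close>)
  qed
  show "(\<lambda>\<sigma>. \<lambda>x\<in>?\<Lambda>'. \<sigma> (x - a)) ` configs n \<Lambda> \<subseteq> configs n ?\<Lambda>'"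
  proof (rule image_subsetI)
    fix \<sigma> assume s: "\<sigma> \<in> configs n \<Lambda>"
    show "(\<lambda>x\<in>?\<Lambda>'. \<sigma> (x - a)) \<in> configs n ?\<Lambda>'"
      unfolding configs_def
    proof (rule PiE_I)
      fix x assume x: "x \<in> ?\<Lambda>'"
      then have "x - a \<in> \<Lambda>" by auto
      then show "(\<lambda>x\<in>?\<Lambda>'. \<sigma> (x - a)) x \<in> {0..n}" using x configs_le[OF s] by simp
    qed simp
  qed
qed

lemma ham_kernel_translate:
  assumes \<Lambda>: "finite \<Lambda>"
    and mem: "\<sigma> \<in> configs n ((\<lambda>x. x + a) ` \<Lambda>)" "\<tau> \<in> configs n ((\<lambda>x. x + a) ` \<Lambda>)"
  shows "ham_kernel n \<Lambda> (pull_config a \<Lambda> \<sigma>) (pull_config a \<Lambda> \<tau>) = ham_kernel n ((\<lambda>x. x + a) ` \<Lambda>) \<sigma> \<tau>"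
proof -
  let ?\<Lambda>' = "(\<lambda>x. x + a) ` \<Lambda>" and ?g = "pull_config a \<Lambda>"
  have gm: "?g \<sigma> \<in> configs n \<Lambda>" "?g \<tau> \<in> configs n \<Lambda>"
    using bij_pull_config[of a \<Lambda> n] mem by (auto simp: bij_betw_def)
  have "ham_kernel n ?\<Lambda>' \<sigma> \<tau> = (\<Sum>p\<in>nn_pairs \<Lambda>. (\<lambda>(x, y). bond_kernel n ?\<Lambda>' x y \<sigma> \<tau>) ((\<lambda>(x, y). (x + a, y + a)) p))"
    unfolding ham_kernel_def by (rule sum.reindex_bij_betw[OF nn_pairs_translate, symmetric])
  also have "\<dots> = (\<Sum>p\<in>nn_pairs \<Lambda>. (\<lambda>(x, y). bond_kernel n \<Lambda> x y (?g \<sigma>) (?g \<tau>)) p)"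
  proof (rule sum.cong[OF refl])
    fix p assume p: "p \<in> nn_pairs \<Lambda>"
    obtain x y where xy: "p = (x, y)" by (cases p)
    have m: "x \<in> \<Lambda>" "y \<in> \<Lambda>" "x \<noteq> y" using nn_pairsD p xy by blast+
    have m': "x + a \<in> ?\<Lambda>'" "y + a \<in> ?\<Lambda>'" "x + a \<noteq> y + a" using m by auto
    have "(\<forall>z\<in>?\<Lambda>' - {x + a, y + a}. \<sigma> z = \<tau> z) \<longleftrightarrow> (\<forall>z\<in>\<Lambda> - {x, y}. \<sigma> (z + a) = \<tau> (z + a))"
      by (auto simp del: split_paired_All split_paired_Ex)
    also have "\<dots> \<longleftrightarrow> (\<forall>z\<in>\<Lambda> - {x, y}. ?g \<sigma> z = ?g \<tau> z)" by (simp add: pull_config_def del: split_paired_All)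
    finally have iff: "(\<forall>z\<in>?\<Lambda>' - {x + a, y + a}. \<sigma> z = \<tau> z) \<longleftrightarrow> (\<forall>z\<in>\<Lambda> - {x, y}. ?g \<sigma> z = ?g \<tau> z)" .
    show "(\<lambda>(x, y). bond_kernel n ?\<Lambda>' x y \<sigma> \<tau>) ((\<lambda>(x, y). (x + a, y + a)) p) = (\<lambda>(x, y). bond_kernel n \<Lambda> x y (?g \<sigma>) (?g \<tau>)) p"
      unfolding xy case_prod_conv bond_kernel_eq[OF finite_imageI[OF \<Lambda>] mem m'] bond_kernel_eq[OF \<Lambda> gm m] iff
      using m by (simp add: pull_config_def)
  qed
  finally show ?thesis unfolding ham_kernel_def ..
qed

lemma partition_fun_translate:
  assumes \<Lambda>: "finite \<Lambda>"
  shows "partition_fun \<beta> n ((\<lambda>x. x + a) ` \<Lambda>) = partition_fun \<beta> n \<Lambda>"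
proof -
  obtain J :: "nat set" and e lam where s: "spectral_on (configs n \<Lambda>) (ham_kernel n \<Lambda>) J e lam"
    by (rule ham_spectral[OF \<Lambda>])
  have "spectral_on (configs n ((\<lambda>x. x + a) ` \<Lambda>)) (ham_kernel n ((\<lambda>x. x + a) ` \<Lambda>)) J
      (\<lambda>i \<sigma>. e i (pull_config a \<Lambda> \<sigma>)) lam"
    by (rule spectral_on_cong[OF _ spectral_on_reindex[OF bij_pull_config s]]) (rule ham_kernel_translate[OF \<Lambda>])
  then show ?thesis
    unfolding partition_fun_spectral[OF \<Lambda> s] using partition_fun_spectral \<Lambda> by blast
qed

lemma partition_fun_singleton: "partition_fun \<beta> n {x} = real n + 1"
proof -
  have no: "nn_pairs {x} = {}" using nn_pairsD[of _ _ "{x}"] by auto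
  have fin: "finite (configs n {x})" by (simp add: finite_configs)
  have "spectral_on (configs n {x}) (ham_kernel n {x}) (configs n {x}) (\<lambda>\<tau> \<sigma>. of_bool (\<sigma> = \<tau>)) (\<lambda>_. 0)"
    unfolding spectral_on_def
  proof (intro conjI ballI)
    fix \<sigma> \<tau> assume st: "\<sigma> \<in> configs n {x}" "\<tau> \<in> configs n {x}"
    show "ip_on (configs n {x}) (\<lambda>s. of_bool (s = \<sigma>)) (\<lambda>s. of_bool (s = \<tau>)) = of_bool (\<sigma> = \<tau>)"
      using ip_on_delta[OF fin st(2)] by auto
    have "(\<Sum>i\<in>configs n {x}. of_bool (\<sigma> = i) * of_bool (\<tau> = i)) = ip_on (configs n {x}) (\<lambda>i. of_bool (\<sigma> = i)) (\<lambda>s. of_bool (s = \<tau>))"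
      unfolding ip_on_def by (intro sum.cong) auto
    then show "(\<Sum>i\<in>configs n {x}. of_bool (\<sigma> = i) * of_bool (\<tau> = i)) = (of_bool (\<sigma> = \<tau>) :: real)"
      using ip_on_delta[OF fin st(2)] by simp
  qed (use fin in \<open>simp_all add: ham_kernel_def no\<close>)
  from partition_fun_spectral[OF _ this] show ?thesis
    by (simp add: configs_def card_PiE)
qed

text \<open>Submultiplicativity iterated down to single sites, which have no bonds and dimension
  \<open>n + 1\<close>.\<close>

lemma partition_fun_le_dim:
  assumes "finite R" "0 \<le> \<beta>" shows "partition_fun \<beta> n R \<le> (real n + 1) ^ card R"
  using partition_fun_Union_le[of R "\<lambda>x. {x}" \<beta> n "real n + 1"] assms by (simp add: partition_fun_singleton)

text \<open>The configuration with all spins up has zero energy, so as the only trial vector it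
  contributes the weight 1.\<close>

lemma partition_fun_ge_1:
  assumes "finite \<Lambda>" shows "1 \<le> partition_fun \<beta> n \<Lambda>"
proof (rule dirichlet_bound_partition_fun[OF assms])
  define z where "z = (\<lambda>x\<in>\<Lambda>. 0 :: nat)"
  define \<psi> where "\<psi> \<sigma> = (of_bool (\<sigma> = z) :: real)" for \<sigma>
  have z: "z \<in> configs n \<Lambda>" by (simp add: z_def configs_def)
  have fin: "finite (configs n \<Lambda>)" by (rule finite_configs[OF assms])
  have ip: "ip_on (configs n \<Lambda>) \<psi> \<eta> = \<eta> z" for \<eta>
    using ip_on_delta[OF fin z, of \<eta>] by (simp add: ip_on_commute[of _ \<eta>] \<psi>_def[abs_def])
  have zero: "\<psi> (B(x := B x + 1)) = 0" if "x \<in> \<Lambda>" for B x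
    using that by (auto simp: \<psi>_def z_def dest: fun_cong[of _ _ x])
  have "bond_energy n \<Lambda> x y \<psi> = 0" if "(x, y) \<in> nn_pairs \<Lambda>" for x y
    unfolding bond_energy_def using zero nn_pairsD[OF that] by simp
  then have Q: "quad_form (configs n \<Lambda>) (ham_kernel n \<Lambda>) \<psi> = 0"
    unfolding quad_form_ham[OF assms] by (simp add: case_prod_beta)
  show "dirichlet_bound \<beta> n \<Lambda> 1"
  proof (rule dirichlet_boundI[of "{()}" _ _ _ "\<lambda>_. \<psi>"])
    show "vanishes_at_boundary n \<Lambda> \<psi>"
      by (auto simp: vanishes_at_boundary_def boundary_def \<psi>_def z_def)
    show "(\<Sum>i\<in>{()}. (ip_on (configs n \<Lambda>) \<psi> \<eta>)\<^sup>2) \<le> ip_on (configs n \<Lambda>) \<eta> \<eta>" for \<eta>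
      using member_le_sum[OF z, of "\<lambda>s. \<eta> s * \<eta> s"] fin unfolding ip by (simp add: ip_on_def power2_eq_square)
    show "1 \<le> (\<Sum>i\<in>{()}. gibbs_weight \<beta> n \<Lambda> \<psi>)"
      by (simp add: gibbs_weight_def Q ip) (simp add: \<psi>_def)
  qed auto
qed

section \<open>Boxes and tilings of squares\<close>

definition lattice_box :: "site \<Rightarrow> nat \<Rightarrow> site set" where
  "lattice_box p b = {fst p..<fst p + int b} \<times> {snd p..<snd p + int b}"

lemma finite_box [simp]: "finite (lattice_box p b)" by (simp add: lattice_box_def)

lemma card_box: "card (lattice_box p b) = b * b" by (simp add: lattice_box_def)

lemma square_eq_box: "square L = lattice_box (0, 0) L" by (simp add: square_def lattice_box_def)

lemma box_eq_translate: "lattice_box p b = (\<lambda>x. x + p) ` square b"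
proof
  show "lattice_box p b \<subseteq> (\<lambda>x. x + p) ` square b"
  proof
    fix x assume "x \<in> lattice_box p b"
    then have "x - p \<in> square b" by (cases x; cases p) (auto simp: lattice_box_def square_def)
    then show "x \<in> (\<lambda>x. x + p) ` square b" by (metis diff_add_cancel image_eqI)
  qed
  show "(\<lambda>x. x + p) ` square b \<subseteq> lattice_box p b" by (cases p) (auto simp: lattice_box_def square_def)
qed

definition tile :: "nat \<Rightarrow> nat \<times> nat \<Rightarrow> site set" where
  "tile b a = lattice_box (int (fst a * b), int (snd a * b)) b"

lemma int_interval_tiles:
  assumes "0 < b"
  shows "x \<in> {0..<int (k * b)} \<longleftrightarrow> (\<exists>i<k. x \<in> {int (i * b)..<int (i * b) + int b})"
proof
  assume x: "x \<in> {0..<int (k * b)}"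
  define i where "i = nat x div b"
  have nx: "nat x = i * b + nat x mod b" "nat x mod b < b" using assms by (simp_all add: i_def)
  have "nat x < k * b" using x by (simp add: nat_less_iff)
  then have "i < k" unfolding i_def using assms by (simp add: div_less_iff_less_mult)
  moreover have "x = int (i * b) + int (nat x mod b)" using x nx(1) by (metis atLeastLessThan_iff int_nat_eq of_nat_add)
  ultimately show "\<exists>i<k. x \<in> {int (i * b)..<int (i * b) + int b}"
    using nx(2) by (intro exI[of _ i]) auto
next
  assume "\<exists>i<k. x \<in> {int (i * b)..<int (i * b) + int b}"
  then obtain i where i: "i < k" "x \<in> {int (i * b)..<int (i * b) + int b}" by blast
  have "(i + 1) * b \<le> k * b" using i(1) by (intro mult_right_mono) auto
  then have "int (i * b) + int b \<le> int (k * b)" by (simp flip: of_nat_add of_nat_mult)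
  moreover have "0 \<le> int (i * b)" by (rule of_nat_0_le_iff)
  ultimately show "x \<in> {0..<int (k * b)}" using i(2) unfolding atLeastLessThan_iff by linarith
qed

lemma interval_tiles_disjoint:
  assumes "x \<in> {int (i * b)..<int (i * b) + int b}" "x \<in> {int (j * b)..<int (j * b) + int b}"
  shows "i = j"
proof (rule ccontr)
  assume "i \<noteq> j"
  then consider "i + 1 \<le> j" | "j + 1 \<le> i" by linarith
  then show False
  proof cases
    case 1
    then have "(i + 1) * b \<le> j * b" by (intro mult_right_mono) auto
    then have "int (i * b) + int b \<le> int (j * b)" by (simp flip: of_nat_add of_nat_mult)
    then show ?thesis using assms by auto
  next
    case 2
    then have "(j + 1) * b \<le> i * b" by (intro mult_right_mono) auto
    then have "int (j * b) + int b \<le> int (i * b)" by (simp flip: of_nat_add of_nat_mult)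
    then show ?thesis using assms by auto
  qed
qed

lemma square_tiles:
  assumes "0 < b" shows "square (k * b) = (\<Union>a\<in>{..<k} \<times> {..<k}. tile b a)"
proof (rule Set.set_eqI)
  fix x :: site
  have "x \<in> square (k * b) \<longleftrightarrow> fst x \<in> {0..<int (k * b)} \<and> snd x \<in> {0..<int (k * b)}"
    by (cases x) (simp add: square_def)
  also have "\<dots> \<longleftrightarrow> x \<in> (\<Union>a\<in>{..<k} \<times> {..<k}. tile b a)"
    unfolding int_interval_tiles[OF assms] by (cases x) (fastforce simp: tile_def lattice_box_def)
  finally show "x \<in> square (k * b) \<longleftrightarrow> x \<in> (\<Union>a\<in>{..<k} \<times> {..<k}. tile b a)" .
qed

lemma tile_disjoint: "a \<noteq> a' \<Longrightarrow> tile b a \<inter> tile b a' = {}"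
proof (rule ccontr)
  assume "a \<noteq> a'" "tile b a \<inter> tile b a' \<noteq> {}"
  then obtain x where "x \<in> tile b a" "x \<in> tile b a'" by blast
  then have "fst a = fst a'" "snd a = snd a'"
    using interval_tiles_disjoint[of "fst x" "fst a" b "fst a'"] interval_tiles_disjoint[of "snd x" "snd a" b "snd a'"]
    by (auto simp: tile_def lattice_box_def mem_Times_iff)
  then show False using \<open>a \<noteq> a'\<close> by (simp add: prod_eq_iff)
qed

lemma finite_square [simp]: "finite (square L)" and card_square: "card (square L) = L * L"
  by (simp_all add: square_eq_box card_box)

text \<open>Submultiplicativity over the \<open>k * k\<close> tiles and the leftover strip, for
  which the crude dimension bound is enough.\<close>

lemma ln_partition_square_le:
  assumes \<beta>: "0 \<le> \<beta>" and b: "0 < b" and N: "k * b \<le> N"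
  shows "ln (partition_fun \<beta> n (square N)) \<le> real (k * k) * ln (partition_fun \<beta> n (square b))
    + (real (N * N) - real ((k * b) * (k * b))) * ln (real n + 1)"
proof -
  let ?Z = "partition_fun \<beta> n"
  define R where "R = square N - square (k * b)"
  have sub: "square (k * b) \<subseteq> square N" using N by (auto simp: square_def simp flip: of_nat_mult)
  have pos: "0 < ?Z \<Lambda>" if "finite \<Lambda>" for \<Lambda> by (rule partition_fun_pos[OF that])
  have "?Z (square N) \<le> ?Z (square (k * b)) * ?Z R"
    using partition_fun_union_le[of "square (k * b)" R \<beta> n] \<beta> sub by (simp add: R_def Un_absorb1)
  also have "\<dots> \<le> ?Z (square b) ^ (k * k) * (real n + 1) ^ card R"
  proof (intro mult_mono)
    have "?Z (tile b a) \<le> ?Z (square b)" for a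
      unfolding tile_def box_eq_translate by (simp add: partition_fun_translate)
    then have "?Z (\<Union>a\<in>{..<k} \<times> {..<k}. tile b a) \<le> ?Z (square b) ^ card ({..<k} \<times> {..<k})"
      using tile_disjoint \<beta> by (intro partition_fun_Union_le) (auto simp: tile_def)
    then show "?Z (square (k * b)) \<le> ?Z (square b) ^ (k * k)" unfolding square_tiles[OF b] by simp
    show "?Z R \<le> (real n + 1) ^ card R" using \<beta> by (intro partition_fun_le_dim) (auto simp: R_def)
  qed (use pos[of "square b"] pos[of R] in \<open>auto simp: R_def less_imp_le\<close>)
  finally have "ln (?Z (square N)) \<le> ln (?Z (square b) ^ (k * k) * (real n + 1) ^ card R)"
    using pos[of "square N"] by (intro ln_mono) auto
  also have "\<dots> = real (k * k) * ln (?Z (square b)) + real (card R) * ln (real n + 1)"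
    using pos[of "square b"] by (simp add: ln_mult ln_realpow)
  also have "real (card R) = real (N * N) - real ((k * b) * (k * b))"
  proof -
    have "card R = N * N - (k * b) * (k * b)"
      unfolding R_def using sub by (subst card_Diff_subset) (auto simp: card_square)
    moreover have "(k * b) * (k * b) \<le> N * N" using N by (intro mult_mono) auto
    ultimately show ?thesis by (simp only: of_nat_diff)
  qed
  finally show ?thesis .
qed

section \<open>Existence of the limit along squares\<close>

definition log_density :: "real \<Rightarrow> nat \<Rightarrow> nat \<Rightarrow> real" where
  "log_density \<beta> n L = ln (partition_fun \<beta> n (square L)) / real (L * L)"

lemma log_density_nonneg: "0 \<le> log_density \<beta> n L"
  unfolding log_density_def using partition_fun_ge_1[of "square L" \<beta> n]
  by (intro divide_nonneg_nonneg ln_ge_zero) auto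

text \<open>After division by \<open>b\<close> the uncovered strip has width at most
  \<open>b\<close>, hence area at most \<open>2 b N\<close>, which is negligible against
  \<open>N^2\<close>.\<close>

lemma log_density_le:
  assumes \<beta>: "0 \<le> \<beta>" and b: "0 < b" and N: "0 < N"
  shows "log_density \<beta> n N \<le> log_density \<beta> n b + 2 * real b * ln (real n + 1) / real N"
proof -
  define k where "k = N div b"
  have kb: "k * b \<le> N" by (simp add: k_def)
  have "N < k * b + b" using div_mult_mod_eq[of N b] mod_less_divisor[OF b, of N] unfolding k_def by linarith
  then have gap: "real N - real (k * b) \<le> real b" by linarith
  have ln0: "0 \<le> ln (real n + 1)" by simp
  have kb': "real (k * b) \<le> real N" using kb by linarith
  have "real (N * N) - real ((k * b) * (k * b)) = (real N - real (k * b)) * (real N + real (k * b))"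
    by (simp add: algebra_simps)
  also have "\<dots> \<le> real b * (2 * real N)"
    using gap kb' by (intro mult_mono) auto
  finally have rest: "(real (N * N) - real ((k * b) * (k * b))) * ln (real n + 1) \<le> real b * (2 * real N) * ln (real n + 1)"
    using ln0 by (rule mult_right_mono)
  have "real (k * k) * ln (partition_fun \<beta> n (square b)) = real ((k * b) * (k * b)) * log_density \<beta> n b"
    using b by (simp add: log_density_def)
  also have "\<dots> \<le> real (N * N) * log_density \<beta> n b"
  proof (rule mult_right_mono[OF _ log_density_nonneg])
    have "(k * b) * (k * b) \<le> N * N" using kb by (intro mult_mono) auto
    then show "real ((k * b) * (k * b)) \<le> real (N * N)" by (simp only: of_nat_le_iff)
  qed
  finally have "ln (partition_fun \<beta> n (square N)) \<le> real (N * N) * log_density \<beta> n b + real b * (2 * real N) * ln (real n + 1)"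
    using ln_partition_square_le[OF \<beta> b kb, of n] rest by linarith
  then have "log_density \<beta> n N \<le> (real (N * N) * log_density \<beta> n b + real b * (2 * real N) * ln (real n + 1)) / real (N * N)"
    unfolding log_density_def[of \<beta> n N] by (rule divide_right_mono) simp
  also have "\<dots> = log_density \<beta> n b + 2 * real b * ln (real n + 1) / real N"
    using N by (simp add: field_simps)
  finally show ?thesis .
qed

text \<open>Fekete's argument: the limit is the infimum, since \<open>log_density_le\<close> brings
  every large square close to any nearly optimal side \<open>b\<close>.\<close>

lemma log_density_convergent:
  assumes \<beta>: "0 \<le> \<beta>" shows "convergent (log_density \<beta> n)"
proof -
  \<comment> \<open>The side 0 is excluded: there division by zero gives the density 0, which would
    spoil the infimum.\<close>
  define \<gamma> where "\<gamma> = (INF L\<in>{1..}. log_density \<beta> n L)"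
  have bdd: "bdd_below (log_density \<beta> n ` {1..})" using log_density_nonneg by (auto intro: bdd_belowI[of _ 0])
  have "log_density \<beta> n \<longlonglongrightarrow> \<gamma>"
  proof (rule LIMSEQ_I)
    fix r :: real assume r: "0 < r"
    have "\<exists>b\<in>{1..}. log_density \<beta> n b < \<gamma> + r / 2"
      unfolding \<gamma>_def using r bdd
      by (subst cINF_less_iff[symmetric]) auto
    then obtain b where "b \<in> {1..}" and b2: "log_density \<beta> n b < \<gamma> + r / 2" by blast
    then have b: "0 < b" "log_density \<beta> n b < \<gamma> + r / 2" by auto
    define A where "A = 2 * real b * ln (real n + 1)"
    obtain N0 :: nat where N0: "real N0 > A / (r / 2)" using reals_Archimedean2 by blast
    show "\<exists>no. \<forall>N\<ge>no. norm (log_density \<beta> n N - \<gamma>) < r"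
    proof (intro exI allI impI)
      fix N assume N: "max 1 N0 \<le> N"
      have lower: "\<gamma> \<le> log_density \<beta> n N"
        unfolding \<gamma>_def using N by (intro cINF_lower[OF bdd]) auto
      have "A / real N < r / 2"
      proof -
        have "A / (r / 2) < real N" using N0 N by simp
        then have "A < real N * (r / 2)" using r by (simp add: field_simps)
        then show ?thesis using N by (simp add: field_simps)
      qed
      then have "log_density \<beta> n N < \<gamma> + r"
        using log_density_le[OF \<beta> b(1), of N n] b(2) N by (simp add: A_def)
      then show "norm (log_density \<beta> n N - \<gamma>) < r" using lower by (simp add: abs_less_iff)
    qed
  qed
  then show ?thesis by (auto simp: convergent_def)
qed

text \<open>Since the sequence converges, its limit may be taken along multiples of
  \<open>b\<close>, where boxes of side \<open>b\<close> tile the square exactly and each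
  contributes a factor \<open>X\<close>.\<close>

lemma free_energy_2d_le:
  assumes \<beta>: "0 < \<beta>" and b: "0 < b" and X: "0 < X" and d: "\<And>p. dirichlet_bound \<beta> n (lattice_box p b) X"
  shows "free_energy_2d \<beta> n \<le> - (ln X / (\<beta> * real (b * b)))"
proof -
  have conv: "convergent (log_density \<beta> n)" using \<beta> by (intro log_density_convergent) simp
  define \<gamma> where "\<gamma> = lim (log_density \<beta> n)"
  have lim: "log_density \<beta> n \<longlonglongrightarrow> \<gamma>" using conv by (simp add: \<gamma>_def convergent_LIMSEQ_iff)
  have fin: "free_energy_fin \<beta> n (square L) = - (1 / \<beta>) * log_density \<beta> n L" for L
    by (simp add: free_energy_fin_def log_density_def card_square)
  have "(\<lambda>L. free_energy_fin \<beta> n (square L)) \<longlonglongrightarrow> - (1 / \<beta>) * \<gamma>"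
    unfolding fin by (intro tendsto_mult tendsto_const lim)
  then have fe: "free_energy_2d \<beta> n = - (1 / \<beta>) * \<gamma>"
    unfolding free_energy_2d_def by (rule limI)
  have sub: "(\<lambda>m. log_density \<beta> n (Suc m * b)) \<longlonglongrightarrow> \<gamma>"
  proof -
    have "strict_mono (\<lambda>m. Suc m * b)" using b by (intro strict_monoI) simp
    from LIMSEQ_subseq_LIMSEQ[OF lim this] show ?thesis by (simp add: o_def)
  qed
  have "ln X / real (b * b) \<le> log_density \<beta> n (Suc m * b)" for m
  proof -
    have "dirichlet_bound \<beta> n (\<Union>a\<in>{..<Suc m} \<times> {..<Suc m}. tile b a) (X ^ card ({..<Suc m} \<times> {..<Suc m}))"
      using d tile_disjoint by (intro dirichlet_bound_Union) (auto simp: tile_def)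
    then have "X ^ (Suc m * Suc m) \<le> partition_fun \<beta> n (square (Suc m * b))"
      unfolding square_tiles[OF b] by (intro dirichlet_bound_partition_fun) (auto simp: tile_def simp del: of_nat_Suc)
    then have "ln (X ^ (Suc m * Suc m)) \<le> ln (partition_fun \<beta> n (square (Suc m * b)))"
      using X by (intro ln_mono) auto
    then have "real (Suc m * Suc m) * ln X \<le> ln (partition_fun \<beta> n (square (Suc m * b)))"
      unfolding ln_realpow .
    then have "real (Suc m * Suc m) * ln X / real ((Suc m * b) * (Suc m * b)) \<le> log_density \<beta> n (Suc m * b)"
      unfolding log_density_def by (rule divide_right_mono) (rule of_nat_0_le_iff)
    moreover have "real (Suc m * Suc m) * ln X / real ((Suc m * b) * (Suc m * b)) = ln X / real (b * b)"
    proof -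
      have "s * s * c / ((s * r) * (s * r)) = c / (r * r)" if "s \<noteq> 0" for s c r :: real
        using that by (cases "r = 0") (simp_all add: field_simps)
      from this[of "real (Suc m)" "ln X" "real b"] show ?thesis by (simp only: of_nat_mult)
    qed
    ultimately show ?thesis by simp
  qed
  then have "ln X / real (b * b) \<le> \<gamma>" by (intro LIMSEQ_le_const[OF sub]) auto
  then have "(1 / \<beta>) * (ln X / real (b * b)) \<le> (1 / \<beta>) * \<gamma>" using \<beta> by (intro mult_left_mono) auto
  then show ?thesis unfolding fe by simp
qed

section \<open>Dirichlet modes of a square\<close>

text \<open>The closed form of the Dirichlet kernel: product-to-sum turns each term into a
  difference of neighbouring sines.\<close>

lemma cos_sum_telescope: "2 * sin (\<theta> / 2) * (\<Sum>j<L. cos (real j * \<theta>)) = sin (real L * \<theta> - \<theta> / 2) + sin (\<theta> / 2)"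
proof (induction L)
  case (Suc L)
  have "2 * sin (\<theta> / 2) * cos (real L * \<theta>) = sin (real L * \<theta> + \<theta> / 2) - sin (real L * \<theta> - \<theta> / 2)"
    by (simp add: sin_add sin_diff)
  moreover have "real L * \<theta> + \<theta> / 2 = real (Suc L) * \<theta> - \<theta> / 2" by (simp add: algebra_simps)
  ultimately show ?case using Suc by (simp add: distrib_left)
qed simp

text \<open>The range of \<open>m\<close> keeps \<open>sin (\<theta> / 2)\<close> positive, so the
  telescoped sum may be divided by it; \<open>L \<theta> = m pi\<close> produces the sign.\<close>

lemma cos_sum_parity:
  assumes "0 < L" "0 < m" "m < 2 * L"
  shows "(\<Sum>j<L. cos (real j * (pi * real m / real L))) = (1 - (- 1) ^ m) / 2"
proof -
  define \<theta> where "\<theta> = pi * real m / real L"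
  have "0 < \<theta> / 2" using assms by (simp add: \<theta>_def)
  moreover have "\<theta> / 2 < pi"
  proof -
    have "real m < 2 * real L" using assms(3) by linarith
    then have "pi * real m < pi * (2 * real L)" by (intro mult_strict_left_mono) auto
    then show ?thesis using assms by (simp add: \<theta>_def field_simps)
  qed
  ultimately have s: "sin (\<theta> / 2) > 0" by (rule sin_gt_zero)
  have L\<theta>: "real L * \<theta> = real m * pi" using assms by (simp add: \<theta>_def)
  have "sin (real L * \<theta> - \<theta> / 2) = - ((- 1) ^ m * sin (\<theta> / 2))"
    unfolding L\<theta> sin_diff by (simp add: cos_npi sin_npi)
  then have "2 * sin (\<theta> / 2) * (\<Sum>j<L. cos (real j * \<theta>)) = sin (\<theta> / 2) * (1 - (- 1) ^ m)"
    using cos_sum_telescope[of \<theta> L] by (simp add: algebra_simps)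
  then have "sin (\<theta> / 2) * (2 * (\<Sum>j<L. cos (real j * \<theta>))) = sin (\<theta> / 2) * (1 - (- 1) ^ m)"
    by (simp only: mult_ac)
  then have "2 * (\<Sum>j<L. cos (real j * \<theta>)) = 1 - (- 1) ^ m"
    using s by (simp only: mult_left_cancel[OF less_imp_neq[OF s, symmetric]])
  then show ?thesis unfolding \<theta>_def by simp
qed

text \<open>Product-to-sum leaves the cosine sums for \<open>k - l\<close> and \<open>k + l\<close>.
  These numbers have the same parity, so the sums cancel for \<open>k \<noteq> l\<close>; for
  \<open>k = l\<close> the first is \<open>L\<close> and the second 0.\<close>

lemma sin_orthogonal:
  assumes k: "0 < k" "k < L" and l: "0 < l" "l < L"
  shows "(\<Sum>j<L. sin (pi * real k * real j / real L) * sin (pi * real l * real j / real L))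
    = (if k = l then real L / 2 else 0)"
proof -
  have main: "(\<Sum>j<L. sin (pi * real k * real j / real L) * sin (pi * real l * real j / real L))
    = (if k = l then real L / 2 else 0)" if kl: "l \<le> k" "0 < l" "k < L" for k l
  proof -
    have "sin (pi * real k * real j / real L) * sin (pi * real l * real j / real L)
        = (cos (real j * (pi * real (k - l) / real L)) - cos (real j * (pi * real (k + l) / real L))) / 2" for j
    proof -
      have "pi * real k * real j / real L - pi * real l * real j / real L = real j * (pi * real (k - l) / real L)"
        "pi * real k * real j / real L + pi * real l * real j / real L = real j * (pi * real (k + l) / real L)"
        using kl by (simp_all add: of_nat_diff field_simps)
      then show ?thesis unfolding sin_times_sin by simp
    qed
    then have eq: "(\<Sum>j<L. sin (pi * real k * real j / real L) * sin (pi * real l * real j / real L))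
        = ((\<Sum>j<L. cos (real j * (pi * real (k - l) / real L))) - (\<Sum>j<L. cos (real j * (pi * real (k + l) / real L)))) / 2"
      by (simp only: sum_subtractf sum_divide_distrib[symmetric])
    have p: "(\<Sum>j<L. cos (real j * (pi * real (k + l) / real L))) = (1 - (- 1) ^ (k + l)) / 2"
      using kl by (intro cos_sum_parity) auto
    show ?thesis
    proof (cases "k = l")
      case True
      then show ?thesis unfolding eq p by simp
    next
      case False
      have "(\<Sum>j<L. cos (real j * (pi * real (k - l) / real L))) = (1 - (- 1) ^ (k - l)) / 2"
        using kl False by (intro cos_sum_parity) auto
      moreover have "(- 1 :: real) ^ (k - l) = (- 1) ^ (k + l)"
      proof -
        have kl': "k + l = (k - l) + 2 * l" using kl by simp
        show ?thesis unfolding kl' power_add power_mult by simp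
      qed
      ultimately show ?thesis using False unfolding eq p by simp
    qed
  qed
  show ?thesis
  proof (cases "l \<le> k")
    case True
    then show ?thesis using main k l by simp
  next
    case False
    then show ?thesis using main[of k l] k l by (simp add: mult.commute)
  qed
qed

text \<open>Expanding the square leaves two norms \<open>L / 2\<close> and a mixed sum
  \<open>P\<close>. Adding two shifted forms of \<open>P\<close>, which agree since \<open>s\<close>
  vanishes at 0 and \<open>L\<close>, brings in \<open>s (j + 2) + s j = 2 cos a s (j + 1)\<close>,
  the eigenvalue equation of the discrete Laplacian.\<close>

lemma sin_dirichlet_energy:
  assumes k: "0 < k" "k < L"
  defines "s \<equiv> \<lambda>j :: nat. sin (pi * real k * real j / real L)"
  shows "(\<Sum>j<L. (s (Suc j) - s j)\<^sup>2) = real L * (1 - cos (pi * real k / real L))"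
proof -
  define a where "a = pi * real k / real L"
  have sa: "s j = sin (real j * a)" for j by (simp add: s_def a_def mult_ac)
  have s0: "s 0 = 0" by (simp add: s_def)
  have sL: "s L = 0" using k by (simp add: s_def mult.commute)
  obtain L' where L: "L = Suc L'" using k by (cases L) auto
  have sq: "(\<Sum>j<L. (s j)\<^sup>2) = real L / 2"
    using sin_orthogonal[OF k k] by (simp add: s_def power2_eq_square)
  have sq': "(\<Sum>j<L. (s (Suc j))\<^sup>2) = real L / 2"
  proof -
    have "(\<Sum>j<Suc L. (s j)\<^sup>2) = (s 0)\<^sup>2 + (\<Sum>j<L. (s (Suc j))\<^sup>2)" by (rule sum.lessThan_Suc_shift)
    then show ?thesis using sq s0 sL by simp
  qed
  define P where "P = (\<Sum>j<L. s (Suc j) * s j)"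
  have P1: "P = (\<Sum>j<L'. s (Suc j) * s j)" using sL by (simp add: P_def L)
  have P2: "P = (\<Sum>j<L'. s (Suc (Suc j)) * s (Suc j))"
    unfolding P_def L sum.lessThan_Suc_shift using s0 by simp
  have "2 * P = (\<Sum>j<L'. s (Suc j) * (s (Suc (Suc j)) + s j))"
    using P1 P2 by (simp add: distrib_left sum.distrib mult.commute)
  also have "\<dots> = (\<Sum>j<L'. 2 * cos a * (s (Suc j))\<^sup>2)"
  proof (intro sum.cong refl)
    fix j
    have "real (Suc (Suc j)) * a = real (Suc j) * a + a" "real j * a = real (Suc j) * a - a"
      by (simp_all add: algebra_simps)
    then have "s (Suc (Suc j)) + s j = 2 * cos a * s (Suc j)" unfolding sa by (simp only: sin_add sin_diff) (simp add: algebra_simps)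
    then show "s (Suc j) * (s (Suc (Suc j)) + s j) = 2 * cos a * (s (Suc j))\<^sup>2" by (simp add: power2_eq_square)
  qed
  also have "\<dots> = 2 * cos a * (\<Sum>j<L. (s j)\<^sup>2)"
    unfolding L sum.lessThan_Suc_shift using s0 by (simp add: sum_distrib_left)
  finally have P: "2 * P = real L * cos a" unfolding sq by simp
  have "(\<Sum>j<L. (s (Suc j) - s j)\<^sup>2) = (\<Sum>j<L. (s (Suc j))\<^sup>2) + (\<Sum>j<L. (s j)\<^sup>2) - 2 * P"
    unfolding P_def by (simp add: power2_diff sum.distrib sum_subtractf sum_distrib_left mult.assoc)
  then show ?thesis using sq sq' P by (simp add: a_def algebra_simps)
qed

text \<open>Both bounds compare the lattice dispersion with the continuum one through
  \<open>2 (1 - cos x) = 4 sin^2 (x / 2)\<close>. The lower one is crude but loses only a constant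
  in particle numbers.\<close>

lemma one_minus_cos_bounds:
  assumes "0 \<le> x" "x \<le> pi"
  shows "2 * (1 - cos x) \<le> x\<^sup>2" "x\<^sup>2 / 4 \<le> 2 * (1 - cos x)"
proof -
  have half: "2 * (1 - cos x) = 4 * (sin (x / 2))\<^sup>2" using cos_double_sin[of "x / 2"] by simp
  have s: "0 \<le> sin (x / 2)" using assms by (intro sin_ge_zero) auto
  have "sin (x / 2) \<le> x / 2" using assms by (intro sin_x_le_x) auto
  then have "(sin (x / 2))\<^sup>2 \<le> (x / 2)\<^sup>2" using s by (intro power_mono) auto
  then show "2 * (1 - cos x) \<le> x\<^sup>2" unfolding half by (simp add: power_divide)
  \<comment> \<open>Used at \<open>y = x / 4 \<le> pi / 4\<close>: there
    \<open>sin (x / 2) = 2 sin y cos y \<ge> 2 y cos^2 y \<ge> y\<close>, because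
    \<open>cos^2 y \<ge> 1 / 2\<close>.\<close>
  have cosle: "y * cos y \<le> sin y" if "0 \<le> y" "y \<le> pi" for y
  proof -
    have "sin 0 - 0 * cos 0 \<le> sin y - y * cos y"
    proof (rule DERIV_nonneg_imp_nondecreasing[OF that(1)])
      fix z assume z: "0 \<le> z" "z \<le> y"
      have "((\<lambda>z. sin z - z * cos z) has_real_derivative z * sin z) (at z)"
        by (auto intro!: derivative_eq_intros)
      moreover have "0 \<le> z * sin z" using z that by (intro mult_nonneg_nonneg sin_ge_zero) auto
      ultimately show "\<exists>d. ((\<lambda>z. sin z - z * cos z) has_real_derivative d) (at z) \<and> 0 \<le> d" by blast
    qed
    then show ?thesis by simp
  qed
  define y where "y = x / 4"
  have y: "0 \<le> y" "y \<le> pi / 4" using assms by (auto simp: y_def)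
  have c: "0 \<le> cos y" "0 \<le> cos (2 * y)" using y by (auto intro!: cos_ge_zero)
  have "sin (x / 2) = 2 * sin y * cos y" unfolding sin_double[symmetric] by (simp add: y_def)
  moreover have "y * cos y * cos y \<le> sin y * cos y"
    using cosle[of y] y c by (intro mult_right_mono) auto
  moreover have "1 / 2 \<le> cos y * cos y" using c(2) cos_double_cos[of y] by (simp add: power2_eq_square)
  then have "y * (1 / 2) \<le> y * (cos y * cos y)" using y by (intro mult_left_mono) auto
  ultimately have "y \<le> sin (x / 2)" by (simp add: mult.assoc)
  then have "y\<^sup>2 \<le> (sin (x / 2))\<^sup>2" using y by (intro power_mono) auto
  then show "x\<^sup>2 / 4 \<le> 2 * (1 - cos x)" unfolding half by (simp add: y_def power_divide)
qed

text \<open>On a box of side \<open>Suc L\<close> the relative coordinates run from 0 to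
  \<open>L\<close> and the sines vanish at both ends, which leaves the indices \<open>1..<L\<close>.
  The factor \<open>2 / L\<close> normalises, each one-dimensional squared norm being
  \<open>L / 2\<close>.\<close>

definition sine_mode :: "site \<Rightarrow> nat \<Rightarrow> nat \<times> nat \<Rightarrow> site \<Rightarrow> real" where
  "sine_mode p L = (\<lambda>(k1, k2) x. 2 / real L *
     (sin (pi * real k1 * real_of_int (fst x - fst p) / real L) * sin (pi * real k2 * real_of_int (snd x - snd p) / real L)))"

definition sine_indices :: "nat \<Rightarrow> (nat \<times> nat) set" where
  "sine_indices L = {1..<L} \<times> {1..<L}"

definition sine_energy :: "nat \<Rightarrow> nat \<times> nat \<Rightarrow> real" where
  "sine_energy L = (\<lambda>(k1, k2). 2 * (1 - cos (pi * real k1 / real L)) + 2 * (1 - cos (pi * real k2 / real L)))"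

lemma sum_box:
  "(\<Sum>x\<in>lattice_box p b. f x) = (\<Sum>i<b. \<Sum>j<b. f (fst p + int i, snd p + int j) :: real)"
proof -
  have bij: "bij_betw (\<lambda>(i, j). (fst p + int i, snd p + int j)) ({..<b} \<times> {..<b}) (lattice_box p b)"
    by (rule bij_betw_byWitness[where f' = "\<lambda>(x, y). (nat (x - fst p), nat (y - snd p))"]) (auto simp: lattice_box_def)
  show ?thesis
    unfolding sum.reindex_bij_betw[OF bij, symmetric] sum.cartesian_product by (simp add: case_prod_beta)
qed

lemma sin_sum_Suc:
  assumes "0 < L"
  shows "(\<Sum>j<Suc L. sin (pi * real k * real j / real L) * sin (pi * real l * real j / real L))
    = (\<Sum>j<L. sin (pi * real k * real j / real L) * sin (pi * real l * real j / real L))"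
  using assms by (simp add: mult.commute)

lemma sine_modes_orthonormal:
  assumes L: "2 \<le> L" shows "orthonormal_modes (lattice_box p (Suc L)) (sine_indices L) (sine_mode p L)"
proof
  show "finite (sine_indices L)" by (simp add: sine_indices_def)
  fix k l assume kl: "k \<in> sine_indices L" "l \<in> sine_indices L"
  obtain k1 k2 l1 l2 where k: "k = (k1, k2)" "l = (l1, l2)" by (cases k; cases l)
  have r: "0 < k1" "k1 < L" "0 < k2" "k2 < L" "0 < l1" "l1 < L" "0 < l2" "l2 < L"
    using kl by (auto simp: k sine_indices_def)
  have L0: "0 < L" using L by simp
  let ?f = "\<lambda>k j. sin (pi * real k * real j / real L)"
  have "(\<Sum>x\<in>lattice_box p (Suc L). sine_mode p L k x * sine_mode p L l x)
      = (\<Sum>i<Suc L. \<Sum>j<Suc L. (2 / real L)\<^sup>2 * ((?f k1 i * ?f l1 i) * (?f k2 j * ?f l2 j)))"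
    unfolding sum_box by (intro sum.cong refl) (simp add: k sine_mode_def power2_eq_square)
  also have "\<dots> = (2 / real L)\<^sup>2 * ((\<Sum>i<Suc L. ?f k1 i * ?f l1 i) * (\<Sum>j<Suc L. ?f k2 j * ?f l2 j))"
    unfolding sum_product unfolding sum_distrib_left ..
  also have "\<dots> = of_bool (k = l)"
    using L unfolding sin_sum_Suc[OF L0] sin_orthogonal[OF r(1,2,5,6)] sin_orthogonal[OF r(3,4,7,8)]
    by (auto simp: k power2_eq_square)
  finally show "(\<Sum>x\<in>lattice_box p (Suc L). sine_mode p L k x * sine_mode p L l x) = of_bool (k = l)" .
qed simp

lemma sine_mode_bound:
  assumes "0 < L" shows "(sine_mode p L k x)\<^sup>2 \<le> 4 / (real L)\<^sup>2"
proof -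
  have "\<bar>sine_mode p L k x\<bar> \<le> 2 / real L * (1 * 1)"
    unfolding sine_mode_def case_prod_beta abs_mult by (intro mult_mono) auto
  then have "\<bar>sine_mode p L k x\<bar>\<^sup>2 \<le> (2 / real L)\<^sup>2" by (intro power_mono) auto
  then show ?thesis by (simp add: power_divide)
qed

lemma sine_mode_boundary:
  assumes L: "0 < L" and x: "x \<in> boundary (lattice_box p (Suc L))"
  shows "sine_mode p L k x = 0"
proof -
  have m: "fst p \<le> fst x" "fst x \<le> fst p + int L" "snd p \<le> snd x" "snd x \<le> snd p + int L"
    using x by (auto simp: boundary_def lattice_box_def)
  have "fst x = fst p \<or> fst x = fst p + int L \<or> snd x = snd p \<or> snd x = snd p + int L"
    using x m by (auto simp: boundary_def lattice_box_def)
  then show ?thesis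
    using L by (auto simp: sine_mode_def case_prod_beta mult.commute)
qed

lemma sum_nn_pairs_box:
  "(\<Sum>(x, y)\<in>nn_pairs (lattice_box p (Suc L)). g x y :: real)
    = (\<Sum>i<L. \<Sum>j<Suc L. g (fst p + int i, snd p + int j) (fst p + int (Suc i), snd p + int j))
    + (\<Sum>i<Suc L. \<Sum>j<L. g (fst p + int i, snd p + int j) (fst p + int i, snd p + int (Suc j)))"
proof -
  define H where "H = (\<lambda>(i, j). ((fst p + int i, snd p + int j), (fst p + int (Suc i), snd p + int j))) ` ({..<L} \<times> {..<Suc L})"
  define V where "V = (\<lambda>(i, j). ((fst p + int i, snd p + int j), (fst p + int i, snd p + int (Suc j)))) ` ({..<Suc L} \<times> {..<L})"
  have "nn_pairs (lattice_box p (Suc L)) = H \<union> V"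
  proof (rule subset_antisym)
    show "nn_pairs (lattice_box p (Suc L)) \<subseteq> H \<union> V"
    proof
      fix q assume q: "q \<in> nn_pairs (lattice_box p (Suc L))"
      obtain x1 x2 y where xy: "q = ((x1, x2), y)" by (metis surj_pair)
      have b: "(x1, x2) \<in> lattice_box p (Suc L)" "y \<in> lattice_box p (Suc L)" "y = (x1 + 1, x2) \<or> y = (x1, x2 + 1)"
        using q xy by (auto simp: nn_pairs_def)
      define i where "i = nat (x1 - fst p)"
      define j where "j = nat (x2 - snd p)"
      have ij: "x1 = fst p + int i" "x2 = snd p + int j" "i < Suc L" "j < Suc L"
        using b(1) by (auto simp: i_def j_def lattice_box_def)
      show "q \<in> H \<union> V"
        using b(3)
      proof
        assume y: "y = (x1 + 1, x2)"
        then have "i < L" using b(2) ij by (auto simp: lattice_box_def)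
        then show ?thesis unfolding H_def using ij y xy by (intro UnI1 image_eqI[of _ _ "(i, j)"]) auto
      next
        assume y: "y = (x1, x2 + 1)"
        then have "j < L" using b(2) ij by (auto simp: lattice_box_def)
        then show ?thesis unfolding V_def using ij y xy by (intro UnI2 image_eqI[of _ _ "(i, j)"]) auto
      qed
    qed
    show "H \<union> V \<subseteq> nn_pairs (lattice_box p (Suc L))" by (auto simp: H_def V_def nn_pairs_def lattice_box_def)
  qed
  moreover have "H \<inter> V = {}" by (auto simp: H_def V_def)
  moreover have "(\<Sum>(x, y)\<in>H. g x y) = (\<Sum>i<L. \<Sum>j<Suc L. g (fst p + int i, snd p + int j) (fst p + int (Suc i), snd p + int j))"
    unfolding H_def by (subst sum.reindex) (auto simp: inj_on_def sum.cartesian_product case_prod_beta o_def simp del: lessThan_Suc of_nat_Suc sum.lessThan_Suc)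
  moreover have "(\<Sum>(x, y)\<in>V. g x y) = (\<Sum>i<Suc L. \<Sum>j<L. g (fst p + int i, snd p + int j) (fst p + int i, snd p + int (Suc j)))"
    unfolding V_def by (subst sum.reindex) (auto simp: inj_on_def sum.cartesian_product case_prod_beta o_def simp del: lessThan_Suc of_nat_Suc sum.lessThan_Suc)
  moreover have "finite H" "finite V" by (auto simp: H_def V_def)
  ultimately show ?thesis by (simp add: sum.union_disjoint del: sum.lessThan_Suc)
qed

text \<open>For a product mode, horizontal and vertical bonds each give a one-dimensional energy
  times a one-dimensional squared norm.\<close>

lemma sine_mode_energy:
  assumes L: "2 \<le> L" and k: "k \<in> sine_indices L"
  shows "(\<Sum>(x, y)\<in>nn_pairs (lattice_box p (Suc L)). (sine_mode p L k x - sine_mode p L k y)\<^sup>2) = sine_energy L k"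
proof -
  obtain k1 k2 where kk: "k = (k1, k2)" by (cases k)
  have r: "0 < k1" "k1 < L" "0 < k2" "k2 < L" using k by (auto simp: kk sine_indices_def)
  have L0: "0 < L" using L by simp
  let ?f = "\<lambda>k j. sin (pi * real k * real j / real L)"
  have sq: "(\<Sum>j<Suc L. (?f k j)\<^sup>2) = real L / 2" if "0 < k" "k < L" for k
    using sin_sum_Suc[OF L0, of k k] sin_orthogonal[OF that that] by (simp only: power2_eq_square if_True refl)
  have D: "(\<Sum>j<L. (?f k (Suc j) - ?f k j)\<^sup>2) = real L * (1 - cos (pi * real k / real L))" if "0 < k" "k < L" for k
    by (rule sin_dirichlet_energy[OF that])
  have mode: "sine_mode p L k (fst p + int i, snd p + int j) = 2 / real L * (?f k1 i * ?f k2 j)" for i j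
    by (simp add: kk sine_mode_def)
  have "(\<Sum>(x, y)\<in>nn_pairs (lattice_box p (Suc L)). (sine_mode p L k x - sine_mode p L k y)\<^sup>2)
      = (\<Sum>i<L. \<Sum>j<Suc L. (2 / real L)\<^sup>2 * ((?f k1 (Suc i) - ?f k1 i)\<^sup>2 * (?f k2 j)\<^sup>2))
      + (\<Sum>i<Suc L. \<Sum>j<L. (2 / real L)\<^sup>2 * ((?f k1 i)\<^sup>2 * (?f k2 (Suc j) - ?f k2 j)\<^sup>2))"
    unfolding sum_nn_pairs_box mode
    by (intro arg_cong2[where f = "(+)"] sum.cong refl) (simp_all only: power2_eq_square, (simp_all only: algebra_simps)?)
  also have "\<dots> = (2 / real L)\<^sup>2 * ((\<Sum>i<L. (?f k1 (Suc i) - ?f k1 i)\<^sup>2) * (\<Sum>j<Suc L. (?f k2 j)\<^sup>2))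
      + (2 / real L)\<^sup>2 * ((\<Sum>i<Suc L. (?f k1 i)\<^sup>2) * (\<Sum>j<L. (?f k2 (Suc j) - ?f k2 j)\<^sup>2))"
    unfolding sum_product unfolding sum_distrib_left ..
  also have "\<dots> = sine_energy L k"
    unfolding D[OF r(1,2)] D[OF r(3,4)] sq[OF r(1,2)] sq[OF r(3,4)]
    using L0 by (simp add: kk sine_energy_def power2_eq_square field_simps)
  finally show ?thesis .
qed

text \<open>The upper bound enters the free boson partition function; the lower one, weakened
  through \<open>4 \<le> pi^2\<close>, controls the mean particle number.\<close>

lemma sine_energy_bounds:
  assumes "(k1, k2) \<in> sine_indices L"
  shows "sine_energy L (k1, k2) \<le> pi\<^sup>2 / (real L)\<^sup>2 * ((real k1)\<^sup>2 + (real k2)\<^sup>2)"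
    "((real k1)\<^sup>2 + (real k2)\<^sup>2) / (real L)\<^sup>2 \<le> sine_energy L (k1, k2)"
proof -
  have k: "0 < k1" "k1 < L" "0 < k2" "k2 < L" using assms by (auto simp: sine_indices_def)
  have x: "0 \<le> pi * real k / real L" "pi * real k / real L \<le> pi" if "k < L" for k
    using that by (auto simp: field_simps)
  have sq: "(pi * real k / real L)\<^sup>2 = pi\<^sup>2 / (real L)\<^sup>2 * (real k)\<^sup>2" for k :: nat
    by (simp add: power_divide power_mult_distrib)
  show "sine_energy L (k1, k2) \<le> pi\<^sup>2 / (real L)\<^sup>2 * ((real k1)\<^sup>2 + (real k2)\<^sup>2)"
    using one_minus_cos_bounds(1)[OF x[OF k(2)]] one_minus_cos_bounds(1)[OF x[OF k(4)]]
    unfolding sq by (simp add: sine_energy_def distrib_left)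
  have "4 \<le> pi\<^sup>2" using power_mono[of 2 pi 2] pi_gt3 by simp
  then have low: "(real k)\<^sup>2 / (real L)\<^sup>2 \<le> (pi * real k / real L)\<^sup>2 / 4" for k
  proof -
    have "4 * ((real k)\<^sup>2 / (real L)\<^sup>2) \<le> pi\<^sup>2 * ((real k)\<^sup>2 / (real L)\<^sup>2)"
      using \<open>4 \<le> pi\<^sup>2\<close> by (intro mult_right_mono) auto
    also have "\<dots> = (pi * real k / real L)\<^sup>2" unfolding sq by simp
    finally have "4 * ((real k)\<^sup>2 / (real L)\<^sup>2) \<le> (pi * real k / real L)\<^sup>2" .
    moreover have "a \<le> x / 4" if "4 * a \<le> x" for a x :: real using that by simp
    ultimately show ?thesis by blast
  qed
  show "((real k1)\<^sup>2 + (real k2)\<^sup>2) / (real L)\<^sup>2 \<le> sine_energy L (k1, k2)"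
    using one_minus_cos_bounds(2)[OF x[OF k(2)]] one_minus_cos_bounds(2)[OF x[OF k(4)]] low[of k1] low[of k2]
    unfolding sine_energy_def case_prod_conv add_divide_distrib by linarith
qed

section \<open>Bose sums and integrals\<close>

lemma gaussian_half_line:
  assumes "0 < (s :: real)"
  shows "has_bochner_integral lborel (\<lambda>x. indicator {0..} x *\<^sub>R exp (- (s * x\<^sup>2))) (sqrt (pi / s) / 2)"
proof -
  have "sqrt s \<noteq> 0" using assms by simp
  from iffD1[OF lborel_has_bochner_integral_real_affine_iff[OF this, of _ _ 0] gaussian_moment_0]
  have "has_bochner_integral lborel (\<lambda>x. indicator {0..} (0 + sqrt s * x) *\<^sub>R exp (- (0 + sqrt s * x)\<^sup>2))
      ((sqrt pi / 2) /\<^sub>R \<bar>sqrt s\<bar>)" .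
  moreover have "(\<lambda>x. indicator {0..} (0 + sqrt s * x) *\<^sub>R exp (- (0 + sqrt s * x)\<^sup>2))
      = (\<lambda>x. indicator {0..} x *\<^sub>R exp (- (s * x\<^sup>2)))"
    using assms by (intro ext) (auto simp: indicator_def power_mult_distrib zero_le_mult_iff)
  moreover have "(sqrt pi / 2) /\<^sub>R \<bar>sqrt s\<bar> = sqrt (pi / s) / 2"
    using assms by (simp add: real_sqrt_divide field_simps)
  ultimately show ?thesis by simp
qed

lemma gaussian_line:
  assumes "0 < (s :: real)"
  shows "has_bochner_integral lborel (\<lambda>x. exp (- (s * x\<^sup>2))) (sqrt (pi / s))"
  using has_bochner_integral_even_function[OF gaussian_half_line[OF assms]] by simp

lemma exp_tail:
  assumes a: "0 < (a :: real)"
  shows "(\<integral>\<^sup>+x. ennreal (exp (- (a * x))) * indicator {T..} x \<partial>lborel) = ennreal (exp (- (a * T)) / a)"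
proof -
  have "(\<integral>\<^sup>+x. ennreal (exp (- (a * x))) * indicator {T..} x \<partial>lborel) = ennreal (0 - (- (exp (- (a * T)) / a)))"
  proof (rule nn_integral_FTC_atLeast)
    show "((\<lambda>x. - (exp (- (a * x)) / a)) has_real_derivative exp (- (a * x))) (at x)" for x
      using a by (auto intro!: derivative_eq_intros)
    show "((\<lambda>x. - (exp (- (a * x)) / a)) \<longlongrightarrow> 0) at_top"
      using a by real_asymp
  qed auto
  then show ?thesis by simp
qed

text \<open>The integrand is majorised by 1 on \<open>[0, 1]\<close>, by its value at the left end
  of each cell \<open>[k, k + 1]\<close>, and by \<open>exp (- s L x)\<close> beyond
  \<open>L\<close>. The first and the last piece cost at most 1 each, the last because of
  \<open>1 \<le> s * real L\<close>.\<close>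

lemma gaussian_sum_ge:
  assumes s: "0 < s" and L: "1 \<le> s * real L" "0 < L"
  shows "sqrt (pi / s) / 2 - 2 \<le> (\<Sum>k\<in>{1..<L}. exp (- (s * (real k)\<^sup>2)))"
proof -
  let ?f = "\<lambda>x :: real. exp (- (s * x\<^sup>2))"
  define G where "G x = ennreal 1 * indicator {0..1} x + (\<Sum>k\<in>{1..<L}. ennreal (?f (real k)) * indicator {real k..real k + 1} x)
      + ennreal (exp (- (s * real L * x))) * indicator {real L..} x" for x :: real
  have le: "ennreal (indicator {0..} x *\<^sub>R ?f x) \<le> G x" for x
  proof (cases "x \<ge> 0")
    case False
    then show ?thesis by simp
  next
    case True
    consider "x \<le> 1" | "1 < x" "x < real L" | "real L \<le> x" by linarith
    then show ?thesis
    proof cases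
      case 1
      then have "ennreal (indicator {0..} x *\<^sub>R ?f x) \<le> ennreal 1 * indicator {0..1} x"
        using True s by (simp add: ennreal_leI)
      also have "\<dots> \<le> G x" unfolding G_def by (simp add: add_increasing2 add.assoc)
      finally show ?thesis .
    next
      case 2
      define k where "k = nat \<lfloor>x\<rfloor>"
      have k: "real k \<le> x" "x < real k + 1" using True unfolding k_def by linarith+
      then have kI: "k \<in> {1..<L}" using 2 by auto
      have "s * (real k)\<^sup>2 \<le> s * x\<^sup>2" using s k by (intro mult_left_mono power_mono) auto
      then have "ennreal (indicator {0..} x *\<^sub>R ?f x) \<le> ennreal (?f (real k)) * indicator {real k..real k + 1} x"
        using True k by (simp add: ennreal_leI)
      also have "\<dots> \<le> (\<Sum>k\<in>{1..<L}. ennreal (?f (real k)) * indicator {real k..real k + 1} x)"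
        using kI by (intro member_le_sum) auto
      also have "\<dots> \<le> G x" unfolding G_def by (simp add: add_increasing add_increasing2)
      finally show ?thesis .
    next
      case 3
      have "s * real L * x \<le> s * x\<^sup>2" using 3 s by (simp add: power2_eq_square mult.assoc mult_right_mono)
      then have "ennreal (indicator {0..} x *\<^sub>R ?f x) \<le> ennreal (exp (- (s * real L * x))) * indicator {real L..} x"
        using True 3 by (simp add: ennreal_leI)
      also have "\<dots> \<le> G x" unfolding G_def by (simp add: add_increasing)
      finally show ?thesis .
    qed
  qed
  have sL: "0 < s * real L" using s L by simp
  have "ennreal (sqrt (pi / s) / 2) = (\<integral>\<^sup>+x. ennreal (indicator {0..} x *\<^sub>R ?f x) \<partial>lborel)"
  proof -
    have int: "integrable lborel (\<lambda>x. indicator {0..} x *\<^sub>R ?f x)"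
      and eq: "(\<integral>x. indicator {0..} x *\<^sub>R ?f x \<partial>lborel) = sqrt (pi / s) / 2"
      using gaussian_half_line[OF s] unfolding has_bochner_integral_iff by blast+
    have "(\<integral>\<^sup>+x. ennreal (indicator {0..} x *\<^sub>R ?f x) \<partial>lborel) = ennreal (\<integral>x. indicator {0..} x *\<^sub>R ?f x \<partial>lborel)"
      by (rule nn_integral_eq_integral[OF int]) simp
    then show ?thesis unfolding eq by (rule sym)
  qed
  also have "\<dots> \<le> (\<integral>\<^sup>+x. G x \<partial>lborel)" by (intro nn_integral_mono le)
  also have "\<dots> = (\<integral>\<^sup>+x. ennreal 1 * indicator {0..1 :: real} x \<partial>lborel)
      + (\<integral>\<^sup>+x. (\<Sum>k\<in>{1..<L}. ennreal (?f (real k)) * indicator {real k..real k + 1} x) \<partial>lborel)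
      + (\<integral>\<^sup>+x. ennreal (exp (- (s * real L * x))) * indicator {real L..} x \<partial>lborel)"
    unfolding G_def by (subst nn_integral_add; (subst nn_integral_add)?; measurable)
  also have "(\<integral>\<^sup>+x. ennreal 1 * indicator {0..1 :: real} x \<partial>lborel) = ennreal 1"
    by (subst nn_integral_cmult_indicator) auto
  also have "(\<integral>\<^sup>+x. (\<Sum>k\<in>{1..<L}. ennreal (?f (real k)) * indicator {real k..real k + 1} x) \<partial>lborel)
      = ennreal (\<Sum>k\<in>{1..<L}. ?f (real k))"
  proof -
    have "(\<integral>\<^sup>+x. ennreal (?f (real k)) * indicator {real k..real k + 1} x \<partial>lborel) = ennreal (?f (real k))" for k :: nat
      by (subst nn_integral_cmult_indicator) auto
    then have "(\<Sum>k\<in>{1..<L}. \<integral>\<^sup>+x. ennreal (?f (real k)) * indicator {real k..real k + 1} x \<partial>lborel)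
        = (\<Sum>k\<in>{1..<L}. ennreal (?f (real k)))" by (simp only:)
    also have "\<dots> = ennreal (\<Sum>k\<in>{1..<L}. ?f (real k))" by (rule sum_ennreal) simp
    finally show ?thesis by (subst nn_integral_sum) simp_all
  qed
  also have "(\<integral>\<^sup>+x. ennreal (exp (- (s * real L * x))) * indicator {real L..} x \<partial>lborel)
      = ennreal (exp (- (s * real L * real L)) / (s * real L))"
    by (rule exp_tail[OF sL])
  also have "ennreal 1 + ennreal (\<Sum>k\<in>{1..<L}. ?f (real k)) + ennreal (exp (- (s * real L * real L)) / (s * real L))
      = ennreal (1 + (\<Sum>k\<in>{1..<L}. ?f (real k)) + exp (- (s * real L * real L)) / (s * real L))"
  proof -
    have "ennreal 1 + ennreal A + ennreal B = ennreal (1 + A + B)" if "0 \<le> A" "0 \<le> B" for A B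
      using that by simp
    then show ?thesis using sL by (auto simp: sum_nonneg simp del: ennreal_1 One_nat_def)
  qed
  finally have "sqrt (pi / s) / 2 \<le> 1 + (\<Sum>k\<in>{1..<L}. ?f (real k)) + exp (- (s * real L * real L)) / (s * real L)"
    using sL by (subst (asm) ennreal_le_iff) (auto intro!: add_nonneg_nonneg sum_nonneg)
  moreover have "exp (- (s * real L * real L)) / (s * real L) \<le> 1"
  proof -
    have "exp (- (s * real L * real L)) \<le> 1" using s by simp
    then have "exp (- (s * real L * real L)) \<le> s * real L" using L(1) by linarith
    then show ?thesis using sL by (simp only: divide_le_eq_1_pos)
  qed
  ultimately show ?thesis by linarith
qed

lemma basel_sums: "(\<lambda>j. 1 / (real j + 1)\<^sup>2) sums (pi\<^sup>2 / 6)"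
  using inverse_squares_sums by (simp add: add.commute)

lemma neg_ln_series:
  assumes "0 \<le> y" "y < (1 :: real)"
  shows "(\<lambda>j. y ^ Suc j / real (Suc j)) sums (- ln (1 - y))"
proof -
  have "(\<lambda>j. - ((- (- y)) ^ j) / real j) sums ln (1 + (- y))"
    using assms by (intro ln_series') auto
  then have "(\<lambda>j. y ^ j / real j) sums (- ln (1 - y))" using sums_minus by fastforce
  then show ?thesis
    using sums_Suc_iff[of "\<lambda>j. y ^ j / real j" "- ln (1 - y)"] by (simp del: of_nat_Suc power_Suc)
qed

lemma neg_ln_ge_partial:
  assumes "0 \<le> y" "y < (1 :: real)"
  shows "(\<Sum>j<J. y ^ Suc j / real (Suc j)) \<le> - ln (1 - y)"
proof -
  have "(\<Sum>j<J. y ^ Suc j / real (Suc j)) \<le> (\<Sum>j. y ^ Suc j / real (Suc j))"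
    using assms neg_ln_series[OF assms] by (intro sum_le_suminf) (auto simp: sums_iff)
  then show ?thesis using neg_ln_series[OF assms] by (simp add: sums_iff)
qed

text \<open>Squaring \<open>c - 2 \<le> a\<close> is legitimate only where \<open>c - 2\<close> is
  nonnegative; for smaller \<open>c\<close> the left side of the claim is at most zero.\<close>

lemma square_ge_of_ge_minus_2:
  fixes a c :: real
  assumes "0 \<le> a" "0 \<le> c" "c - 2 \<le> a" shows "c\<^sup>2 - 4 * c \<le> a\<^sup>2"
proof (cases "c \<le> 2")
  case True
  then have "c * c \<le> 4 * c" using assms by (intro mult_right_mono) auto
  then show ?thesis using zero_le_square[of a] unfolding power2_eq_square by linarith
next
  case False
  then have "(c - 2)\<^sup>2 \<le> a\<^sup>2" using assms by (intro power_mono) auto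
  then show ?thesis by (simp add: power2_diff)
qed

text \<open>With the series of \<open>- ln (1 - y)\<close> the lattice sum becomes, for each power
  \<open>j + 1\<close>, the square of a one-dimensional Gaussian sum. The leading parts add up to
  \<open>pi / (4 t)\<close> times Basel's \<open>pi^2 / 6\<close>, while the corrections decay like
  \<open>(j + 1) powr (- 3 / 2)\<close> and are summable.\<close>

lemma log_partition_sum_ge:
  "\<exists>D>0. \<forall>t L. 0 < t \<longrightarrow> 0 < L \<longrightarrow> 1 \<le> t * real L \<longrightarrow>
    pi ^ 3 / (24 * t) - D / sqrt t \<le>
      (\<Sum>(k1, k2)\<in>{1..<L} \<times> {1..<L}. - ln (1 - exp (- (t * ((real k1)\<^sup>2 + (real k2)\<^sup>2)))))"
proof -
  define z where "z j = real (Suc j) powr (- 3 / 2)" for j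
  have "summable (\<lambda>j. real j powr (- 3 / 2))" by (subst summable_real_powr_iff) simp
  then have zs: "summable z" unfolding z_def by (subst summable_Suc_iff)
  define B where "B = suminf z"
  have z0: "0 \<le> z j" for j by (simp add: z_def)
  have zB: "(\<Sum>j<J. z j) \<le> B" for J unfolding B_def using zs z0 by (intro sum_le_suminf) auto
  have B1: "0 < B" using zB[of 1] by (simp add: z_def)
  \<comment> \<open>\<open>B\<close> is zeta at 3/2, and \<open>2 sqrt pi\<close> is what remains of
    \<open>4 c\<close>, where \<open>c\<close> is the half-line Gaussian integral below.\<close>
  define D where "D = 2 * sqrt pi * B"
  have D: "0 < D" using B1 by (simp add: D_def)
  moreover have "pi ^ 3 / (24 * t) - D / sqrt t \<le>
      (\<Sum>(k1, k2)\<in>{1..<L} \<times> {1..<L}. - ln (1 - exp (- (t * ((real k1)\<^sup>2 + (real k2)\<^sup>2)))))" (is "_ \<le> ?S")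
    if t: "0 < t" and L: "0 < L" "1 \<le> t * real L" for t L
  proof -
    have part: "pi / (4 * t) * (\<Sum>j<J. 1 / (real j + 1)\<^sup>2) - D / sqrt t \<le> ?S" for J
    proof -
      have summand: "pi / (4 * t) * (1 / (real j + 1)\<^sup>2) - 2 * sqrt pi / sqrt t * z j
          \<le> (\<Sum>k\<in>{1..<L}. exp (- (t * real (Suc j) * (real k)\<^sup>2)))\<^sup>2 / real (Suc j)" for j
      proof -
        define s where "s = t * real (Suc j)"
        define c where "c = sqrt (pi / s) / 2"
        define a where "a = (\<Sum>k\<in>{1..<L}. exp (- (s * (real k)\<^sup>2)))"
        have s: "0 < s" using t by (simp add: s_def)
        have "t * real L * 1 \<le> t * real L * real (Suc j)" using t by (intro mult_left_mono) auto
        then have "1 \<le> s * real L" using L by (simp add: s_def mult_ac)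
        then have "c - 2 \<le> a" unfolding c_def a_def using s L by (intro gaussian_sum_ge) auto
        moreover have "0 \<le> a" "0 \<le> c" using s by (auto simp: a_def c_def sum_nonneg)
        ultimately have ca: "c\<^sup>2 - 4 * c \<le> a\<^sup>2" by (intro square_ge_of_ge_minus_2)
        have c2: "c\<^sup>2 / real (Suc j) = pi / (4 * t) * (1 / (real j + 1)\<^sup>2)"
          using s t by (simp add: c_def s_def power_divide power2_eq_square add.commute)
        have "c / real (Suc j) = sqrt pi / sqrt t / 2 * z j"
        proof -
          have "real (Suc j) powr (3 / 2) = real (Suc j) powr (1 + 1 / 2)" by simp
          also have "\<dots> = real (Suc j) * sqrt (real (Suc j))"
            unfolding powr_add by (simp add: powr_half_sqrt)
          finally have "z j = 1 / (real (Suc j) * sqrt (real (Suc j)))"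
            unfolding z_def by (simp add: powr_minus_divide)
          then show ?thesis by (simp add: c_def s_def real_sqrt_divide real_sqrt_mult)
        qed
        then have "(c\<^sup>2 - 4 * c) / real (Suc j) = pi / (4 * t) * (1 / (real j + 1)\<^sup>2) - 2 * sqrt pi / sqrt t * z j"
          unfolding diff_divide_distrib c2 by simp
        moreover have "(c\<^sup>2 - 4 * c) / real (Suc j) \<le> a\<^sup>2 / real (Suc j)" using ca by (intro divide_right_mono) auto
        ultimately show ?thesis by (simp only: a_def s_def)
      qed
      have "pi / (4 * t) * (\<Sum>j<J. 1 / (real j + 1)\<^sup>2) - D / sqrt t
          \<le> pi / (4 * t) * (\<Sum>j<J. 1 / (real j + 1)\<^sup>2) - 2 * sqrt pi / sqrt t * (\<Sum>j<J. z j)"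
        using mult_left_mono[OF zB[of J], of "2 * sqrt pi / sqrt t"] t by (simp add: D_def)
      also have "\<dots> = (\<Sum>j<J. pi / (4 * t) * (1 / (real j + 1)\<^sup>2) - 2 * sqrt pi / sqrt t * z j)"
        by (simp only: sum_subtractf sum_distrib_left)
      also have "\<dots> \<le> (\<Sum>j<J. (\<Sum>k\<in>{1..<L}. exp (- (t * real (Suc j) * (real k)\<^sup>2)))\<^sup>2 / real (Suc j))"
        by (intro sum_mono summand)
      also have "\<dots> = (\<Sum>j<J. \<Sum>p\<in>{1..<L} \<times> {1..<L}. exp (- (t * ((real (fst p))\<^sup>2 + (real (snd p))\<^sup>2))) ^ Suc j / real (Suc j))"
      proof (rule sum.cong[OF refl])
        fix j
        have "exp (- (t * real (Suc j) * (real k)\<^sup>2)) * exp (- (t * real (Suc j) * (real l)\<^sup>2))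
            = exp (- (t * ((real k)\<^sup>2 + (real l)\<^sup>2))) ^ Suc j" for k l
          unfolding exp_of_nat_mult[symmetric] exp_add[symmetric] by (simp add: algebra_simps)
        then have "(\<Sum>k\<in>{1..<L}. exp (- (t * real (Suc j) * (real k)\<^sup>2)))\<^sup>2
            = (\<Sum>p\<in>{1..<L} \<times> {1..<L}. exp (- (t * ((real (fst p))\<^sup>2 + (real (snd p))\<^sup>2))) ^ Suc j)"
          unfolding power2_eq_square[of "sum _ _"] sum_product sum.cartesian_product by (simp only: case_prod_unfold)
        then show "(\<Sum>k\<in>{1..<L}. exp (- (t * real (Suc j) * (real k)\<^sup>2)))\<^sup>2 / real (Suc j)
            = (\<Sum>p\<in>{1..<L} \<times> {1..<L}. exp (- (t * ((real (fst p))\<^sup>2 + (real (snd p))\<^sup>2))) ^ Suc j / real (Suc j))"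
          by (simp only: sum_divide_distrib)
      qed
      also have "\<dots> = (\<Sum>p\<in>{1..<L} \<times> {1..<L}. \<Sum>j<J. exp (- (t * ((real (fst p))\<^sup>2 + (real (snd p))\<^sup>2))) ^ Suc j / real (Suc j))"
        by (rule sum.swap)
      also have "\<dots> \<le> (\<Sum>p\<in>{1..<L} \<times> {1..<L}. - ln (1 - exp (- (t * ((real (fst p))\<^sup>2 + (real (snd p))\<^sup>2)))))"
      proof (intro sum_mono neg_ln_ge_partial)
        fix p assume "p \<in> {1..<L} \<times> {1..<L}"
        then have "0 < (real (fst p))\<^sup>2 + (real (snd p))\<^sup>2" by (intro add_pos_pos) auto
        then show "exp (- (t * ((real (fst p))\<^sup>2 + (real (snd p))\<^sup>2))) < 1" using t by simp
      qed simp
      also have "\<dots> = ?S" by (simp only: case_prod_unfold)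
      finally show ?thesis .
    qed
    have "(\<lambda>J. pi / (4 * t) * (\<Sum>j<J. 1 / (real j + 1)\<^sup>2) - D / sqrt t) \<longlonglongrightarrow> pi / (4 * t) * (pi\<^sup>2 / 6) - D / sqrt t"
      using basel_sums unfolding sums_def by (intro tendsto_intros)
    then have "pi / (4 * t) * (pi\<^sup>2 / 6) - D / sqrt t \<le> ?S" by (rule LIMSEQ_le_const2) (use part in blast)
    then show ?thesis by (simp add: power2_eq_square power3_eq_cube)
  qed
  ultimately show ?thesis by blast
qed

section \<open>Logarithmic growth of the two-dimensional lattice sum\<close>

lemma harmonic_sum_le:
  assumes "0 < L" shows "(\<Sum>a\<in>{1..<L}. 1 / real a) \<le> 1 + ln (real L)"
proof -
  have main: "(\<Sum>a\<in>{1..Suc m}. 1 / real a) \<le> 1 + ln (real (Suc m))" for m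
  proof (induction m)
    case (Suc m)
    have "ln (real (Suc m) / real (Suc (Suc m))) \<le> real (Suc m) / real (Suc (Suc m)) - 1"
      by (intro ln_le_minus_one) simp
    moreover have "real (Suc m) / real (Suc (Suc m)) - 1 = - (1 / real (Suc (Suc m)))"
      by (simp add: field_simps)
    ultimately have "1 / real (Suc (Suc m)) \<le> ln (real (Suc (Suc m))) - ln (real (Suc m))"
      by (simp add: ln_div del: of_nat_Suc)
    then show ?case using Suc by (simp del: of_nat_Suc)
  qed simp
  show ?thesis
  proof (cases "L = 1")
    case False
    then obtain m where L: "L = Suc (Suc m)" using assms by (metis One_nat_def not0_implies_Suc gr0_conv_Suc)
    have "(\<Sum>a\<in>{1..<L}. 1 / real a) = (\<Sum>a\<in>{1..Suc m}. 1 / real a)"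
      unfolding L by (intro sum.cong) auto
    also have "\<dots> \<le> 1 + ln (real (Suc m))" by (rule main)
    also have "\<dots> \<le> 1 + ln (real L)" unfolding L by simp
    finally show ?thesis .
  qed simp
qed

text \<open>Each point is charged to its larger coordinate \<open>a\<close>; in either order at most
  \<open>a\<close> points share it, each contributing at most \<open>1 / a^2\<close>. The remaining
  harmonic sum is the origin of the logarithm in the error term.\<close>

lemma inverse_square_lattice_sum_le:
  assumes "0 < L"
  shows "(\<Sum>(a, b)\<in>{1..<L} \<times> {1..<L}. 1 / ((real a)\<^sup>2 + (real b)\<^sup>2)) \<le> 2 * (1 + ln (real L))"
proof -
  let ?I = "{1..<L}"
  have half: "(\<Sum>b\<in>?I. if b \<le> a then 1 / (real a)\<^sup>2 else 0) \<le> 1 / real a" if a: "a \<in> ?I" for a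
  proof -
    have "(\<Sum>b\<in>?I. if b \<le> a then 1 / (real a)\<^sup>2 else 0) = (\<Sum>b\<in>{b \<in> ?I. b \<le> a}. 1 / (real a)\<^sup>2)"
      by (rule sum.inter_filter[symmetric]) simp
    also have "{b \<in> ?I. b \<le> a} = {1..a}" using a by auto
    finally show ?thesis using a by (simp add: power2_eq_square)
  qed
  have "(\<Sum>(a, b)\<in>?I \<times> ?I. 1 / ((real a)\<^sup>2 + (real b)\<^sup>2))
      \<le> (\<Sum>(a, b)\<in>?I \<times> ?I. (if b \<le> a then 1 / (real a)\<^sup>2 else 0) + (if a \<le> b then 1 / (real b)\<^sup>2 else 0))"
  proof (rule sum_mono, clarify)
    fix a b assume ab: "a \<in> ?I" "b \<in> ?I"
    have "1 / ((real a)\<^sup>2 + (real b)\<^sup>2) \<le> 1 / (real a)\<^sup>2" "1 / ((real a)\<^sup>2 + (real b)\<^sup>2) \<le> 1 / (real b)\<^sup>2"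
      using ab by (intro divide_left_mono mult_pos_pos add_pos_pos; simp)+
    then show "1 / ((real a)\<^sup>2 + (real b)\<^sup>2)
        \<le> (if b \<le> a then 1 / (real a)\<^sup>2 else 0) + (if a \<le> b then 1 / (real b)\<^sup>2 else 0)"
      by (cases "b \<le> a"; cases "a \<le> b") (auto intro: add_increasing2)
  qed
  also have "\<dots> = (\<Sum>a\<in>?I. \<Sum>b\<in>?I. if b \<le> a then 1 / (real a)\<^sup>2 else 0) + (\<Sum>b\<in>?I. \<Sum>a\<in>?I. if a \<le> b then 1 / (real b)\<^sup>2 else 0)"
    unfolding sum.cartesian_product[symmetric] sum.distrib by (intro arg_cong2[where f = "(+)"] refl sum.swap)
  also have "\<dots> \<le> (\<Sum>a\<in>?I. 1 / real a) + (\<Sum>b\<in>?I. 1 / real b)"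
    by (intro add_mono sum_mono half)
  also have "\<dots> \<le> 2 * (1 + ln (real L))" using harmonic_sum_le[OF assms] by simp
  finally show ?thesis .
qed

section \<open>The constant \<open>C2\<close> and the value \<open>riemann_zeta 2\<close>\<close>

lemma DIM_real2: "DIM(real ^ 2) = 2" by simp

lemma gaussian_plane:
  assumes a: "0 < (a :: real)"
  shows "(\<integral>\<^sup>+p. ennreal (exp (- (a * (norm p)\<^sup>2))) \<partial>(lborel :: (real ^ 2) measure)) = ennreal (pi / a)"
proof -
  have "exp (- (a * (norm p)\<^sup>2)) = (\<Prod>b\<in>Basis. exp (- (a * (p \<bullet> b)\<^sup>2)))" for p :: "real ^ 2"
  proof -
    have "(norm p)\<^sup>2 = (\<Sum>b\<in>Basis. (p \<bullet> b)\<^sup>2)"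
      unfolding power2_norm_eq_inner by (subst euclidean_inner) (simp add: power2_eq_square)
    then show ?thesis by (simp add: exp_sum[symmetric] sum_negf sum_distrib_left)
  qed
  then have "(\<integral>\<^sup>+p. ennreal (exp (- (a * (norm p)\<^sup>2))) \<partial>(lborel :: (real ^ 2) measure))
      = (\<integral>\<^sup>+p. (\<Prod>b\<in>Basis. ennreal (exp (- (a * (p \<bullet> b)\<^sup>2)))) \<partial>(lborel :: (real ^ 2) measure))"
    by (simp add: prod_ennreal)
  also have "\<dots> = (\<Prod>b\<in>(Basis :: (real ^ 2) set). (\<integral>\<^sup>+x. ennreal (exp (- (a * x\<^sup>2))) \<partial>lborel))"
    by (rule nn_integral_lborel_prod) auto
  also have "(\<integral>\<^sup>+x. ennreal (exp (- (a * x\<^sup>2))) \<partial>lborel) = ennreal (sqrt (pi / a))"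
  proof -
    have int: "integrable lborel (\<lambda>x. exp (- (a * x\<^sup>2)))" and eq: "(\<integral>x. exp (- (a * x\<^sup>2)) \<partial>lborel) = sqrt (pi / a)"
      using gaussian_line[OF a] unfolding has_bochner_integral_iff by blast+
    have "(\<integral>\<^sup>+x. ennreal (exp (- (a * x\<^sup>2))) \<partial>lborel) = ennreal (\<integral>x. exp (- (a * x\<^sup>2)) \<partial>lborel)"
      by (rule nn_integral_eq_integral[OF int]) simp
    then show ?thesis unfolding eq .
  qed
  also have "(\<Prod>b\<in>(Basis :: (real ^ 2) set). ennreal (sqrt (pi / a))) = ennreal (sqrt (pi / a)) ^ 2"
    using DIM_real2 by (simp only: prod_constant)
  also have "\<dots> = ennreal (pi / a)"
    using a by (simp add: ennreal_power)
  finally show ?thesis .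
qed

text \<open>The series of \<open>g\<close> has nonnegative terms, so it may be integrated termwise;
  the Gaussians contribute \<open>pi / j^2\<close> for \<open>j = 1, 2, ...\<close>. The origin is
  removed as a null set because the series diverges there while \<open>ln 0\<close> has the value
  0.\<close>

lemma bose_integral:
  "(\<integral>p. ln (1 - exp (- (norm p)\<^sup>2)) \<partial>(lborel :: (real ^ 2) measure)) = - (pi * (pi\<^sup>2 / 6))"
proof -
  define g where "g p = - ln (1 - exp (- (norm p)\<^sup>2))" for p :: "real ^ 2"
  have g0: "0 \<le> g p" for p
  proof (cases "p = 0")
    case False
    then have "ln (1 - exp (- (norm p)\<^sup>2)) \<le> (1 - exp (- (norm p)\<^sup>2)) - 1"
      by (intro ln_le_minus_one) simp
    also have "\<dots> \<le> 0" by simp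
    finally show ?thesis by (simp add: g_def)
  qed (simp add: g_def)
  have meas: "g \<in> borel_measurable lborel" unfolding g_def by measurable
  have "(\<integral>\<^sup>+p. ennreal (g p) \<partial>lborel) = (\<integral>\<^sup>+p. (\<Sum>j. ennreal (1 / real (Suc j)) * ennreal (exp (- (real (Suc j) * (norm p)\<^sup>2)))) \<partial>(lborel :: (real ^ 2) measure))"
  proof (rule nn_integral_cong_AE)
    have "AE p in lborel. p \<noteq> (0 :: real ^ 2)" by (rule AE_lborel_singleton)
    then show "AE p in (lborel :: (real ^ 2) measure). ennreal (g p) = (\<Sum>j. ennreal (1 / real (Suc j)) * ennreal (exp (- (real (Suc j) * (norm p)\<^sup>2))))"
    proof (rule AE_mp[OF _ AE_I2], intro impI)
      fix p :: "real ^ 2" assume p: "p \<noteq> 0"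
      have "(\<lambda>j. exp (- (norm p)\<^sup>2) ^ Suc j / real (Suc j)) sums g p"
        unfolding g_def using p by (intro neg_ln_series) auto
      moreover have "exp (- (norm p)\<^sup>2) ^ Suc j / real (Suc j) = 1 / real (Suc j) * exp (- (real (Suc j) * (norm p)\<^sup>2))" for j
        unfolding exp_of_nat_mult[symmetric] by simp
      ultimately have "(\<lambda>j. 1 / real (Suc j) * exp (- (real (Suc j) * (norm p)\<^sup>2))) sums g p" by simp
      then have "(\<lambda>j. ennreal (1 / real (Suc j) * exp (- (real (Suc j) * (norm p)\<^sup>2)))) sums ennreal (g p)"
        by (subst sums_ennreal) (auto intro: g0)
      moreover have "ennreal (1 / real (Suc j) * exp (- (real (Suc j) * (norm p)\<^sup>2)))
          = ennreal (1 / real (Suc j)) * ennreal (exp (- (real (Suc j) * (norm p)\<^sup>2)))" for j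
        by (rule ennreal_mult) auto
      ultimately have "(\<lambda>j. ennreal (1 / real (Suc j)) * ennreal (exp (- (real (Suc j) * (norm p)\<^sup>2)))) sums ennreal (g p)"
        by (simp only:)
      then show "ennreal (g p) = (\<Sum>j. ennreal (1 / real (Suc j)) * ennreal (exp (- (real (Suc j) * (norm p)\<^sup>2))))"
        by (rule sums_unique)
    qed
  qed
  also have "\<dots> = (\<Sum>j. \<integral>\<^sup>+p. ennreal (1 / real (Suc j)) * ennreal (exp (- (real (Suc j) * (norm p)\<^sup>2))) \<partial>(lborel :: (real ^ 2) measure))"
    by (rule nn_integral_suminf) measurable
  also have "\<dots> = (\<Sum>j. ennreal (pi * (1 / (real j + 1)\<^sup>2)))"
  proof (rule suminf_cong)
    fix j
    have "(\<integral>\<^sup>+p. ennreal (1 / real (Suc j)) * ennreal (exp (- (real (Suc j) * (norm p)\<^sup>2))) \<partial>(lborel :: (real ^ 2) measure))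
        = ennreal (1 / real (Suc j)) * ennreal (pi / real (Suc j))"
      by (subst nn_integral_cmult) (simp_all add: gaussian_plane del: of_nat_Suc)
    also have "\<dots> = ennreal (pi * (1 / (real j + 1)\<^sup>2))"
      by (subst ennreal_mult'[symmetric]) (auto simp: power2_eq_square add.commute)
    finally show "(\<integral>\<^sup>+p. ennreal (1 / real (Suc j)) * ennreal (exp (- (real (Suc j) * (norm p)\<^sup>2))) \<partial>(lborel :: (real ^ 2) measure))
        = ennreal (pi * (1 / (real j + 1)\<^sup>2))" .
  qed
  also have "\<dots> = ennreal (pi * (pi\<^sup>2 / 6))"
  proof -
    have "(\<lambda>j. pi * (1 / (real j + 1)\<^sup>2)) sums (pi * (pi\<^sup>2 / 6))" by (intro sums_mult basel_sums)
    then have "(\<lambda>j. ennreal (pi * (1 / (real j + 1)\<^sup>2))) sums ennreal (pi * (pi\<^sup>2 / 6))"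
      by (subst sums_ennreal) auto
    then show ?thesis by (simp add: sums_iff)
  qed
  finally have nn: "(\<integral>\<^sup>+p. ennreal (g p) \<partial>lborel) = ennreal (pi * (pi\<^sup>2 / 6))" .
  have "(\<integral>p. g p \<partial>lborel) = pi * (pi\<^sup>2 / 6)"
    using g0 by (subst integral_eq_nn_integral[OF meas]) (auto simp: nn)
  moreover have "(\<integral>p. ln (1 - exp (- (norm p)\<^sup>2)) \<partial>(lborel :: (real ^ 2) measure)) = - (\<integral>p. g p \<partial>lborel)"
    by (simp add: g_def)
  ultimately show ?thesis by simp
qed

lemma C2_eq: "C2 = - pi / 24"
  unfolding C2_def bose_integral by (simp add: power2_eq_square)

lemma riemann_zeta_2: "riemann_zeta 2 = pi\<^sup>2 / 6"
proof -
  have "riemann_zeta 2 = (\<Sum>k. 1 / (real k + 1)\<^sup>2)"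
    unfolding riemann_zeta_def by (intro suminf_cong) (simp add: add.commute)
  then show ?thesis using basel_sums by (simp add: sums_iff)
qed

section \<open>Choice of the box size\<close>

lemma dirichlet_bound_mono:
  "dirichlet_bound \<beta> n \<Lambda> X \<Longrightarrow> 0 \<le> Y \<Longrightarrow> Y \<le> X \<Longrightarrow> dirichlet_bound \<beta> n \<Lambda> Y"
  unfolding dirichlet_bound_def by (meson order_trans)

text \<open>The Bose occupation number is \<open>1 / (exp a - 1)\<close>, and
  \<open>exp a \<ge> 1 + a\<close>.\<close>

lemma bose_occupation_le:
  fixes a :: real
  assumes "0 < a" shows "exp (- a) / (1 - exp (- a)) \<le> 1 / a"
proof -
  have "(1 + a) * exp (- a) \<le> exp a * exp (- a)"
    using exp_ge_add_one_self[of a] by (intro mult_right_mono) auto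
  then have "(1 + a) * exp (- a) \<le> 1" by (simp flip: exp_add)
  then have "exp (- a) * a \<le> 1 - exp (- a)" by (simp add: algebra_simps)
  then show ?thesis using assms by (simp add: field_simps)
qed

text \<open>The conditions on \<open>M\<close> pull in opposite directions: few enough particles
  that coinciding pairs cost at most \<open>q\<close> of the squared norm, yet at least twice the
  mean number, so that the truncation costs only a factor 2.\<close>

lemma box_dirichlet_bound:
  fixes \<beta> q :: real and n L M :: nat
  assumes L: "2 \<le> L" and n: "0 < n" and \<beta>: "0 < \<beta>" and q: "0 \<le> q" "q < 1"
    and M: "(real L + 1)\<^sup>2 * (4 / (real L)\<^sup>2)\<^sup>2 * (real M)\<^sup>2 \<le> q"
      "4 * (real L)\<^sup>2 / (\<beta> * (real n / 2)) * (1 + ln (real L)) \<le> real M + 1"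
  defines "c \<equiv> \<beta> / (1 - q) * (real n / 2)"
  shows "dirichlet_bound \<beta> n (lattice_box p (Suc L))
    ((1 - q) * ((\<Prod>k\<in>sine_indices L. 1 / (1 - exp (- (c * sine_energy L k)))) / 2))"
proof -
  let ?K = "sine_indices L" and ?\<epsilon> = "sine_energy L"
  have L0: "0 < L" using L by simp
  have finK: "finite ?K" by (simp add: sine_indices_def)
  have c: "\<beta> * (real n / 2) \<le> c" "0 < \<beta> * (real n / 2)"
  proof -
    have "\<beta> / 1 \<le> \<beta> / (1 - q)" using \<beta> q by (intro divide_left_mono) auto
    then show "\<beta> * (real n / 2) \<le> c" unfolding c_def by (intro mult_right_mono) auto
    show "0 < \<beta> * (real n / 2)" using \<beta> n by simp
  qed
  have sq: "0 < (real (fst k))\<^sup>2 + (real (snd k))\<^sup>2" if "k \<in> ?K" for k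
    using that by (intro add_pos_pos) (auto simp: sine_indices_def)
  have low: "((real (fst k))\<^sup>2 + (real (snd k))\<^sup>2) / (real L)\<^sup>2 \<le> ?\<epsilon> k" if "k \<in> ?K" for k
    using sine_energy_bounds(2)[of "fst k" "snd k" L] that by simp
  have \<epsilon>: "0 < ?\<epsilon> k" if "k \<in> ?K" for k
    using less_le_trans[OF divide_pos_pos[OF sq[OF that]] low[OF that]] L0 by simp
  define t where "t k = exp (- (c * ?\<epsilon> k))" for k
  have t: "0 \<le> t k" "t k < 1" if "k \<in> ?K" for k using \<epsilon>[OF that] c by (auto simp: t_def)
  \<comment> \<open>The 4 in the hypothesis is Markov's factor 2 times the 2 of
    \<open>inverse_square_lattice_sum_le\<close>.\<close>
  have "2 * (\<Sum>k\<in>?K. t k / (1 - t k)) \<le> real M + 1"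
  proof -
    have "t k / (1 - t k) \<le> (real L)\<^sup>2 / (\<beta> * (real n / 2)) * (1 / ((real (fst k))\<^sup>2 + (real (snd k))\<^sup>2))" if k: "k \<in> ?K" for k
    proof -
      have "t k / (1 - t k) \<le> 1 / (c * ?\<epsilon> k)"
        unfolding t_def using c \<epsilon>[OF k] by (intro bose_occupation_le) auto
      also have "\<dots> \<le> 1 / ((\<beta> * (real n / 2)) * (((real (fst k))\<^sup>2 + (real (snd k))\<^sup>2) / (real L)\<^sup>2))"
        using c less_le_trans[OF c(2,1)] low[OF k] sq[OF k] L0 \<epsilon>[OF k] \<beta> n
        by (intro divide_left_mono mult_mono mult_pos_pos) auto
      also have "1 / (A * (B / C)) = C / A * (1 / B)" for A B C :: real by simp
      finally show ?thesis .
    qed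
    then have "(\<Sum>k\<in>?K. t k / (1 - t k)) \<le> (\<Sum>k\<in>?K. (real L)\<^sup>2 / (\<beta> * (real n / 2)) * (1 / ((real (fst k))\<^sup>2 + (real (snd k))\<^sup>2)))"
      by (rule sum_mono)
    also have "\<dots> = (real L)\<^sup>2 / (\<beta> * (real n / 2)) * (\<Sum>k\<in>?K. 1 / ((real (fst k))\<^sup>2 + (real (snd k))\<^sup>2))"
      by (simp only: sum_distrib_left)
    also have "\<dots> \<le> (real L)\<^sup>2 / (\<beta> * (real n / 2)) * (2 * (1 + ln (real L)))"
      using inverse_square_lattice_sum_le[OF L0] c(2)
      by (intro mult_left_mono) (simp_all add: sine_indices_def case_prod_unfold)
    finally have "2 * (\<Sum>k\<in>?K. t k / (1 - t k)) \<le> 2 * ((real L)\<^sup>2 / (\<beta> * (real n / 2)) * (2 * (1 + ln (real L))))"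
      by (rule mult_left_mono) simp
    also have "2 * (C / A * (2 * w)) = 4 * C / A * w" for A C w :: real by simp
    finally show ?thesis using M(2) by (rule order_trans)
  qed
  then have grand: "(\<Prod>k\<in>?K. 1 / (1 - t k)) / 2 \<le> (\<Sum>m\<in>bounded_multisets ?K M. \<Prod>k\<in>?K. t k ^ count m k)"
    by (intro grand_canonical_sum_ge finK t)
  have weight: "(\<Prod>k\<in>?K. t k ^ count m k) = exp (- c * (\<Sum>k\<in>?K. real (count m k) * ?\<epsilon> k))" for m
  proof -
    have "t k ^ count m k = exp (- c * (real (count m k) * ?\<epsilon> k))" for k
      unfolding t_def exp_of_nat_mult[symmetric] by (simp add: mult_ac)
    then show ?thesis by (simp only: exp_sum[OF finK, symmetric] sum_distrib_left)
  qed
  have cardq: "real (card (lattice_box p (Suc L))) * (4 / (real L)\<^sup>2)\<^sup>2 * (real M)\<^sup>2 / real n \<le> q"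
  proof -
    have card: "real (card (lattice_box p (Suc L))) = (real L + 1)\<^sup>2"
      by (simp add: card_box power2_eq_square algebra_simps)
    \<comment> \<open>Here \<open>1 / n\<close> is bounded by 1, which keeps the estimate uniform in
      the spin.\<close>
    have "(real L + 1)\<^sup>2 * (4 / (real L)\<^sup>2)\<^sup>2 * (real M)\<^sup>2 / real n \<le> q / 1" using M(1) n q(1) by (intro frac_le) auto
    then show ?thesis unfolding card by simp
  qed
  have "dirichlet_bound \<beta> n (lattice_box p (Suc L))
      ((1 - q) * (\<Sum>m\<in>bounded_multisets ?K M. exp (- (\<beta> / (1 - q) * (real n / 2)) * (\<Sum>k\<in>?K. real (count m k) * ?\<epsilon> k))))"
  proof (rule modes_dirichlet_bound[OF sine_modes_orthonormal[OF L] n])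
    show "0 \<le> \<beta>" using \<beta> by simp
    show "(sine_mode p L k x)\<^sup>2 \<le> 4 / (real L)\<^sup>2" for k x by (rule sine_mode_bound[OF L0])
    show "sine_mode p L k x = 0" if "x \<in> boundary (lattice_box p (Suc L))" for k x by (rule sine_mode_boundary[OF L0 that])
    show "(\<Sum>(x, y)\<in>nn_pairs (lattice_box p (Suc L)). (sine_mode p L k x - sine_mode p L k y)\<^sup>2) \<le> ?\<epsilon> k" if "k \<in> ?K" for k
      using sine_mode_energy[OF L that] by simp
    show "real (card (lattice_box p (Suc L))) * (4 / (real L)\<^sup>2)\<^sup>2 * (real M)\<^sup>2 / real n \<le> q" by (rule cardq)
    show "q < 1" by (rule q(2))
    show "finite (bounded_multisets ?K M)" by (rule finite_bounded_multisets[OF finK])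
  qed (auto simp: bounded_multisets_def)
  then show ?thesis
  proof (rule dirichlet_bound_mono)
    show "0 \<le> (1 - q) * ((\<Prod>k\<in>?K. 1 / (1 - exp (- (c * ?\<epsilon> k)))) / 2)"
      using q t unfolding t_def by (intro mult_nonneg_nonneg divide_nonneg_nonneg prod_nonneg) (auto simp: less_imp_le)
    show "(1 - q) * ((\<Prod>k\<in>?K. 1 / (1 - exp (- (c * ?\<epsilon> k)))) / 2)
        \<le> (1 - q) * (\<Sum>m\<in>bounded_multisets ?K M. exp (- (\<beta> / (1 - q) * (real n / 2)) * (\<Sum>k\<in>?K. real (count m k) * ?\<epsilon> k)))"
      unfolding c_def[symmetric] using grand[unfolded weight, unfolded t_def] q by (intro mult_left_mono) simp_all
  qed
qed

text \<open>The upper bound on \<open>sine_energy\<close> replaces it by the quadratic dispersion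
  with \<open>t = c pi^2 / L^2\<close>, to which \<open>bose\<close> applies;
  \<open>real L \<le> b\<close> supplies the condition \<open>1 \<le> t * real L\<close>.\<close>

lemma ln_box_weight_ge:
  fixes b q D :: real and L :: nat
  assumes L: "2 \<le> L" "real L \<le> b" and q: "0 \<le> q" "q \<le> 1 / 2" and D: "0 < D"
    and bose: "\<And>t. 0 < t \<Longrightarrow> 1 \<le> t * real L \<Longrightarrow> pi ^ 3 / (24 * t) - D / sqrt t \<le>
      (\<Sum>(k1, k2)\<in>{1..<L} \<times> {1..<L}. - ln (1 - exp (- (t * ((real k1)\<^sup>2 + (real k2)\<^sup>2)))))"
  defines "X \<equiv> (1 - q) * ((\<Prod>k\<in>sine_indices L. 1 / (1 - exp (- (b / (1 - q) * sine_energy L k)))) / 2)"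
  shows "0 < X" "pi * (real L)\<^sup>2 * (1 - q) / (24 * b) - D * real L / sqrt b - 2 \<le> ln X"
proof -
  let ?K = "sine_indices L" and ?\<epsilon> = "sine_energy L"
  define c where "c = b / (1 - q)"
  define t where "t = c * pi\<^sup>2 / (real L)\<^sup>2"
  have L0: "0 < real L" using L by simp
  have b: "0 < b" using L by simp
  have q1: "0 < 1 - q" "1 - q \<le> 1" using q by auto
  have cb: "b \<le> c" using divide_left_mono[of "1 - q" 1 b] q1 b by (simp add: c_def)
  have t: "0 < t" using L0 cb b by (simp add: t_def)
  have pi1: "1 \<le> pi\<^sup>2" "1 \<le> pi" using pi_gt3 by (auto simp: one_le_power)
  have tL: "1 \<le> t * real L"
  proof -
    have "real L * 1 \<le> c * pi\<^sup>2" using L cb pi1 b by (intro mult_mono) auto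
    then show ?thesis using L0 by (simp add: t_def power2_eq_square[of "real L"] field_simps)
  qed
  have sq: "0 < (real k1)\<^sup>2 + (real k2)\<^sup>2" if "(k1, k2) \<in> ?K" for k1 k2
    using that by (intro add_pos_pos) (auto simp: sine_indices_def)
  have e: "0 < c * ?\<epsilon> k \<and> c * ?\<epsilon> k \<le> t * ((real (fst k))\<^sup>2 + (real (snd k))\<^sup>2)" if "k \<in> ?K" for k
  proof -
    obtain k1 k2 where k: "k = (k1, k2)" by (cases k)
    note kK = that[unfolded k]
    have "0 < ?\<epsilon> (k1, k2)"
      using less_le_trans[OF divide_pos_pos[OF sq[OF kK]] sine_energy_bounds(2)[OF kK]] L0 by simp
    moreover have "c * ?\<epsilon> (k1, k2) \<le> c * (pi\<^sup>2 / (real L)\<^sup>2 * ((real k1)\<^sup>2 + (real k2)\<^sup>2))"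
      using sine_energy_bounds(1)[OF kK] cb b by (intro mult_left_mono) auto
    ultimately show ?thesis using cb b by (simp add: k t_def)
  qed
  have fac: "0 < 1 - exp (- (c * ?\<epsilon> k))" if "k \<in> ?K" for k using e[OF that] by simp
  have P: "0 < (\<Prod>k\<in>?K. 1 / (1 - exp (- (c * ?\<epsilon> k))))" using fac by (intro prod_pos) auto
  show X: "0 < X" using P q1 by (simp add: X_def c_def)
  have "pi ^ 3 / (24 * t) - D / sqrt t \<le> (\<Sum>k\<in>?K. - ln (1 - exp (- (t * ((real (fst k))\<^sup>2 + (real (snd k))\<^sup>2)))))"
    using bose[OF t tL] by (simp add: sine_indices_def case_prod_unfold)
  also have "\<dots> \<le> (\<Sum>k\<in>?K. - ln (1 - exp (- (c * ?\<epsilon> k))))"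
  proof (rule sum_mono)
    fix k assume k: "k \<in> ?K"
    have "1 - exp (- (c * ?\<epsilon> k)) \<le> 1 - exp (- (t * ((real (fst k))\<^sup>2 + (real (snd k))\<^sup>2)))"
      using e[OF k] by simp
    then show "- ln (1 - exp (- (t * ((real (fst k))\<^sup>2 + (real (snd k))\<^sup>2)))) \<le> - ln (1 - exp (- (c * ?\<epsilon> k)))"
      using fac[OF k] by (subst neg_le_iff_le) (rule ln_mono)
  qed
  also have "\<dots> = ln (\<Prod>k\<in>?K. 1 / (1 - exp (- (c * ?\<epsilon> k))))"
  proof -
    have "ln (\<Prod>k\<in>?K. 1 / (1 - exp (- (c * ?\<epsilon> k)))) = (\<Sum>k\<in>?K. ln (1 / (1 - exp (- (c * ?\<epsilon> k)))))"
    proof (rule ln_prod)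
      show "finite ?K" by (simp add: sine_indices_def)
      show "1 / (1 - exp (- (c * ?\<epsilon> k))) \<noteq> 0" if "k \<in> ?K" for k
        using fac[OF that] by (simp only: divide_eq_0_iff) auto
    qed
    also have "\<dots> = (\<Sum>k\<in>?K. - ln (1 - exp (- (c * ?\<epsilon> k))))"
    proof (rule sum.cong[OF refl])
      fix k assume "k \<in> ?K"
      then show "ln (1 / (1 - exp (- (c * ?\<epsilon> k)))) = - ln (1 - exp (- (c * ?\<epsilon> k)))"
        using ln_divide_pos[OF _ fac, of 1 k] by simp
    qed
    finally show ?thesis ..
  qed
  finally have main: "pi ^ 3 / (24 * t) - D / sqrt t \<le> ln (\<Prod>k\<in>?K. 1 / (1 - exp (- (c * ?\<epsilon> k))))" .
  \<comment> \<open>The factors \<open>1 - q \<ge> 1 / 2\<close> and \<open>1 / 2\<close> cost at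
    most \<open>ln 2 \<le> 1\<close> each, which gives the additive 2.\<close>
  have "ln X = ln (1 - q) + ln (\<Prod>k\<in>?K. 1 / (1 - exp (- (c * ?\<epsilon> k)))) - ln 2"
    unfolding X_def c_def[symmetric] using P q1 by (simp add: ln_mult ln_div)
  moreover have "ln (1 / 2) \<le> ln (1 - q)" using q by (intro ln_mono) auto
  moreover have "ln (1 / 2 :: real) = - ln 2" by (simp add: ln_div)
  moreover have "ln 2 \<le> (1 :: real)" using ln_le_minus_one[of 2] by simp
  ultimately have "pi ^ 3 / (24 * t) - D / sqrt t - 2 \<le> ln X" using main by linarith
  moreover have "pi ^ 3 / (24 * t) = pi * (real L)\<^sup>2 * (1 - q) / (24 * b)"
    using L0 b q1 by (simp add: t_def c_def power2_eq_square power3_eq_cube field_simps)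
  moreover have "D / sqrt t \<le> D * real L / sqrt b"
  proof -
    have "b / (real L)\<^sup>2 \<le> t"
      using mult_mono[OF cb pi1(1)] b cb unfolding t_def by (intro divide_right_mono) auto
    then have "sqrt (b / (real L)\<^sup>2) \<le> sqrt t" by (rule real_sqrt_le_mono)
    then have "sqrt b / real L \<le> sqrt t" by (simp add: real_sqrt_divide)
    then have "D / sqrt t \<le> D / (sqrt b / real L)" using D L0 b t by (intro divide_left_mono) auto
    then show ?thesis by simp
  qed
  ultimately show "pi * (real L)\<^sup>2 * (1 - q) / (24 * b) - D * real L / sqrt b - 2 \<le> ln X" by linarith
qed

text \<open>Compares the \<open>L^2\<close> of the mode count with the \<open>(L + 1)^2\<close>
  sites of a box. The ratio is at least \<open>1 - 2 / L\<close>, and for negative \<open>r\<close>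
  a factor of at most 1 can only increase the value.\<close>

lemma shrink_ratio_ge:
  fixes r :: real and L :: nat
  assumes "0 < L" "r \<le> 1" shows "r - 2 / real L \<le> (real L)\<^sup>2 / (real L + 1)\<^sup>2 * r"
proof -
  define f where "f = (real L)\<^sup>2 / (real L + 1)\<^sup>2"
  have f1: "f \<le> 1" unfolding f_def by (simp add: power_mono)
  have "(real L + 1)\<^sup>2 * (real L - 2) \<le> (real L)\<^sup>2 * real L"
    by (simp add: power2_eq_square algebra_simps)
  then have f2: "1 - 2 / real L \<le> f" using assms by (simp add: f_def field_simps)
  show ?thesis
  proof (cases "0 \<le> r")
    case True
    have "(1 - 2 / real L) * r \<le> f * r" using f2 True by (intro mult_right_mono) auto
    moreover have "2 / real L * r \<le> 2 / real L * 1" using assms by (intro mult_left_mono) auto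
    ultimately show ?thesis by (simp add: f_def left_diff_distrib)
  next
    case False
    then have "1 * r \<le> f * r" using f1 by (intro mult_right_mono_neg) auto
    moreover have "0 \<le> 2 / real L" by simp
    ultimately show ?thesis unfolding f_def by linarith
  qed
qed

text \<open>At box side \<open>y\<close>, with \<open>l = ln b\<close>, the competing errors
  \<open>sqrt b / y\<close> from the boundary and \<open>y^2 l^2 / b^2\<close> from coinciding
  magnons have the common value \<open>x\<close>.\<close>

lemma scale_powr_identities:
  fixes b l :: real
  assumes b: "0 < b" and l: "0 < l"
  defines "x \<equiv> b powr (- 1 / 3) * l powr (2 / 3)" and "y \<equiv> b powr (5 / 6) * l powr (- 2 / 3)"
  shows "sqrt b / y = x" "y\<^sup>2 * l\<^sup>2 / b\<^sup>2 = x"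
proof -
  have y0: "0 < y" using b l by (simp add: y_def)
  have "x * y = (b powr (- 1 / 3) * b powr (5 / 6)) * (l powr (2 / 3) * l powr (- 2 / 3))"
    by (simp add: x_def y_def)
  also have "\<dots> = sqrt b" using b l by (simp add: powr_add[symmetric] powr_half_sqrt)
  finally show "sqrt b / y = x" using y0 by (simp add: field_simps)
  have sq: "(z powr a)\<^sup>2 = z powr (2 * a)" for z a :: real
    by (simp add: power2_eq_square powr_add[symmetric])
  have p2: "z\<^sup>2 = z powr 2" if "0 < z" for z :: real using that by (simp add: powr_numeral)
  have "y\<^sup>2 * l\<^sup>2 = b powr (5 / 3) * (l powr (- 4 / 3) * l powr 2)"
    unfolding y_def power_mult_distrib sq p2[OF l] by simp
  also have "\<dots> = b powr (- 1 / 3) * b powr 2 * l powr (2 / 3)"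
    by (simp add: powr_add[symmetric])
  also have "\<dots> = x * b\<^sup>2" unfolding x_def p2[OF b] by simp
  finally show "y\<^sup>2 * l\<^sup>2 / b\<^sup>2 = x" using b by simp
qed

text \<open>The box side is of order \<open>b^(5/6) (ln b)^(-2/3)\<close>: this balances the boundary error \<open>sqrt b / L\<close> against
  the probability \<open>L^2 (ln b)^2 / b^2\<close> that two magnons of a box meet.\<close>

lemma scale_conditions:
  "\<exists>K>0. \<forall>b>K. 1 \<le> ln b \<and> 1 \<le> b \<and> 2 \<le> b powr (5 / 6) * ln b powr (- 2 / 3) \<and>
    2 * (b powr (5 / 6) * ln b powr (- 2 / 3)) \<le> b \<and>
    65536 * (b powr (- 1 / 3) * ln b powr (2 / 3)) \<le> (1 / 2 :: real) \<and>
    1 \<le> 8 * (b powr (5 / 6) * ln b powr (- 2 / 3))\<^sup>2 * ln b / b"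
proof -
  have "eventually (\<lambda>b :: real. 1 \<le> ln b) at_top" by real_asymp
  moreover have "eventually (\<lambda>b :: real. 1 \<le> b) at_top" by real_asymp
  moreover have "eventually (\<lambda>b :: real. 2 \<le> b powr (5 / 6) * ln b powr (- 2 / 3)) at_top" by real_asymp
  moreover have "eventually (\<lambda>b :: real. 2 * (b powr (5 / 6) * ln b powr (- 2 / 3)) \<le> b) at_top" by real_asymp
  moreover have "eventually (\<lambda>b. 65536 * (b powr (- 1 / 3) * ln b powr (2 / 3)) \<le> (1 / 2 :: real)) at_top" by real_asymp
  moreover have "eventually (\<lambda>b :: real. 1 \<le> 8 * (b powr (5 / 6) * ln b powr (- 2 / 3))\<^sup>2 * ln b / b) at_top" by real_asymp
  ultimately have "eventually (\<lambda>b. 1 \<le> ln b \<and> 1 \<le> b \<and> 2 \<le> b powr (5 / 6) * ln b powr (- 2 / 3) \<and>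
      2 * (b powr (5 / 6) * ln b powr (- 2 / 3)) \<le> b \<and>
      65536 * (b powr (- 1 / 3) * ln b powr (2 / 3)) \<le> (1 / 2 :: real) \<and>
      1 \<le> 8 * (b powr (5 / 6) * ln b powr (- 2 / 3))\<^sup>2 * ln b / b) at_top"
    by eventually_elim blast
  then obtain K where K: "\<And>b. K \<le> b \<Longrightarrow> 1 \<le> ln b \<and> 1 \<le> b \<and> 2 \<le> b powr (5 / 6) * ln b powr (- 2 / 3) \<and>
      2 * (b powr (5 / 6) * ln b powr (- 2 / 3)) \<le> b \<and>
      65536 * (b powr (- 1 / 3) * ln b powr (2 / 3)) \<le> (1 / 2 :: real) \<and>
      1 \<le> 8 * (b powr (5 / 6) * ln b powr (- 2 / 3))\<^sup>2 * ln b / b"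
    unfolding eventually_at_top_linorder by blast
  show ?thesis
  proof (intro exI[of _ "max K 1"] conjI[of "0 < max K 1"] allI impI)
    show "0 < max K 1" by simp
    fix b assume "max K 1 < b"
    then have "K \<le> b" by simp
    from K[OF this] show "1 \<le> ln b \<and> 1 \<le> b \<and> 2 \<le> b powr (5 / 6) * ln b powr (- 2 / 3) \<and>
      2 * (b powr (5 / 6) * ln b powr (- 2 / 3)) \<le> b \<and>
      65536 * (b powr (- 1 / 3) * ln b powr (2 / 3)) \<le> (1 / 2 :: real) \<and>
      1 \<le> 8 * (b powr (5 / 6) * ln b powr (- 2 / 3))\<^sup>2 * ln b / b" .
  qed
qed

text \<open>With \<open>L\<close> of order \<open>y\<close>, every loss (norm defect, boundary term,
  additive constants, the extra row of sites) becomes a multiple of \<open>x\<close>.\<close>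

lemma free_energy_2d_bound:
  fixes D \<beta> :: real and n :: nat
  assumes D: "0 < D"
    and bose: "\<And>t L. 0 < t \<Longrightarrow> 0 < L \<Longrightarrow> 1 \<le> t * real L \<Longrightarrow> pi ^ 3 / (24 * t) - D / sqrt t \<le>
      (\<Sum>(k1, k2)\<in>{1..<L} \<times> {1..<L}. - ln (1 - exp (- (t * ((real k1)\<^sup>2 + (real k2)\<^sup>2)))))"
    and n: "0 < n" and \<beta>: "0 < \<beta>"
  defines "b \<equiv> \<beta> * (real n / 2)"
  defines "x \<equiv> b powr (- 1 / 3) * ln b powr (2 / 3)" and "y \<equiv> b powr (5 / 6) * ln b powr (- 2 / 3)"
  assumes large: "1 \<le> ln b" "1 \<le> b" "2 \<le> y" "2 * y \<le> b" "65536 * x \<le> 1 / 2" "1 \<le> 8 * y\<^sup>2 * ln b / b"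
  shows "free_energy_2d \<beta> n \<le> - (pi / 24) / (\<beta> * b) * (1 - (65538 + 8 * (D + 2)) * x)"
proof -
  define l where "l = ln b"
  have b: "0 < b" and l: "0 < l" using large by (auto simp: l_def)
  have x0: "0 \<le> x" by (simp add: x_def)
  have x1: "x \<le> 1" using large(5) x0 by linarith
  have id: "sqrt b / y = x" "y\<^sup>2 * l\<^sup>2 / b\<^sup>2 = x"
    using scale_powr_identities[OF b l] by (simp_all add: x_def y_def l_def)
  define L where "L = nat \<lceil>y\<rceil>"
  have yL: "y \<le> real L" unfolding L_def by linarith
  have Ly: "real L \<le> 2 * y" unfolding L_def using large(3) by linarith
  have L2: "2 \<le> L" using yL large(3) by linarith
  have Lb: "real L \<le> b" using Ly large(4) by linarith
  have L0: "0 < real L" using L2 by simp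
  have y0: "0 < y" using large(3) by simp
  \<comment> \<open>From \<open>ln L \<le> ln b\<close> and \<open>1 \<le> ln b\<close> follows
    \<open>4 (1 + ln L) \<le> 8 ln b\<close>, so \<open>R\<close> is at least twice the mean
    particle number of a box.\<close>
  define R where "R = 8 * (real L)\<^sup>2 * l / b"
  define M where "M = nat \<lceil>R\<rceil>"
  have "8 * y\<^sup>2 * l / b \<le> R"
    unfolding R_def using yL y0 b l by (intro divide_right_mono mult_right_mono mult_left_mono power_mono) auto
  then have R1: "1 \<le> R" using large(6) by (simp add: l_def)
  have RM: "R \<le> real M" unfolding M_def by linarith
  have MR: "real M \<le> 2 * R" unfolding M_def using R1 by linarith
  \<comment> \<open>The doublings \<open>L + 1 \<le> 2 L\<close>, \<open>M \<le> 2 R\<close>,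
    \<open>L \<le> 2 y\<close>, the 4 of the mode bound and the 8 in \<open>R\<close> give
    \<open>2^2 * 4^2 * (2 * 8)^2 * 2^2 = 65536\<close>.\<close>
  define q where "q = 65536 * x"
  have q: "0 \<le> q" "q \<le> 1 / 2" using x0 large(5) by (auto simp: q_def)
  have Mq: "(real L + 1)\<^sup>2 * (4 / (real L)\<^sup>2)\<^sup>2 * (real M)\<^sup>2 \<le> q"
  proof -
    have "(real L + 1)\<^sup>2 * (4 / (real L)\<^sup>2)\<^sup>2 * (real M)\<^sup>2 \<le> (2 * real L)\<^sup>2 * (4 / (real L)\<^sup>2)\<^sup>2 * (2 * R)\<^sup>2"
      using L2 MR by (intro mult_mono power_mono) auto
    also have "\<dots> = 16384 * ((real L)\<^sup>2 * l\<^sup>2 / b\<^sup>2)"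
      using L0 b by (simp add: R_def power2_eq_square field_simps)
    also have "\<dots> \<le> 16384 * ((2 * y)\<^sup>2 * l\<^sup>2 / b\<^sup>2)"
      using Ly L0 by (intro mult_left_mono divide_right_mono mult_right_mono power_mono) auto
    also have "\<dots> = q" unfolding q_def id(2)[symmetric] by (simp add: power_mult_distrib)
    finally show ?thesis .
  qed
  have MN: "4 * (real L)\<^sup>2 / (\<beta> * (real n / 2)) * (1 + ln (real L)) \<le> real M + 1"
  proof -
    have "ln (real L) \<le> l" unfolding l_def using L0 Lb by (intro ln_mono) auto
    then have "1 + ln (real L) \<le> 2 * l" using large(1) by (simp add: l_def)
    then have "4 * (real L)\<^sup>2 / b * (1 + ln (real L)) \<le> 4 * (real L)\<^sup>2 / b * (2 * l)"
      using b by (intro mult_left_mono) auto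
    also have "\<dots> = R" by (simp add: R_def)
    finally show ?thesis using RM by (simp add: b_def)
  qed
  define X where "X = (1 - q) * ((\<Prod>k\<in>sine_indices L. 1 / (1 - exp (- (b / (1 - q) * sine_energy L k)))) / 2)"
  have "dirichlet_bound \<beta> n (lattice_box p (Suc L)) X" for p
  proof -
    have q1: "q < 1" using q(2) by simp
    have c: "b / (1 - q) = \<beta> / (1 - q) * (real n / 2)" by (simp add: b_def)
    show ?thesis unfolding X_def c by (rule box_dirichlet_bound[OF L2 n \<beta> q(1) q1 Mq MN])
  qed
  moreover have X: "0 < X" "pi * (real L)\<^sup>2 * (1 - q) / (24 * b) - D * real L / sqrt b - 2 \<le> ln X"
    unfolding X_def using L2 by (intro ln_box_weight_ge[OF L2 Lb q D] bose; simp)+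
  ultimately have fe: "free_energy_2d \<beta> n \<le> - (ln X / (\<beta> * real (Suc L * Suc L)))"
    using \<beta> by (intro free_energy_2d_le) auto
  \<comment> \<open>The 8 comes from \<open>3 \<le> pi\<close>: a relative loss \<open>w\<close> is
    worth \<open>pi / 24 * w \<ge> w / 8\<close>, which covers both the boundary term with
    \<open>D\<close> and the additive 2.\<close>
  define w where "w = 8 * (D + 2) * x"
  have sbL: "sqrt b / real L \<le> x"
    unfolding id(1)[symmetric] using yL y0 b by (intro divide_left_mono) auto
  have "D * real L / sqrt b + 2 \<le> pi * (real L)\<^sup>2 / (24 * b) * w"
  proof -
    have sb: "sqrt b * sqrt b = b" using b by simp
    define z where "z = sqrt b / real L"
    have z: "0 < z" "z \<le> x" using sbL b L0 by (auto simp: z_def)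
    have "D * z + 2 * (z * z) \<le> D * x + 2 * (x * 1)"
      using z D x1 by (intro add_mono mult_left_mono mult_mono) auto
    also have "\<dots> = w / 8" by (simp add: w_def algebra_simps)
    also have "\<dots> \<le> pi / 24 * w"
    proof -
      have "0 \<le> w" using x0 D by (simp add: w_def)
      then have "3 * w \<le> pi * w" using pi_gt3 by (intro mult_right_mono) auto
      then show ?thesis by simp
    qed
    finally have "(real L)\<^sup>2 / b * (D * z + 2 * (z * z)) \<le> (real L)\<^sup>2 / b * (pi / 24 * w)"
      using b by (intro mult_left_mono) auto
    moreover have "(real L)\<^sup>2 / b * (D * z + 2 * (z * z)) = D * real L / sqrt b + 2"
    proof -
      have "(real L)\<^sup>2 / b * (z * z) = 1" using L0 b by (simp add: z_def power2_eq_square)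
      moreover have "(real L)\<^sup>2 / b * z = real L / sqrt b"
      proof -
        have "a\<^sup>2 / (r * r) * (r / a) = a / r" if "a \<noteq> 0" "r \<noteq> 0" for a r :: real
          using that by (simp add: power2_eq_square)
        from this[of "real L" "sqrt b"] show ?thesis using L0 b by (simp add: sb z_def)
      qed
      moreover have "A * (D * z + 2 * (z * z)) = D * (A * z) + 2 * (A * (z * z))" for A
        by (simp add: algebra_simps)
      ultimately have "(real L)\<^sup>2 / b * (D * z + 2 * (z * z)) = D * (real L / sqrt b) + 2 * 1"
        by (simp only:)
      then show ?thesis by simp
    qed
    ultimately show ?thesis by (simp add: mult_ac)
  qed
  moreover have "pi * (real L)\<^sup>2 * (1 - q) / (24 * b) = pi * (real L)\<^sup>2 / (24 * b) * (1 - q)" by simp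
  ultimately have lnX: "pi / (24 * b) * ((real L)\<^sup>2 * (1 - q - w)) \<le> ln X"
    using X(2) by (simp add: right_diff_distrib)
  \<comment> \<open>Of the 65538, 65536 is the norm defect \<open>q\<close>; the other 2 is the loss
    \<open>2 / L \<le> 2 x\<close> from counting \<open>(L + 1)^2\<close> sites.\<close>
  have "pi / (24 * b) * (1 - (65538 + 8 * (D + 2)) * x) \<le> pi / (24 * b) * ((real L)\<^sup>2 / (real L + 1)\<^sup>2 * (1 - q - w))"
  proof (rule mult_left_mono)
    have "2 / real L \<le> 2 * (sqrt b / real L)"
      using large(2) L0 by (simp add: divide_right_mono)
    then have "2 / real L \<le> 2 * x" using sbL by linarith
    moreover have "0 \<le> w" using x0 D by (simp add: w_def)
    then have "1 - q - w \<le> 1" using q(1) by linarith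
    ultimately show "1 - (65538 + 8 * (D + 2)) * x \<le> (real L)\<^sup>2 / (real L + 1)\<^sup>2 * (1 - q - w)"
      using shrink_ratio_ge[of L "1 - q - w"] L2 by (simp add: q_def w_def algebra_simps)
  qed (use b in simp)
  also have "\<dots> = pi / (24 * b) * ((real L)\<^sup>2 * (1 - q - w)) / real (Suc L * Suc L)"
  proof -
    have "(real L + 1)\<^sup>2 = real (Suc L * Suc L)" by (simp add: power2_eq_square algebra_simps)
    then show ?thesis by simp
  qed
  also have "\<dots> \<le> ln X / real (Suc L * Suc L)" by (rule divide_right_mono[OF lnX]) simp
  finally have "(1 / \<beta>) * (pi / (24 * b) * (1 - (65538 + 8 * (D + 2)) * x)) \<le> (1 / \<beta>) * (ln X / real (Suc L * Suc L))"
    using \<beta> by (intro mult_left_mono) auto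
  then show ?thesis using fe by (simp add: mult.commute)
qed

theorem propositionA1:
  shows "C2 = - riemann_zeta 2 / (4 * pi) \<and> C2 = - pi / 24 \<and>
    (\<exists>C > 0. \<exists>K > 0. \<forall>(n :: nat) (S :: real) (\<beta> :: real).
       n \<ge> 1 \<and> S = real n / 2 \<and> \<beta> > 0 \<and> \<beta> * S > K \<longrightarrow>
       free_energy_2d \<beta> n \<le>
         C2 * (1 / S) * (1 / \<beta>\<^sup>2) *
           (1 - C * ((\<beta> * S) powr (- 1 / 3) * ln (\<beta> * S) powr (2 / 3))))"
proof -
  obtain D where D: "0 < D" and bose: "\<And>t L. 0 < t \<Longrightarrow> 0 < L \<Longrightarrow> 1 \<le> t * real L \<Longrightarrow> pi ^ 3 / (24 * t) - D / sqrt t \<le>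
      (\<Sum>(k1, k2)\<in>{1..<L} \<times> {1..<L}. - ln (1 - exp (- (t * ((real k1)\<^sup>2 + (real k2)\<^sup>2)))))"
    using log_partition_sum_ge by metis
  obtain K where K: "0 < K" and large: "\<And>b. K < b \<Longrightarrow> 1 \<le> ln b \<and> 1 \<le> b \<and> 2 \<le> b powr (5 / 6) * ln b powr (- 2 / 3) \<and>
      2 * (b powr (5 / 6) * ln b powr (- 2 / 3)) \<le> b \<and>
      65536 * (b powr (- 1 / 3) * ln b powr (2 / 3)) \<le> (1 / 2 :: real) \<and>
      1 \<le> 8 * (b powr (5 / 6) * ln b powr (- 2 / 3))\<^sup>2 * ln b / b"
    using scale_conditions by blast
  have bound: "free_energy_2d \<beta> n \<le> C2 * (1 / S) * (1 / \<beta>\<^sup>2) *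
      (1 - (65538 + 8 * (D + 2)) * ((\<beta> * S) powr (- 1 / 3) * ln (\<beta> * S) powr (2 / 3)))"
    if h: "n \<ge> 1 \<and> S = real n / 2 \<and> \<beta> > 0 \<and> \<beta> * S > K" for n :: nat and S \<beta> :: real
  proof -
    have S: "S = real n / 2" and n: "0 < n" and \<beta>: "0 < \<beta>" using h by auto
    note lg = large[of "\<beta> * (real n / 2)"]
    have "free_energy_2d \<beta> n \<le> - (pi / 24) / (\<beta> * (\<beta> * (real n / 2))) *
        (1 - (65538 + 8 * (D + 2)) * ((\<beta> * (real n / 2)) powr (- 1 / 3) * ln (\<beta> * (real n / 2)) powr (2 / 3)))"
      by (rule free_energy_2d_bound[OF D bose n \<beta>]) (use lg h S in auto)
    also have "- (pi / 24) / (\<beta> * (\<beta> * (real n / 2))) = C2 * (1 / S) * (1 / \<beta>\<^sup>2)"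
      by (simp add: C2_eq S power2_eq_square)
    finally show ?thesis by (simp only: S)
  qed
  have C: "0 < 65538 + 8 * (D + 2)" using D by simp
  have "C2 = - riemann_zeta 2 / (4 * pi)" by (simp add: C2_eq riemann_zeta_2 power2_eq_square)
  then show ?thesis using C2_eq C K bound by blast
qed

end
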